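(* Let $\mathfrak g\cong\mathfrak{sl}(\infty),\mathfrak{so}(\infty)$ or $\mathfrak{sp}(\infty)$ with exhaustion $\mathfrak g=\bigcup_n\mathfrak g_n$, and let $\mathfrak k_0\subset\mathfrak g_1$, $\mathfrak t_0$, $\mathfrak p=\mathfrak m\oplus\mathfrak n$, $\mathfrak k=\mathfrak k_0+C_{\mathfrak g}(\mathfrak k_0)$ be as in the context. Let $E=\bigcup_nE_n$ be an $\mathfrak m$-module where, for $n$ large enough, each $E_n$ is a simple $\mathfrak m_n$-submodule of a tensor power $T^k(V_n^a\oplus(V_n^* )^b\oplus\mathbb C^c)$ for fixed $k,a,b,c$, $V_n$ being the natural $\mathfrak g_n$-module. Extend $E$ to $\mathfrak p$ by $\mathfrak n\cdot E=0$. Then $M(\mathfrak p,E)=\mathrm{ind}^{\mathfrak g}_{\mathfrak p}E$ is an $(\mathfrak m,\mathfrak k\cap\mathfrak m)$-module of finite type.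
   Context: Everything is over $\mathbb C$; $\mathrm{ind}^{\mathfrak g}_{\mathfrak p}E=U(\mathfrak g)\otimes_{U(\mathfrak p)}E$; $C_{\mathfrak g}(\cdot)$ is the centralizer in $\mathfrak g$; $W^p$ is the direct sum of $p$ copies of $W$. $\mathfrak g=\bigcup_n\mathfrak g_n$ where the inclusions $\mathfrak g_n\subset\mathfrak g_{n+1}$ are the standard root injections of the form $\mathfrak{sl}(i)\subset\mathfrak{sl}(i+1)$, $\mathfrak{so}(i)\subset\mathfrak{so}(i+2)$, $\mathfrak{sp}(2i)\subset\mathfrak{sp}(2i+2)$ for $\mathfrak g\cong\mathfrak{sl}(\infty),\mathfrak{so}(\infty),\mathfrak{sp}(\infty)$ respectively. $\mathfrak k_0\subset\mathfrak g_1$ is a subalgebra reductive in $\mathfrak g_1$ (i.e. $\mathfrak g_1$ is a semisimple $\mathfrak k_0$-module), $\mathfrak t_0$ a Cartan subalgebra of $\mathfrak k_0$, $\mathfrak k=\mathfrak k_0+C_{\mathfrak g}(\mathfrak k_0)$. A $\mathfrak t_0$-compatible parabolic subalgebra of $\mathfrak g_n$ is one of the form $\bigoplus_{\mathrm{Re}\,\sigma\ge0}(\mathfrak g_n)^\sigma_{h_n}$, with $h_n\in\mathfrak t_0$ semisimple and $(\mathfrak g_n)^\sigma_{h_n}$ the $\sigma$-eigenspace of $\mathrm{ad}\,h_n$. A subalgebra $\mathfrak p\subset\mathfrak g$ is a $\mathfrak t_0$-compatible parabolic subalgebra if for all $n$, $\mathfrak p_n=\mathfrak p\cap\mathfrak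 g_n$ is a $\mathfrak t_0$-compatible parabolic subalgebra of $\mathfrak g_n$ and $\mathfrak n_n=\mathfrak n_{n+1}\cap\mathfrak g_n$, $\mathfrak n_n$ being the nilradical of $\mathfrak p_n$. Fix such $\mathfrak p$ and decompositions $\mathfrak p_n=\mathfrak m_n\oplus\mathfrak n_n$ with $\mathfrak m_n$ reductive in $\mathfrak g_n$, $\mathfrak m_{n+1}\cap\mathfrak g_n=\mathfrak m_n$, $\mathfrak t_0\subset\mathfrak m_n$, $C_{\mathfrak g_n}(\mathfrak k_0)\subset\mathfrak m_n$; $\mathfrak m=\bigcup\mathfrak m_n$, $\mathfrak n=\bigcup\mathfrak n_n$, $\mathfrak p=\mathfrak m\oplus\mathfrak n$. One has $\mathfrak k\cap\mathfrak m=(\mathfrak k_0\cap\mathfrak m)+C_{\mathfrak g}(\mathfrak k_0)$. For a Lie algebra $\mathfrak l=\bigcup_n\mathfrak l_n$ (union of nested finite-dimensional Lie algebras), an $\mathfrak l$-module is integrable if every vector generates a finite-dimensional $\mathfrak l_n$-submodule for each $n$. For a subalgebra $\mathfrak l\subset\mathfrak m$, an $(\mathfrak m,\mathfrak l)$-module is an $\mathfrak m$-module which is integrable over $\mathfrak l$. It is of finite type if (i) every finitely generated $\mathfrak l$-submodule $M'$ has finite length over $\mathfrak l$, and (ii) for each simple integrable $\mathfrak l$-module $L$ the multiplicity of $L$ as a subquotient of $M'$ is bounded as $M'$ runs over the finitely generated $\mathfrak l$-submodules. *)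

theory Defs
  imports
    Complex_Main
    "HOL-Library.Function_Algebras"
    "HOL-Library.Poly_Mapping"
    "HOL-Algebra.QuotRing"
    "HOL-Algebra.Algebraic_Closure_Type"
begin

section \<open>Lie algebras of finitary matrices\<close>

text \<open>The Lie algebras sl(infinity), so(infinity), sp(infinity) are realised by matrices with rows
  and columns indexed by the natural numbers; their elements have only finitely many nonzero
  entries. The inclusion of a \<open>d \<times> d\<close> matrix in a larger one as its upper left corner is thereby an
  inclusion of sets.\<close>

type_synonym mat = "nat \<Rightarrow> nat \<Rightarrow> complex"

definition mat_scale :: "complex \<Rightarrow> mat \<Rightarrow> mat" where
  "mat_scale c A = (\<lambda>i j. c * A i j)"

global_interpretation cmat: vector_space mat_scale
  by unfold_locales (auto simp: mat_scale_def fun_eq_iff algebra_simps)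

text \<open>Only meant for \<open>A\<close> with finitely supported rows.\<close>

definition mat_mult :: "mat \<Rightarrow> mat \<Rightarrow> mat" where
  "mat_mult A B = (\<lambda>i j. \<Sum>k | A i k \<noteq> 0. A i k * B k j)"

definition lie_bracket :: "mat \<Rightarrow> mat \<Rightarrow> mat" where
  "lie_bracket A B = mat_mult A B - mat_mult B A"

definition gl :: "nat \<Rightarrow> mat set" where
  "gl d = {A. \<forall>i j. A i j \<noteq> 0 \<longrightarrow> i < d \<and> j < d}"

definition sl :: "nat \<Rightarrow> mat set" where
  "sl d = {A \<in> gl d. (\<Sum>i<d. A i i) = 0}"

definition so :: "nat \<Rightarrow> mat set" where
  "so d = {A \<in> gl d. \<forall>i j. A j i = - A i j}"

text \<open>The symplectic form pairs the basis vectors number \<open>2i\<close> and \<open>2i + 1\<close>; the condition on \<open>A\<close>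
  is the entrywise form of \<open>A\<^sup>T J + J A = 0\<close>.\<close>

definition sp_form :: mat where
  "sp_form i j = (if even i \<and> j = i + 1 then 1 else if odd i \<and> i = j + 1 then - 1 else 0)"

definition sp :: "nat \<Rightarrow> mat set" where
  "sp d = {A \<in> gl d. \<forall>i<d. \<forall>j<d. (\<Sum>k<d. A k i * sp_form k j + sp_form i k * A k j) = 0}"

datatype series = SL | SO | SP

text \<open>Dimension of the natural module of the \<open>n\<close>-th term (\<open>n \<ge> 1\<close>) of the exhaustion. The rank at
  which it starts is governed by \<open>r\<close>, which in type SO also fixes the parity.\<close>

fun nat_dim :: "series \<Rightarrow> nat \<Rightarrow> nat \<Rightarrow> nat" where
  "nat_dim SL r n = r + n"
| "nat_dim SO r n = r + 2 * n"
| "nat_dim SP r n = 2 * (r + n)"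

fun classical :: "series \<Rightarrow> nat \<Rightarrow> mat set" where
  "classical SL d = sl d"
| "classical SO d = so d"
| "classical SP d = sp d"

definition exhaustion :: "series \<Rightarrow> nat \<Rightarrow> nat \<Rightarrow> mat set" where
  "exhaustion s r n = classical s (nat_dim s r n)"

definition lie_subalgebra :: "mat set \<Rightarrow> mat set \<Rightarrow> bool" where
  "lie_subalgebra K L \<longleftrightarrow>
     cmat.subspace K \<and> K \<subseteq> L \<and> (\<forall>x\<in>K. \<forall>y\<in>K. lie_bracket x y \<in> K)"

definition lie_ideal :: "mat set \<Rightarrow> mat set \<Rightarrow> bool" where
  "lie_ideal I L \<longleftrightarrow>
     cmat.subspace I \<and> I \<subseteq> L \<and> (\<forall>x\<in>L. \<forall>y\<in>I. lie_bracket x y \<in> I)"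

definition sum_space :: "mat set \<Rightarrow> mat set \<Rightarrow> mat set" where
  "sum_space A B = {x + y |x y. x \<in> A \<and> y \<in> B}"

definition centralizer :: "mat set \<Rightarrow> mat set \<Rightarrow> mat set" where
  "centralizer L K = {x \<in> L. \<forall>y\<in>K. lie_bracket x y = 0}"

primrec lower_central :: "mat set \<Rightarrow> nat \<Rightarrow> mat set" where
  "lower_central L 0 = L"
| "lower_central L (Suc i) = cmat.span {lie_bracket x y |x y. x \<in> L \<and> y \<in> lower_central L i}"

definition nilpotent_lie :: "mat set \<Rightarrow> bool" where
  "nilpotent_lie L \<longleftrightarrow> (\<exists>i. lower_central L i = {0})"

text \<open>The sum of all nilpotent ideals.\<close>

definition nilradical :: "mat set \<Rightarrow> mat set" where
  "nilradical L = cmat.span (\<Union>{I. lie_ideal I L \<and> nilpotent_lie I})"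

definition cartan_subalgebra :: "mat set \<Rightarrow> mat set \<Rightarrow> bool" where
  "cartan_subalgebra T K \<longleftrightarrow>
     lie_subalgebra T K \<and> nilpotent_lie T \<and> {x \<in> K. \<forall>y\<in>T. lie_bracket x y \<in> T} = T"

definition ad_eigenspace :: "mat set \<Rightarrow> mat \<Rightarrow> complex \<Rightarrow> mat set" where
  "ad_eigenspace L h \<sigma> = {x \<in> L. lie_bracket h x = mat_scale \<sigma> x}"

definition ad_semisimple :: "mat set \<Rightarrow> mat \<Rightarrow> bool" where
  "ad_semisimple L h \<longleftrightarrow> cmat.span (\<Union>\<sigma>. ad_eigenspace L h \<sigma>) = L"

definition parabolic_of :: "mat set \<Rightarrow> mat \<Rightarrow> mat set" where
  "parabolic_of L h = cmat.span (\<Union>\<sigma>\<in>{\<sigma>. Re \<sigma> \<ge> 0}. ad_eigenspace L h \<sigma>)"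

definition compatible_parabolic_fin :: "mat set \<Rightarrow> mat set \<Rightarrow> mat set \<Rightarrow> bool" where
  "compatible_parabolic_fin T L P \<longleftrightarrow> (\<exists>h\<in>T. ad_semisimple L h \<and> P = parabolic_of L h)"

definition compatible_parabolic :: "mat set \<Rightarrow> (nat \<Rightarrow> mat set) \<Rightarrow> mat set \<Rightarrow> bool" where
  "compatible_parabolic T G P \<longleftrightarrow>
     lie_subalgebra P (\<Union>n\<in>{1..}. G n) \<and>
     (\<forall>n\<ge>1. compatible_parabolic_fin T (G n) (P \<inter> G n) \<and>
        nilradical (P \<inter> G n) = nilradical (P \<inter> G (Suc n)) \<inter> G n)"


section \<open>Modules over Lie algebras\<close>

text \<open>A representation is a complex vector space in the sense of HOL-Algebra together with an action
  of matrices, of which only the part coming from the Lie algebra under consideration matters. The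
  components \<open>mult\<close> and \<open>one\<close>, which the record type inherits from rings, are irrelevant.\<close>

abbreviation complex_field :: "complex ring" (\<open>\<complex>\<close>) where
  "\<complex> \<equiv> ring_of_type_algebra"

record 'v rep = "(complex, 'v) module" +
  act :: "mat \<Rightarrow> 'v \<Rightarrow> 'v"

definition lie_rep :: "mat set \<Rightarrow> 'v rep \<Rightarrow> bool" where
  "lie_rep L M \<longleftrightarrow> module \<complex> M \<and>
     (\<forall>x\<in>L. \<forall>v\<in>carrier M. act M x v \<in> carrier M) \<and>
     (\<forall>x\<in>L. \<forall>v\<in>carrier M. \<forall>w\<in>carrier M. act M x (v \<oplus>\<^bsub>M\<^esub> w) = act M x v \<oplus>\<^bsub>M\<^esub> act M x w) \<and>
     (\<forall>x\<in>L. \<forall>c. \<forall>v\<in>carrier M. act M x (c \<odot>\<^bsub>M\<^esub> v) = c \<odot>\<^bsub>M\<^esub> act M x v) \<and>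
     (\<forall>x\<in>L. \<forall>y\<in>L. \<forall>v\<in>carrier M. act M (x + y) v = act M x v \<oplus>\<^bsub>M\<^esub> act M y v) \<and>
     (\<forall>x\<in>L. \<forall>c. \<forall>v\<in>carrier M. act M (mat_scale c x) v = c \<odot>\<^bsub>M\<^esub> act M x v) \<and>
     (\<forall>x\<in>L. \<forall>y\<in>L. \<forall>v\<in>carrier M.
        act M (lie_bracket x y) v = act M x (act M y v) \<ominus>\<^bsub>M\<^esub> act M y (act M x v))"

definition subrep :: "mat set \<Rightarrow> 'v rep \<Rightarrow> 'v set \<Rightarrow> bool" where
  "subrep L M N \<longleftrightarrow> submodule N \<complex> M \<and> (\<forall>x\<in>L. \<forall>v\<in>N. act M x v \<in> N)"

definition restr :: "'v rep \<Rightarrow> 'v set \<Rightarrow> 'v rep" where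
  "restr M N = M\<lparr>carrier := N\<rparr>"

definition gen_subrep :: "mat set \<Rightarrow> 'v rep \<Rightarrow> 'v set \<Rightarrow> 'v set" where
  "gen_subrep L M S = \<Inter>{N. subrep L M N \<and> S \<subseteq> N}"

definition lin_span :: "'v rep \<Rightarrow> 'v set \<Rightarrow> 'v set" where
  "lin_span M S = \<Inter>{N. submodule N \<complex> M \<and> S \<subseteq> N}"

definition fin_dim :: "'v rep \<Rightarrow> 'v set \<Rightarrow> bool" where
  "fin_dim M N \<longleftrightarrow> (\<exists>B. finite B \<and> B \<subseteq> carrier M \<and> N = lin_span M B)"

definition simple_rep :: "mat set \<Rightarrow> 'v rep \<Rightarrow> bool" where
  "simple_rep L M \<longleftrightarrow> lie_rep L M \<and> carrier M \<noteq> {\<zero>\<^bsub>M\<^esub>} \<and>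
     (\<forall>N. subrep L M N \<longrightarrow> N = {\<zero>\<^bsub>M\<^esub>} \<or> N = carrier M)"

text \<open>Semisimple: the sum of the simple submodules is everything.\<close>

definition semisimple_rep :: "mat set \<Rightarrow> 'v rep \<Rightarrow> bool" where
  "semisimple_rep L M \<longleftrightarrow> lie_rep L M \<and>
     gen_subrep L M (\<Union>{N. subrep L M N \<and> simple_rep L (restr M N)}) = carrier M"

definition rep_hom :: "mat set \<Rightarrow> 'v rep \<Rightarrow> 'w rep \<Rightarrow> ('v \<Rightarrow> 'w) \<Rightarrow> bool" where
  "rep_hom L M N \<phi> \<longleftrightarrow> \<phi> \<in> carrier M \<rightarrow> carrier N \<and>
     (\<forall>v\<in>carrier M. \<forall>w\<in>carrier M. \<phi> (v \<oplus>\<^bsub>M\<^esub> w) = \<phi> v \<oplus>\<^bsub>N\<^esub> \<phi> w) \<and>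
     (\<forall>c. \<forall>v\<in>carrier M. \<phi> (c \<odot>\<^bsub>M\<^esub> v) = c \<odot>\<^bsub>N\<^esub> \<phi> v) \<and>
     (\<forall>x\<in>L. \<forall>v\<in>carrier M. \<phi> (act M x v) = act N x (\<phi> v))"

definition rep_embeds :: "mat set \<Rightarrow> 'v rep \<Rightarrow> 'w rep \<Rightarrow> bool" where
  "rep_embeds L M N \<longleftrightarrow> (\<exists>\<phi>. rep_hom L M N \<phi> \<and> inj_on \<phi> (carrier M))"

definition rep_iso :: "mat set \<Rightarrow> 'v rep \<Rightarrow> 'w rep \<Rightarrow> bool" where
  "rep_iso L M N \<longleftrightarrow> (\<exists>\<phi>. rep_hom L M N \<phi> \<and> bij_betw \<phi> (carrier M) (carrier N))"

definition quot_rep :: "'v rep \<Rightarrow> 'v set \<Rightarrow> 'v set rep" where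
  "quot_rep M N =
     \<lparr>carrier = a_rcosets\<^bsub>M\<^esub> N, monoid.mult = undefined, monoid.one = undefined,
      ring.zero = N, ring.add = set_add M,
      module.smult = (\<lambda>c A. \<Union>v\<in>A. N +>\<^bsub>M\<^esub> (c \<odot>\<^bsub>M\<^esub> v)),
      act = (\<lambda>x A. \<Union>v\<in>A. N +>\<^bsub>M\<^esub> act M x v)\<rparr>"

definition ad_rep :: "mat set \<Rightarrow> mat rep" where
  "ad_rep L =
     \<lparr>carrier = L, monoid.mult = undefined, monoid.one = undefined, ring.zero = 0, ring.add = (+),
      module.smult = mat_scale, act = lie_bracket\<rparr>"

definition reductive_in :: "mat set \<Rightarrow> mat set \<Rightarrow> bool" where
  "reductive_in K L \<longleftrightarrow> lie_subalgebra K L \<and> semisimple_rep K (ad_rep L)"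


section \<open>Tensor modules\<close>

text \<open>Column vectors of length \<open>d\<close>.\<close>

definition nat_rep :: "nat \<Rightarrow> (nat \<Rightarrow> complex) rep" where
  "nat_rep d =
     \<lparr>carrier = {v. \<forall>i\<ge>d. v i = 0}, monoid.mult = undefined, monoid.one = undefined,
      ring.zero = 0, ring.add = (+), module.smult = (\<lambda>c v i. c * v i),
      act = (\<lambda>x v i. \<Sum>j<d. x i j * v j)\<rparr>"

definition dual_rep :: "'v rep \<Rightarrow> ('v \<Rightarrow> complex) rep" where
  "dual_rep M =
     \<lparr>carrier = {f \<in> extensional (carrier M).
        (\<forall>v\<in>carrier M. \<forall>w\<in>carrier M. f (v \<oplus>\<^bsub>M\<^esub> w) = f v + f w) \<and>
        (\<forall>c. \<forall>v\<in>carrier M. f (c \<odot>\<^bsub>M\<^esub> v) = c * f v)},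
      monoid.mult = undefined, monoid.one = undefined,
      ring.zero = (\<lambda>v\<in>carrier M. 0), ring.add = (\<lambda>f g. \<lambda>v\<in>carrier M. f v + g v),
      module.smult = (\<lambda>c f. \<lambda>v\<in>carrier M. c * f v),
      act = (\<lambda>x f. \<lambda>v\<in>carrier M. - f (act M x v))\<rparr>"

definition triv_rep :: "complex rep" where
  "triv_rep =
     \<lparr>carrier = UNIV, monoid.mult = undefined, monoid.one = undefined, ring.zero = 0, ring.add = (+),
      module.smult = (*), act = (\<lambda>x v. 0)\<rparr>"

definition power_rep :: "'v rep \<Rightarrow> nat \<Rightarrow> (nat \<Rightarrow> 'v) rep" where
  "power_rep M a =
     \<lparr>carrier = {..<a} \<rightarrow>\<^sub>E carrier M, monoid.mult = undefined, monoid.one = undefined,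
      ring.zero = (\<lambda>i\<in>{..<a}. \<zero>\<^bsub>M\<^esub>), ring.add = (\<lambda>f g. \<lambda>i\<in>{..<a}. f i \<oplus>\<^bsub>M\<^esub> g i),
      module.smult = (\<lambda>c f. \<lambda>i\<in>{..<a}. c \<odot>\<^bsub>M\<^esub> f i), act = (\<lambda>x f. \<lambda>i\<in>{..<a}. act M x (f i))\<rparr>"

definition dsum_rep :: "'v rep \<Rightarrow> 'w rep \<Rightarrow> ('v \<times> 'w) rep" where
  "dsum_rep M N =
     \<lparr>carrier = carrier M \<times> carrier N, monoid.mult = undefined, monoid.one = undefined,
      ring.zero = (\<zero>\<^bsub>M\<^esub>, \<zero>\<^bsub>N\<^esub>),
      ring.add = (\<lambda>u v. (fst u \<oplus>\<^bsub>M\<^esub> fst v, snd u \<oplus>\<^bsub>N\<^esub> snd v)),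
      module.smult = (\<lambda>c u. (c \<odot>\<^bsub>M\<^esub> fst u, c \<odot>\<^bsub>N\<^esub> snd u)),
      act = (\<lambda>x u. (act M x (fst u), act N x (snd u)))\<rparr>"

text \<open>The free vector space on a set \<open>Y\<close>, on which \<open>x\<close> acts linearly and sends the basis element
  \<open>w\<close> to \<open>\<phi> x w\<close>. Modules presented by generators and relations are quotients of such.\<close>

definition pm_scale :: "complex \<Rightarrow> ('x \<Rightarrow>\<^sub>0 complex) \<Rightarrow> ('x \<Rightarrow>\<^sub>0 complex)" where
  "pm_scale c f = Poly_Mapping.map ((*) c) f"

definition free_rep :: "'x set \<Rightarrow> (mat \<Rightarrow> 'x \<Rightarrow> ('x \<Rightarrow>\<^sub>0 complex)) \<Rightarrow> ('x \<Rightarrow>\<^sub>0 complex) rep" where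
  "free_rep Y \<phi> =
     \<lparr>carrier = {f. Poly_Mapping.keys f \<subseteq> Y}, monoid.mult = undefined, monoid.one = undefined,
      ring.zero = 0, ring.add = (+), module.smult = pm_scale,
      act = (\<lambda>x f. \<Sum>w\<in>Poly_Mapping.keys f. pm_scale (Poly_Mapping.lookup f w) (\<phi> x w))\<rparr>"

text \<open>\<open>T\<^sup>k(W)\<close>: the quotient of the free vector space on the \<open>k\<close>-tuples of vectors (lists
  of length \<open>k\<close>) by the multilinearity relations, with the Leibniz rule for the action.\<close>

definition tuples_rep :: "nat \<Rightarrow> 'v rep \<Rightarrow> ('v list \<Rightarrow>\<^sub>0 complex) rep" where
  "tuples_rep k W = free_rep {ws. length ws = k \<and> set ws \<subseteq> carrier W}
     (\<lambda>x ws. \<Sum>i<k. Poly_Mapping.single (ws[i := act W x (ws ! i)]) 1)"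

definition tensor_rels :: "nat \<Rightarrow> 'v rep \<Rightarrow> ('v list \<Rightarrow>\<^sub>0 complex) set" where
  "tensor_rels k W =
     {Poly_Mapping.single (ws[i := u \<oplus>\<^bsub>W\<^esub> v]) 1
        - Poly_Mapping.single (ws[i := u]) 1 - Poly_Mapping.single (ws[i := v]) 1 |ws i u v.
        length ws = k \<and> set ws \<subseteq> carrier W \<and> i < k \<and> u \<in> carrier W \<and> v \<in> carrier W} \<union>
     {Poly_Mapping.single (ws[i := c \<odot>\<^bsub>W\<^esub> u]) 1 - Poly_Mapping.single (ws[i := u]) c |ws i c u.
        length ws = k \<and> set ws \<subseteq> carrier W \<and> i < k \<and> u \<in> carrier W}"

definition tensor_power :: "nat \<Rightarrow> 'v rep \<Rightarrow> ('v list \<Rightarrow>\<^sub>0 complex) set rep" where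
  "tensor_power k W = quot_rep (tuples_rep k W) (lin_span (tuples_rep k W) (tensor_rels k W))"

type_synonym mixed =
  "(nat \<Rightarrow> nat \<Rightarrow> complex) \<times> (nat \<Rightarrow> (nat \<Rightarrow> complex) \<Rightarrow> complex) \<times> (nat \<Rightarrow> complex)"

text \<open>\<open>T\<^sup>k(V\<^sup>a \<oplus> (V\<^sup>*)\<^sup>b \<oplus> \<complex>\<^sup>c)\<close> for the natural module \<open>V\<close> of dimension \<open>d\<close>\<close>

definition mixed_tensors ::
    "nat \<Rightarrow> nat \<Rightarrow> nat \<Rightarrow> nat \<Rightarrow> nat \<Rightarrow> (mixed list \<Rightarrow>\<^sub>0 complex) set rep" where
  "mixed_tensors d k a b c = tensor_power k
     (dsum_rep (power_rep (nat_rep d) a)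
        (dsum_rep (power_rep (dual_rep (nat_rep d)) b) (power_rep triv_rep c)))"


section \<open>The universal enveloping algebra and induced modules\<close>

text \<open>\<open>U(L)\<close> is the free associative algebra on the set \<open>L\<close> (formal linear combinations of words)
  modulo the two-sided ideal generated by the relations that make the inclusion of \<open>L\<close> linear and a
  homomorphism of Lie algebras.\<close>

definition free_alg :: "mat set \<Rightarrow> (complex, mat list \<Rightarrow>\<^sub>0 complex) module" where
  "free_alg L =
     \<lparr>carrier = {f. Poly_Mapping.keys f \<subseteq> lists L},
      monoid.mult = (\<lambda>f g. \<Sum>u\<in>Poly_Mapping.keys f. \<Sum>v\<in>Poly_Mapping.keys g.
         Poly_Mapping.single (u @ v) (Poly_Mapping.lookup f u * Poly_Mapping.lookup g v)),
      monoid.one = Poly_Mapping.single [] 1, ring.zero = 0, ring.add = (+), module.smult = pm_scale\<rparr>"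

definition uea_rels :: "mat set \<Rightarrow> (mat list \<Rightarrow>\<^sub>0 complex) set" where
  "uea_rels L =
     {Poly_Mapping.single [x + y] 1 - Poly_Mapping.single [x] 1 - Poly_Mapping.single [y] 1 |x y.
        x \<in> L \<and> y \<in> L} \<union>
     {Poly_Mapping.single [mat_scale c x] 1 - Poly_Mapping.single [x] c |c x. x \<in> L} \<union>
     {Poly_Mapping.single [x, y] 1 - Poly_Mapping.single [y, x] 1
        - Poly_Mapping.single [lie_bracket x y] 1 |x y. x \<in> L \<and> y \<in> L}"

definition uea_ideal :: "mat set \<Rightarrow> (mat list \<Rightarrow>\<^sub>0 complex) set" where
  "uea_ideal L = Idl\<^bsub>free_alg L\<^esub> (uea_rels L)"

definition uea_class :: "mat set \<Rightarrow> (mat list \<Rightarrow>\<^sub>0 complex) \<Rightarrow> (mat list \<Rightarrow>\<^sub>0 complex) set" where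
  "uea_class L f = uea_ideal L +>\<^bsub>free_alg L\<^esub> f"

definition uea :: "mat set \<Rightarrow> (complex, (mat list \<Rightarrow>\<^sub>0 complex) set) module" where
  "uea L = ring.extend (free_alg L Quot uea_ideal L)
     (module.fields (\<lambda>c A. \<Union>f\<in>A. uea_class L (pm_scale c f)))"

text \<open>The homomorphism \<open>U(P) \<rightarrow> U(G)\<close> induced by an inclusion \<open>P \<subseteq> G\<close>\<close>

definition uea_incl :: "mat set \<Rightarrow> (mat list \<Rightarrow>\<^sub>0 complex) set \<Rightarrow> (mat list \<Rightarrow>\<^sub>0 complex) set" where
  "uea_incl G A = (\<Union>f\<in>A. uea_class G f)"

text \<open>The action of \<open>U(P)\<close> on a \<open>P\<close>-module: all representatives of an element of \<open>U(P)\<close> act in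
  the same way.\<close>

definition word_act :: "'v rep \<Rightarrow> (mat list \<Rightarrow>\<^sub>0 complex) \<Rightarrow> 'v \<Rightarrow> 'v" where
  "word_act E f e =
     (\<Oplus>\<^bsub>E\<^esub>w\<in>Poly_Mapping.keys f. Poly_Mapping.lookup f w \<odot>\<^bsub>E\<^esub> foldr (act E) w e)"

definition uea_act :: "'v rep \<Rightarrow> (mat list \<Rightarrow>\<^sub>0 complex) set \<Rightarrow> 'v \<Rightarrow> 'v" where
  "uea_act E A e = the_elem ((\<lambda>f. word_act E f e) ` A)"

text \<open>\<open>U(G) \<otimes> E\<close> over \<open>U(P)\<close>: the free vector space on pairs \<open>(u, e)\<close> modulo the
  relations making \<open>(u, e) \<mapsto> u \<otimes> e\<close> bilinear and balanced over \<open>U(P)\<close>; \<open>G\<close> acts by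
  left multiplication on the first factor.\<close>

definition ind_free ::
    "mat set \<Rightarrow> 'e rep \<Rightarrow> ((mat list \<Rightarrow>\<^sub>0 complex) set \<times> 'e \<Rightarrow>\<^sub>0 complex) rep" where
  "ind_free G E = free_rep (carrier (uea G) \<times> carrier E)
     (\<lambda>x (u, e). Poly_Mapping.single (uea_class G (Poly_Mapping.single [x] 1) \<otimes>\<^bsub>uea G\<^esub> u, e) 1)"

definition ind_rels ::
    "mat set \<Rightarrow> mat set \<Rightarrow> 'e rep \<Rightarrow> ((mat list \<Rightarrow>\<^sub>0 complex) set \<times> 'e \<Rightarrow>\<^sub>0 complex) set" where
  "ind_rels G P E =
     {Poly_Mapping.single (u \<oplus>\<^bsub>uea G\<^esub> u', e) 1
        - Poly_Mapping.single (u, e) 1 - Poly_Mapping.single (u', e) 1 |u u' e.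
        u \<in> carrier (uea G) \<and> u' \<in> carrier (uea G) \<and> e \<in> carrier E} \<union>
     {Poly_Mapping.single (u, e \<oplus>\<^bsub>E\<^esub> e') 1
        - Poly_Mapping.single (u, e) 1 - Poly_Mapping.single (u, e') 1 |u e e'.
        u \<in> carrier (uea G) \<and> e \<in> carrier E \<and> e' \<in> carrier E} \<union>
     {Poly_Mapping.single (c \<odot>\<^bsub>uea G\<^esub> u, e) 1 - Poly_Mapping.single (u, e) c |c u e.
        u \<in> carrier (uea G) \<and> e \<in> carrier E} \<union>
     {Poly_Mapping.single (u, c \<odot>\<^bsub>E\<^esub> e) 1 - Poly_Mapping.single (u, e) c |c u e.
        u \<in> carrier (uea G) \<and> e \<in> carrier E} \<union>
     {Poly_Mapping.single (u \<otimes>\<^bsub>uea G\<^esub> uea_incl G q, e) 1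
        - Poly_Mapping.single (u, uea_act E q e) 1 |u q e.
        u \<in> carrier (uea G) \<and> q \<in> carrier (uea P) \<and> e \<in> carrier E}"

definition induced ::
    "mat set \<Rightarrow> mat set \<Rightarrow> 'e rep \<Rightarrow> ((mat list \<Rightarrow>\<^sub>0 complex) set \<times> 'e \<Rightarrow>\<^sub>0 complex) set rep" where
  "induced G P E = quot_rep (ind_free G E) (lin_span (ind_free G E) (ind_rels G P E))"

text \<open>For a Lie algebra \<open>P\<close> that is the direct sum of a subalgebra \<open>M\<close> and an ideal \<open>N\<close>: the
  \<open>P\<close>-module obtained from an \<open>M\<close>-module by letting \<open>N\<close> act by zero.\<close>

definition extend_by_zero :: "mat set \<Rightarrow> mat set \<Rightarrow> 'e rep \<Rightarrow> 'e rep" where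
  "extend_by_zero M N E = E\<lparr>act := \<lambda>x. act E (THE y. y \<in> M \<and> x - y \<in> N)\<rparr>"


section \<open>Modules of finite type\<close>

text \<open>\<open>G\<close> is an exhaustion \<open>G 1 \<subseteq> G 2 \<subseteq> \<dots>\<close> by finite-dimensional Lie algebras of some Lie algebra
  containing \<open>L\<close>; \<open>L\<close> itself is exhausted by the \<open>L \<inter> G n\<close>.\<close>

definition integrable_rep :: "(nat \<Rightarrow> mat set) \<Rightarrow> mat set \<Rightarrow> 'v rep \<Rightarrow> bool" where
  "integrable_rep G L M \<longleftrightarrow>
     (\<forall>v\<in>carrier M. \<forall>n\<ge>1. fin_dim M (gen_subrep (L \<inter> G n) M {v}))"

definition pair_module :: "(nat \<Rightarrow> mat set) \<Rightarrow> mat set \<Rightarrow> mat set \<Rightarrow> 'v rep \<Rightarrow> bool" where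
  "pair_module G M L Y \<longleftrightarrow> lie_subalgebra L M \<and> lie_rep M Y \<and> integrable_rep G L Y"

definition comp_factor :: "'v rep \<Rightarrow> 'v set list \<Rightarrow> nat \<Rightarrow> 'v set rep" where
  "comp_factor M cs i = quot_rep (restr M (cs ! Suc i)) (cs ! i)"

definition composition_series :: "mat set \<Rightarrow> 'v rep \<Rightarrow> 'v set list \<Rightarrow> bool" where
  "composition_series L M cs \<longleftrightarrow>
     cs \<noteq> [] \<and> hd cs = {\<zero>\<^bsub>M\<^esub>} \<and> last cs = carrier M \<and> (\<forall>N\<in>set cs. subrep L M N) \<and>
     (\<forall>i. Suc i < length cs \<longrightarrow> cs ! i \<subseteq> cs ! Suc i \<and> simple_rep L (comp_factor M cs i))"

definition finite_length :: "mat set \<Rightarrow> 'v rep \<Rightarrow> bool" where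
  "finite_length L M \<longleftrightarrow> (\<exists>cs. composition_series L M cs)"

definition factor_count :: "mat set \<Rightarrow> 'v rep \<Rightarrow> 'v set list \<Rightarrow> 'w rep \<Rightarrow> nat" where
  "factor_count L M cs S = card {i. Suc i < length cs \<and> rep_iso L (comp_factor M cs i) S}"

text \<open>The multiplicity of \<open>S\<close> in a module of finite length is the number of factors isomorphic to
  \<open>S\<close> in a composition series. By the Jordan-Hoelder theorem this does not depend on the series; the
  second clause bounds it for all of them. The type argument is the type carrying
  the simple modules \<open>S\<close>.\<close>

definition finite_type ::
    "'w itself \<Rightarrow> (nat \<Rightarrow> mat set) \<Rightarrow> mat set \<Rightarrow> 'v rep \<Rightarrow> bool" where
  "finite_type (_ :: 'w itself) G L Y \<longleftrightarrow>
     (\<forall>F. finite F \<and> F \<subseteq> carrier Y \<longrightarrow> finite_length L (restr Y (gen_subrep L Y F))) \<and>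
     (\<forall>S :: 'w rep. simple_rep L S \<and> integrable_rep G L S \<longrightarrow>
        (\<exists>B. \<forall>F cs. finite F \<and> F \<subseteq> carrier Y \<and>
             composition_series L (restr Y (gen_subrep L Y F)) cs \<longrightarrow>
             factor_count L (restr Y (gen_subrep L Y F)) cs S \<le> B))"

end

theory Submission
  imports Defs "HOL-Computational_Algebra.Fundamental_Theorem_Algebra"
begin

text \<open>The two-dimensional coordinate blocks beyond the natural module of \<open>\<gg>\<^sub>1\<close> are permuted by
  infinitesimal rotations of \<open>\<gg>\<close>. These commute with \<open>\<kk>\<^sub>0\<close> and hence lie in \<open>\<kk> \<inter> \<mm>\<close>. On a tensor
  power of bounded degree, chains of subspaces stable under the rotations of the first \<open>nb\<close> blocks
  have length bounded independently of \<open>nb\<close>: an equivariant endomorphism is determined by its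
  matrix coefficients on the words that involve only boundedly many blocks. The step \<open>Fil j\<close> of the
  filtration of \<open>M(\<pp>, E)\<close> by degree is, locally, an equivariant image of a tensor power of degree
  \<open>l + 2 j\<close>, since \<open>\<gg>\<^sub>n\<close> is itself an equivariant image of a tensor square. So it has bounded chains
  of \<open>\<kk> \<inter> \<mm>\<close>-submodules, whence integrability and finite length. For the multiplicities, let \<open>h\<close>
  be the element of \<open>\<tt>\<^sub>0\<close> that defines \<open>\<pp>\<close> at a fixed level. As \<open>\<gg>\<close> is generated from that level
  by rotations, which commute with \<open>h\<close>, the splitting \<open>\<gg> = \<pp> + W\<close>, with \<open>ad h\<close> having eigenvalues of
  real part at most \<open>- \<epsilon> < 0\<close> on \<open>W\<close>, persists on all of \<open>\<gg>\<close>. Hence \<open>M(\<pp>, E)\<close> is the sum of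
  \<open>Fil j\<close> and of vectors whose weights for \<open>h\<close> have real part at most \<open>\<rho> - (j + 1) \<epsilon>\<close>. Once this
  is below the real part of an eigenvalue of \<open>h\<close> on a simple module, every occurrence of that
  module as a composition factor is already visible in \<open>Fil j\<close>.\<close>


section \<open>Orthogonal projections in spaces of finitely supported functions\<close>

text \<open>The obstacle is uniformity: the levels grow without bound, while lengths and
  multiplicities must obey one number. A rotation is a real skew matrix that exchanges two blocks of
  two coordinates; two coordinates per block let it preserve the symplectic form, so it serves sl,
  so and sp alike. Being skew, it identifies the natural module with its dual, so that all tensors
  become functions on words, and it is skew-adjoint for the standard Hermitian form. Hence
  orthogonal projections onto stable subspaces are equivariant; they take the place of complements
  and turn subspaces into images. The projections of a strict chain are linearly independent, and an
  equivariant operator on words of length K is an invariant function on words of length 2 K: this is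
  where the 2 K blocks, d + 4 K coordinates, come from. On the side of weights, the element that
  defines the parabolic subalgebra may change with the level. One h is taken at the first level with
  a spare block, since the part of a matrix that joins old coordinates to a remote block can be
  rotated into the spare one.\<close>

definition fscale :: "complex => ('w => complex) => 'w => complex" where
  "fscale c f = (\<lambda>w. c * f w)"

lemma fscale_apply [simp]: "fscale c f w = c * f w"
  by (simp add: fscale_def)

global_interpretation cfun: vector_space fscale
  by unfold_locales (auto simp: fscale_def fun_eq_iff algebra_simps)

definition cspace :: "'w set => ('w => complex) set" where
  "cspace Y = {f. \<forall>w. w \<notin> Y \<longrightarrow> f w = 0}"

definition delta :: "'w => 'w => complex" where
  "delta w = (\<lambda>v. if v = w then 1 else 0)"

definition ip :: "'w set => ('w => complex) => ('w => complex) => complex" where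
  "ip Y f g = (\<Sum>w\<in>Y. f w * cnj (g w))"

lemma subspace_cspace: "cfun.subspace (cspace Y)"
  by (auto simp: cfun.subspace_def cspace_def)

lemma delta_in_cspace: "w \<in> Y ==> delta w \<in> cspace Y"
  by (auto simp: delta_def cspace_def)

lemma sum_fun_apply: "(\<Sum>i\<in>A. f i) x = (\<Sum>i\<in>A. f i x)" for f :: "'i => 'w => complex"
  by (induction A rule: infinite_finite_induct) auto

lemma cspace_eq_sum_delta:
  assumes "finite Y" "f \<in> cspace Y"
  shows "f = (\<Sum>w\<in>Y. fscale (f w) (delta w))"
proof
  fix x
  have "(\<Sum>w\<in>Y. fscale (f w) (delta w)) x = (\<Sum>w\<in>Y. if w = x then f w else 0)"
    unfolding sum_fun_apply by (rule sum.cong) (auto simp: delta_def)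
  also have "\<dots> = f x" using assms by (auto simp: cspace_def)
  finally show "f x = (\<Sum>w\<in>Y. fscale (f w) (delta w)) x" ..
qed

lemma span_delta:
  assumes "finite Y"
  shows "cfun.span (delta ` Y) = cspace Y"
proof
  show "cfun.span (delta ` Y) \<subseteq> cspace Y"
    by (rule cfun.span_minimal) (auto simp: subspace_cspace intro: delta_in_cspace)
  show "cspace Y \<subseteq> cfun.span (delta ` Y)"
  proof
    fix f assume "f \<in> cspace Y"
    then show "f \<in> cfun.span (delta ` Y)"
      by (subst cspace_eq_sum_delta[OF assms])
        (auto intro!: cfun.span_sum cfun.span_scale intro: cfun.span_base)
  qed
qed

lemma finite_basis_cspace:
  assumes "finite Y" "cfun.subspace N" "N \<subseteq> cspace Y"
  obtains B where "finite B" "B \<subseteq> N" "cfun.span B = N"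
proof -
  obtain B where B: "B \<subseteq> N" "cfun.independent B" "N \<subseteq> cfun.span B"
    using cfun.maximal_independent_subset by blast
  have "B \<subseteq> cfun.span (delta ` Y)" using B assms span_delta by blast
  then have "finite B" using cfun.independent_span_bound[of "delta ` Y" B] assms B by auto
  moreover have "cfun.span B = N" using B assms cfun.span_minimal by blast
  ultimately show ?thesis using B that by blast
qed

section \<open>Gram-Schmidt and orthogonal projection\<close>

lemma ip_simps:
  "ip Y (f + g) h = ip Y f h + ip Y g h" "ip Y (f - g) h = ip Y f h - ip Y g h"
  "ip Y (fscale c f) h = c * ip Y f h"
  "ip Y h (f + g) = ip Y h f + ip Y h g" "ip Y h (f - g) = ip Y h f - ip Y h g"
  "ip Y h (fscale c f) = cnj c * ip Y h f" "ip Y 0 h = 0" "ip Y h 0 = 0"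
  by (simp_all add: ip_def algebra_simps sum.distrib sum_subtractf sum_distrib_left)

lemma cnj_ip: "cnj (ip Y f g) = ip Y g f"
  by (simp add: ip_def mult.commute)

lemma ip_self_eq_0:
  assumes "finite Y" "f \<in> cspace Y" "ip Y f f = 0"
  shows "f = 0"
proof -
  have "complex_of_real (\<Sum>w\<in>Y. (cmod (f w))\<^sup>2) = 0"
    using assms(3) by (simp add: ip_def complex_norm_square[symmetric])
  then have "(\<Sum>w\<in>Y. (cmod (f w))\<^sup>2) = 0" using of_real_eq_0_iff by blast
  then have "\<forall>w\<in>Y. f w = 0" using assms(1) by (simp add: sum_nonneg_eq_0_iff)
  then show ?thesis using assms(2) by (auto simp: cspace_def fun_eq_iff)
qed

text \<open>Gram-Schmidt by induction on \<open>B\<close>: the component \<open>e\<close> of the new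
  vector orthogonal to the old span corrects the projection \<open>u\<close> already found, and
  orthogonality to the old vectors survives because \<open>e\<close> is orthogonal to them.\<close>

lemma gram_schmidt_proj:
  assumes "finite Y" "finite B" "B \<subseteq> cspace Y"
  shows "\<exists>u\<in>cfun.span B. \<forall>b\<in>B. ip Y (f - u) b = 0"
  using assms(2,3)
proof (induction B arbitrary: f rule: finite_induct)
  case empty
  then show ?case using cfun.span_zero by blast
next
  case (insert b B)
  obtain u where u: "u \<in> cfun.span B" "\<forall>b\<in>B. ip Y (f - u) b = 0" using insert by blast
  obtain v where v: "v \<in> cfun.span B" "\<forall>c\<in>B. ip Y (b - v) c = 0" using insert by blast
  define e where "e = b - v"
  have sub: "cfun.span B \<subseteq> cspace Y" using insert.prems subspace_cspace cfun.span_minimal by auto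
  have e_span: "e \<in> cfun.span (insert b B)"
    unfolding e_def using v cfun.span_base[of b "insert b B"] cfun.span_mono[of B "insert b B"]
    by (auto intro!: cfun.span_diff)
  have eY: "e \<in> cspace Y"
    unfolding e_def using insert.prems v sub subspace_cspace cfun.subspace_diff by blast
  have ort: "ip Y e w = 0" "ip Y w e = 0" if "w \<in> cfun.span B" for w
  proof -
    show 1: "ip Y e w = 0" using that
      by (induction rule: cfun.span_induct_alt) (simp_all only: ip_simps(4-8) v(2)[rule_format] e_def mult_zero_right add_0)
    show "ip Y w e = 0" using 1 cnj_ip[of Y e w] by simp
  qed
  \<comment> \<open>If \<open>b\<close> already lies in the span of \<open>B\<close>, then
    \<open>e = 0\<close> and nothing is corrected.\<close>
  define c where "c = (if e = 0 then 0 else ip Y (f - u) e / ip Y e e)"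
  define z where "z = u + fscale c e"
  have z: "z \<in> cfun.span (insert b B)"
    unfolding z_def using u e_span cfun.span_mono[of B "insert b B"]
    by (auto intro!: cfun.span_add cfun.span_scale)
  have ip_e: "ip Y (f - z) e = 0"
    using ip_self_eq_0[OF assms(1) eY] by (auto simp: z_def c_def ip_simps)
  have fz: "f - z = (f - u) - fscale c e" by (simp add: z_def)
  have ip_B: "ip Y (f - z) w = 0" if "w \<in> B" for w
    unfolding fz using u(2) that ort(1)[OF cfun.span_base[OF that]] by (simp add: ip_simps(2,3))
  have ip_sp: "ip Y (f - z) w = 0" if "w \<in> cfun.span B" for w
    using that by (induction rule: cfun.span_induct_alt)
      (simp_all only: ip_simps(4-8) ip_B mult_zero_right add_0)
  have "ip Y (f - z) b = 0"
  proof -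
    have "b = e + v" by (simp add: e_def)
    then show ?thesis using ip_e ip_sp[OF v(1)] by (metis ip_simps(4) add_0)
  qed
  then show ?case using z ip_B by blast
qed

lemma orth_proj_ex1:
  assumes "finite Y" "cfun.subspace N" "N \<subseteq> cspace Y"
  shows "\<exists>!u. u \<in> N \<and> (\<forall>b\<in>N. ip Y (f - u) b = 0)"
proof -
  obtain B where B: "finite B" "B \<subseteq> N" "cfun.span B = N"
    using finite_basis_cspace[OF assms] .
  obtain u where u: "u \<in> N" "\<forall>b\<in>B. ip Y (f - u) b = 0"
    using gram_schmidt_proj[of Y B f] B assms by blast
  have all: "ip Y (f - u) w = 0" if "w \<in> N" for w
    using that unfolding B(3)[symmetric]
    by (induction rule: cfun.span_induct_alt) (simp_all only: ip_simps(4-8) u(2)[rule_format] mult_zero_right add_0)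
  show ?thesis
  proof (rule ex1I[of _ u])
    fix u' assume u': "u' \<in> N \<and> (\<forall>b\<in>N. ip Y (f - u') b = 0)"
    have d: "u' - u \<in> N" using u' u(1) assms(2) cfun.subspace_diff by blast
    have "ip Y (u' - u) (u' - u) = ip Y (f - u) (u' - u) - ip Y (f - u') (u' - u)"
      by (simp add: ip_simps(1-3))
    then have "ip Y (u' - u) (u' - u) = 0" using all u' d by simp
    then have "u' - u = 0" using ip_self_eq_0 assms d by blast
    then show "u' = u" by simp
  qed (use u all in blast)
qed

definition orth_proj :: "'w set => ('w => complex) set => ('w => complex) => 'w => complex" where
  "orth_proj Y N f = (THE u. u \<in> N \<and> (\<forall>b\<in>N. ip Y (f - u) b = 0))"

definition clinear_on :: "'w set => (('w => complex) => ('w => complex)) => bool" where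
  "clinear_on Y A \<longleftrightarrow> (\<forall>f\<in>cspace Y. A f \<in> cspace Y) \<and>
     (\<forall>f\<in>cspace Y. \<forall>g\<in>cspace Y. A (f + g) = A f + A g) \<and>
     (\<forall>c. \<forall>f\<in>cspace Y. A (fscale c f) = fscale c (A f))"

context
  fixes Y :: "'w set" and N :: "('w => complex) set"
  assumes Y: "finite Y" and N: "cfun.subspace N" "N \<subseteq> cspace Y"
begin

lemma orth_proj_in: "orth_proj Y N f \<in> N"
  and orth_proj_orth: "b \<in> N ==> ip Y (f - orth_proj Y N f) b = 0"
  using theI'[OF orth_proj_ex1[OF Y N, of f]] unfolding orth_proj_def by auto

lemma orth_proj_eqI: "u \<in> N ==> (!!b. b \<in> N ==> ip Y (f - u) b = 0) ==> orth_proj Y N f = u"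
  using orth_proj_ex1[OF Y N, of f] orth_proj_in orth_proj_orth by blast

lemma orth_proj_id: "f \<in> N ==> orth_proj Y N f = f"
  by (rule orth_proj_eqI) (auto simp: ip_simps)

lemma orth_proj_eq_0: "(!!b. b \<in> N ==> ip Y f b = 0) ==> orth_proj Y N f = 0"
  by (rule orth_proj_eqI) (auto simp: cfun.subspace_0 N(1))

lemma orth_proj_add: "orth_proj Y N (f + g) = orth_proj Y N f + orth_proj Y N g"
proof (rule orth_proj_eqI)
  fix b assume b: "b \<in> N"
  have "f + g - (orth_proj Y N f + orth_proj Y N g) = (f - orth_proj Y N f) + (g - orth_proj Y N g)"
    by simp
  then show "ip Y (f + g - (orth_proj Y N f + orth_proj Y N g)) b = 0"
    using orth_proj_orth[OF b] by (metis ip_simps(1) add_0)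
qed (use orth_proj_in N cfun.subspace_add in blast)

lemma orth_proj_scale: "orth_proj Y N (fscale c f) = fscale c (orth_proj Y N f)"
proof (rule orth_proj_eqI)
  fix b assume b: "b \<in> N"
  have "fscale c f - fscale c (orth_proj Y N f) = fscale c (f - orth_proj Y N f)"
    by (simp add: cfun.scale_right_diff_distrib)
  then show "ip Y (fscale c f - fscale c (orth_proj Y N f)) b = 0"
    using orth_proj_orth[OF b] by (metis ip_simps(3) mult_zero_right)
qed (use orth_proj_in N cfun.subspace_scale in blast)

text \<open>Skewness moves \<open>A\<close> onto the test vector \<open>b\<close>, and
  \<open>A b\<close> lies again in \<open>N\<close>, to which the residual
  \<open>f - orth_proj Y N f\<close> is orthogonal. This makes projections onto rotation-stable
  subspaces equivariant.\<close>

lemma orth_proj_commute: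
  assumes A: "clinear_on Y A" and skew: "!!f g. f \<in> cspace Y ==> g \<in> cspace Y ==> ip Y (A f) g = - ip Y f (A g)"
    and stable: "!!f. f \<in> N ==> A f \<in> N" and f: "f \<in> cspace Y"
  shows "orth_proj Y N (A f) = A (orth_proj Y N f)"
proof (rule orth_proj_eqI)
  fix b assume b: "b \<in> N"
  have P: "orth_proj Y N f \<in> cspace Y" using orth_proj_in N by blast
  have "ip Y (A f - A (orth_proj Y N f)) b = - ip Y (f - orth_proj Y N f) (A b)"
    using skew f P b N(2) by (simp add: ip_simps(1-3) subset_iff)
  also have "\<dots> = 0" using orth_proj_orth stable b by simp
  finally show "ip Y (A f - A (orth_proj Y N f)) b = 0" .
qed (use orth_proj_in stable in blast)

end

text \<open>Gaussian elimination: the equation \<open>s\<close> is solved for a pivot unknown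
  \<open>k\<close>, and the remaining system, with one equation and one unknown fewer, is solved by
  induction. It serves both the independence of projections and the annihilating polynomial of an
  operator.\<close>

lemma underdetermined_system:
  fixes a :: "'i => 's => complex"
  assumes "finite S" "finite I" "card S < card I"
  shows "\<exists>c. (\<exists>i\<in>I. c i \<noteq> 0) \<and> (\<forall>s\<in>S. (\<Sum>i\<in>I. c i * a i s) = 0)"
  using assms
proof (induction S arbitrary: I a rule: finite_induct)
  case empty
  then have "I \<noteq> {}" by auto
  then show ?case by (intro exI[of _ "\<lambda>_. 1"]) auto
next
  case (insert s S)
  show ?case
  proof (cases "\<forall>i\<in>I. a i s = 0")
    case True
    have "\<exists>c. (\<exists>i\<in>I. c i \<noteq> 0) \<and> (\<forall>s\<in>S. (\<Sum>i\<in>I. c i * a i s) = 0)"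
      using insert by (intro insert.IH) auto
    with True show ?thesis by auto
  next
    case False
    then obtain k where k: "k \<in> I" "a k s \<noteq> 0" by blast
    define J where "J = I - {k}"
    define b where "b i t = a i t - a i s / a k s * a k t" for i t
    have "card S < card J" "finite J" using insert k by (auto simp: J_def)
    then obtain c where c: "\<exists>i\<in>J. c i \<noteq> 0" "\<forall>t\<in>S. (\<Sum>i\<in>J. c i * b i t) = 0"
      using insert.IH by blast
    \<comment> \<open>The value at the pivot is forced by equation \<open>s\<close>.\<close>
    define e where "e = (\<lambda>i. if i = k then - (\<Sum>i\<in>J. c i * (a i s / a k s)) else c i)"
    have e_sum: "(\<Sum>i\<in>I. e i * a i t) = (\<Sum>i\<in>J. c i * b i t)" for t
    proof -
      have "(\<Sum>i\<in>I. e i * a i t) = e k * a k t + (\<Sum>i\<in>J. e i * a i t)"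
        unfolding J_def using k insert.prems by (subst sum.remove[of I k]) auto
      also have "(\<Sum>i\<in>J. e i * a i t) = (\<Sum>i\<in>J. c i * a i t)"
        by (rule sum.cong) (auto simp: e_def J_def)
      also have "e k * a k t + \<dots> = (\<Sum>i\<in>J. c i * b i t)"
        by (simp add: e_def b_def algebra_simps sum_subtractf sum_distrib_left sum_distrib_right)
      finally show ?thesis .
    qed
    have "b i s = 0" for i using k by (simp add: b_def)
    then have "(\<Sum>i\<in>I. e i * a i t) = 0" if "t \<in> insert s S" for t
      using that c(2) by (auto simp: e_sum)
    moreover have "\<exists>i\<in>I. e i \<noteq> 0" using c(1) by (auto simp: J_def e_def)
    ultimately show ?thesis by blast
  qed
qed

section \<open>Rotations acting on functions on words\<close>

text \<open>A letter is a pair of a label, which tells copies of the natural module apart, and a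
  coordinate.\<close>

type_synonym word = "(nat \<times> nat) list"

text \<open>Coordinates from \<open>d\<close> on form blocks of two; block \<open>i\<close> consists
  of \<open>d + 2 * i\<close> and its successor. Adding before subtracting keeps the natural numbers
  from truncating.\<close>

definition sw :: "nat => nat => nat => nat => nat" where
  "sw d i j u = (if u = d + 2 * i \<or> u = d + 2 * i + 1 then u + 2 * j - 2 * i
     else if u = d + 2 * j \<or> u = d + 2 * j + 1 then u + 2 * i - 2 * j else u)"

definition sg :: "nat => nat => nat => nat => complex" where
  "sg d i j u = (if u = d + 2 * i \<or> u = d + 2 * i + 1 then 1
     else if u = d + 2 * j \<or> u = d + 2 * j + 1 then - 1 else 0)"

definition wsw :: "nat => nat => nat => nat => word => word" where
  "wsw d i j p w = w[p := (fst (w ! p), sw d i j (snd (w ! p)))]"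

definition wsg :: "nat => nat => nat => nat => word => complex" where
  "wsg d i j p w = sg d i j (snd (w ! p))"

text \<open>The rotation of blocks \<open>i\<close> and \<open>j\<close> acting as a derivation on
  tensors written as functions of their coordinates: one summand for each position of the
  word.\<close>

definition wact :: "nat => nat => nat => (word => complex) => word => complex" where
  "wact d i j f w = (\<Sum>p<length w. wsg d i j p w * f (wsw d i j p w))"

definition words :: "nat => nat => nat => word set" where
  "words c D K = {w. length w = K \<and> set w \<subseteq> {..<c} \<times> {..<D}}"

lemma finite_words: "finite (words c D K)"
  using finite_lists_length_eq[of "{..<c} \<times> {..<D}" K] by (simp add: words_def conj_commute)

lemma length_words: "w \<in> words c D K ==> length w = K"
  by (simp add: words_def)

lemma sw_sw [simp]: "i \<noteq> j ==> sw d i j (sw d i j u) = u"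
  by (auto simp: sw_def)

lemma sg_sw [simp]: "i \<noteq> j ==> sg d i j (sw d i j u) = - sg d i j u"
  by (auto simp: sg_def sw_def)

lemma sw_less: "u < d + 2 * nb ==> i < nb ==> j < nb ==> sw d i j u < d + 2 * nb"
  by (auto simp: sw_def)

lemma length_wsw [simp]: "length (wsw d i j p w) = length w"
  by (simp add: wsw_def)

lemma wsw_wsw [simp]: "i \<noteq> j ==> p < length w ==> wsw d i j p (wsw d i j p w) = w"
  by (simp add: wsw_def)

lemma wsg_wsw [simp]: "i \<noteq> j ==> p < length w ==> wsg d i j p (wsw d i j p w) = - wsg d i j p w"
  by (simp add: wsg_def wsw_def)

lemma cnj_wsg [simp]: "cnj (wsg d i j p w) = wsg d i j p w"
  by (simp add: wsg_def sg_def)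

lemma nth_wsw: "q < length w ==>
    wsw d i j p w ! q = (if q = p then (fst (w ! p), sw d i j (snd (w ! p))) else w ! q)"
  by (simp add: wsw_def)

lemma wsw_in_words:
  assumes "w \<in> words c (d + 2 * nb) K" "i < nb" "j < nb"
  shows "wsw d i j p w \<in> words c (d + 2 * nb) K"
proof (cases "p < K")
  case True
  then have "w ! p \<in> {..<c} \<times> {..<d + 2 * nb}" using assms(1) nth_mem by (fastforce simp: words_def)
  then have "(fst (w ! p), sw d i j (snd (w ! p))) \<in> {..<c} \<times> {..<d + 2 * nb}"
    using assms by (auto simp: sw_less)
  then show ?thesis using assms(1) set_update_subset_insert[of w p "(fst (w ! p), sw d i j (snd (w ! p)))"]
    by (simp add: words_def wsw_def) blast
next
  case False
  then show ?thesis using assms by (simp add: words_def wsw_def list_update_beyond)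
qed

lemma wsw_in_words_iff:
  assumes "i < nb" "j < nb" "i \<noteq> j" "p < length w"
  shows "wsw d i j p w \<in> words c (d + 2 * nb) K \<longleftrightarrow> w \<in> words c (d + 2 * nb) K"
  using wsw_in_words[OF _ assms(1,2)] wsw_wsw[OF assms(3,4)] by metis

lemma wact_add: "wact d i j (f + g) = wact d i j f + wact d i j g"
  by (simp add: wact_def fun_eq_iff sum.distrib algebra_simps)

lemma wact_scale: "wact d i j (fscale c f) = fscale c (wact d i j f)"
  by (simp add: wact_def fun_eq_iff sum_distrib_left mult.left_commute)

lemma wact_zero: "wact d i j 0 = 0"
  by (simp add: wact_def fun_eq_iff)

lemma wact_sum: "wact d i j (\<Sum>k\<in>I. fscale (a k) (g k)) = (\<Sum>k\<in>I. fscale (a k) (wact d i j (g k)))"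
  by (induction I rule: infinite_finite_induct)
    (simp_all only: wact_zero wact_add wact_scale sum.empty sum.insert sum.infinite simp_thms)

lemma wact_linear:
  assumes "i < nb" "j < nb" "i \<noteq> j"
  shows "clinear_on (words c (d + 2 * nb) K) (wact d i j)"
  unfolding clinear_on_def
proof (intro conjI ballI allI)
  fix f assume f: "f \<in> cspace (words c (d + 2 * nb) K)"
  show "wact d i j f \<in> cspace (words c (d + 2 * nb) K)"
    using f assms by (auto simp: cspace_def wact_def wsw_in_words_iff intro!: sum.neutral)
qed (simp_all only: wact_add wact_scale)

text \<open>For each position, moving its letter is an involution of the words that reverses the
  real sign; reindexing the inner product by it carries the operator to the other argument with a
  minus sign.\<close>

lemma wact_skew:
  fixes c d nb K :: nat
  assumes "i < nb" "j < nb" "i \<noteq> j"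
  defines "Y \<equiv> words c (d + 2 * nb) K"
  shows "ip Y (wact d i j f) g = - ip Y f (wact d i j g)"
proof -
  have "ip Y (wact d i j f) g = (\<Sum>w\<in>Y. \<Sum>p<K. wsg d i j p w * f (wsw d i j p w) * cnj (g w))"
    unfolding ip_def wact_def
    by (rule sum.cong) (auto simp: Y_def length_words sum_distrib_right)
  also have "\<dots> = (\<Sum>p<K. \<Sum>w\<in>Y. wsg d i j p w * f (wsw d i j p w) * cnj (g w))"
    by (rule sum.swap)
  also have "\<dots> = (\<Sum>p<K. \<Sum>w\<in>Y. - (f w * cnj (wsg d i j p w * g (wsw d i j p w))))"
  proof (rule sum.cong[OF refl])
    fix p assume "p \<in> {..<K}"
    then have p: "p < length w" if "w \<in> Y" for w using that by (auto simp: Y_def length_words)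
    have Y: "wsw d i j p w \<in> Y" if "w \<in> Y" for w
      using that wsw_in_words assms(1,2) by (auto simp: Y_def)
    show "(\<Sum>w\<in>Y. wsg d i j p w * f (wsw d i j p w) * cnj (g w))
        = (\<Sum>w\<in>Y. - (f w * cnj (wsg d i j p w * g (wsw d i j p w))))"
      by (rule sum.reindex_bij_witness[of Y "wsw d i j p" "wsw d i j p"])
        (use p Y assms(3) in \<open>simp_all add: cnj_wsg\<close>)
  qed
  also have "\<dots> = (\<Sum>w\<in>Y. \<Sum>p<K. - (f w * cnj (wsg d i j p w * g (wsw d i j p w))))"
    by (rule sum.swap)
  also have "\<dots> = - ip Y f (wact d i j g)"
    unfolding ip_def wact_def sum_negf[symmetric]
    by (rule sum.cong) (auto simp: Y_def length_words sum_negf sum_distrib_left)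
  finally show ?thesis .
qed

lemma wact_delta:
  assumes "i \<noteq> j"
  shows "wact d i j (delta w) = - (\<Sum>p<length w. fscale (wsg d i j p w) (delta (wsw d i j p w)))"
proof
  fix v
  show "wact d i j (delta w) v
      = (- (\<Sum>p<length w. fscale (wsg d i j p w) (delta (wsw d i j p w)))) v"
  proof (cases "length v = length w")
    case True
    have "wsg d i j p v * delta w (wsw d i j p v) = - (wsg d i j p w * delta (wsw d i j p w) v)"
      if p: "p < length w" for p
    proof -
      have "v = wsw d i j p w" if "wsw d i j p v = w"
        using that p True wsw_wsw[OF assms, of p v d] by simp
      moreover have "wsw d i j p v = w" if "v = wsw d i j p w"
        using that p True wsw_wsw[OF assms, of p w d] by simp
      ultimately have iff: "wsw d i j p v = w \<longleftrightarrow> v = wsw d i j p w" by blast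
      have "wsg d i j p v = - wsg d i j p w" if "wsw d i j p w = v"
        using that p wsg_wsw[OF assms, of p w d] by blast
      then show ?thesis unfolding delta_def
        by (cases "wsw d i j p w = v") (auto simp: iff)
    qed
    then have "wact d i j (delta w) v = (\<Sum>p<length w. - (wsg d i j p w * delta (wsw d i j p w) v))"
      unfolding wact_def True by (intro sum.cong) auto
    then show ?thesis
      by (simp add: sum_fun_apply sum_negf)
  next
    case False
    then have "wsw d i j p v \<noteq> w" "v \<noteq> wsw d i j p w" for p
      by (metis length_wsw)+
    then have "delta w (wsw d i j p v) = 0" "delta (wsw d i j p w) v = 0" for p
      by (simp_all add: delta_def)
    then show ?thesis by (simp add: wact_def sum_fun_apply)
  qed
qed

text \<open>The relation at the word in which one letter from a large block is moved to a small block not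
  used by the word expresses the value at the original word by values at words with fewer letters
  from large blocks.\<close>

lemma wact_invariant_determined:
  assumes inv: "!!i j w. i < nb ==> j < nb ==> i \<noteq> j ==> w \<in> words c (d + 2 * nb) K ==> wact d i j T w = 0"
    and small: "!!w. w \<in> words c (d + 2 * nb) K ==> w \<in> words c (d + 2 * K) K ==> T w = 0"
    and w: "w \<in> words c (d + 2 * nb) K"
  shows "T w = 0"
  using w
proof (induction "card {p. p < K \<and> d + 2 * K \<le> snd (w ! p)}" arbitrary: w rule: less_induct)
  case less
  have len: "length w = K" using less.prems length_words by blast
  show ?case
  proof (cases "\<exists>p<K. d + 2 * K \<le> snd (w ! p)")
    case False
    have "x \<in> {..<c} \<times> {..<d + 2 * K}" if x: "x \<in> set w" for x
    proof -
      obtain p where "p < K" "x = w ! p" using x len by (auto simp: in_set_conv_nth)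
      then have "snd x < d + 2 * K" using False not_le by blast
      moreover have "fst x < c" using that less.prems by (auto simp: words_def)
      ultimately show ?thesis by (simp add: mem_Times_iff)
    qed
    then have "set w \<subseteq> {..<c} \<times> {..<d + 2 * K}" by blast
    then show ?thesis using small[of w] less.prems len by (simp add: words_def)
  next
    case True
    then obtain p where p: "p < K" "d + 2 * K \<le> snd (w ! p)" by blast
    \<comment> \<open>The blocks used at the other \<open>K - 1\<close> positions, so that some
      block \<open>j < K\<close> is free. Letters with coordinate below \<open>d\<close> are counted
      in block 0, which only makes \<open>B\<close> larger.\<close>
    define B where "B = (\<lambda>q. (snd (w ! q) - d) div 2) ` ({..<K} - {p})"
    have "card B \<le> card ({..<K} - {p})" unfolding B_def by (rule card_image_le) simp
    also have "\<dots> < K" using p by simp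
    finally have "card B < K" .
    moreover have "finite B" by (simp add: B_def)
    ultimately have "\<not> {..<K} \<subseteq> B" using card_mono[of B "{..<K}"] by auto
    then obtain j where j: "j < K" "j \<notin> B" by blast
    define i where "i = (snd (w ! p) - d) div 2"
    have u: "snd (w ! p) = d + 2 * i \<or> snd (w ! p) = d + 2 * i + 1" "K \<le> i"
      using p by (auto simp: i_def)
    have "w ! p \<in> {..<c} \<times> {..<d + 2 * nb}"
      using less.prems p(1) len nth_mem[of p w] unfolding words_def by blast
    then have "snd (w ! p) < d + 2 * nb" by (simp add: mem_Times_iff)
    then have i: "i < nb" using u by auto
    have ij: "i \<noteq> j" "j < nb" using u j i by auto
    define v where "v = wsw d i j p w"
    have v: "v \<in> words c (d + 2 * nb) K" unfolding v_def using wsw_in_words less.prems i ij by blast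
    \<comment> \<open>The letter of \<open>v\<close> at \<open>q\<close> is not in block
      \<open>j\<close>, so a nonzero sign puts it in block \<open>i\<close>. Swapping it as well
      leaves both \<open>p\<close> and \<open>q\<close> in the small block \<open>j\<close>, and the
      induction hypothesis applies.\<close>
    have other: "wsg d i j q v * T (wsw d i j q v) = 0" if q: "q < K" "q \<noteq> p" for q
    proof (cases "wsg d i j q v = 0")
      case False
      have vq: "v ! q = w ! q" using q len by (simp add: v_def nth_wsw)
      have "snd (w ! q) \<noteq> d + 2 * j" "snd (w ! q) \<noteq> d + 2 * j + 1"
        using j(2) q unfolding B_def by force+
      then have "snd (w ! q) = d + 2 * i \<or> snd (w ! q) = d + 2 * i + 1"
        using False by (auto simp: wsg_def sg_def vq split: if_splits)
      have "{r. r < K \<and> d + 2 * K \<le> snd (wsw d i j q v ! r)}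
          \<subset> {r. r < K \<and> d + 2 * K \<le> snd (w ! r)}" (is "?A \<subset> ?B")
      proof
        show "?A \<subseteq> ?B"
          using u j ij len q \<open>snd (w ! q) = d + 2 * i \<or> snd (w ! q) = d + 2 * i + 1\<close>
          by (auto simp: v_def nth_wsw sw_def split: if_splits)
        have "p \<in> ?B" using p by simp
        moreover have "p \<notin> ?A" using u j len q p by (auto simp: v_def nth_wsw sw_def)
        ultimately show "?A \<noteq> ?B" by blast
      qed
      then have "T (wsw d i j q v) = 0"
        by (intro less.hyps psubset_card_mono wsw_in_words v i ij) auto
      then show ?thesis by simp
    qed simp
    have "wact d i j T v = wsg d i j p v * T (wsw d i j p v) + (\<Sum>q\<in>{..<K} - {p}. wsg d i j q v * T (wsw d i j q v))"
      unfolding wact_def using p by (subst sum.remove[of _ p]) (auto simp: v_def len)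
    also have "(\<Sum>q\<in>{..<K} - {p}. wsg d i j q v * T (wsw d i j q v)) = 0"
      by (rule sum.neutral) (use other in auto)
    \<comment> \<open>In \<open>v\<close> the letter at \<open>p\<close> sits in block
      \<open>j\<close>, whose sign is -1, and swapping it again restores \<open>w\<close>.\<close>
    also have "wsg d i j p v * T (wsw d i j p v) = - T w"
      using u ij p len by (auto simp: v_def) (auto simp: wsg_def sg_def)
    finally show ?thesis using inv[OF i ij(2,1) v] by simp
  qed
qed

section \<open>Chains of rotation-stable subspaces\<close>

lemma wact_append:
  "wact d i j T (v @ w) = wact d i j (\<lambda>x. T (x @ w)) v + wact d i j (\<lambda>y. T (v @ y)) w"
proof -
  have "wact d i j T (v @ w) = (\<Sum>p<length v. wsg d i j p (v @ w) * T (wsw d i j p (v @ w)))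
      + (\<Sum>p<length w. wsg d i j (length v + p) (v @ w) * T (wsw d i j (length v + p) (v @ w)))"
    unfolding wact_def length_append
    using sum.atLeastLessThan_concat[of 0 "length v" "length v + length w"
        "\<lambda>p. wsg d i j p (v @ w) * T (wsw d i j p (v @ w))"]
      sum.shift_bounds_nat_ivl[of "\<lambda>p. wsg d i j p (v @ w) * T (wsw d i j p (v @ w))" 0 "length v" "length w"]
    by (simp add: atLeast0LessThan add.commute)
  then show ?thesis
    by (simp add: wact_def wsg_def wsw_def nth_append list_update_append)
qed

text \<open>Were \<open>I\<close> larger than the number of matrix coefficients between words over
  the first \<open>2 * K\<close> blocks, some nontrivial combination of the equivariant projections
  would have all these coefficients zero, hence vanish. Its largest index then contradicts
  strictness there. Strictness is asked only at \<open>I\<close>, which later selects the factors of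
  one isomorphism type.\<close>

theorem chain_bound:
  fixes N :: "nat => (word => complex) set" and c d nb K :: nat
  defines "Y \<equiv> \<lambda>nb. words c (d + 2 * nb) K"
  assumes I: "finite I" and mono: "mono N"
    and sub: "!!k. cfun.subspace (N k)" "!!k. N k \<subseteq> cspace (Y nb)"
    and stable: "!!k i j f. i < nb ==> j < nb ==> i \<noteq> j ==> f \<in> N k ==> wact d i j f \<in> N k"
    and strict: "!!k. k \<in> I ==> \<exists>v. v \<in> N (Suc k) \<and> v \<notin> N k"
  shows "card I \<le> card (words c (d + 4 * K) K \<times> words c (d + 4 * K) K)"
proof (rule ccontr)
  let ?S = "words c (d + 4 * K) K \<times> words c (d + 4 * K) K"
  assume neg: "\<not> ?thesis"
  define P where "P k = orth_proj (Y nb) (N k)" for k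
  have Y: "finite (Y nb)" by (simp add: Y_def finite_words)
  note proj = orth_proj_in[OF Y sub] orth_proj_orth[OF Y sub] orth_proj_id[OF Y sub] orth_proj_eq_0[OF Y sub]
    orth_proj_add[OF Y sub] orth_proj_scale[OF Y sub]
  obtain a where a: "\<exists>k\<in>I. a k \<noteq> 0"
    "\<forall>s\<in>?S. (\<Sum>k\<in>I. a k * (case s of (v, w) => P (Suc k) (delta w) v)) = 0"
    using underdetermined_system[of ?S I "\<lambda>k (v, w). P (Suc k) (delta w) v"] I neg
    by (auto simp: finite_words)
  define Q where "Q f = (\<Sum>k\<in>I. fscale (a k) (P (Suc k) f))" for f
  have Q_add: "Q (f + g) = Q f + Q g" for f g
    by (simp add: Q_def P_def proj cfun.scale_right_distrib sum.distrib)
  have Q_scale: "Q (fscale b f) = fscale b (Q f)" for b f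
    by (simp add: Q_def P_def proj cfun.scale_sum_right mult.commute)
  have Q_0: "Q 0 = 0" using Q_scale[of 0 0] by simp
  have Q_sum: "Q (\<Sum>x\<in>A. f x) = (\<Sum>x\<in>A. Q (f x))" for A :: "nat set" and f
    by (induction A rule: infinite_finite_induct)
      (simp_all only: Q_0 Q_add sum.empty sum.insert sum.infinite simp_thms)
  have Q_neg: "Q (- f) = - Q f" for f using Q_scale[of "- 1" f] by simp
  have Q_wact: "Q (wact d i j f) = wact d i j (Q f)"
    if "i < nb" "j < nb" "i \<noteq> j" "f \<in> cspace (Y nb)" for i j f
  proof -
    have "P k (wact d i j f) = wact d i j (P k f)" for k
      unfolding P_def Y_def
    proof (rule orth_proj_commute)
      show "clinear_on (words c (d + 2 * nb) K) (wact d i j)" by (rule wact_linear) fact+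
      show "ip (words c (d + 2 * nb) K) (wact d i j f) g = - ip (words c (d + 2 * nb) K) f (wact d i j g)"
        for f g by (rule wact_skew) fact+
    qed (use that sub stable finite_words in \<open>simp_all add: Y_def\<close>)
    then show ?thesis by (simp only: Q_def wact_sum)
  qed
  \<comment> \<open>The matrix of \<open>Q\<close> read as one function of the row word followed by
    the column word. Since the rotations are skew, commuting with them means that this function is
    invariant on words of length \<open>2 * K\<close>.\<close>
  define T where "T z = Q (delta (drop K z)) (take K z)" for z
  have T0: "T z = 0" if "z \<in> words c (d + 2 * nb) (2 * K)" for z
    using _ _ that
  proof (rule wact_invariant_determined)
    fix i j w assume ij: "i < nb" "j < nb" "i \<noteq> j" and w: "w \<in> words c (d + 2 * nb) (2 * K)"
    define x where "x = take K w"
    define y where "y = drop K w"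
    have xy: "w = x @ y" "length x = K" "length y = K" and yY: "y \<in> Y nb"
      using w set_take_subset[of K w] set_drop_subset[of K w] by (auto simp: x_def y_def words_def Y_def)
    have "wact d i j T w = wact d i j (\<lambda>z. Q (delta (drop K (z @ y))) (take K (z @ y))) x
        + wact d i j (\<lambda>z. Q (delta (drop K (x @ z))) (take K (x @ z))) y"
      unfolding xy(1) wact_append T_def ..
    also have "wact d i j (\<lambda>z. Q (delta (drop K (z @ y))) (take K (z @ y))) x = wact d i j (Q (delta y)) x"
      by (simp add: wact_def xy)
    also have "\<dots> = Q (wact d i j (delta y)) x"
      using Q_wact ij delta_in_cspace[OF yY] by simp
    also have "\<dots> = - (\<Sum>p<K. wsg d i j p y * Q (delta (wsw d i j p y)) x)"
      using ij by (simp add: wact_delta Q_neg Q_sum Q_scale sum_fun_apply xy)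
    also have "wact d i j (\<lambda>z. Q (delta (drop K (x @ z))) (take K (x @ z))) y
        = (\<Sum>p<K. wsg d i j p y * Q (delta (wsw d i j p y)) x)"
      by (simp add: wact_def xy)
    finally show "wact d i j T w = 0" by simp
  next
    fix w assume "w \<in> words c (d + 2 * (2 * K)) (2 * K)"
    then have "take K w \<in> words c (d + 4 * K) K" "drop K w \<in> words c (d + 4 * K) K"
      using set_take_subset[of K w] set_drop_subset[of K w] by (auto simp: words_def)
    then show "T w = 0" using a(2) by (fastforce simp: T_def Q_def sum_fun_apply)
  qed
  have Q_delta: "Q (delta w) = 0" if "w \<in> Y nb" for w
  proof
    fix v
    show "Q (delta w) v = 0 v"
    proof (cases "v \<in> Y nb")
      case True
      then have "v @ w \<in> words c (d + 2 * nb) (2 * K)" "length v = K"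
        using that by (auto simp: Y_def words_def)
      then show ?thesis using T0[of "v @ w"] by (simp add: T_def)
    next
      case False
      then have "P k (delta w) v = 0" for k using proj(1) sub unfolding P_def cspace_def by blast
      then show ?thesis by (simp add: Q_def sum_fun_apply)
    qed
  qed
  have Q_zero: "Q f = 0" if "f \<in> cspace (Y nb)" for f
  proof -
    have "f \<in> cfun.span (delta ` Y nb)" using that span_delta[OF Y] by simp
    moreover have "Q x = 0" if "x \<in> delta ` Y nb" for x using Q_delta that by blast
    ultimately show ?thesis
      by (induction rule: cfun.span_induct_alt) (simp_all only: Q_0 Q_add Q_scale cfun.scale_zero_right add_0)
  qed
  \<comment> \<open>At the largest index with nonzero coefficient, the component \<open>u\<close> of
    a new vector orthogonal to \<open>N k\<close> is killed by all earlier projections and fixed by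
    the projection onto \<open>N (Suc k)\<close>, so that \<open>Q\<close> acts on \<open>u\<close>
    by the scalar \<open>a k\<close>.\<close>
  define k where "k = Max {k \<in> I. a k \<noteq> 0}"
  have k: "k \<in> I" "a k \<noteq> 0" "!!k'. k' \<in> I ==> a k' \<noteq> 0 ==> k' \<le> k"
    using Max_in[of "{k \<in> I. a k \<noteq> 0}"] a(1) I by (auto simp: k_def)
  obtain v where v: "v \<in> N (Suc k)" "v \<notin> N k" using strict k(1) by blast
  define u where "u = v - P k v"
  have "P k v \<in> N (Suc k)" using proj(1) mono unfolding P_def by (meson le_SucI monoD order_refl subsetD)
  then have u: "u \<in> N (Suc k)" unfolding u_def using v sub cfun.subspace_diff by blast
  have "P k' u = 0" if "k' \<le> k" for k'
    unfolding P_def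
  proof (rule proj(4))
    fix b assume "b \<in> N k'"
    then have "b \<in> N k" using that mono by (meson monoD subsetD)
    then show "ip (Y nb) u b = 0" unfolding u_def P_def by (rule proj(2))
  qed
  then have "fscale (a k') (P (Suc k') u) = 0" if "k' \<in> I - {k}" for k'
    using that k(3)[of k'] by (cases "a k' = 0") (simp_all add: fun_eq_iff Suc_le_eq order_less_le)
  moreover have "P (Suc k) u = u" unfolding P_def using u by (rule proj(3))
  moreover have "Q u = fscale (a k) (P (Suc k) u) + (\<Sum>k'\<in>I - {k}. fscale (a k') (P (Suc k') u))"
    unfolding Q_def using k(1) I by (rule sum.remove[rotated])
  moreover have "(\<Sum>k'\<in>I - {k}. fscale (a k') (P (Suc k') u)) = 0"
    by (rule sum.neutral) (use calculation(1) in blast)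
  ultimately have "Q u = fscale (a k) u" by (simp only: add_0_right)
  then have "fscale (a k) u = 0" using Q_zero u sub by (metis subsetD)
  then have "u = 0" using k(2) by (simp add: fun_eq_iff)
  then show False using v(2) proj(1)[of k v] by (simp add: u_def P_def)
qed

section \<open>Modules over the complex numbers\<close>

lemma complex_field_simps [simp]:
  "carrier \<complex> = UNIV" "x \<oplus>\<^bsub>\<complex>\<^esub> y = x + y" "x \<otimes>\<^bsub>\<complex>\<^esub> y = x * y" "\<one>\<^bsub>\<complex>\<^esub> = 1" "\<zero>\<^bsub>\<complex>\<^esub> = 0"
  by (simp_all add: ring_of_type_algebra_def)

lemma cring_complex_field: "cring \<complex>"
  by (rule cring_from_type_algebra)

lemma a_inv_complex_field [simp]: "\<ominus>\<^bsub>\<complex>\<^esub> x = - x"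
proof -
  interpret cring \<complex> by (rule cring_complex_field)
  show ?thesis using minus_equality[of "- x" x] by simp
qed

locale cmodule = module "\<complex>" M for M :: "(complex, 'v, 'm) module_scheme" (structure)
begin

lemma scale_closed [simp, intro]: "v \<in> carrier M ==> c \<odot> v \<in> carrier M"
  by (rule smult_closed) simp

lemma scale_add_left: "v \<in> carrier M ==> (a + b) \<odot> v = a \<odot> v \<oplus> b \<odot> v"
  using smult_l_distr[of a b v] by simp

lemma scale_add_right: "v \<in> carrier M ==> w \<in> carrier M ==> a \<odot> (v \<oplus> w) = a \<odot> v \<oplus> a \<odot> w"
  using smult_r_distr[of a v w] by simp

lemma scale_scale: "v \<in> carrier M ==> a \<odot> (b \<odot> v) = (a * b) \<odot> v"
  using smult_assoc1[of a b v] by simp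

lemma scale_one [simp]: "v \<in> carrier M ==> 1 \<odot> v = v"
  using smult_one[of v] by simp

lemma scale_zero [simp]: "v \<in> carrier M ==> 0 \<odot> v = \<zero>"
  using smult_l_null[of v] by simp

lemma scale_zero_right [simp]: "c \<odot> \<zero> = \<zero>"
  using smult_r_null[of c] by simp

lemma neg_eq_scale: "v \<in> carrier M ==> \<ominus> v = (- 1) \<odot> v"
  using smult_l_minus[of 1 v] by simp

lemma diff_eq_scale: "v \<in> carrier M ==> w \<in> carrier M ==> v \<ominus> w = v \<oplus> (- 1) \<odot> w"
  by (simp add: minus_eq neg_eq_scale)

lemma submodule_iff:
  "submodule N \<complex> M \<longleftrightarrow> N \<subseteq> carrier M \<and> \<zero> \<in> N \<and> (\<forall>v\<in>N. \<forall>w\<in>N. v \<oplus> w \<in> N) \<and> (\<forall>c. \<forall>v\<in>N. c \<odot> v \<in> N)"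
proof
  assume N: "submodule N \<complex> M"
  have "\<zero> \<in> N" using submoduleE(1,2,4)[OF N] smult_l_null[of _]
    by (metis all_not_in_conv complex_field_simps(1,5) iso_tuple_UNIV_I subsetD)
  then show "N \<subseteq> carrier M \<and> \<zero> \<in> N \<and> (\<forall>v\<in>N. \<forall>w\<in>N. v \<oplus> w \<in> N) \<and> (\<forall>c. \<forall>v\<in>N. c \<odot> v \<in> N)"
    using submoduleE[OF N] by auto
next
  assume "N \<subseteq> carrier M \<and> \<zero> \<in> N \<and> (\<forall>v\<in>N. \<forall>w\<in>N. v \<oplus> w \<in> N) \<and> (\<forall>c. \<forall>v\<in>N. c \<odot> v \<in> N)"
  then show "submodule N \<complex> M" by (intro submoduleI) (auto simp: neg_eq_scale subset_iff)
qed

lemma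
  assumes "submodule N \<complex> M"
  shows submodule_carrier: "v \<in> N ==> v \<in> carrier M"
    and submodule_zero_mem: "\<zero> \<in> N"
    and submodule_add: "v \<in> N ==> w \<in> N ==> v \<oplus> w \<in> N"
    and submodule_scale: "v \<in> N ==> c \<odot> v \<in> N"
  using assms[unfolded submodule_iff] by auto

lemma submodule_diff: "submodule N \<complex> M ==> v \<in> N ==> w \<in> N ==> v \<ominus> w \<in> N"
  by (subst diff_eq_scale) (auto simp: submodule_iff)

lemma add_diff_cancel_sub: "v \<in> carrier M ==> w \<in> carrier M ==> (v \<ominus> w) \<oplus> w = v"
  by (simp add: minus_eq a_assoc l_neg)

lemma diff_zero_iff: "v \<in> carrier M ==> w \<in> carrier M ==> v \<ominus> w = \<zero> \<longleftrightarrow> v = w"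
  using add_diff_cancel_sub[of v w] by (auto simp: minus_eq r_neg)

end

section \<open>Criteria for vector spaces\<close>

lemma cmodule_iff: "cmodule M \<longleftrightarrow> module \<complex> M"
  by (simp add: cmodule_def)

lemma cmoduleI:
  fixes M (structure)
  assumes "abelian_group M"
    and "!!c v. v \<in> carrier M ==> c \<odot> v \<in> carrier M"
    and "!!a b v. v \<in> carrier M ==> (a + b) \<odot> v = a \<odot> v \<oplus> b \<odot> v"
    and "!!a v w. v \<in> carrier M ==> w \<in> carrier M ==> a \<odot> (v \<oplus> w) = a \<odot> v \<oplus> a \<odot> w"
    and "!!a b v. v \<in> carrier M ==> (a * b) \<odot> v = a \<odot> (b \<odot> v)"
    and "!!v. v \<in> carrier M ==> 1 \<odot> v = v"
  shows "module \<complex> M"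
  using assms cring_complex_field by (intro moduleI) auto

text \<open>The inverse of \<open>v\<close> is supplied as \<open>(- 1) \<odot> v\<close>, so the
  concrete modules below are checked by closure and equations between their operations
  alone.\<close>

lemma module_direct:
  fixes M (structure)
  assumes "!!v w. v \<in> carrier M ==> w \<in> carrier M ==> v \<oplus> w \<in> carrier M"
    and "\<zero> \<in> carrier M"
    and "!!u v w. u \<in> carrier M ==> v \<in> carrier M ==> w \<in> carrier M ==> (u \<oplus> v) \<oplus> w = u \<oplus> (v \<oplus> w)"
    and "!!v w. v \<in> carrier M ==> w \<in> carrier M ==> v \<oplus> w = w \<oplus> v"
    and "!!v. v \<in> carrier M ==> \<zero> \<oplus> v = v"
    and "!!v. v \<in> carrier M ==> (- 1) \<odot> v \<oplus> v = \<zero>"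
    and "!!c v. v \<in> carrier M ==> c \<odot> v \<in> carrier M"
    and "!!a b v. v \<in> carrier M ==> (a + b) \<odot> v = a \<odot> v \<oplus> b \<odot> v"
    and "!!a v w. v \<in> carrier M ==> w \<in> carrier M ==> a \<odot> (v \<oplus> w) = a \<odot> v \<oplus> a \<odot> w"
    and "!!a b v. v \<in> carrier M ==> (a * b) \<odot> v = a \<odot> (b \<odot> v)"
    and "!!v. v \<in> carrier M ==> 1 \<odot> v = v"
  shows "module \<complex> M"
proof (rule cmoduleI)
  show "abelian_group M"
  proof (rule abelian_groupI)
    fix v assume v: "v \<in> carrier M"
    then show "\<exists>y\<in>carrier M. y \<oplus> v = \<zero>"
      by (intro bexI[of _ "(- 1) \<odot> v"]) (simp_all add: assms(6,7))
  qed (fact assms)+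
qed (fact assms)+

text \<open>The axioms pass to a surjective image that respects the operations. This covers
  quotients and changes of the action.\<close>

lemma module_image:
  fixes M :: "(complex, 'v, 'm) module_scheme" and Q :: "(complex, 'w, 'q) module_scheme"
  assumes M: "module \<complex> M" and surj: "carrier Q = \<pi> ` carrier M" and zero: "\<zero>\<^bsub>Q\<^esub> = \<pi> \<zero>\<^bsub>M\<^esub>"
    and add: "!!v w. v \<in> carrier M ==> w \<in> carrier M ==> \<pi> v \<oplus>\<^bsub>Q\<^esub> \<pi> w = \<pi> (v \<oplus>\<^bsub>M\<^esub> w)"
    and smult: "!!c v. v \<in> carrier M ==> c \<odot>\<^bsub>Q\<^esub> \<pi> v = \<pi> (c \<odot>\<^bsub>M\<^esub> v)"
  shows "module \<complex> Q"
proof -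
  interpret M: cmodule M using M by (simp add: cmodule_iff)
  show ?thesis
    by (rule module_direct)
      (auto simp: surj zero add smult M.a_ac M.scale_add_left M.scale_add_right M.scale_scale
        M.neg_eq_scale[symmetric] M.l_neg M.r_neg)
qed

section \<open>Linear maps, submodules and restrictions\<close>

definition lin_map :: "(complex, 'v, 'm) module_scheme => (complex, 'w, 'n) module_scheme => ('v => 'w) => bool" where
  "lin_map M N \<phi> \<longleftrightarrow> \<phi> \<in> carrier M \<rightarrow> carrier N \<and>
     (\<forall>v\<in>carrier M. \<forall>w\<in>carrier M. \<phi> (v \<oplus>\<^bsub>M\<^esub> w) = \<phi> v \<oplus>\<^bsub>N\<^esub> \<phi> w) \<and>
     (\<forall>c. \<forall>v\<in>carrier M. \<phi> (c \<odot>\<^bsub>M\<^esub> v) = c \<odot>\<^bsub>N\<^esub> \<phi> v)"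

lemma lin_mapD:
  assumes "lin_map M N \<phi>" "v \<in> carrier M"
  shows lin_map_closed: "\<phi> v \<in> carrier N"
    and lin_map_add: "w \<in> carrier M ==> \<phi> (v \<oplus>\<^bsub>M\<^esub> w) = \<phi> v \<oplus>\<^bsub>N\<^esub> \<phi> w"
    and lin_map_scale: "\<phi> (c \<odot>\<^bsub>M\<^esub> v) = c \<odot>\<^bsub>N\<^esub> \<phi> v"
  using assms by (auto simp: lin_map_def)

lemma lin_map_zero:
  assumes "cmodule M" "cmodule N" "lin_map M N \<phi>"
  shows "\<phi> \<zero>\<^bsub>M\<^esub> = \<zero>\<^bsub>N\<^esub>"
proof -
  interpret M: cmodule M by fact
  interpret N: cmodule N by fact
  show ?thesis
    using lin_map_scale[OF assms(3) M.zero_closed, of 0] lin_map_closed[OF assms(3) M.zero_closed] by simp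
qed

lemma lin_map_diff:
  assumes "cmodule M" "cmodule N" "lin_map M N \<phi>" "v \<in> carrier M" "w \<in> carrier M"
  shows "\<phi> (v \<ominus>\<^bsub>M\<^esub> w) = \<phi> v \<ominus>\<^bsub>N\<^esub> \<phi> w"
proof -
  interpret M: cmodule M by fact
  interpret N: cmodule N by fact
  show ?thesis using assms
    by (simp add: M.diff_eq_scale N.diff_eq_scale lin_map_add lin_map_scale lin_map_closed)
qed

lemma (in cmodule) submodule_vimage:
  assumes N: "cmodule N" and \<phi>: "lin_map M N \<phi>" and S: "submodule S \<complex> N"
  shows "submodule {v \<in> carrier M. \<phi> v \<in> S} \<complex> M"
proof -
  interpret N: cmodule N by fact
  have "\<phi> \<zero> = \<zero>\<^bsub>N\<^esub>" by (rule lin_map_zero[OF cmodule_axioms N \<phi>])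
  then show ?thesis using S by (auto simp: submodule_iff N.submodule_iff lin_mapD[OF \<phi>])
qed

lemma (in cmodule) submodule_image:
  assumes N: "cmodule N" and \<phi>: "lin_map M N \<phi>" and S: "submodule S \<complex> M"
  shows "submodule (\<phi> ` S) \<complex> N"
proof -
  interpret N: cmodule N by fact
  note S' = S[unfolded submodule_iff]
  have c: "v \<in> carrier M" if "v \<in> S" for v using S' that by blast
  show ?thesis unfolding N.submodule_iff
  proof (intro conjI ballI allI)
    show "\<phi> ` S \<subseteq> carrier N" using c lin_map_closed[OF \<phi>] by blast
    show "\<zero>\<^bsub>N\<^esub> \<in> \<phi> ` S" using lin_map_zero[OF cmodule_axioms N \<phi>] S' by (metis imageI)
  next
    fix v w assume "v \<in> \<phi> ` S" "w \<in> \<phi> ` S"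
    then obtain a b where "a \<in> S" "b \<in> S" "v = \<phi> a" "w = \<phi> b" by blast
    then show "v \<oplus>\<^bsub>N\<^esub> w \<in> \<phi> ` S"
      using S' c lin_map_add[OF \<phi>, of a b] by (metis imageI)
  next
    fix e v assume "v \<in> \<phi> ` S"
    then obtain a where "a \<in> S" "v = \<phi> a" by blast
    then show "e \<odot>\<^bsub>N\<^esub> v \<in> \<phi> ` S" using S' c lin_map_scale[OF \<phi>, of a e] by (metis imageI)
  qed
qed

lemma (in cmodule) lin_map_add_fun:
  assumes "lin_map M M f" "lin_map M M g"
  shows "lin_map M M (\<lambda>u. f u \<oplus> g u)"
  unfolding lin_map_def
proof (intro conjI ballI allI funcsetI)
  fix v w assume vw: "v \<in> carrier M" "w \<in> carrier M"
  have "f v \<in> carrier M" "f w \<in> carrier M" "g v \<in> carrier M" "g w \<in> carrier M"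
    using vw by (simp_all add: lin_map_closed[OF assms(1)] lin_map_closed[OF assms(2)])
  then show "f (v \<oplus> w) \<oplus> g (v \<oplus> w) = f v \<oplus> g v \<oplus> (f w \<oplus> g w)"
    using vw by (simp add: lin_map_add[OF assms(1)] lin_map_add[OF assms(2)] a_ac)
next
  fix c v assume v: "v \<in> carrier M"
  have "f v \<in> carrier M" "g v \<in> carrier M" using v by (simp_all add: lin_map_closed[OF assms(1)] lin_map_closed[OF assms(2)])
  then show "f (c \<odot> v) \<oplus> g (c \<odot> v) = c \<odot> (f v \<oplus> g v)"
    using v by (simp add: lin_map_scale[OF assms(1)] lin_map_scale[OF assms(2)] scale_add_right)
qed (simp add: lin_map_closed[OF assms(1)] lin_map_closed[OF assms(2)])

lemma (in cmodule) lin_map_scale_fun: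
  assumes "lin_map M M f"
  shows "lin_map M M (\<lambda>u. c \<odot> f u)"
  using lin_mapD[OF assms]
  by (auto simp: lin_map_def scale_add_right scale_scale mult.commute)

lemma lin_map_comp: "lin_map M N f ==> lin_map N K g ==> lin_map M K (\<lambda>u. g (f u))"
  by (auto simp: lin_map_def Pi_iff)

context cmodule
begin

lemma carrier_submodule: "submodule (carrier M) \<complex> M"
  by (rule carrier_is_submodule)

lemma submodule_zero: "submodule {\<zero>} \<complex> M"
  by (auto simp: submodule_iff)

lemma submodule_Int: "submodule A \<complex> M ==> submodule B \<complex> M ==> submodule (A \<inter> B) \<complex> M"
  by (auto simp: submodule_iff)

end

lemma module_restr:
  assumes "module \<complex> M" "submodule N \<complex> M"
  shows "module \<complex> (restr M N)"
  unfolding restr_def using submodule.submodule_is_module[OF assms(2,1)] .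

lemma restr_simps [simp]:
  "carrier (restr M N) = N" "\<zero>\<^bsub>restr M N\<^esub> = \<zero>\<^bsub>M\<^esub>" "v \<oplus>\<^bsub>restr M N\<^esub> w = v \<oplus>\<^bsub>M\<^esub> w"
  "c \<odot>\<^bsub>restr M N\<^esub> v = c \<odot>\<^bsub>M\<^esub> v" "act (restr M N) x v = act M x v"
  by (simp_all add: restr_def)

lemma restr_restr [simp]: "restr (restr M A) B = restr M B"
  by (simp add: restr_def)

lemma submodule_restr_iff:
  assumes "module \<complex> M" "submodule N \<complex> M"
  shows "submodule S \<complex> (restr M N) \<longleftrightarrow> submodule S \<complex> M \<and> S \<subseteq> N"
proof -
  interpret M: cmodule M using assms by (simp add: cmodule_iff)
  interpret R: cmodule "restr M N" using assms module_restr by (simp add: cmodule_iff)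
  show ?thesis using assms(2) by (auto simp: M.submodule_iff R.submodule_iff)
qed

lemma minus_restr:
  assumes "module \<complex> M" "submodule N \<complex> M" "v \<in> N" "w \<in> N"
  shows "v \<ominus>\<^bsub>restr M N\<^esub> w = v \<ominus>\<^bsub>M\<^esub> w"
proof -
  interpret M: cmodule M using assms by (simp add: cmodule_iff)
  interpret R: cmodule "restr M N" using assms module_restr by (simp add: cmodule_iff)
  have "v \<in> carrier M" "w \<in> carrier M" using assms by (auto simp: M.submodule_iff)
  then show ?thesis using assms by (simp add: M.diff_eq_scale R.diff_eq_scale)
qed

definition act_linear :: "'v rep => mat => bool" where
  "act_linear M x \<longleftrightarrow> lin_map M M (act M x)"

lemma lie_rep_iff:
  "lie_rep L M \<longleftrightarrow> module \<complex> M \<and> (\<forall>x\<in>L. act_linear M x) \<and>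
     (\<forall>x\<in>L. \<forall>y\<in>L. \<forall>v\<in>carrier M. act M (x + y) v = act M x v \<oplus>\<^bsub>M\<^esub> act M y v) \<and>
     (\<forall>x\<in>L. \<forall>c. \<forall>v\<in>carrier M. act M (mat_scale c x) v = c \<odot>\<^bsub>M\<^esub> act M x v) \<and>
     (\<forall>x\<in>L. \<forall>y\<in>L. \<forall>v\<in>carrier M.
        act M (lie_bracket x y) v = act M x (act M y v) \<ominus>\<^bsub>M\<^esub> act M y (act M x v))"
  unfolding lie_rep_def act_linear_def lin_map_def by auto

lemma lie_rep_module: "lie_rep L M ==> cmodule M"
  by (simp add: lie_rep_iff cmodule_iff)

lemma lie_rep_act_linear: "lie_rep L M ==> x \<in> L ==> lin_map M M (act M x)"
  by (simp add: lie_rep_iff act_linear_def)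

lemma
  assumes "lie_rep L M" "x \<in> L" "v \<in> carrier M"
  shows act_closed: "act M x v \<in> carrier M"
    and act_add: "w \<in> carrier M ==> act M x (v \<oplus>\<^bsub>M\<^esub> w) = act M x v \<oplus>\<^bsub>M\<^esub> act M x w"
    and act_scale: "act M x (c \<odot>\<^bsub>M\<^esub> v) = c \<odot>\<^bsub>M\<^esub> act M x v"
    and act_plus: "y \<in> L ==> act M (x + y) v = act M x v \<oplus>\<^bsub>M\<^esub> act M y v"
    and act_mat_scale: "act M (mat_scale c x) v = c \<odot>\<^bsub>M\<^esub> act M x v"
    and act_bracket: "y \<in> L ==>
      act M (lie_bracket x y) v = act M x (act M y v) \<ominus>\<^bsub>M\<^esub> act M y (act M x v)"
proof -
  note D = assms(1)[unfolded lie_rep_def, THEN conjunct2]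
  note D2 = D[THEN conjunct2]
  note D3 = D2[THEN conjunct2]
  note D4 = D3[THEN conjunct2]
  note D5 = D4[THEN conjunct2]
  show "act M x v \<in> carrier M"
    by (rule D[THEN conjunct1, rule_format, OF assms(2,3)])
  show "w \<in> carrier M ==> act M x (v \<oplus>\<^bsub>M\<^esub> w) = act M x v \<oplus>\<^bsub>M\<^esub> act M x w"
    by (rule D2[THEN conjunct1, rule_format, OF assms(2,3)])
  show "act M x (c \<odot>\<^bsub>M\<^esub> v) = c \<odot>\<^bsub>M\<^esub> act M x v"
    by (rule D3[THEN conjunct1, rule_format, OF assms(2,3)])
  show "y \<in> L ==> act M (x + y) v = act M x v \<oplus>\<^bsub>M\<^esub> act M y v"
    by (rule D4[THEN conjunct1, rule_format, OF assms(2) _ assms(3)])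
  show "act M (mat_scale c x) v = c \<odot>\<^bsub>M\<^esub> act M x v"
    by (rule D5[THEN conjunct1, rule_format, OF assms(2,3)])
  show "y \<in> L ==> act M (lie_bracket x y) v = act M x (act M y v) \<ominus>\<^bsub>M\<^esub> act M y (act M x v)"
    by (rule D5[THEN conjunct2, rule_format, OF assms(2) _ assms(3)])
qed

lemma lie_rep_mono: "lie_rep L M ==> K \<subseteq> L ==> lie_rep K M"
  unfolding lie_rep_iff by blast

lemma lie_rep_restr:
  assumes M: "lie_rep L M" and N: "subrep L M N"
  shows "lie_rep L (restr M N)"
proof -
  interpret M: cmodule M by (rule lie_rep_module[OF M])
  have sub: "submodule N \<complex> M" using N by (simp add: subrep_def)
  have mod: "module \<complex> M" using M by (simp add: lie_rep_iff)
  have NM: "v \<in> carrier M" if "v \<in> N" for v using that by (rule M.submodule_carrier[OF sub])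
  have a: "act M x v \<in> N" if "x \<in> L" "v \<in> N" for x v using N that by (simp add: subrep_def)
  show ?thesis
    unfolding lie_rep_def restr_simps
  proof (intro conjI ballI allI)
    show "module \<complex> (restr M N)" by (rule module_restr[OF mod sub])
  next
    fix x y v assume x: "x \<in> L" "y \<in> L" and v: "v \<in> N"
    show "act M (lie_bracket x y) v = act M x (act M y v) \<ominus>\<^bsub>restr M N\<^esub> act M y (act M x v)"
      unfolding minus_restr[OF mod sub a[OF x(1) a[OF x(2) v]] a[OF x(2) a[OF x(1) v]]]
      by (rule act_bracket[OF M x(1) NM[OF v] x(2)])
    show "act M (x + y) v = act M x v \<oplus>\<^bsub>M\<^esub> act M y v"
      by (rule act_plus[OF M x(1) NM[OF v] x(2)])
  next
    fix x v w assume x: "x \<in> L" and v: "v \<in> N" "w \<in> N"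
    show "act M x (v \<oplus>\<^bsub>M\<^esub> w) = act M x v \<oplus>\<^bsub>M\<^esub> act M x w"
      by (rule act_add[OF M x NM[OF v(1)] NM[OF v(2)]])
  next
    fix x c v assume x: "x \<in> L" and v: "v \<in> N"
    show "act M x (c \<odot>\<^bsub>M\<^esub> v) = c \<odot>\<^bsub>M\<^esub> act M x v" by (rule act_scale[OF M x NM[OF v]])
    show "act M (mat_scale c x) v = c \<odot>\<^bsub>M\<^esub> act M x v" by (rule act_mat_scale[OF M x NM[OF v]])
  qed (rule a)
qed

lemma subrep_restr_iff:
  assumes "module \<complex> M" "submodule N \<complex> M"
  shows "subrep L (restr M N) S \<longleftrightarrow> subrep L M S \<and> S \<subseteq> N"
  unfolding subrep_def submodule_restr_iff[OF assms] restr_simps by blast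

section \<open>Quotient modules\<close>

definition qcl :: "(complex, 'v, 'm) module_scheme => 'v set => 'v => 'v set" where
  "qcl M N v = N +>\<^bsub>M\<^esub> v"

locale quot = M: cmodule M for M :: "'v rep" +
  fixes N :: "'v set"
  assumes N: "submodule N \<complex> M"
begin

sublocale abelian_subgroup N M
proof (rule abelian_subgroupI3)
  show "additive_subgroup N M" using N by (simp add: additive_subgroup_def submodule_def)
  show "abelian_group M" by (rule M.abelian_group_axioms)
qed

lemma N_carrier: "v \<in> N ==> v \<in> carrier M"
  by (rule M.submodule_carrier[OF N])

lemma qcl_in: "v \<in> carrier M ==> qcl M N v \<in> carrier (quot_rep M N)"
  unfolding qcl_def quot_rep_def using M.a_rcosetsI[OF a_subset] by simp

lemma carrier_quot: "carrier (quot_rep M N) = qcl M N ` carrier M"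
  by (auto simp: quot_rep_def qcl_def A_RCOSETS_def')

lemma qcl_add: "v \<in> carrier M ==> w \<in> carrier M ==>
    qcl M N v \<oplus>\<^bsub>quot_rep M N\<^esub> qcl M N w = qcl M N (v \<oplus>\<^bsub>M\<^esub> w)"
  by (simp add: quot_rep_def qcl_def a_rcos_sum)

lemma qcl_self: "v \<in> carrier M ==> v \<in> qcl M N v"
  unfolding qcl_def by (rule a_rcos_self)

lemma mem_qcl:
  assumes "v \<in> carrier M"
  shows "u \<in> qcl M N v \<longleftrightarrow> u \<in> carrier M \<and> u \<ominus>\<^bsub>M\<^esub> v \<in> N"
proof (cases "u \<in> carrier M")
  case True
  then show ?thesis using a_rcos_module[OF assms True] by (simp add: qcl_def M.minus_eq)
next
  case False
  then show ?thesis using a_elemrcos_carrier[OF assms, of u] by (auto simp: qcl_def)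
qed

lemma qcl_eq_iff:
  assumes v: "v \<in> carrier M" and w: "w \<in> carrier M"
  shows "qcl M N v = qcl M N w \<longleftrightarrow> v \<ominus>\<^bsub>M\<^esub> w \<in> N"
proof
  assume "qcl M N v = qcl M N w"
  then have "v \<in> qcl M N w" using qcl_self[OF v] by simp
  then show "v \<ominus>\<^bsub>M\<^esub> w \<in> N" using mem_qcl[OF w] by simp
next
  assume "v \<ominus>\<^bsub>M\<^esub> w \<in> N"
  then have "v \<in> N +>\<^bsub>M\<^esub> w" using mem_qcl[OF w, of v] v by (simp add: qcl_def)
  from a_repr_independence'[OF this w] show "qcl M N v = qcl M N w" by (simp add: qcl_def)
qed

text \<open>\<open>quot_rep\<close> defines its operations by a union over representatives. If
  \<open>f\<close> respects congruence modulo \<open>N\<close>, all cosets in the union coincide,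
  and one representative suffices.\<close>

lemma qcl_UN:
  assumes v: "v \<in> carrier M" and f: "!!u. u \<in> carrier M ==> u \<ominus>\<^bsub>M\<^esub> v \<in> N ==> f u \<in> carrier M \<and> f u \<ominus>\<^bsub>M\<^esub> f v \<in> N"
  shows "(\<Union>u\<in>qcl M N v. N +>\<^bsub>M\<^esub> f u) = qcl M N (f v)"
proof -
  have "f v \<in> carrier M" using f[OF v] N by (simp add: M.minus_eq M.r_neg M.submodule_iff v)
  then have "N +>\<^bsub>M\<^esub> f u = qcl M N (f v)" if "u \<in> qcl M N v" for u
    using that f[of u] qcl_eq_iff[of "f u" "f v"] by (simp add: mem_qcl v qcl_def[symmetric])
  then show ?thesis using qcl_self[OF v] by auto
qed

lemma qcl_scale:
  assumes v: "v \<in> carrier M"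
  shows "c \<odot>\<^bsub>quot_rep M N\<^esub> qcl M N v = qcl M N (c \<odot>\<^bsub>M\<^esub> v)"
proof -
  have "(\<Union>u\<in>qcl M N v. N +>\<^bsub>M\<^esub> (c \<odot>\<^bsub>M\<^esub> u)) = qcl M N (c \<odot>\<^bsub>M\<^esub> v)"
  proof (rule qcl_UN[OF v])
    fix u assume u: "u \<in> carrier M" "u \<ominus>\<^bsub>M\<^esub> v \<in> N"
    have "c \<odot>\<^bsub>M\<^esub> u \<ominus>\<^bsub>M\<^esub> c \<odot>\<^bsub>M\<^esub> v = c \<odot>\<^bsub>M\<^esub> (u \<ominus>\<^bsub>M\<^esub> v)"
      using u v by (simp add: M.diff_eq_scale M.scale_add_right M.scale_scale)
    then show "c \<odot>\<^bsub>M\<^esub> u \<in> carrier M \<and> c \<odot>\<^bsub>M\<^esub> u \<ominus>\<^bsub>M\<^esub> c \<odot>\<^bsub>M\<^esub> v \<in> N"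
      using u N by (auto simp: M.submodule_iff)
  qed
  then show ?thesis by (simp add: quot_rep_def)
qed

lemma qcl_zero: "\<zero>\<^bsub>quot_rep M N\<^esub> = qcl M N \<zero>\<^bsub>M\<^esub>"
  by (simp add: quot_rep_def qcl_def M.a_coset_add_zero a_subset)

lemma qcl_eq_zero_iff: "v \<in> carrier M ==> qcl M N v = \<zero>\<^bsub>quot_rep M N\<^esub> \<longleftrightarrow> v \<in> N"
  unfolding qcl_zero by (simp add: qcl_eq_iff M.diff_eq_scale)

lemma module_quot: "module \<complex> (quot_rep M N)"
  by (rule module_image[OF M.module_axioms carrier_quot qcl_zero qcl_add qcl_scale])

lemma lin_map_qcl: "lin_map M (quot_rep M N) (qcl M N)"
  by (auto simp: lin_map_def qcl_in qcl_add qcl_scale)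

lemma qcl_act:
  assumes x: "act_linear M x" "!!n. n \<in> N ==> act M x n \<in> N" and v: "v \<in> carrier M"
  shows "act (quot_rep M N) x (qcl M N v) = qcl M N (act M x v)"
proof -
  have lin: "lin_map M M (act M x)" using x(1) by (simp add: act_linear_def)
  have "(\<Union>u\<in>qcl M N v. N +>\<^bsub>M\<^esub> act M x u) = qcl M N (act M x v)"
  proof (rule qcl_UN[OF v])
    fix u assume u: "u \<in> carrier M" "u \<ominus>\<^bsub>M\<^esub> v \<in> N"
    then show "act M x u \<in> carrier M \<and> act M x u \<ominus>\<^bsub>M\<^esub> act M x v \<in> N"
      using lin_map_diff[OF M.cmodule_axioms M.cmodule_axioms lin u(1) v] x(2) lin_map_closed[OF lin u(1)] by metis
  qed
  then show ?thesis by (simp add: quot_rep_def)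
qed

lemma act_linear_quot:
  assumes x: "act_linear M x" "!!n. n \<in> N ==> act M x n \<in> N"
  shows "act_linear (quot_rep M N) x"
proof -
  have lin: "lin_map M M (act M x)" using x(1) by (simp add: act_linear_def)
  show ?thesis
    unfolding act_linear_def lin_map_def carrier_quot
    by (auto simp: qcl_act[OF x] qcl_add qcl_scale lin_mapD[OF lin])
qed

lemma lie_rep_quot:
  assumes M: "lie_rep L M" and sub: "subrep L M N"
  shows "lie_rep L (quot_rep M N)"
proof -
  interpret Q: cmodule "quot_rep M N" using module_quot by (simp add: cmodule_iff)
  have x: "act_linear M x" "!!n. n \<in> N ==> act M x n \<in> N" if "x \<in> L" for x
    using M sub that by (auto simp: lie_rep_iff subrep_def)
  have lin: "lin_map M M (act M x)" if "x \<in> L" for x using x(1)[OF that] by (simp add: act_linear_def)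
  have c: "act M x v \<in> carrier M" if "x \<in> L" "v \<in> carrier M" for x v using lin_map_closed[OF lin] that .
  have q: "act (quot_rep M N) x (qcl M N v) = qcl M N (act M x v)" if "x \<in> L \<or> x \<in> L" "v \<in> carrier M" for x v
    using qcl_act[OF x] that by auto
  \<comment> \<open>\<open>L\<close> is not assumed closed, so \<open>x + y\<close>, multiples and
    brackets may lie outside it; that they act linearly and preserve \<open>N\<close> is read off
    from the formula \<open>f\<close> for their action.\<close>
  have UN: "act (quot_rep M N) x (qcl M N v) = qcl M N (act M x v)"
    if v: "v \<in> carrier M" and f: "!!u. u \<in> carrier M ==> act M x u = f u" and l: "lin_map M M f"
      and n: "!!n. n \<in> N ==> f n \<in> N" for x v f
  proof (rule qcl_act)
    show "act_linear M x" using l unfolding act_linear_def lin_map_def by (auto simp: f)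
    show "act M x n \<in> N" if "n \<in> N" for n using n[OF that] f[OF N_carrier[OF that]] by simp
  qed fact
  note sm = N[unfolded M.submodule_iff]
  show ?thesis
    unfolding lie_rep_iff
  proof (intro conjI ballI allI)
    show "module \<complex> (quot_rep M N)" by (rule module_quot)
  next
    fix x assume "x \<in> L" then show "act_linear (quot_rep M N) x" by (intro act_linear_quot x)
  next
    fix x y v assume xy: "x \<in> L" "y \<in> L" and "v \<in> carrier (quot_rep M N)"
    then obtain u where u: "u \<in> carrier M" "v = qcl M N u" by (auto simp: carrier_quot)
    have "act (quot_rep M N) (x + y) (qcl M N u) = qcl M N (act M (x + y) u)"
    proof (rule UN[of _ _ "\<lambda>u. act M x u \<oplus>\<^bsub>M\<^esub> act M y u"])
      show "lin_map M M (\<lambda>u. act M x u \<oplus>\<^bsub>M\<^esub> act M y u)" by (intro M.lin_map_add_fun lin xy)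
    qed (use M u xy x(2) sm in \<open>auto simp: lie_rep_iff\<close>)
    then show "act (quot_rep M N) (x + y) v = act (quot_rep M N) x v \<oplus>\<^bsub>quot_rep M N\<^esub> act (quot_rep M N) y v"
      using u xy M by (simp add: q qcl_add c lie_rep_iff)
  next
    fix x e v assume xy: "x \<in> L" and "v \<in> carrier (quot_rep M N)"
    then obtain u where u: "u \<in> carrier M" "v = qcl M N u" by (auto simp: carrier_quot)
    have "act (quot_rep M N) (mat_scale e x) (qcl M N u) = qcl M N (act M (mat_scale e x) u)"
    proof (rule UN[of _ _ "\<lambda>u. e \<odot>\<^bsub>M\<^esub> act M x u"])
      show "lin_map M M (\<lambda>u. e \<odot>\<^bsub>M\<^esub> act M x u)" by (intro M.lin_map_scale_fun lin xy)
    qed (use M u xy x(2) sm in \<open>auto simp: lie_rep_iff\<close>)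
    then show "act (quot_rep M N) (mat_scale e x) v = e \<odot>\<^bsub>quot_rep M N\<^esub> act (quot_rep M N) x v"
      using u xy M by (simp add: q qcl_scale c lie_rep_iff)
  next
    fix x y v assume xy: "x \<in> L" "y \<in> L" and "v \<in> carrier (quot_rep M N)"
    then obtain u where u: "u \<in> carrier M" "v = qcl M N u" by (auto simp: carrier_quot)
    have "act (quot_rep M N) (lie_bracket x y) (qcl M N u) = qcl M N (act M (lie_bracket x y) u)"
    proof (rule UN[of _ _ "\<lambda>u. act M x (act M y u) \<oplus>\<^bsub>M\<^esub> (- 1) \<odot>\<^bsub>M\<^esub> act M y (act M x u)"])
      show "lin_map M M (\<lambda>u. act M x (act M y u) \<oplus>\<^bsub>M\<^esub> (- 1) \<odot>\<^bsub>M\<^esub> act M y (act M x u))"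
        by (intro M.lin_map_add_fun M.lin_map_scale_fun lin_map_comp[OF lin lin] xy)
    qed (use M u xy x(2) c sm in \<open>auto simp: lie_rep_iff M.diff_eq_scale\<close>)
    then show "act (quot_rep M N) (lie_bracket x y) v =
        act (quot_rep M N) x (act (quot_rep M N) y v) \<ominus>\<^bsub>quot_rep M N\<^esub> act (quot_rep M N) y (act (quot_rep M N) x v)"
      using u xy M
      by (simp add: q c lie_rep_iff Q.diff_eq_scale qcl_in qcl_scale qcl_add M.diff_eq_scale)
  qed
qed

end

section \<open>Word maps\<close>

definition cmap :: "'w set => (complex, 'v, 'm) module_scheme => (('w => complex) => 'v) => bool" where
  "cmap Y M \<Phi> \<longleftrightarrow> (\<forall>f\<in>cspace Y. \<Phi> f \<in> carrier M) \<and>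
     (\<forall>f\<in>cspace Y. \<forall>g\<in>cspace Y. \<Phi> (f + g) = \<Phi> f \<oplus>\<^bsub>M\<^esub> \<Phi> g) \<and>
     (\<forall>c. \<forall>f\<in>cspace Y. \<Phi> (fscale c f) = c \<odot>\<^bsub>M\<^esub> \<Phi> f)"

lemma
  assumes "cmap Y M \<Phi>" "f \<in> cspace Y"
  shows cmap_closed: "\<Phi> f \<in> carrier M"
    and cmap_add: "g \<in> cspace Y ==> \<Phi> (f + g) = \<Phi> f \<oplus>\<^bsub>M\<^esub> \<Phi> g"
    and cmap_scale: "\<Phi> (fscale c f) = c \<odot>\<^bsub>M\<^esub> \<Phi> f"
  using assms(1)[unfolded cmap_def] assms(2) by simp_all

lemma cspace_add: "f \<in> cspace Y ==> g \<in> cspace Y ==> f + g \<in> cspace Y"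
  and cspace_scale: "f \<in> cspace Y ==> fscale c f \<in> cspace Y"
  and cspace_zero: "0 \<in> cspace Y"
  by (auto simp: cspace_def)

lemma fscale_0 [simp]: "fscale 0 f = 0"
  by (simp add: fun_eq_iff)

lemma cmap_zero:
  assumes M: "cmodule M" and \<Phi>: "cmap Y M \<Phi>"
  shows "\<Phi> 0 = \<zero>\<^bsub>M\<^esub>"
proof -
  interpret M: cmodule M by fact
  show ?thesis
    using cmap_scale[OF \<Phi> cspace_zero, of 0] cmap_closed[OF \<Phi> cspace_zero]
    by (simp only: fscale_0 M.scale_zero)
qed

lemma cspace_insert_split:
  assumes f: "f \<in> cspace (insert y Y)"
  shows "f(y := 0) \<in> cspace Y" "f = f(y := 0) + fscale (f y) (delta y)"
  using f by (auto simp: cspace_def delta_def fun_eq_iff)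

lemma cmap_extend:
  fixes \<phi> :: "'w => 'v"
  assumes M: "cmodule M" and Y: "finite Y" and \<phi>: "!!w. w \<in> Y ==> \<phi> w \<in> carrier M"
  shows "\<exists>\<Phi>. cmap Y M \<Phi> \<and> (\<forall>w\<in>Y. \<Phi> (delta w) = \<phi> w)"
  using Y \<phi>
proof (induction Y rule: finite_induct)
  interpret M: cmodule M by fact
  case empty
  have "cspace {} = {0 :: 'w => complex}" by (auto simp: cspace_def fun_eq_iff)
  then have "cmap {} M (\<lambda>_. \<zero>\<^bsub>M\<^esub>)" by (simp add: cmap_def)
  then show ?case by blast
next
  interpret M: cmodule M by fact
  case (insert y Y)
  then obtain \<Phi> where \<Phi>: "cmap Y M \<Phi>" and \<Phi>_delta: "\<forall>w\<in>Y. \<Phi> (delta w) = \<phi> w" by blast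
  define \<Psi> where "\<Psi> = (\<lambda>f. \<Phi> (f(y := 0)) \<oplus>\<^bsub>M\<^esub> f y \<odot>\<^bsub>M\<^esub> \<phi> y)"
  have \<phi>y: "\<phi> y \<in> carrier M" using insert.prems by blast
  note cl = cmap_closed[OF \<Phi> cspace_insert_split(1)]
  have "cmap (insert y Y) M \<Psi>"
    unfolding cmap_def
  proof (intro conjI ballI allI)
    fix f assume f: "f \<in> cspace (insert y Y)"
    show "\<Psi> f \<in> carrier M" using cl[OF f] \<phi>y by (simp add: \<Psi>_def)
    fix c
    have "(fscale c f)(y := 0) = fscale c (f(y := 0))" by (auto simp: fun_eq_iff)
    then have "\<Phi> ((fscale c f)(y := 0)) = c \<odot>\<^bsub>M\<^esub> \<Phi> (f(y := 0))"
      using cmap_scale[OF \<Phi> cspace_insert_split(1)[OF f]] by simp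
    then show "\<Psi> (fscale c f) = c \<odot>\<^bsub>M\<^esub> \<Psi> f"
      using cl[OF f] \<phi>y by (simp add: \<Psi>_def M.scale_add_right M.scale_scale)
  next
    fix f g assume f: "f \<in> cspace (insert y Y)" and g: "g \<in> cspace (insert y Y)"
    have "(f + g)(y := 0) = f(y := 0) + g(y := 0)" by (auto simp: fun_eq_iff)
    then have "\<Phi> ((f + g)(y := 0)) = \<Phi> (f(y := 0)) \<oplus>\<^bsub>M\<^esub> \<Phi> (g(y := 0))"
      using cmap_add[OF \<Phi> cspace_insert_split(1)[OF f] cspace_insert_split(1)[OF g]] by simp
    then show "\<Psi> (f + g) = \<Psi> f \<oplus>\<^bsub>M\<^esub> \<Psi> g"
      using cl[OF f] cl[OF g] \<phi>y by (simp add: \<Psi>_def M.scale_add_left M.a_ac)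
  qed
  moreover have "\<Psi> (delta w) = \<phi> w" if "w \<in> insert y Y" for w
  proof (cases "w = y")
    case True
    have "(delta y)(y := 0) = (0 :: 'w => complex)" by (auto simp: delta_def fun_eq_iff)
    then show ?thesis using True \<phi>y cmap_zero[OF M \<Phi>] by (simp add: \<Psi>_def delta_def)
  next
    case False
    have "(delta w)(y := 0) = (delta w :: 'w => complex)" using False by (auto simp: delta_def fun_eq_iff)
    moreover have "delta w y = 0" using False by (simp add: delta_def)
    ultimately show ?thesis using False that \<Phi>_delta \<phi>y insert.prems by (simp add: \<Psi>_def)
  qed
  ultimately show ?case by blast
qed

lemma cmap_induct:
  assumes Y: "finite Y" and f: "f \<in> cspace Y" and S: "cfun.subspace S" and "!!w. w \<in> Y ==> delta w \<in> S"
  shows "f \<in> S"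
proof -
  have "cfun.span (delta ` Y) \<subseteq> S" by (rule cfun.span_minimal) (use assms in auto)
  then show ?thesis using span_delta[OF Y] f by auto
qed

lemma cmap_eqI:
  assumes M: "cmodule M" and Y: "finite Y" and \<Phi>: "cmap Y M \<Phi>" and \<Psi>: "cmap Y M \<Psi>"
    and eq: "!!w. w \<in> Y ==> \<Phi> (delta w) = \<Psi> (delta w)" and f: "f \<in> cspace Y"
  shows "\<Phi> f = \<Psi> f"
proof -
  have "cfun.subspace {f \<in> cspace Y. \<Phi> f = \<Psi> f}"
    unfolding cfun.subspace_def
    by (simp add: cspace_zero cspace_add cspace_scale cmap_zero[OF M \<Phi>] cmap_zero[OF M \<Psi>]
        cmap_add[OF \<Phi>] cmap_add[OF \<Psi>] cmap_scale[OF \<Phi>] cmap_scale[OF \<Psi>])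
  then have "f \<in> {f \<in> cspace Y. \<Phi> f = \<Psi> f}"
    by (rule cmap_induct[OF Y f]) (simp add: eq delta_in_cspace)
  then show ?thesis by simp
qed

lemma subspace_cmap_vimage:
  assumes M: "cmodule M" and \<Phi>: "cmap Y M \<Phi>" and S: "submodule S \<complex> M"
  shows "cfun.subspace {f \<in> cspace Y. \<Phi> f \<in> S}"
proof -
  interpret M: cmodule M by fact
  show ?thesis
    unfolding cfun.subspace_def
    by (simp add: cspace_zero cspace_add cspace_scale cmap_zero[OF M \<Phi>] cmap_add[OF \<Phi>] cmap_scale[OF \<Phi>]
        M.submodule_zero_mem[OF S] M.submodule_add[OF S] M.submodule_scale[OF S])
qed

lemma submodule_cmap_image:
  assumes M: "cmodule M" and \<Phi>: "cmap Y M \<Phi>" and N: "cfun.subspace N" "N \<subseteq> cspace Y"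
  shows "submodule (\<Phi> ` N) \<complex> M"
proof -
  interpret M: cmodule M by fact
  have Y: "f \<in> cspace Y" if "f \<in> N" for f using that N(2) by blast
  show ?thesis
    unfolding M.submodule_iff
  proof (intro conjI ballI allI)
    show "\<Phi> ` N \<subseteq> carrier M" using cmap_closed[OF \<Phi> Y] by auto
    show "\<zero>\<^bsub>M\<^esub> \<in> \<Phi> ` N" using cmap_zero[OF M \<Phi>] cfun.subspace_0[OF N(1)] by (metis imageI)
  next
    fix v w assume "v \<in> \<Phi> ` N" "w \<in> \<Phi> ` N"
    then obtain f g where fg: "f \<in> N" "g \<in> N" "v = \<Phi> f" "w = \<Phi> g" by blast
    then have "v \<oplus>\<^bsub>M\<^esub> w = \<Phi> (f + g)" by (simp add: cmap_add[OF \<Phi> Y Y])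
    then show "v \<oplus>\<^bsub>M\<^esub> w \<in> \<Phi> ` N" using fg cfun.subspace_add[OF N(1)] by blast
  next
    fix c v assume "v \<in> \<Phi> ` N"
    then obtain f where f: "f \<in> N" "v = \<Phi> f" by blast
    then have "c \<odot>\<^bsub>M\<^esub> v = \<Phi> (fscale c f)" by (simp add: cmap_scale[OF \<Phi> Y])
    then show "c \<odot>\<^bsub>M\<^esub> v \<in> \<Phi> ` N" using f cfun.subspace_scale[OF N(1)] by blast
  qed
qed

section \<open>Equivariant maps from words\<close>

text \<open>A skew matrix that exchanges blocks \<open>i\<close> and \<open>j\<close> with opposite
  signs. Moving both coordinates of a block alike makes it compatible with the symplectic form when
  the blocks are symplectic pairs.\<close>

definition rot :: "nat => nat => nat => mat" where
  "rot d i j = (\<lambda>u v. if v = sw d i j u then sg d i j u else 0)"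

text \<open>An equivariant linear map from the tensors of degree \<open>K\<close> in
  \<open>c\<close> copies of the natural module, in coordinates. Only rotations of the first
  \<open>nb\<close> blocks are considered, for these preserve
  \<open>words c (d + 2 * nb) K\<close>.\<close>

definition word_map :: "nat => nat => nat => nat => 'v rep => ((word => complex) => 'v) => bool" where
  "word_map d nb c K M \<Phi> \<longleftrightarrow> cmap (words c (d + 2 * nb) K) M \<Phi> \<and>
     (\<forall>i<nb. \<forall>j<nb. i \<noteq> j \<longrightarrow> (\<forall>f\<in>cspace (words c (d + 2 * nb) K).
        act M (rot d i j) (\<Phi> f) = \<Phi> (wact d i j f)))"

definition word_im :: "nat => nat => nat => nat => ((word => complex) => 'v) => 'v set" where
  "word_im d nb c K \<Phi> = \<Phi> ` cspace (words c (d + 2 * nb) K)"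

lemma word_map_cmap: "word_map d nb c K M \<Phi> ==> cmap (words c (d + 2 * nb) K) M \<Phi>"
  by (simp add: word_map_def)

lemma word_map_act:
  "word_map d nb c K M \<Phi> ==> i < nb ==> j < nb ==> i \<noteq> j ==> f \<in> cspace (words c (d + 2 * nb) K) ==>
    act M (rot d i j) (\<Phi> f) = \<Phi> (wact d i j f)"
  by (simp add: word_map_def)

lemma wact_cspace:
  "i < nb ==> j < nb ==> i \<noteq> j ==> f \<in> cspace (words c (d + 2 * nb) K) ==>
    wact d i j f \<in> cspace (words c (d + 2 * nb) K)"
  using wact_linear[of i nb j c d K] by (simp add: clinear_on_def)

lemma submodule_word_im: "cmodule M ==> word_map d nb c K M \<Phi> ==> submodule (word_im d nb c K \<Phi>) \<complex> M"
  unfolding word_im_def by (rule submodule_cmap_image[OF _ word_map_cmap subspace_cspace order_refl])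

text \<open>The preimages of the \<open>N k\<close> form a chain of stable subspaces of functions,
  and a witness that lies in the image makes the preimages strict as well. The bound does not
  involve \<open>nb\<close>.\<close>

lemma word_map_chain:
  fixes N :: "nat => 'v set"
  assumes M: "cmodule M" and \<Phi>: "word_map d nb c K M \<Phi>"
    and I: "finite I" and mono: "mono N"
    and N: "!!k. submodule (N k) \<complex> M"
      "!!k i j v. i < nb ==> j < nb ==> i \<noteq> j ==> v \<in> N k ==> act M (rot d i j) v \<in> N k"
    and strict: "!!k. k \<in> I ==> \<exists>v. v \<in> word_im d nb c K \<Phi> \<and> v \<in> N (Suc k) \<and> v \<notin> N k"
  shows "card I \<le> card (words c (d + 4 * K) K \<times> words c (d + 4 * K) K)"
proof (rule chain_bound[OF I])
  define N' where "N' = (\<lambda>k. {f \<in> cspace (words c (d + 2 * nb) K). \<Phi> f \<in> N k})"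
  show "mono N'" using mono by (auto simp: N'_def mono_def)
  show "cfun.subspace (N' k)" for k unfolding N'_def
    by (rule subspace_cmap_vimage[OF M word_map_cmap[OF \<Phi>] N(1)])
  show "N' k \<subseteq> cspace (words c (d + 2 * nb) K)" for k by (auto simp: N'_def)
  show "wact d i j f \<in> N' k" if "i < nb" "j < nb" "i \<noteq> j" "f \<in> N' k" for i j f k
    using that word_map_act[OF \<Phi> that(1-3), of f] N(2)[OF that(1-3), of "\<Phi> f" k]
    by (simp add: N'_def wact_cspace)
  show "\<exists>v. v \<in> N' (Suc k) \<and> v \<notin> N' k" if "k \<in> I" for k
    using strict[OF that] by (auto simp: N'_def word_im_def)
qed

text \<open>A submodule of the image is an image of words, too: compose with the orthogonal projection onto
  the preimage.\<close>

lemma word_map_submodule: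
  assumes M: "cmodule M" and \<Phi>: "word_map d nb c K M \<Phi>" and N: "submodule N \<complex> M"
      "!!i j v. i < nb ==> j < nb ==> i \<noteq> j ==> v \<in> N ==> act M (rot d i j) v \<in> N"
    and sub: "N \<subseteq> word_im d nb c K \<Phi>"
  shows "\<exists>\<Psi>. word_map d nb c K M \<Psi> \<and> word_im d nb c K \<Psi> = N"
proof -
  let ?Y = "words c (d + 2 * nb) K"
  define N' where "N' = {f \<in> cspace ?Y. \<Phi> f \<in> N}"
  define \<Psi> where "\<Psi> = (\<lambda>f. \<Phi> (orth_proj ?Y N' f))"
  have cm: "cmap ?Y M \<Phi>" by (rule word_map_cmap[OF \<Phi>])
  have N': "cfun.subspace N'" "N' \<subseteq> cspace ?Y"
    unfolding N'_def using subspace_cmap_vimage[OF M cm N(1)] by auto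
  note P = orth_proj_in[OF finite_words N'] orth_proj_id[OF finite_words N']
    orth_proj_add[OF finite_words N'] orth_proj_scale[OF finite_words N']
  have PY: "orth_proj ?Y N' f \<in> cspace ?Y" for f using P(1) N'(2) by blast
  have "word_map d nb c K M \<Psi>"
    unfolding word_map_def
  proof (intro conjI allI impI ballI)
    show "cmap ?Y M \<Psi>"
      unfolding cmap_def \<Psi>_def P(3,4)
      using cmap_closed[OF cm PY] cmap_add[OF cm PY PY] cmap_scale[OF cm PY] by simp
    fix i j f assume ij: "i < nb" "j < nb" "i \<noteq> j" and f: "f \<in> cspace ?Y"
    have "wact d i j g \<in> N'" if "g \<in> N'" for g
      using that word_map_act[OF \<Phi> ij, of g] N(2)[OF ij, of "\<Phi> g"] wact_cspace[OF ij]
      by (simp add: N'_def)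
    then have "orth_proj ?Y N' (wact d i j f) = wact d i j (orth_proj ?Y N' f)"
      by (intro orth_proj_commute[OF finite_words N'] wact_linear[OF ij] wact_skew[OF ij] f)
    then show "act M (rot d i j) (\<Psi> f) = \<Psi> (wact d i j f)"
      using word_map_act[OF \<Phi> ij PY] by (simp add: \<Psi>_def)
  qed
  moreover have "word_im d nb c K \<Psi> = N"
  proof
    show "word_im d nb c K \<Psi> \<subseteq> N" using P(1) by (auto simp: word_im_def \<Psi>_def N'_def)
    show "N \<subseteq> word_im d nb c K \<Psi>"
    proof
      fix v assume v: "v \<in> N"
      then obtain f where f: "f \<in> cspace ?Y" "v = \<Phi> f" using sub by (auto simp: word_im_def)
      then have "f \<in> N'" using v by (simp add: N'_def)
      then have "\<Psi> f = v" using P(2) f by (simp add: \<Psi>_def)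
      then show "v \<in> word_im d nb c K \<Psi>" using f unfolding word_im_def by blast
    qed
  qed
  ultimately show ?thesis by blast
qed

lemma word_map_fin_dim:
  assumes M: "cmodule M" and \<Phi>: "word_map d nb c K M \<Phi>" and N: "submodule N \<complex> M"
    and sub: "N \<subseteq> word_im d nb c K \<Phi>"
  shows "fin_dim M N"
proof -
  let ?Y = "words c (d + 2 * nb) K"
  interpret M: cmodule M by fact
  have cm: "cmap ?Y M \<Phi>" by (rule word_map_cmap[OF \<Phi>])
  define N' where "N' = {f \<in> cspace ?Y. \<Phi> f \<in> N}"
  have N': "cfun.subspace N'" "N' \<subseteq> cspace ?Y"
    unfolding N'_def using subspace_cmap_vimage[OF M cm N] by auto
  obtain B where B: "finite B" "B \<subseteq> N'" "cfun.span B = N'"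
    using finite_basis_cspace[OF finite_words N'] .
  have im: "N = \<Phi> ` N'" using sub by (auto simp: N'_def word_im_def)
  have "lin_span M (\<Phi> ` B) = N"
  proof
    show "lin_span M (\<Phi> ` B) \<subseteq> N" unfolding lin_span_def using N B(2) im by blast
    show "N \<subseteq> lin_span M (\<Phi> ` B)"
      unfolding lin_span_def
    proof (intro Inter_greatest)
      fix S assume S: "S \<in> {N. submodule N \<complex> M \<and> \<Phi> ` B \<subseteq> N}"
      have "cfun.span B \<subseteq> {f \<in> cspace ?Y. \<Phi> f \<in> S}"
        by (rule cfun.span_minimal) (use S B N' subspace_cmap_vimage[OF M cm] in auto)
      then show "N \<subseteq> S" using im B(3) by auto
    qed
  qed
  moreover have "\<Phi> ` B \<subseteq> carrier M" using B(2) N'(2) cmap_closed[OF cm] by blast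
  ultimately show ?thesis unfolding fin_dim_def using B(1) by blast
qed

text \<open>The tensor product of the basis vector \<open>delta q\<close> with
  \<open>f\<close>.\<close>

definition wprefix :: "word => (word => complex) => word => complex" where
  "wprefix q f w = (if take (length q) w = q \<and> length q \<le> length w then f (drop (length q) w) else 0)"

lemma delta_append: "delta (q @ w) = wprefix q (delta w)"
  by (auto simp: delta_def wprefix_def fun_eq_iff) (metis append_take_drop_id)+

lemma wprefix_linear:
  "wprefix q (f + g) = wprefix q f + wprefix q g" "wprefix q (fscale a f) = fscale a (wprefix q f)"
  "wprefix q 0 = 0"
  by (auto simp: wprefix_def fun_eq_iff)

lemma words_append:
  "q @ w \<in> words c D (length q + K) \<longleftrightarrow> q \<in> words c D (length q) \<and> w \<in> words c D K"
  by (auto simp: words_def)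

lemma wprefix_cspace:
  assumes "q \<in> words c D (length q)" "f \<in> cspace (words c D K)"
  shows "wprefix q f \<in> cspace (words c D (length q + K))"
proof -
  have "wprefix q f w = 0" if "w \<notin> words c D (length q + K)" for w
  proof (cases "take (length q) w = q \<and> length q \<le> length w")
    case True
    then have "w = q @ drop (length q) w" by (metis append_take_drop_id)
    then have "drop (length q) w \<notin> words c D K" using that assms(1) words_append by metis
    then show ?thesis using assms(2) by (auto simp: wprefix_def cspace_def)
  qed (auto simp: wprefix_def)
  then show ?thesis by (simp add: cspace_def)
qed

lemma wact_delta_append:
  assumes ij: "i \<noteq> j"
  shows "wact d i j (delta (q @ w)) = wprefix q (wact d i j (delta w))
    - (\<Sum>p<length q. fscale (wsg d i j p q) (delta (wsw d i j p q @ w)))"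
proof -
  have 1: "(\<Sum>p<length q + length w. g p) = (\<Sum>p<length q. g p) + (\<Sum>p<length w. g (length q + p))"
    for g :: "nat => word => complex"
    using sum.atLeastLessThan_concat[of 0 "length q" "length q + length w" g]
      sum.shift_bounds_nat_ivl[of g 0 "length q" "length w"]
    by (simp only: atLeast0LessThan add.commute le_add1 add_0 le0)
  have 2: "wprefix q (\<Sum>p<m. g p) = (\<Sum>p<m. wprefix q (g p))" for g and m :: nat
    by (induction m) (simp_all only: wprefix_linear sum.lessThan_Suc lessThan_0 sum.empty)
  have 3: "wprefix q (- f) = - wprefix q f" for f by (auto simp: wprefix_def fun_eq_iff)
  show ?thesis
    unfolding wact_delta[OF ij] length_append 1 2 3 wprefix_linear(2) delta_append[symmetric]
    by (simp add: wsg_def wsw_def nth_append list_update_append)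
qed

text \<open>The operators \<open>\<omega> q\<close> are transformed by the rotations as the words
  \<open>q\<close> of length 2 are. Sending \<open>q @ u\<close> to \<open>\<omega> q\<close>
  applied to \<open>\<Phi> (delta u)\<close> is then equivariant by the Leibniz rule. Length 2 is
  the degree in which the adjoint module appears as tensors.\<close>

lemma word_map_prod:
  assumes M: "cmodule M" and \<Phi>: "word_map d nb c K M \<Phi>"
    and rot: "!!i j. i < nb ==> j < nb ==> i \<noteq> j ==> act_linear M (rot d i j)"
    and \<omega>: "!!q. q \<in> words c (d + 2 * nb) 2 ==> lin_map M M (\<omega> q)"
    and equiv: "!!i j q v. i < nb ==> j < nb ==> i \<noteq> j ==> q \<in> words c (d + 2 * nb) 2 ==> v \<in> carrier M ==>
      act M (rot d i j) (\<omega> q v) = \<omega> q (act M (rot d i j) v) \<oplus>\<^bsub>M\<^esub>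
        ((- wsg d i j 0 q) \<odot>\<^bsub>M\<^esub> \<omega> (wsw d i j 0 q) v \<oplus>\<^bsub>M\<^esub> (- wsg d i j 1 q) \<odot>\<^bsub>M\<^esub> \<omega> (wsw d i j 1 q) v)"
  shows "\<exists>\<Psi>. word_map d nb c (2 + K) M \<Psi> \<and>
    (\<forall>q\<in>words c (d + 2 * nb) 2. \<omega> q ` word_im d nb c K \<Phi> \<subseteq> word_im d nb c (2 + K) \<Psi>)"
proof -
  interpret M: cmodule M by fact
  let ?Y = "words c (d + 2 * nb)"
  have cm: "cmap (?Y K) M \<Phi>" by (rule word_map_cmap[OF \<Phi>])
  have take: "take 2 w \<in> ?Y 2" "drop 2 w \<in> ?Y K" if "w \<in> ?Y (2 + K)" for w
    using that set_take_subset[of 2 w] set_drop_subset[of 2 w] by (auto simp: words_def)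
  have split: "\<exists>q u. q \<in> ?Y 2 \<and> u \<in> ?Y K \<and> w = q @ u" if "w \<in> ?Y (2 + K)" for w
    using take[OF that] by (metis append_take_drop_id)
  have app: "q @ u \<in> ?Y (2 + K)" if "q \<in> ?Y 2" "u \<in> ?Y K" for q u
    using that by (auto simp: words_def)
  obtain \<Psi> where \<Psi>: "cmap (?Y (2 + K)) M \<Psi>"
    and \<Psi>_delta: "!!w. w \<in> ?Y (2 + K) ==> \<Psi> (delta w) = \<omega> (take 2 w) (\<Phi> (delta (drop 2 w)))"
    using cmap_extend[OF M finite_words[of c "d + 2 * nb" "2 + K"], of "\<lambda>w. \<omega> (take 2 w) (\<Phi> (delta (drop 2 w)))"]
      lin_map_closed[OF \<omega>[OF take(1)] cmap_closed[OF cm delta_in_cspace[OF take(2)]]] by blast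
  have pre: "wprefix q f \<in> cspace (?Y (2 + K))" if "q \<in> ?Y 2" "f \<in> cspace (?Y K)" for q f
    using wprefix_cspace[of q c "d + 2 * nb" f K] that length_words[OF that(1)] by simp
  have \<Psi>_prefix: "\<Psi> (wprefix q f) = \<omega> q (\<Phi> f)" if q: "q \<in> ?Y 2" and f: "f \<in> cspace (?Y K)" for q f
  proof (rule cmap_eqI[OF M finite_words _ _ _ f])
    show "cmap (?Y K) M (\<lambda>f. \<Psi> (wprefix q f))"
      unfolding cmap_def wprefix_linear
      using cmap_closed[OF \<Psi> pre[OF q]] cmap_add[OF \<Psi> pre[OF q] pre[OF q]] cmap_scale[OF \<Psi> pre[OF q]]
      by simp
    show "cmap (?Y K) M (\<lambda>f. \<omega> q (\<Phi> f))"
      unfolding cmap_def using lin_mapD[OF \<omega>[OF q] cmap_closed[OF cm]]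
      by (simp add: cmap_add[OF cm] cmap_scale[OF cm] cmap_closed[OF cm])
    show "\<Psi> (wprefix q (delta u)) = \<omega> q (\<Phi> (delta u))" if u: "u \<in> ?Y K" for u
      unfolding delta_append[symmetric] using \<Psi>_delta[OF app[OF q u]] length_words[OF q] by simp
  qed
  have "word_map d nb c (2 + K) M \<Psi>"
    unfolding word_map_def
  proof (intro conjI allI impI ballI)
    fix i j f assume ij: "i < nb" "j < nb" "i \<noteq> j" and f: "f \<in> cspace (?Y (2 + K))"
    have r: "lin_map M M (act M (rot d i j))" using rot[OF ij] by (simp add: act_linear_def)
    show "act M (rot d i j) (\<Psi> f) = \<Psi> (wact d i j f)"
    proof (rule cmap_eqI[OF M finite_words _ _ _ f])
      show "cmap (?Y (2 + K)) M (\<lambda>f. act M (rot d i j) (\<Psi> f))"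
        unfolding cmap_def using lin_mapD[OF r cmap_closed[OF \<Psi>]]
        by (simp add: cmap_add[OF \<Psi>] cmap_scale[OF \<Psi>] cmap_closed[OF \<Psi>])
      show "cmap (?Y (2 + K)) M (\<lambda>f. \<Psi> (wact d i j f))"
        unfolding cmap_def wact_add wact_scale
        using cmap_closed[OF \<Psi> wact_cspace[OF ij]] cmap_add[OF \<Psi> wact_cspace[OF ij] wact_cspace[OF ij]]
          cmap_scale[OF \<Psi> wact_cspace[OF ij]] by simp
    next
      fix w assume "w \<in> ?Y (2 + K)"
      then obtain q u where q: "q \<in> ?Y 2" and u: "u \<in> ?Y K" and w: "w = q @ u" using split by blast
      note lq = length_words[OF q]
      have du: "delta u \<in> cspace (?Y K)" by (rule delta_in_cspace[OF u])
      have q': "wsw d i j p q \<in> ?Y 2" for p by (rule wsw_in_words[OF q ij(1,2)])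
      have dq: "delta (wsw d i j p q @ u) \<in> cspace (?Y (2 + K))" for p
        by (rule delta_in_cspace[OF app[OF q' u]])
      have v: "\<Phi> (delta u) \<in> carrier M" by (rule cmap_closed[OF cm du])
      have "wact d i j (delta w) = wprefix q (wact d i j (delta u))
          + (fscale (- wsg d i j 0 q) (delta (wsw d i j 0 q @ u)) + fscale (- wsg d i j 1 q) (delta (wsw d i j 1 q @ u)))"
        unfolding w wact_delta_append[OF ij(3)] lq
        by (simp add: numeral_2_eq_2 fun_eq_iff)
      then have "\<Psi> (wact d i j (delta w)) = \<Psi> (wprefix q (wact d i j (delta u))) \<oplus>\<^bsub>M\<^esub>
          ((- wsg d i j 0 q) \<odot>\<^bsub>M\<^esub> \<Psi> (delta (wsw d i j 0 q @ u)) \<oplus>\<^bsub>M\<^esub> (- wsg d i j 1 q) \<odot>\<^bsub>M\<^esub> \<Psi> (delta (wsw d i j 1 q @ u)))"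
        by (simp only: cmap_add[OF \<Psi>] cmap_scale[OF \<Psi>] cspace_add cspace_scale dq pre[OF q wact_cspace[OF ij du]])
      also have "\<dots> = \<omega> q (\<Phi> (wact d i j (delta u))) \<oplus>\<^bsub>M\<^esub>
          ((- wsg d i j 0 q) \<odot>\<^bsub>M\<^esub> \<omega> (wsw d i j 0 q) (\<Phi> (delta u)) \<oplus>\<^bsub>M\<^esub> (- wsg d i j 1 q) \<odot>\<^bsub>M\<^esub> \<omega> (wsw d i j 1 q) (\<Phi> (delta u)))"
        unfolding delta_append \<Psi>_prefix[OF q wact_cspace[OF ij du]] \<Psi>_prefix[OF q' du] ..
      also have "\<dots> = act M (rot d i j) (\<omega> q (\<Phi> (delta u)))"
        unfolding equiv[OF ij q v] word_map_act[OF \<Phi> ij du] ..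
      also have "\<omega> q (\<Phi> (delta u)) = \<Psi> (delta w)"
        unfolding w delta_append \<Psi>_prefix[OF q du] ..
      finally show "act M (rot d i j) (\<Psi> (delta w)) = \<Psi> (wact d i j (delta w))" ..
    qed
  qed (rule \<Psi>)
  moreover have "\<omega> q ` word_im d nb c K \<Phi> \<subseteq> word_im d nb c (2 + K) \<Psi>" if q: "q \<in> ?Y 2" for q
    unfolding word_im_def
  proof (intro image_subsetI)
    fix v assume "v \<in> \<Phi> ` cspace (?Y K)"
    then obtain f where f: "f \<in> cspace (?Y K)" "v = \<Phi> f" by blast
    then show "\<omega> q v \<in> \<Psi> ` cspace (?Y (2 + K))"
      using \<Psi>_prefix[OF q f(1)] pre[OF q f(1)] by (metis imageI)
  qed
  ultimately show ?thesis by blast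
qed

section \<open>Weight spaces and finite length\<close>

text \<open>The operator \<open>T - a\<close>; \<open>shifts\<close> below composes such operators,
  the last entry of the list acting first.\<close>

definition shift :: "(complex, 'v, 'm) module_scheme => ('v => 'v) => complex => 'v => 'v" where
  "shift M T a v = T v \<oplus>\<^bsub>M\<^esub> (- a) \<odot>\<^bsub>M\<^esub> v"

definition shifts :: "(complex, 'v, 'm) module_scheme => ('v => 'v) => complex list => 'v => 'v" where
  "shifts M T as v = foldr (shift M T) as v"

text \<open>The sum of the generalised eigenspaces for eigenvalues of real part at most \<open>\<rho>\<close>.\<close>

definition wt_space :: "(complex, 'v, 'm) module_scheme => ('v => 'v) => real => 'v set" where
  "wt_space M T \<rho> = {v \<in> carrier M. \<exists>as. (\<forall>a\<in>set as. Re a \<le> \<rho>) \<and> shifts M T as v = \<zero>\<^bsub>M\<^esub>}"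

locale endo = cmodule M for M :: "(complex, 'v, 'm) module_scheme" (structure) +
  fixes T :: "'v => 'v"
  assumes T: "lin_map M M T"
begin

lemmas T_closed [simp] = lin_map_closed[OF T]
lemmas T_add = lin_map_add[OF T]
lemmas T_scale = lin_map_scale[OF T]

lemma lin_map_shift: "lin_map M M (shift M T a)"
  unfolding shift_def
proof (rule lin_map_add_fun[OF T])
  show "lin_map M M ((\<odot>) (- a))"
    using lin_map_scale_fun[of "\<lambda>u. u" "- a"] by (simp add: lin_map_def)
qed

lemma lin_map_shifts: "lin_map M M (shifts M T as)"
proof (induction as)
  case Nil
  show ?case by (simp add: shifts_def lin_map_def)
next
  case (Cons a as)
  show ?case using lin_map_comp[OF Cons lin_map_shift] by (simp add: shifts_def comp_def)
qed

lemmas shift_closed [simp] = lin_map_closed[OF lin_map_shift]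
lemmas shifts_closed [simp] = lin_map_closed[OF lin_map_shifts]

lemma shifts_simps:
  "shifts M T [] v = v" "shifts M T (a # as) v = shift M T a (shifts M T as v)"
  "shifts M T (as @ bs) v = shifts M T as (shifts M T bs v)"
  by (simp_all add: shifts_def)

lemma shift_commute:
  "v \<in> carrier M ==> shift M T a (shift M T b v) = shift M T b (shift M T a v)"
  by (simp add: shift_def T_add T_scale scale_add_right scale_scale a_ac mult.commute)

lemma shifts_shift:
  "v \<in> carrier M ==> shifts M T as (shift M T b v) = shift M T b (shifts M T as v)"
  by (induction as) (simp_all add: shifts_simps shift_commute)

lemma shifts_commute:
  "v \<in> carrier M ==> shifts M T as (shifts M T bs v) = shifts M T bs (shifts M T as v)"
  by (induction as) (simp_all add: shifts_simps shifts_shift)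

lemma shifts_zero: "shifts M T as \<zero> = \<zero>"
  by (rule lin_map_zero[OF cmodule_axioms cmodule_axioms lin_map_shifts])

lemma shift_stable:
  assumes "submodule N \<complex> M" "!!v. v \<in> N ==> T v \<in> N" "v \<in> N"
  shows "shift M T a v \<in> N"
  unfolding shift_def using assms by (intro submodule_add[OF assms(1)] submodule_scale[OF assms(1)])

lemma shifts_stable:
  assumes "submodule N \<complex> M" "!!v. v \<in> N ==> T v \<in> N" "v \<in> N"
  shows "shifts M T as v \<in> N"
  by (induction as) (simp_all add: shifts_simps assms shift_stable[OF assms(1,2)])

lemma wt_spaceI: "v \<in> carrier M ==> \<forall>a\<in>set as. Re a \<le> \<rho> ==> shifts M T as v = \<zero> ==> v \<in> wt_space M T \<rho>"
  unfolding wt_space_def by blast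

lemma wt_spaceE:
  assumes "v \<in> wt_space M T \<rho>"
  obtains as where "v \<in> carrier M" "\<forall>a\<in>set as. Re a \<le> \<rho>" "shifts M T as v = \<zero>"
  using assms unfolding wt_space_def by blast

lemma submodule_wt_space: "submodule (wt_space M T \<rho>) \<complex> M"
  unfolding submodule_iff
proof (intro conjI ballI allI)
  show "wt_space M T \<rho> \<subseteq> carrier M" unfolding wt_space_def by blast
  show "\<zero> \<in> wt_space M T \<rho>" by (rule wt_spaceI[of _ "[]"]) (simp_all add: shifts_simps)
next
  fix v w assume "v \<in> wt_space M T \<rho>" "w \<in> wt_space M T \<rho>"
  then obtain as bs where v: "v \<in> carrier M" "\<forall>a\<in>set as. Re a \<le> \<rho>" "shifts M T as v = \<zero>"
    and w: "w \<in> carrier M" "\<forall>a\<in>set bs. Re a \<le> \<rho>" "shifts M T bs w = \<zero>"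
    by (elim wt_spaceE)
  show "v \<oplus> w \<in> wt_space M T \<rho>"
  proof (rule wt_spaceI[of _ "as @ bs"])
    have "shifts M T as (shifts M T bs v) = \<zero>"
      by (simp add: shifts_commute[OF v(1), of as] v(3) shifts_zero)
    then show "shifts M T (as @ bs) (v \<oplus> w) = \<zero>"
      using v w by (simp add: shifts_simps lin_map_add[OF lin_map_shifts] shifts_zero)
  qed (use v w in auto)
next
  fix c v assume "v \<in> wt_space M T \<rho>"
  then obtain as where v: "v \<in> carrier M" "\<forall>a\<in>set as. Re a \<le> \<rho>" "shifts M T as v = \<zero>"
    by (elim wt_spaceE)
  then show "c \<odot> v \<in> wt_space M T \<rho>"
    by (intro wt_spaceI[of _ as]) (simp_all add: lin_map_scale[OF lin_map_shifts])
qed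

lemma wt_space_mono: "\<rho> \<le> \<tau> ==> wt_space M T \<rho> \<subseteq> wt_space M T \<tau>"
  unfolding wt_space_def by fastforce

lemma wt_space_step:
  assumes "v \<in> carrier M" "Re a \<le> \<rho>" "shift M T a v \<in> wt_space M T \<rho>"
  shows "v \<in> wt_space M T \<rho>"
proof -
  obtain as where as: "\<forall>a\<in>set as. Re a \<le> \<rho>" "shifts M T as (shift M T a v) = \<zero>"
    using assms(3) by (elim wt_spaceE)
  then show ?thesis using assms by (intro wt_spaceI[of _ "as @ [a]"]) (simp_all add: shifts_simps)
qed

lemma wt_space_eigenvector:
  assumes v: "v \<in> carrier M" "T v = a \<odot> v" and "Re a \<le> \<rho>"
  shows "v \<in> wt_space M T \<rho>"
proof (rule wt_spaceI[of _ "[a]"])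
  have "a \<odot> v \<oplus> (- a) \<odot> v = (a + - a) \<odot> v" using v(1) scale_add_left by metis
  then show "shifts M T [a] v = \<zero>" using v by (simp add: shifts_simps shift_def)
qed (use assms in auto)

end

lemma shifts_equivariant:
  assumes "endo M T" "endo N U" and \<phi>: "lin_map M N \<phi>" and eq: "!!v. v \<in> carrier M ==> \<phi> (T v) = U (\<phi> v)"
    and v: "v \<in> carrier M"
  shows "\<phi> (shifts M T as v) = shifts N U as (\<phi> v)"
proof -
  interpret M: endo M T by fact
  interpret N: endo N U by fact
  show ?thesis
    by (induction as)
      (simp_all add: M.shifts_simps N.shifts_simps shift_def lin_map_add[OF \<phi>] lin_map_scale[OF \<phi>] eq v)
qed

lemma wt_space_equivariant:
  assumes "endo M T" "endo N U" and \<phi>: "lin_map M N \<phi>" and eq: "!!v. v \<in> carrier M ==> \<phi> (T v) = U (\<phi> v)"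
    and v: "v \<in> wt_space M T \<rho>"
  shows "\<phi> v \<in> wt_space N U \<rho>"
proof -
  interpret M: endo M T by fact
  interpret N: endo N U by fact
  obtain as where as: "v \<in> carrier M" "\<forall>a\<in>set as. Re a \<le> \<rho>" "shifts M T as v = \<zero>\<^bsub>M\<^esub>"
    using v by (rule M.wt_spaceE)
  then have "shifts N U as (\<phi> v) = \<zero>\<^bsub>N\<^esub>"
    using shifts_equivariant[OF assms(1-4) as(1), of as] lin_map_zero[OF M.cmodule_axioms N.cmodule_axioms \<phi>]
    by simp
  then show ?thesis using as lin_map_closed[OF \<phi> as(1)] by (intro N.wt_spaceI[of _ as])
qed

text \<open>Injectivity reflects annihilation by a product of shifts, so the weights of a module are
  bounded by those of a module containing it.\<close>

lemma wt_space_reflect: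
  assumes "endo M T" "endo N U" and \<phi>: "lin_map M N \<phi>" and eq: "!!v. v \<in> carrier M ==> \<phi> (T v) = U (\<phi> v)"
    and inj: "inj_on \<phi> (carrier M)" and v: "v \<in> carrier M" "\<phi> v \<in> wt_space N U \<rho>"
  shows "v \<in> wt_space M T \<rho>"
proof -
  interpret M: endo M T by fact
  interpret N: endo N U by fact
  obtain as where as: "\<forall>a\<in>set as. Re a \<le> \<rho>" "shifts N U as (\<phi> v) = \<zero>\<^bsub>N\<^esub>"
    using v(2) by (rule N.wt_spaceE)
  then have "\<phi> (shifts M T as v) = \<phi> \<zero>\<^bsub>M\<^esub>"
    using shifts_equivariant[OF assms(1-4) v(1), of as] lin_map_zero[OF M.cmodule_axioms N.cmodule_axioms \<phi>]
    by simp
  then have "shifts M T as v = \<zero>\<^bsub>M\<^esub>" using inj v(1) by (simp add: inj_on_def)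
  then show ?thesis using as v(1) by (intro M.wt_spaceI[of _ as])
qed

text \<open>By the Leibniz rule \<open>V - (a + b)\<close> sends \<open>\<beta> u v\<close> to
  \<open>\<beta> ((T - a) u) v\<close> plus \<open>\<beta> u ((U - b) v)\<close>. In either term one
  list of shifts has become shorter, so induction on the total length applies.\<close>

lemma wt_space_bilinear:
  assumes "endo M T" "endo N U" "endo P V"
    and lin1: "!!v. v \<in> carrier N ==> lin_map M P (\<lambda>u. \<beta> u v)"
    and lin2: "!!u. u \<in> carrier M ==> lin_map N P (\<beta> u)"
    and leibniz: "!!u v. u \<in> carrier M ==> v \<in> carrier N ==> V (\<beta> u v) = \<beta> (T u) v \<oplus>\<^bsub>P\<^esub> \<beta> u (U v)"
    and u: "u \<in> wt_space M T \<rho>" and v: "v \<in> wt_space N U \<tau>"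
  shows "\<beta> u v \<in> wt_space P V (\<rho> + \<tau>)"
proof -
  interpret M: endo M T by fact
  interpret N: endo N U by fact
  interpret P: endo P V by fact
  note W = P.submodule_wt_space[of "\<rho> + \<tau>"]
  have main: "\<beta> u v \<in> wt_space P V (\<rho> + \<tau>)"
    if "u \<in> carrier M" "v \<in> carrier N" "\<forall>a\<in>set as. Re a \<le> \<rho>" "\<forall>b\<in>set bs. Re b \<le> \<tau>"
      "shifts M T as u = \<zero>\<^bsub>M\<^esub>" "shifts N U bs v = \<zero>\<^bsub>N\<^esub>" for u v as bs
    using that
  proof (induction "length as + length bs" arbitrary: u v as bs rule: less_induct)
    case less
    note u = less.prems(1) and v = less.prems(2)
    have c: "\<beta> u v \<in> carrier P" if "u \<in> carrier M" "v \<in> carrier N" for u v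
      using lin_map_closed[OF lin1[OF that(2)] that(1)] .
    show ?case
    proof (cases "as = [] \<or> bs = []")
      case True
      then have "u = \<zero>\<^bsub>M\<^esub> \<or> v = \<zero>\<^bsub>N\<^esub>"
        using less.prems(5,6) by (auto simp: M.shifts_simps N.shifts_simps)
      then have "\<beta> u v = \<zero>\<^bsub>P\<^esub>"
        using lin_map_zero[OF M.cmodule_axioms P.cmodule_axioms lin1[OF v]]
          lin_map_zero[OF N.cmodule_axioms P.cmodule_axioms lin2[OF u]] by auto
      then show ?thesis using P.submodule_zero_mem[OF W] by simp
    next
      case False
      \<comment> \<open>The shift to be split off is the last entry, since it acts first.\<close>
      then obtain as' a bs' b where ab: "as = as' @ [a]" "bs = bs' @ [b]"
        by (metis append_butlast_last_id)
      have "\<beta> (shift M T a u) v \<in> wt_space P V (\<rho> + \<tau>)"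
        by (rule less.hyps[of as' bs]) (use less.prems ab in \<open>auto simp: M.shifts_simps\<close>)
      moreover have "\<beta> u (shift N U b v) \<in> wt_space P V (\<rho> + \<tau>)"
        by (rule less.hyps[of as bs']) (use less.prems ab in \<open>auto simp: N.shifts_simps\<close>)
      moreover have "shift P V (a + b) (\<beta> u v) = \<beta> (shift M T a u) v \<oplus>\<^bsub>P\<^esub> \<beta> u (shift N U b v)"
      proof -
        have "\<beta> (shift M T a u) v = \<beta> (T u) v \<oplus>\<^bsub>P\<^esub> (- a) \<odot>\<^bsub>P\<^esub> \<beta> u v"
          using u v by (simp add: shift_def lin_map_add[OF lin1[OF v]] lin_map_scale[OF lin1[OF v]])
        moreover have "\<beta> u (shift N U b v) = \<beta> u (U v) \<oplus>\<^bsub>P\<^esub> (- b) \<odot>\<^bsub>P\<^esub> \<beta> u v"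
          using u v by (simp add: shift_def lin_map_add[OF lin2[OF u]] lin_map_scale[OF lin2[OF u]])
        moreover have "(- (a + b)) \<odot>\<^bsub>P\<^esub> \<beta> u v = (- a) \<odot>\<^bsub>P\<^esub> \<beta> u v \<oplus>\<^bsub>P\<^esub> (- b) \<odot>\<^bsub>P\<^esub> \<beta> u v"
          using P.scale_add_left[OF c[OF u v], of "- a" "- b"] by simp
        ultimately show ?thesis
          using u v c[OF u v] c[of "T u" v] c[of u "U v"] by (simp add: shift_def leibniz P.a_ac)
      qed
      ultimately have "shift P V (a + b) (\<beta> u v) \<in> wt_space P V (\<rho> + \<tau>)"
        using P.submodule_add[OF W] by simp
      moreover have "Re (a + b) \<le> \<rho> + \<tau>" using less.prems(3,4) ab by auto
      ultimately show ?thesis using P.wt_space_step[OF c[OF u v]] by blast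
    qed
  qed
  show ?thesis using u v by (elim M.wt_spaceE N.wt_spaceE) (rule main)
qed

text \<open>Modulo \<open>N\<close> each factor \<open>T - b\<close> multiplies \<open>v\<close> by
  \<open>a - b\<close>, which is nonzero.\<close>

lemma (in endo) shifts_near_eigenvector:
  assumes N: "submodule N \<complex> M" "!!v. v \<in> N ==> T v \<in> N"
    and v: "v \<in> carrier M" "shift M T a v \<in> N" and bs: "a \<notin> set bs"
  shows "\<exists>c n. c \<noteq> 0 \<and> n \<in> N \<and> shifts M T bs v = n \<oplus> c \<odot> v"
  using bs
proof (induction bs)
  case Nil
  show ?case by (intro exI[of _ 1] exI[of _ \<zero>]) (simp add: shifts_simps v submodule_zero_mem[OF N(1)])
next
  case (Cons b bs)
  then obtain c n where cn: "c \<noteq> 0" "n \<in> N" "shifts M T bs v = n \<oplus> c \<odot> v" by auto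
  have nM: "n \<in> carrier M" by (rule submodule_carrier[OF N(1) cn(2)])
  have sb: "shift M T b v = shift M T a v \<oplus> (a - b) \<odot> v"
    using v scale_add_left[OF v(1), of "- a" "a - b"] by (simp add: shift_def a_assoc)
  have "shifts M T (b # bs) v = shift M T b n \<oplus> c \<odot> shift M T b v"
    using nM v by (simp add: shifts_simps cn(3) lin_map_add[OF lin_map_shift] lin_map_scale[OF lin_map_shift])
  also have "\<dots> = (shift M T b n \<oplus> c \<odot> shift M T a v) \<oplus> (c * (a - b)) \<odot> v"
    using nM v by (simp add: sb scale_add_right scale_scale a_assoc)
  finally have "shifts M T (b # bs) v = (shift M T b n \<oplus> c \<odot> shift M T a v) \<oplus> (c * (a - b)) \<odot> v" .
  moreover have "shift M T b n \<oplus> c \<odot> shift M T a v \<in> N"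
    by (intro submodule_add[OF N(1)] submodule_scale[OF N(1)] shift_stable[OF N] cn v)
  moreover have "c * (a - b) \<noteq> 0" using cn Cons.prems by auto
  ultimately show ?case by blast
qed

text \<open>An eigenvector modulo \<open>N\<close> can be moved into \<open>S\<close> by killing the part of its decomposition that
  lies in lower weights.\<close>

lemma (in endo) eigenvector_in_summand:
  assumes N: "submodule N \<complex> M" "!!v. v \<in> N ==> T v \<in> N"
    and N': "submodule N' \<complex> M" "!!v. v \<in> N' ==> T v \<in> N'"
    and S: "submodule S \<complex> M" "!!v. v \<in> S ==> T v \<in> S"
    and v: "v \<in> N'" "v \<notin> N" "shift M T a v \<in> N"
    and split: "v = v\<^sub>0 \<oplus> v\<^sub>1" "v\<^sub>0 \<in> S" "v\<^sub>1 \<in> wt_space M T \<rho>" "\<rho> < Re a"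
  shows "\<exists>w. w \<in> N' \<and> w \<in> S \<and> w \<notin> N"
proof -
  have vM: "v \<in> carrier M" by (rule submodule_carrier[OF N'(1) v(1)])
  obtain bs where bs: "v\<^sub>1 \<in> carrier M" "\<forall>b\<in>set bs. Re b \<le> \<rho>" "shifts M T bs v\<^sub>1 = \<zero>"
    using split(3) by (rule wt_spaceE)
  have "a \<notin> set bs" using bs(2) split(4) by auto
  then obtain c n where cn: "c \<noteq> 0" "n \<in> N" "shifts M T bs v = n \<oplus> c \<odot> v"
    using shifts_near_eigenvector[OF N vM v(3)] by blast
  have nM: "n \<in> carrier M" by (rule submodule_carrier[OF N(1) cn(2)])
  \<comment> \<open>The shifts that kill the low part \<open>v\<^sub>1\<close> leave an element of
    \<open>S\<close>; modulo \<open>N\<close> it is a nonzero multiple of \<open>v\<close>.\<close>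
  let ?w = "shifts M T bs v"
  have "?w = shifts M T bs v\<^sub>0"
    using bs submodule_carrier[OF S(1) split(2)] by (simp add: split(1) lin_map_add[OF lin_map_shifts])
  then have "?w \<in> S" using shifts_stable[OF S split(2)] by simp
  moreover have "?w \<in> N'" by (rule shifts_stable[OF N' v(1)])
  moreover have "?w \<notin> N"
  proof
    assume "?w \<in> N"
    then have "?w \<ominus> n \<in> N" using submodule_diff[OF N(1)] cn(2) by blast
    moreover have "?w \<ominus> n = c \<odot> v"
    proof -
      have "n \<oplus> c \<odot> v \<ominus> n = c \<odot> v \<oplus> (n \<ominus> n)" using nM vM by (simp add: minus_eq a_ac)
      then show ?thesis using nM vM unfolding cn(3) by (simp add: minus_eq r_neg)
    qed
    ultimately have "(1 / c) \<odot> (c \<odot> v) \<in> N" using submodule_scale[OF N(1)] by simp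
    then show False using v(2) cn(1) vM by (simp add: scale_scale)
  qed
  ultimately show ?thesis by blast
qed

lemma endo_act: "lie_rep L M ==> x \<in> L ==> endo M (act M x)"
  by (simp add: endo_def endo_axioms_def lie_rep_module lie_rep_act_linear)

section \<open>Finite length\<close>

lemma quot_restr:
  assumes "module \<complex> M" "submodule A \<complex> M" "submodule D \<complex> M" "A \<subseteq> D"
  shows "quot (restr M D) A"
  using assms module_restr[OF assms(1,3)] submodule_restr_iff[OF assms(1,3)]
  by (simp add: quot_def quot_axioms_def cmodule_iff)

text \<open>A chain of greatest length among the strict chains from zero to the whole module is a
  composition series: a proper nonzero submodule of a factor pulls back to a term that could be
  inserted.\<close>

theorem finite_length_if_chains_bounded:
  assumes M: "lie_rep L M"
    and bound: "!!cs. sorted_wrt (\<subset>) cs ==> \<forall>N\<in>set cs. subrep L M N ==> length cs \<le> B"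
  shows "finite_length L M"
proof (cases "carrier M = {\<zero>\<^bsub>M\<^esub>}")
  interpret M: cmodule M by (rule lie_rep_module[OF M])
  have mod: "module \<complex> M" using M.module_axioms .
  \<comment> \<open>In the zero module the two ends coincide, so the series has a single term.
    Otherwise the chain of the two ends is strict and starts the maximisation.\<close>
  case True
  have "subrep L M {\<zero>\<^bsub>M\<^esub>}"
    unfolding subrep_def using M.submodule_zero act_closed[OF M _ M.zero_closed] True by auto
  then have "composition_series L M [{\<zero>\<^bsub>M\<^esub>}]" by (simp add: composition_series_def True)
  then show ?thesis unfolding finite_length_def by blast
next
  interpret M: cmodule M by (rule lie_rep_module[OF M])
  have mod: "module \<complex> M" using M.module_axioms .
  case False
  define C where "C cs \<longleftrightarrow> cs \<noteq> [] \<and> hd cs = {\<zero>\<^bsub>M\<^esub>} \<and> last cs = carrier M \<and>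
    (\<forall>N\<in>set cs. subrep L M N) \<and> sorted_wrt (\<subset>) cs" for cs
  have zero: "act M x \<zero>\<^bsub>M\<^esub> = \<zero>\<^bsub>M\<^esub>" if "x \<in> L" for x
    by (rule lin_map_zero[OF M.cmodule_axioms M.cmodule_axioms lie_rep_act_linear[OF M that]])
  have "subrep L M {\<zero>\<^bsub>M\<^esub>}" "subrep L M (carrier M)"
    unfolding subrep_def using M.submodule_zero M.carrier_submodule zero act_closed[OF M] by auto
  then have "C [{\<zero>\<^bsub>M\<^esub>}, carrier M]" using False by (auto simp: C_def)
  moreover have "\<forall>ds. C ds \<longrightarrow> length ds < Suc B" using bound by (auto simp: C_def less_Suc_eq_le)
  ultimately have "\<exists>cs. C cs \<and> (\<forall>ds. C ds \<longrightarrow> length ds \<le> length cs)"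
    by (rule ex_has_greatest_nat)
  then obtain cs where cs: "C cs" and max: "!!ds. C ds ==> length ds \<le> length cs" by blast
  have sub: "subrep L M (cs ! i)" if "i < length cs" for i using cs that by (simp add: C_def)
  have nth_mono: "cs ! k \<subseteq> cs ! j" if "k \<le> j" "j < length cs" for k j
  proof (cases "k = j")
    case False
    then show ?thesis using cs that unfolding C_def sorted_wrt_iff_nth_less by (meson le_neq_implies_less psubset_imp_subset)
  qed simp
  have "composition_series L M cs"
    unfolding composition_series_def
  proof (intro conjI allI impI)
    fix i assume i: "Suc i < length cs"
    define A where "A = cs ! i"
    define D where "D = cs ! Suc i"
    have AD: "A \<subset> D" using cs i by (simp add: C_def A_def D_def sorted_wrt_iff_nth_less)
    then show "cs ! i \<subseteq> cs ! Suc i" by (auto simp: A_def D_def)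
    have sA: "subrep L M A" "submodule A \<complex> M" and sD: "subrep L M D" "submodule D \<complex> M"
      using sub i by (auto simp: A_def D_def subrep_def)
    interpret Q: quot "restr M D" A using quot_restr[OF mod sA(2) sD(2)] AD by blast
    have lr: "lie_rep L (restr M D)" by (rule lie_rep_restr[OF M sD(1)])
    have sAD: "subrep L (restr M D) A" using subrep_restr_iff[OF mod sD(2)] sA AD by blast
    have cf: "comp_factor M cs i = quot_rep (restr M D) A" by (simp add: comp_factor_def A_def D_def)
    interpret QM: cmodule "quot_rep (restr M D) A" using Q.module_quot by (simp add: cmodule_iff)
    show "simple_rep L (comp_factor M cs i)"
      unfolding simple_rep_def cf
    proof (intro conjI allI impI)
      show "lie_rep L (quot_rep (restr M D) A)" by (rule Q.lie_rep_quot[OF lr sAD])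
      obtain v where "v \<in> D" "v \<notin> A" using AD by blast
      then have "qcl (restr M D) A v \<noteq> \<zero>\<^bsub>quot_rep (restr M D) A\<^esub>" "qcl (restr M D) A v \<in> carrier (quot_rep (restr M D) A)"
        using Q.qcl_eq_zero_iff[of v] Q.qcl_in[of v] by simp_all
      then show "carrier (quot_rep (restr M D) A) \<noteq> {\<zero>\<^bsub>quot_rep (restr M D) A\<^esub>}" by blast
    next
      fix S assume S: "subrep L (quot_rep (restr M D) A) S"
      then have S': "submodule S \<complex> (quot_rep (restr M D) A)" by (simp add: subrep_def)
      define S0 where "S0 = {v \<in> carrier (restr M D). qcl (restr M D) A v \<in> S}"
      have m0: "submodule S0 \<complex> (restr M D)" unfolding S0_def
        by (rule Q.M.submodule_vimage[OF QM.cmodule_axioms Q.lin_map_qcl S'])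
      have "act M x v \<in> S0" if x: "x \<in> L" and v: "v \<in> S0" for x v
      proof -
        have vD: "v \<in> D" "qcl (restr M D) A v \<in> S" using v by (auto simp: S0_def)
        have "act_linear (restr M D) x" using lr x by (simp add: lie_rep_iff)
        moreover have "act (restr M D) x n \<in> A" if "n \<in> A" for n using sA(1) that x by (simp add: subrep_def)
        ultimately have "act (quot_rep (restr M D) A) x (qcl (restr M D) A v) = qcl (restr M D) A (act M x v)"
          using Q.qcl_act[of x v] vD(1) by simp
        moreover have "act (quot_rep (restr M D) A) x (qcl (restr M D) A v) \<in> S"
          using S x vD(2) unfolding subrep_def by blast
        moreover have "act M x v \<in> D" using x vD(1) sD(1) unfolding subrep_def by blast
        ultimately show ?thesis by (simp add: S0_def)
      qed
      then have sub0: "subrep L M S0" "S0 \<subseteq> D"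
        using m0 submodule_restr_iff[OF mod sD(2)] by (auto simp: subrep_def)
      have AS: "A \<subseteq> S0"
      proof
        fix v assume v: "v \<in> A"
        then have "v \<in> carrier (restr M D)" using AD by auto
        then show "v \<in> S0" using v Q.qcl_eq_zero_iff[of v] QM.submodule_zero_mem[OF S'] by (simp add: S0_def)
      qed
      have SQ: "S \<subseteq> qcl (restr M D) A ` S0"
        using QM.submodule_carrier[OF S'] by (auto simp: Q.carrier_quot S0_def)
      show "S = {\<zero>\<^bsub>quot_rep (restr M D) A\<^esub>} \<or> S = carrier (quot_rep (restr M D) A)"
      proof (cases "S0 = A \<or> S0 = D")
        case True
        then show ?thesis
        proof
          assume eq: "S0 = A"
          have "q = \<zero>\<^bsub>quot_rep (restr M D) A\<^esub>" if "q \<in> S" for q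
            using that SQ eq AD Q.qcl_eq_zero_iff by auto
          then show ?thesis using QM.submodule_zero_mem[OF S'] by blast
        next
          assume eq: "S0 = D"
          have "carrier (quot_rep (restr M D) A) \<subseteq> S"
            unfolding Q.carrier_quot using eq by (auto simp: S0_def)
          then show ?thesis using QM.submodule_carrier[OF S'] by blast
        qed
      next
        case neq: False
        define ds where "ds = take (Suc i) cs @ S0 # drop (Suc i) cs"
        have split: "cs = take (Suc i) cs @ drop (Suc i) cs" by simp
        have srt: "sorted_wrt (\<subset>) (take (Suc i) cs @ drop (Suc i) cs)" using cs by (simp add: C_def)
        have lower: "Z \<subset> S0" if Z: "Z \<in> set (take (Suc i) cs)" for Z
        proof -
          have "\<exists>k\<le>i. Z = cs ! k" using Z i by (auto simp: in_set_conv_nth less_Suc_eq_le)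
          then obtain k where k: "k \<le> i" "Z = cs ! k" by blast
          then have "Z \<subseteq> A" using nth_mono[of k i] i by (simp add: A_def)
          then show ?thesis using AS neq by blast
        qed
        have upper: "S0 \<subset> Z" if Z: "Z \<in> set (drop (Suc i) cs)" for Z
        proof -
          have "\<exists>k. k + Suc i < length cs \<and> Z = cs ! (Suc i + k)" using Z i
            by (auto simp: in_set_conv_nth less_diff_conv)
          then obtain k where k: "k + Suc i < length cs" "Z = cs ! (Suc i + k)" by blast
          then have "D \<subseteq> Z" using nth_mono[of "Suc i" "Suc i + k"] by (simp add: D_def)
          then show ?thesis using sub0 neq by blast
        qed
        have "sorted_wrt (\<subset>) ds"
          using srt lower upper unfolding ds_def sorted_wrt_append by auto
        moreover have "hd ds = hd cs" "last ds = last cs" "set ds \<subseteq> insert S0 (set cs)"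
          using cs i set_take_subset[of "Suc i" cs] set_drop_subset[of "Suc i" cs] unfolding ds_def C_def
          by (auto simp: hd_append hd_conv_nth last_append)
        ultimately have "C ds" using cs sub0 unfolding C_def ds_def by auto
        then have "length ds \<le> length cs" by (rule max)
        then show ?thesis using i by (simp add: ds_def)
      qed
    qed
  qed (use cs in \<open>auto simp: C_def\<close>)
  then show ?thesis unfolding finite_length_def by blast
qed

section \<open>Rotations in the classical Lie algebras\<close>

lemma mat_scale_apply [simp]: "mat_scale c A u v = c * A u v"
  by (simp add: mat_scale_def)

lemma mat_mult_gl: "A \<in> gl D ==> mat_mult A B u v = (\<Sum>k<D. A u k * B k v)"
  unfolding mat_mult_def by (rule sum.mono_neutral_left) (auto simp: gl_def)

lemma mat_mult_mem_gl: "A \<in> gl D ==> B \<in> gl D ==> mat_mult A B \<in> gl D"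
proof -
  assume A: "A \<in> gl D" and B: "B \<in> gl D"
  have "mat_mult A B u v = 0" if "\<not> (u < D \<and> v < D)" for u v
    unfolding mat_mult_gl[OF A] using A B that by (intro sum.neutral) (auto simp: gl_def)
  then show ?thesis by (auto simp: gl_def)
qed

lemma mat_mult_assoc_gl:
  assumes "A \<in> gl D" "B \<in> gl D"
  shows "mat_mult (mat_mult A B) C = mat_mult A (mat_mult B C)"
proof (intro ext)
  fix u v
  have "mat_mult (mat_mult A B) C u v = (\<Sum>k<D. \<Sum>l<D. A u l * B l k * C k v)"
    by (simp add: mat_mult_gl[OF mat_mult_mem_gl[OF assms]] mat_mult_gl[OF assms(1)] sum_distrib_right)
  also have "\<dots> = (\<Sum>l<D. \<Sum>k<D. A u l * B l k * C k v)" by (rule sum.swap)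
  also have "\<dots> = mat_mult A (mat_mult B C) u v"
    by (simp add: mat_mult_gl[OF assms(1)] mat_mult_gl[OF assms(2)] sum_distrib_left mult.assoc)
  finally show "mat_mult (mat_mult A B) C u v = mat_mult A (mat_mult B C) u v" .
qed

lemma gl_mono: "d \<le> D ==> gl d \<subseteq> gl D"
  by (fastforce simp: gl_def)

lemma subspace_gl: "cmat.subspace (gl D)"
  unfolding cmat.subspace_def by (auto simp: gl_def) (metis add.right_neutral, metis add.right_neutral)

lemma lie_bracket_gl:
  "x \<in> gl D ==> y \<in> gl D ==> lie_bracket x y u v = (\<Sum>k<D. x u k * y k v - y u k * x k v)"
  by (simp add: lie_bracket_def mat_mult_gl sum_subtractf)

lemma lie_bracket_mem_gl: "x \<in> gl D ==> y \<in> gl D ==> lie_bracket x y \<in> gl D"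
  unfolding lie_bracket_def by (intro cmat.subspace_diff subspace_gl mat_mult_mem_gl)

lemma
  assumes x: "x \<in> gl D" and y: "y \<in> gl D" and z: "z \<in> gl D"
  shows lie_bracket_add_left: "lie_bracket (x + y) z = lie_bracket x z + lie_bracket y z"
    and lie_bracket_add_right: "lie_bracket x (y + z) = lie_bracket x y + lie_bracket x z"
    and lie_bracket_scale_left: "lie_bracket (mat_scale c x) y = mat_scale c (lie_bracket x y)"
    and lie_bracket_scale_right: "lie_bracket x (mat_scale c y) = mat_scale c (lie_bracket x y)"
    and lie_bracket_anti: "lie_bracket y x = - lie_bracket x y"
    and jacobi: "lie_bracket (lie_bracket x y) z
      = lie_bracket x (lie_bracket y z) - lie_bracket y (lie_bracket x z)"
proof -
  note cl = cmat.subspace_add[OF subspace_gl] cmat.subspace_scale[OF subspace_gl]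
  show "lie_bracket (x + y) z = lie_bracket x z + lie_bracket y z"
    using x y z
    by (simp add: fun_eq_iff lie_bracket_gl[of _ D] cl algebra_simps sum.distrib sum_subtractf)
  show "lie_bracket x (y + z) = lie_bracket x y + lie_bracket x z"
    using x y z
    by (simp add: fun_eq_iff lie_bracket_gl[of _ D] cl algebra_simps sum.distrib sum_subtractf)
  show "lie_bracket (mat_scale c x) y = mat_scale c (lie_bracket x y)"
    using x y by (simp add: fun_eq_iff lie_bracket_gl[of _ D] cl algebra_simps sum_distrib_left)
  show "lie_bracket x (mat_scale c y) = mat_scale c (lie_bracket x y)"
    using x y by (simp add: fun_eq_iff lie_bracket_gl[of _ D] cl algebra_simps sum_distrib_left)
  show "lie_bracket y x = - lie_bracket x y" by (simp add: lie_bracket_def)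
  have mm: "mat_mult (a - b) c = mat_mult a c - mat_mult b c" "mat_mult c (a - b) = mat_mult c a - mat_mult c b"
    if "a \<in> gl D" "b \<in> gl D" "c \<in> gl D" for a b c
  proof -
    have "a - b \<in> gl D" using that cmat.subspace_diff[OF subspace_gl] by blast
    then show "mat_mult (a - b) c = mat_mult a c - mat_mult b c" "mat_mult c (a - b) = mat_mult c a - mat_mult c b"
      using that by (simp_all add: fun_eq_iff mat_mult_gl[of _ D] algebra_simps sum_subtractf)
  qed
  show "lie_bracket (lie_bracket x y) z = lie_bracket x (lie_bracket y z) - lie_bracket y (lie_bracket x z)"
    unfolding lie_bracket_def using x y z
    by (simp add: mm mat_mult_mem_gl mat_mult_assoc_gl[of _ D])
qed

section \<open>Orthogonal and symplectic algebras by one symmetry condition\<close>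

text \<open>One description for so and sp: \<open>A\<close> is minus its adjoint for a bilinear form
  that pairs the coordinate \<open>u\<close> with \<open>\<tau> u\<close> up to the sign
  \<open>e\<close>. Type SO takes the identity and 1, type SP takes \<open>pr\<close> and
  \<open>eps\<close>.\<close>

definition theta :: "(nat => nat) => (nat => complex) => nat => mat set" where
  "theta \<tau> e D = {A \<in> gl D. \<forall>u<D. \<forall>v<D. A u v = - (e u * e v * A (\<tau> v) (\<tau> u))}"

lemma so_eq_theta: "so D = theta id (\<lambda>_. 1) D"
proof -
  have "A u v = - A v u" if "A \<in> theta id (\<lambda>_. 1) D" for A u v
  proof (cases "u < D \<and> v < D")
    case True then show ?thesis using that unfolding theta_def mult_1_left id_apply by blast
  next
    case False
    have "A \<in> gl D" using that unfolding theta_def by blast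
    then have "A u v = 0" "A v u = 0" using False by (auto simp: gl_def)
    then show ?thesis by simp
  qed
  moreover have "A u v = - A v u" if "A \<in> so D" for A u v
    using that unfolding so_def by blast
  moreover have "so D \<subseteq> gl D" "theta id (\<lambda>_. 1) D \<subseteq> gl D" by (auto simp: so_def theta_def)
  ultimately show ?thesis
    unfolding so_def theta_def id_apply mult_1_left by blast
qed

text \<open>The partner of a coordinate in its symplectic pair; \<open>eps\<close> below is the sign
  of the form there.\<close>

definition pr :: "nat => nat" where "pr u = (if even u then u + 1 else u - 1)"
definition eps :: "nat => complex" where "eps u = (if even u then 1 else - 1)"

lemma pr_pr [simp]: "pr (pr u) = u"
  by (auto simp: pr_def)

lemma eps_pr [simp]: "eps (pr u) = - eps u"
  by (auto simp: eps_def pr_def)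

lemma eps_eps [simp]: "eps u * eps u = 1" "eps u * (eps u * x) = x"
  by (auto simp: eps_def)

lemma pr_less: "even D ==> pr u < D \<longleftrightarrow> u < D"
  by (auto simp: pr_def elim!: evenE oddE)

lemma sp_form_pr: "sp_form u v = (if v = pr u then eps u else 0)"
  by (auto simp: sp_form_def pr_def eps_def elim!: oddE) presburger

lemma pr_eq_iff: "u = pr v \<longleftrightarrow> v = pr u"
  by (metis pr_pr)

lemma sp_eq_theta:
  assumes D: "even D"
  shows "sp D = theta pr eps D"
proof -
  \<comment> \<open>Each sum has one nonzero term, at the partner of \<open>v\<close> respectively
    \<open>u\<close>; evenness of \<open>D\<close> keeps that partner below
    \<open>D\<close>.\<close>
  have form: "(\<Sum>k<D. A k u * sp_form k v + sp_form u k * A k v) = eps u * A (pr u) v - eps v * A (pr v) u"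
    if "u < D" "v < D" for A u v
  proof -
    have "(\<Sum>k<D. A k u * sp_form k v) = (\<Sum>k<D. if k = pr v then - (eps v * A (pr v) u) else 0)"
      by (rule sum.cong) (auto simp: sp_form_pr pr_eq_iff)
    moreover have "(\<Sum>k<D. sp_form u k * A k v) = (\<Sum>k<D. if k = pr u then eps u * A (pr u) v else 0)"
      by (rule sum.cong) (auto simp: sp_form_pr)
    ultimately show ?thesis using that by (simp add: sum.distrib pr_less D)
  qed
  have "(\<forall>u<D. \<forall>v<D. eps u * A (pr u) v - eps v * A (pr v) u = 0)
      \<longleftrightarrow> (\<forall>u<D. \<forall>v<D. A u v = - (eps u * eps v * A (pr v) (pr u)))" for A
  proof (intro iffI allI impI)
    fix u v assume H: "\<forall>u<D. \<forall>v<D. eps u * A (pr u) v - eps v * A (pr v) u = 0" and uv: "u < D" "v < D"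
    then have "eps (pr u) * A u v - eps v * A (pr v) (pr u) = 0" using D pr_less[of D u] by (metis pr_pr)
    then have "eps u * A u v = - (eps v * A (pr v) (pr u))" by (simp add: eq_neg_iff_add_eq_0 neg_eq_iff_add_eq_0)
    then have "eps u * (eps u * A u v) = eps u * - (eps v * A (pr v) (pr u))" by (simp only:)
    then show "A u v = - (eps u * eps v * A (pr v) (pr u))" by (simp add: mult.assoc)
  next
    fix u v assume H: "\<forall>u<D. \<forall>v<D. A u v = - (eps u * eps v * A (pr v) (pr u))" and uv: "u < D" "v < D"
    then have "A (pr u) v = - (eps (pr u) * eps v * A (pr v) u)" using D pr_less[of D u] by (metis pr_pr)
    then show "eps u * A (pr u) v - eps v * A (pr v) u = 0" by (simp add: mult.assoc)
  qed
  moreover have "sp D = {A \<in> gl D. \<forall>u<D. \<forall>v<D. eps u * A (pr u) v - eps v * A (pr v) u = 0}"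
    by (auto simp: sp_def form)
  ultimately show ?thesis unfolding theta_def by (simp only:)
qed

text \<open>The adjunction reverses products, so the adjoint of a product of two skew matrices is
  the product in the other order, and the commutator is skew. \<open>mm\<close> is this reversal
  entrywise.\<close>

lemma lie_bracket_theta:
  assumes \<tau>: "!!u. \<tau> (\<tau> u) = u" "!!u. u < D ==> \<tau> u < D" and e: "!!u. e u * e u = 1"
    and x: "x \<in> theta \<tau> e D" and y: "y \<in> theta \<tau> e D"
  shows "lie_bracket x y \<in> theta \<tau> e D"
proof -
  have gl: "x \<in> gl D" "y \<in> gl D" using x y by (auto simp: theta_def)
  have mm: "(\<Sum>k<D. a u k * b k v) = e u * e v * (\<Sum>k<D. b (\<tau> v) k * a k (\<tau> u))"
    if "a \<in> theta \<tau> e D" "b \<in> theta \<tau> e D" "u < D" "v < D" for a b u v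
  proof -
    have "a u k * b k v = e u * e v * (b (\<tau> v) (\<tau> k) * a (\<tau> k) (\<tau> u))" if k: "k < D" for k
    proof -
      have "a u k = - (e u * e k * a (\<tau> k) (\<tau> u))" "b k v = - (e k * e v * b (\<tau> v) (\<tau> k))"
        using k \<open>a \<in> theta \<tau> e D\<close> \<open>b \<in> theta \<tau> e D\<close> \<open>u < D\<close> \<open>v < D\<close> unfolding theta_def by blast+
      then have "a u k * b k v = (e k * e k) * (e u * e v * (b (\<tau> v) (\<tau> k) * a (\<tau> k) (\<tau> u)))"
        by (simp add: algebra_simps)
      then show ?thesis by (simp add: e)
    qed
    then have "(\<Sum>k<D. a u k * b k v) = (\<Sum>k<D. e u * e v * (b (\<tau> v) (\<tau> k) * a (\<tau> k) (\<tau> u)))"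
      by (intro sum.cong) auto
    also have "\<dots> = (\<Sum>k<D. e u * e v * (b (\<tau> v) k * a k (\<tau> u)))"
      by (rule sum.reindex_bij_witness[of _ \<tau> \<tau>]) (use \<tau> in auto)
    finally show ?thesis by (simp add: sum_distrib_left)
  qed
  show ?thesis
    unfolding theta_def
  proof (intro CollectI conjI allI impI)
    fix u v assume uv: "u < D" "v < D"
    have "lie_bracket x y u v = e u * e v * (\<Sum>k<D. y (\<tau> v) k * x k (\<tau> u)) - e u * e v * (\<Sum>k<D. x (\<tau> v) k * y k (\<tau> u))"
      using mm[OF x y uv] mm[OF y x uv] by (simp add: lie_bracket_gl[OF gl] sum_subtractf)
    also have "\<dots> = - (e u * e v * lie_bracket x y (\<tau> v) (\<tau> u))"
      by (simp add: lie_bracket_gl[OF gl] sum_subtractf algebra_simps)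
    finally show "lie_bracket x y u v = - (e u * e v * lie_bracket x y (\<tau> v) (\<tau> u))" .
  qed (rule lie_bracket_mem_gl[OF gl])
qed

lemma subspace_theta: "cmat.subspace (theta \<tau> e D)"
  unfolding cmat.subspace_def
proof (intro conjI ballI allI)
  show "0 \<in> theta \<tau> e D" by (simp add: theta_def gl_def)
next
  fix x y assume "x \<in> theta \<tau> e D" "y \<in> theta \<tau> e D"
  then have gl: "x \<in> gl D" "y \<in> gl D"
    and th: "!!u v. u < D ==> v < D ==> x u v = - (e u * e v * x (\<tau> v) (\<tau> u))"
      "!!u v. u < D ==> v < D ==> y u v = - (e u * e v * y (\<tau> v) (\<tau> u))"
    unfolding theta_def by blast+
  have "(x + y) u v = - (e u * e v * (x + y) (\<tau> v) (\<tau> u))" if "u < D" "v < D" for u v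
    using th[OF that] by (simp only: plus_fun_apply distrib_left minus_add_distrib)
  then show "x + y \<in> theta \<tau> e D"
    using cmat.subspace_add[OF subspace_gl gl] unfolding theta_def by blast
next
  fix c x assume "x \<in> theta \<tau> e D"
  then have gl: "x \<in> gl D"
    and th: "!!u v. u < D ==> v < D ==> x u v = - (e u * e v * x (\<tau> v) (\<tau> u))"
    unfolding theta_def by blast+
  have "mat_scale c x u v = - (e u * e v * mat_scale c x (\<tau> v) (\<tau> u))" if "u < D" "v < D" for u v
    using th[OF that] by (simp only: mat_scale_apply mult.left_commute mult_minus_right)
  then show "mat_scale c x \<in> theta \<tau> e D"
    using cmat.subspace_scale[OF subspace_gl gl] unfolding theta_def by blast
qed

lemma subspace_sl: "cmat.subspace (sl D)"
  using cmat.subspace_add[OF subspace_gl] cmat.subspace_scale[OF subspace_gl] cmat.subspace_0[OF subspace_gl]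
  unfolding cmat.subspace_def sl_def
  by (auto simp: sum.distrib sum_distrib_left[symmetric])

lemma lie_bracket_sl:
  assumes "x \<in> gl D" "y \<in> gl D"
  shows "lie_bracket x y \<in> sl D"
proof -
  have "(\<Sum>u<D. \<Sum>k<D. x u k * y k u) = (\<Sum>k<D. \<Sum>u<D. x u k * y k u)" by (rule sum.swap)
  then have "(\<Sum>u<D. lie_bracket x y u u) = 0"
    by (simp add: lie_bracket_gl[OF assms] sum_subtractf mult.commute)
  then show ?thesis using lie_bracket_mem_gl[OF assms] by (simp add: sl_def)
qed

lemma even_nat_dim_SP: "even (nat_dim SP r n)" by simp

lemma classical_cases:
  assumes "L = classical s (nat_dim s r n)"
  obtains "s = SL" "L = sl (nat_dim s r n)"
  | \<tau> e where "L = theta \<tau> e (nat_dim s r n)" "!!u. \<tau> (\<tau> u) = u" "!!u. e u * e u = 1"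
      "!!m u. \<tau> u < nat_dim s r m \<longleftrightarrow> u < nat_dim s r m" "s \<noteq> SL"
      "(\<tau>, e) = (if s = SO then (id, \<lambda>_. 1) else (pr, eps))"
proof (cases s)
  case SO
  then show ?thesis using assms that(2)[of id "\<lambda>_. 1"] so_eq_theta by auto
next
  case SP
  then show ?thesis using assms that(2)[of pr eps] sp_eq_theta[OF even_nat_dim_SP] pr_less[OF even_nat_dim_SP] by auto
qed (use assms that(1) in auto)

lemma nat_dim_mono: "m \<le> n ==> nat_dim s r m \<le> nat_dim s r n"
  by (cases s) auto

lemma exhaustion_gl: "exhaustion s r n \<subseteq> gl (nat_dim s r n)"
  by (cases s) (auto simp: exhaustion_def sl_def so_def sp_def)

lemma subspace_exhaustion: "cmat.subspace (exhaustion s r n)"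
  unfolding exhaustion_def
  by (rule classical_cases[OF refl, of s r n]) (simp_all add: subspace_sl subspace_theta)

lemma lie_bracket_exhaustion:
  assumes "x \<in> exhaustion s r n" "y \<in> exhaustion s r n"
  shows "lie_bracket x y \<in> exhaustion s r n"
proof (rule classical_cases[OF refl, of s r n])
  assume "classical s (nat_dim s r n) = sl (nat_dim s r n)"
  then show ?thesis
    using assms exhaustion_gl[of s r n] lie_bracket_sl[of x "nat_dim s r n" y]
    unfolding exhaustion_def by auto
next
  fix \<tau> :: "nat => nat" and e
  assume th: "classical s (nat_dim s r n) = theta \<tau> e (nat_dim s r n)"
    and \<tau>: "!!u. \<tau> (\<tau> u) = u" "!!u. e u * e u = 1" "!!m u. \<tau> u < nat_dim s r m \<longleftrightarrow> u < nat_dim s r m"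
  show ?thesis
    using assms unfolding exhaustion_def th by (intro lie_bracket_theta \<tau>) (simp_all add: \<tau>(3))
qed

text \<open>For a matrix supported in the corner, the trace, respectively the symmetry condition,
  concerns only entries of the corner. This allows a matrix to be placed at a low level by
  inspecting its support alone.\<close>

lemma exhaustion_Int_gl:
  assumes mn: "m \<le> n"
  shows "exhaustion s r n \<inter> gl (nat_dim s r m) = exhaustion s r m"
proof -
  let ?d = "nat_dim s r m" and ?D = "nat_dim s r n"
  have dD: "?d \<le> ?D" using mn by (rule nat_dim_mono)
  show ?thesis
  proof (cases "s = SL")
    case True
    have "A u u = 0" if "A \<in> gl ?d" "\<not> u < ?d" for A u using that unfolding gl_def by blast
    then have "(\<Sum>u<?D. A u u) = (\<Sum>u<?d. A u u)" if "A \<in> gl ?d" for A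
      by (intro sum.mono_neutral_right) (use that dD in auto)
    then show ?thesis using True gl_mono[OF dD] by (auto simp: exhaustion_def sl_def)
  next
    case False
    define \<tau> e where "\<tau> = (if s = SO then id else pr)" and "e = (if s = SO then (\<lambda>_. 1) else eps)"
    have ex: "exhaustion s r n = theta \<tau> e (nat_dim s r n)" for n
      using False so_eq_theta sp_eq_theta[OF even_nat_dim_SP]
      by (cases s) (auto simp: exhaustion_def \<tau>_def e_def)
    have \<tau>: "\<tau> u < nat_dim s r k \<longleftrightarrow> u < nat_dim s r k" for u k
      using False pr_less[OF even_nat_dim_SP] by (cases s) (auto simp: \<tau>_def)
    have "A u v = - (e u * e v * A (\<tau> v) (\<tau> u))"
      if A: "A \<in> gl ?d" and th: "\<forall>u<?d. \<forall>v<?d. A u v = - (e u * e v * A (\<tau> v) (\<tau> u))" for A u v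
    proof (cases "u < ?d \<and> v < ?d")
      case True then show ?thesis using th by blast
    next
      case False
      then have "A u v = 0" "A (\<tau> v) (\<tau> u) = 0" using A \<tau> by (auto simp: gl_def)
      then show ?thesis by simp
    qed
    then have "theta \<tau> e ?d \<subseteq> theta \<tau> e ?D" using gl_mono[OF dD] unfolding theta_def by blast
    moreover have "theta \<tau> e ?D \<inter> gl ?d \<subseteq> theta \<tau> e ?d"
      using less_le_trans[OF _ dD] unfolding theta_def by blast
    moreover have "theta \<tau> e ?d \<subseteq> gl ?d" unfolding theta_def by blast
    ultimately show ?thesis unfolding ex by blast
  qed
qed

lemma exhaustion_mono: "m \<le> n ==> exhaustion s r m \<subseteq> exhaustion s r n"
  using exhaustion_Int_gl by blast

section \<open>Rotations and the decomposition into blocks\<close>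

lemma rot_gl: "i < nb ==> j < nb ==> rot d i j \<in> gl (d + 2 * nb)"
  by (auto simp: rot_def gl_def sg_def sw_def split: if_splits)

lemma sw_commute: "i \<noteq> j ==> v = sw d i j u \<longleftrightarrow> u = sw d i j v"
  by (metis sw_sw)

lemma lie_bracket_rot:
  assumes ij: "i < nb" "j < nb" "i \<noteq> j" and y: "y \<in> gl (d + 2 * nb)"
  shows "lie_bracket (rot d i j) y u v = sg d i j u * y (sw d i j u) v + sg d i j v * y u (sw d i j v)"
proof -
  let ?D = "d + 2 * nb"
  have 1: "(\<Sum>k<?D. rot d i j u k * y k v) = sg d i j u * y (sw d i j u) v"
  proof -
    have "(\<Sum>k<?D. rot d i j u k * y k v) = (\<Sum>k<?D. if k = sw d i j u then sg d i j u * y (sw d i j u) v else 0)"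
      by (rule sum.cong) (auto simp: rot_def)
    also have "\<dots> = sg d i j u * y (sw d i j u) v"
      using y by (auto simp: gl_def)
    finally show ?thesis .
  qed
  have 2: "(\<Sum>k<?D. y u k * rot d i j k v) = - (sg d i j v * y u (sw d i j v))"
  proof -
    have "(\<Sum>k<?D. y u k * rot d i j k v) = (\<Sum>k<?D. if k = sw d i j v then - (sg d i j v * y u (sw d i j v)) else 0)"
      by (rule sum.cong) (use sw_commute[OF ij(3)] sg_sw[OF ij(3)] in \<open>auto simp: rot_def\<close>)
    also have "\<dots> = - (sg d i j v * y u (sw d i j v))"
      using y by (auto simp: gl_def)
    finally show ?thesis .
  qed
  show ?thesis by (simp add: lie_bracket_gl[OF rot_gl[OF ij(1,2)] y] sum_subtractf 1 2)
qed

text \<open>The index of the term of the exhaustion whose natural module has \<open>nb\<close>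
  blocks beyond dimension \<open>d\<close>. In type SL the dimension grows by one, so a block takes
  two steps.\<close>

definition level :: "series => nat => nat" where
  "level s nb = (if s = SL then 2 * nb + 1 else nb + 1)"

lemma nat_dim_level: "nat_dim s r (level s nb) = nat_dim s r 1 + 2 * nb"
  by (cases s) (auto simp: level_def)

lemma level_ge: "nb < level s nb" "1 \<le> level s nb"
  by (auto simp: level_def)

lemma level_mono: "m \<le> n ==> level s m \<le> level s n"
  by (auto simp: level_def)

lemma nat_dim_pos: "0 < nat_dim s r 1"
  by (cases s) auto

lemma sw_double:
  "sw (2 * e) i j (2 * w) = 2 * (if w = e + i then e + j else if w = e + j then e + i else w)"
  "sw (2 * e) i j (Suc (2 * w)) = Suc (2 * (if w = e + i then e + j else if w = e + j then e + i else w))"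
  "sg (2 * e) i j (2 * w) = (if w = e + i then 1 else if w = e + j then - 1 else 0)"
  "sg (2 * e) i j (Suc (2 * w)) = (if w = e + i then 1 else if w = e + j then - 1 else 0)"
proof -
  have eqs: "2 * w = 2 * e + 2 * k \<longleftrightarrow> w = e + k" "(2 * w = 2 * e + 2 * k + 1) = False"
    "Suc (2 * w) = 2 * e + 2 * k + 1 \<longleftrightarrow> w = e + k" "(Suc (2 * w) = 2 * e + 2 * k) = False" for k
    by presburger+
  show "sw (2 * e) i j (2 * w) = 2 * (if w = e + i then e + j else if w = e + j then e + i else w)"
    "sw (2 * e) i j (Suc (2 * w)) = Suc (2 * (if w = e + i then e + j else if w = e + j then e + i else w))"
    unfolding sw_def eqs by simp_all
  show "sg (2 * e) i j (2 * w) = (if w = e + i then 1 else if w = e + j then - 1 else 0)"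
    "sg (2 * e) i j (Suc (2 * w)) = (if w = e + i then 1 else if w = e + j then - 1 else 0)"
    unfolding sg_def eqs by simp_all
qed

text \<open>With \<open>d\<close> even the blocks are symplectic pairs, and the swap moves pairs as
  wholes.\<close>

lemma sw_pr:
  assumes "even d"
  shows "sw d i j (pr u) = pr (sw d i j u)" "sg d i j (pr u) = sg d i j u" "eps (sw d i j u) = eps u"
proof -
  obtain e where d: "d = 2 * e" using assms by (elim evenE)
  have pe: "pr (2 * w) = Suc (2 * w)" "pr (Suc (2 * w)) = 2 * w" "eps (2 * w) = 1" "eps (Suc (2 * w)) = - 1" for w
    by (simp_all add: pr_def eps_def)
  obtain w where "u = 2 * w \<or> u = Suc (2 * w)" by (metis evenE oddE Suc_eq_plus1)
  then show "sw d i j (pr u) = pr (sw d i j u)" "sg d i j (pr u) = sg d i j u" "eps (sw d i j u) = eps u"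
    unfolding d by (elim disjE; simp only: pe sw_double)+
qed

lemma rot_exhaustion:
  fixes s r
  defines "d \<equiv> nat_dim s r 1"
  assumes ij: "i < nb" "j < nb" "i \<noteq> j"
  shows "rot d i j \<in> exhaustion s r (level s nb)"
proof -
  have gl: "rot d i j \<in> gl (nat_dim s r (level s nb))"
    unfolding nat_dim_level d_def by (rule rot_gl[OF ij(1,2)])
  show ?thesis
  proof (cases s)
    case SL
    have "rot d i j u u = 0" for u using ij(3) by (auto simp: rot_def sg_def sw_def)
    then show ?thesis using gl SL by (simp add: exhaustion_def sl_def)
  next
    case SO
    have "rot d i j u v = - rot d i j v u" for u v
      using sw_commute[OF ij(3)] sg_sw[OF ij(3)] by (auto simp: rot_def)
    then show ?thesis using gl unfolding exhaustion_def SO classical.simps so_def by blast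
  next
    case SP
    then have "even d" by (simp add: d_def)
    note p = sw_pr[OF this]
    have "rot d i j u v = - (eps u * eps v * rot d i j (pr v) (pr u))" for u v
    proof (cases "v = sw d i j u")
      case True
      then have "rot d i j (pr v) (pr u) = - sg d i j u" using ij(3) by (simp add: rot_def p)
      then show ?thesis using True by (simp add: rot_def p mult.assoc)
    next
      case False
      then have "pr u \<noteq> sw d i j (pr v)" unfolding p by (metis pr_pr sw_commute[OF ij(3)])
      then show ?thesis using False by (simp add: rot_def)
    qed
    then show ?thesis
      using gl unfolding exhaustion_def SP classical.simps sp_eq_theta[OF even_nat_dim_SP] theta_def by blast
  qed
qed

definition supp_ge :: "nat => mat set" where
  "supp_ge d = {z. \<forall>u v. z u v \<noteq> 0 \<longrightarrow> d \<le> u \<and> d \<le> v}"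

lemma rot_supp_ge: "rot d i j \<in> supp_ge d"
  by (auto simp: rot_def sg_def sw_def supp_ge_def split: if_splits)

lemma lie_bracket_supp_ge:
  assumes z: "z \<in> supp_ge d" and x: "x \<in> gl d"
  shows "lie_bracket z x = 0"
proof (intro ext)
  fix u v
  have "mat_mult z x u v = 0" unfolding mat_mult_def
    by (rule sum.neutral) (use z x in \<open>fastforce simp: supp_ge_def gl_def\<close>)
  moreover have "mat_mult x z u v = 0" unfolding mat_mult_gl[OF x]
    by (rule sum.neutral) (use z in \<open>fastforce simp: supp_ge_def\<close>)
  ultimately show "lie_bracket z x u v = (0 :: mat) u v" by (simp add: lie_bracket_def)
qed

definition trunc :: "(nat => nat => bool) => mat => mat" where
  "trunc Q x = (\<lambda>u v. if Q u v then x u v else 0)"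

text \<open>The conditions on \<open>Q\<close> are what the defining equations ask for: invariance
  under transposition, in type SP also under \<open>pr\<close>, and in type SL an empty diagonal,
  which makes the trace vanish.\<close>

lemma trunc_exhaustion:
  assumes x: "x \<in> exhaustion s r n" and sym: "!!u v. Q v u = Q u v"
    and pr: "!!u v. s = SP ==> Q (pr u) (pr v) = Q u v" and diag: "!!u. s = SL ==> \<not> Q u u"
  shows "trunc Q x \<in> exhaustion s r n"
proof (cases s)
  case SL
  then show ?thesis using x diag by (auto simp: exhaustion_def sl_def trunc_def gl_def)
next
  case SO
  have x': "x \<in> gl (nat_dim s r n)" "!!i j. x j i = - x i j"
    using x unfolding SO exhaustion_def classical.simps so_def by blast+
  have "trunc Q x j i = - trunc Q x i j" for i j
    using x'(2)[where i = i and j = j] sym[of j i] by (cases "Q i j") (simp_all add: trunc_def)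
  moreover have "trunc Q x \<in> gl (nat_dim s r n)" using x'(1) by (auto simp: trunc_def gl_def)
  ultimately show ?thesis unfolding SO exhaustion_def classical.simps so_def by blast
next
  case SP
  have x': "x \<in> gl (nat_dim s r n)"
    "!!u v. u < nat_dim s r n ==> v < nat_dim s r n ==> x u v = - (eps u * eps v * x (pr v) (pr u))"
    using x unfolding SP exhaustion_def classical.simps sp_eq_theta[OF even_nat_dim_SP] theta_def by blast+
  have "trunc Q x u v = - (eps u * eps v * trunc Q x (pr v) (pr u))" if "u < nat_dim s r n" "v < nat_dim s r n" for u v
  proof (cases "Q u v")
    case True
    then have "Q (pr v) (pr u)" using pr[OF SP] sym by blast
    then show ?thesis using True x'(2)[OF that] unfolding trunc_def by (simp only: if_True)
  next
    case False
    then have "\<not> Q (pr v) (pr u)" using pr[OF SP] sym by blast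
    then show ?thesis using False by (simp add: trunc_def)
  qed
  moreover have "trunc Q x \<in> gl (nat_dim s r n)" using x'(1) by (auto simp: trunc_def gl_def)
  ultimately show ?thesis
    unfolding SP exhaustion_def classical.simps sp_eq_theta[OF even_nat_dim_SP] theta_def by blast
qed

lemma pr_block: "even d ==> pr u < d \<longleftrightarrow> u < d" "even d ==> (pr u - d) div 2 = (u - d) div 2"
proof -
  assume "even d"
  then obtain e where d: "d = 2 * e" by (elim evenE)
  obtain w where "u = 2 * w \<or> u = Suc (2 * w)" by (metis evenE oddE Suc_eq_plus1)
  then show "pr u < d \<longleftrightarrow> u < d" "(pr u - d) div 2 = (u - d) div 2"
    unfolding d pr_def by (elim disjE; simp; presburger)+
qed

text \<open>\<open>y\<close> joins the coordinates below \<open>d\<close> with block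
  \<open>j\<close>. One bracket carries it to block 0, hence into \<open>gl (d + 2)\<close>, and a
  second one carries it back, with a sign because a rotation squares to -1 on its blocks.\<close>

lemma block_part_double_bracket:
  fixes d nb j :: nat
  assumes y: "y \<in> gl (d + 2 * nb)" and j: "0 < j" "j < nb"
    and supp: "!!u v. y u v \<noteq> 0 ==> (u < d \<and> (v = d + 2 * j \<or> v = d + 2 * j + 1)) \<or>
      (v < d \<and> (u = d + 2 * j \<or> u = d + 2 * j + 1))"
  defines "z \<equiv> lie_bracket (rot d 0 j) y"
  shows "z \<in> gl (d + 2)" "lie_bracket (rot d 0 j) z = - y"
proof -
  have ij: "0 < nb" "j < nb" "0 \<noteq> j" using j by auto
  have zy: "z u v = sg d 0 j u * y (sw d 0 j u) v + sg d 0 j v * y u (sw d 0 j v)" for u v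
    unfolding z_def by (rule lie_bracket_rot[OF ij y])
  have sw_ge: "d \<le> sw d 0 j u" if "d \<le> u" for u using that by (auto simp: sw_def)
  have small: "u < d + 2" if "sg d 0 j u \<noteq> 0" "sw d 0 j u = d + 2 * j \<or> sw d 0 j u = d + 2 * j + 1" for u
    using that j by (auto simp: sg_def sw_def split: if_splits)
  have ge: "d \<le> u" if "sg d 0 j u \<noteq> 0" for u using that by (auto simp: sg_def split: if_splits)
  show z: "z \<in> gl (d + 2)"
    unfolding gl_def
  proof (intro CollectI allI impI)
    fix u v assume "z u v \<noteq> 0"
    then consider "sg d 0 j u \<noteq> 0" "y (sw d 0 j u) v \<noteq> 0" | "sg d 0 j v \<noteq> 0" "y u (sw d 0 j v) \<noteq> 0"
      unfolding zy by (metis add.right_neutral mult_zero_left mult_zero_right)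
    then show "u < d + 2 \<and> v < d + 2"
    proof cases
      case 1
      then show ?thesis using supp[OF 1(2)] small[OF 1(1)] ge[OF 1(1)] sw_ge[of u] by linarith
    next
      case 2
      then show ?thesis using supp[OF 2(2)] small[OF 2(1)] ge[OF 2(1)] sw_ge[of v] by linarith
    qed
  qed
  have zD: "z \<in> gl (d + 2 * nb)" using z gl_mono[of "d + 2" "d + 2 * nb"] j by auto
  show "lie_bracket (rot d 0 j) z = - y"
  proof (intro ext)
    fix u v
    have "lie_bracket (rot d 0 j) z u v = sg d 0 j u * z (sw d 0 j u) v + sg d 0 j v * z u (sw d 0 j v)"
      by (rule lie_bracket_rot[OF ij zD])
    \<comment> \<open>Where \<open>y u v\<close> is nonzero, exactly one of the two indices lies in
      block \<open>j\<close>, so the squares of the signs add up to 1. The mixed term would need an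
      entry of \<open>y\<close> with both indices at least \<open>d\<close>, and vanishes.\<close>
    also have "\<dots> = - (sg d 0 j u * sg d 0 j u + sg d 0 j v * sg d 0 j v) * y u v
        + 2 * (sg d 0 j u * sg d 0 j v * y (sw d 0 j u) (sw d 0 j v))"
      using ij(3) by (simp add: zy algebra_simps)
    also have "sg d 0 j u * sg d 0 j v * y (sw d 0 j u) (sw d 0 j v) = 0"
    proof (cases "sg d 0 j u = 0 \<or> sg d 0 j v = 0")
      case False
      then have "d \<le> sw d 0 j u" "d \<le> sw d 0 j v" using ge sw_ge by blast+
      then show ?thesis using supp[of "sw d 0 j u" "sw d 0 j v"] by fastforce
    qed auto
    also have "- (sg d 0 j u * sg d 0 j u + sg d 0 j v * sg d 0 j v) * y u v = - y u v"
    proof (cases "y u v = 0")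
      case False
      have "sg d 0 j w = 0" if "w < d" for w using that by (auto simp: sg_def)
      moreover have "sg d 0 j w * sg d 0 j w = 1" if "w = d + 2 * j \<or> w = d + 2 * j + 1" for w
        using that by (auto simp: sg_def)
      ultimately have "sg d 0 j u * sg d 0 j u + sg d 0 j v * sg d 0 j v = 1"
        using supp[OF False] by auto
      then show ?thesis by simp
    qed simp
    finally show "lie_bracket (rot d 0 j) z u v = (- y) u v" by simp
  qed
qed

text \<open>A matrix splits into its corner below \<open>d\<close>, its part from \<open>d\<close>
  on, and for each block a part that joins the block to the corner. For a block other than 0 the
  last kind comes from \<open>level s 1\<close> by one bracket with a rotation, by the double
  bracket formula; hence the base contains block 0 in addition to the first \<open>d\<close>
  coordinates.\<close>

lemma exhaustion_generated:
  fixes s r nb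
  defines "d \<equiv> nat_dim s r 1"
  assumes Q: "cmat.subspace Q" and base: "exhaustion s r (level s 1) \<subseteq> Q"
    and deep: "exhaustion s r (level s nb) \<inter> supp_ge d \<subseteq> Q"
    and step: "!!j q. 0 < j ==> j < nb ==> q \<in> Q ==> lie_bracket (rot d 0 j) q \<in> Q"
    and nb: "1 \<le> nb" and x: "x \<in> exhaustion s r (level s nb)"
  shows "x \<in> Q"
proof -
  let ?D = "d + 2 * nb"
  have dims: "nat_dim s r (level s nb) = ?D" "nat_dim s r (level s 1) = d + 2"
    unfolding nat_dim_level d_def by simp_all
  have lev: "level s 1 \<le> level s nb" using level_mono nb by blast
  have low: "z \<in> Q" if "z \<in> exhaustion s r (level s nb)" "z \<in> gl (d + 2)" for z
    using that base exhaustion_Int_gl[OF lev, of s r] unfolding dims by blast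
  have evd: "even d" if "s = SP" using that by (simp add: d_def)
  have xgl: "x \<in> gl ?D" using x exhaustion_gl dims(1) by (metis subsetD)
  define B where "B j u v \<longleftrightarrow> (u < d \<and> d \<le> v \<and> (v - d) div 2 = j) \<or> (v < d \<and> d \<le> u \<and> (u - d) div 2 = j)" for j u v
  define y where "y j = trunc (B j) x" for j
  have yG: "y j \<in> exhaustion s r (level s nb)" for j
    unfolding y_def
  proof (rule trunc_exhaustion[OF x])
    show "B j (pr u) (pr v) = B j u v" if "s = SP" for u v
      using pr_block[OF evd[OF that]] by (simp add: B_def not_less[symmetric])
  qed (auto simp: B_def)
  have yQ: "y j \<in> Q" if j: "j < nb" for j
  proof (cases "j = 0")
    case True
    have "y j \<in> gl (d + 2)" using True by (auto simp: y_def trunc_def B_def gl_def)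
    then show ?thesis using low yG by blast
  next
    case False
    have ygl: "y j \<in> gl ?D" using yG exhaustion_gl dims(1) by (metis subsetD)
    have supp: "(u < d \<and> (v = d + 2 * j \<or> v = d + 2 * j + 1)) \<or> (v < d \<and> (u = d + 2 * j \<or> u = d + 2 * j + 1))"
      if "y j u v \<noteq> 0" for u v
    proof -
      have "B j u v" using that by (auto simp: y_def trunc_def split: if_splits)
      then show ?thesis unfolding B_def by auto
    qed
    have j0: "0 < j" using False by simp
    note db = block_part_double_bracket[OF ygl j0 j supp]
    have "lie_bracket (rot d 0 j) (y j) \<in> exhaustion s r (level s nb)"
      using rot_exhaustion[of 0 nb j s r] j j0 yG by (intro lie_bracket_exhaustion) (auto simp: d_def)
    then have "lie_bracket (rot d 0 j) (y j) \<in> Q" using low db(1) by blast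
    then have "- y j \<in> Q" using step[OF j0 j] db(2) by metis
    then show ?thesis using cmat.subspace_neg[OF Q] by fastforce
  qed
  define c0 where "c0 = trunc (\<lambda>u v. u < d \<and> v < d) x"
  define c1 where "c1 = trunc (\<lambda>u v. d \<le> u \<and> d \<le> v) x"
  have decomp: "x = c0 + c1 + (\<Sum>j<nb. y j)"
  proof (intro ext)
    fix u v
    have app: "(\<Sum>j<m. y j) u v = (\<Sum>j<m. y j u v)" for m by (induction m) auto
    show "x u v = (c0 + c1 + (\<Sum>j<nb. y j)) u v"
    proof (cases "(u < d \<and> d \<le> v) \<or> (v < d \<and> d \<le> u)")
      case False
      then have "y j u v = 0" for j by (auto simp: y_def trunc_def B_def)
      then show ?thesis using False by (auto simp: app c0_def c1_def trunc_def)
    next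
      case True
      define j0 where "j0 = (if u < d then (v - d) div 2 else (u - d) div 2)"
      have "y j u v = (if j = j0 then x u v else 0)" for j
        using True by (auto simp: y_def trunc_def B_def j0_def)
      moreover have "x u v = 0" if "\<not> j0 < nb"
      proof -
        have "\<not> (u < ?D \<and> v < ?D)" using that True by (auto simp: j0_def split: if_splits)
        then show ?thesis using xgl unfolding gl_def by blast
      qed
      ultimately show ?thesis using True by (auto simp: app c0_def c1_def trunc_def)
    qed
  qed
  have "c0 + c1 \<in> Q"
  proof (cases "s = SL")
    case False
    have "c0 \<in> exhaustion s r (level s nb)" unfolding c0_def
    proof (rule trunc_exhaustion[OF x])
      show "(pr u < d \<and> pr v < d) = (u < d \<and> v < d)" if "s = SP" for u v
        using pr_block[OF evd[OF that]] by simp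
    qed (use False in auto)
    moreover have "c0 \<in> gl (d + 2)" by (auto simp: c0_def trunc_def gl_def)
    moreover have "c1 \<in> exhaustion s r (level s nb)" unfolding c1_def
    proof (rule trunc_exhaustion[OF x])
      show "(d \<le> pr u \<and> d \<le> pr v) = (d \<le> u \<and> d \<le> v)" if "s = SP" for u v
        using pr_block[OF evd[OF that]] by (simp add: not_less[symmetric])
    qed (use False in auto)
    moreover have "c1 \<in> supp_ge d" by (auto simp: c1_def trunc_def supp_ge_def)
    ultimately show ?thesis using low deep cmat.subspace_add[OF Q] by blast
  next
    case True
    define t where "t = (\<Sum>u<?D. c0 u u)"
    \<comment> \<open>In type SL the two diagonal parts need not be traceless separately. The matrix
      unit at coordinate \<open>d\<close> belongs to \<open>gl (d + 2)\<close> and to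
      \<open>supp_ge d\<close>, so it can shift the trace from one part to the other.\<close>
    define E :: mat where "E = (\<lambda>u v. if u = d \<and> v = d then t else 0)"
    have Etr: "(\<Sum>u<?D. E u u) = t" using nb by (simp add: E_def)
    have Egl: "E \<in> gl ?D" "E \<in> gl (d + 2)" "E \<in> supp_ge d" using nb by (auto simp: E_def gl_def supp_ge_def)
    have c0gl: "c0 \<in> gl ?D" "c0 \<in> gl (d + 2)" using xgl by (auto simp: c0_def trunc_def gl_def)
    have c1gl: "c1 \<in> gl ?D" "c1 \<in> supp_ge d" using xgl by (auto simp: c1_def trunc_def gl_def supp_ge_def)
    have y0: "(\<Sum>j<m. y j) u u = 0" for m u
      by (induction m) (auto simp: y_def trunc_def B_def)
    have "(\<Sum>u<?D. x u u) = 0" using x True dims(1) by (simp add: exhaustion_def sl_def)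
    moreover have "x u u = c0 u u + c1 u u" for u
      by (subst decomp) (simp add: y0)
    ultimately have tr: "(\<Sum>u<?D. c1 u u) = - t" by (simp add: t_def sum.distrib eq_neg_iff_add_eq_0 add.commute)
    have "c0 - E \<in> exhaustion s r (level s nb)"
      using True dims(1) cmat.subspace_diff[OF subspace_gl c0gl(1) Egl(1)] Etr
      by (simp add: exhaustion_def sl_def sum_subtractf t_def)
    moreover have "c0 - E \<in> gl (d + 2)" by (rule cmat.subspace_diff[OF subspace_gl c0gl(2) Egl(2)])
    moreover have "c1 + E \<in> exhaustion s r (level s nb)"
      using True dims(1) cmat.subspace_add[OF subspace_gl c1gl(1) Egl(1)] Etr tr
      by (simp add: exhaustion_def sl_def sum.distrib)
    moreover have "c1 + E \<in> supp_ge d"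
      using c1gl(2) Egl(3) unfolding supp_ge_def by (auto simp: E_def split: if_splits)
    ultimately have "c0 - E \<in> Q" "c1 + E \<in> Q" using low deep by blast+
    then have "(c0 - E) + (c1 + E) \<in> Q" by (rule cmat.subspace_add[OF Q])
    then show ?thesis by (simp add: algebra_simps)
  qed
  moreover have "(\<Sum>j<nb. y j) \<in> Q" using yQ by (intro cmat.subspace_sum[OF Q]) auto
  ultimately show ?thesis using decomp cmat.subspace_add[OF Q] by metis
qed

section \<open>The adjoint module as an image of words of length two\<close>

lemma ad_rep_simps [simp]:
  "carrier (ad_rep L) = L" "\<zero>\<^bsub>ad_rep L\<^esub> = 0" "x \<oplus>\<^bsub>ad_rep L\<^esub> y = x + y" "c \<odot>\<^bsub>ad_rep L\<^esub> x = mat_scale c x"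
  "act (ad_rep L) x = lie_bracket x"
  by (simp_all add: ad_rep_def)

lemma module_ad_rep:
  assumes "cmat.subspace L"
  shows "module \<complex> (ad_rep L)"
  by (rule module_direct)
    (use assms in \<open>auto simp: cmat.subspace_add cmat.subspace_0 cmat.subspace_scale fun_eq_iff algebra_simps\<close>)

lemma submodule_ad_rep_iff:
  assumes "cmat.subspace L"
  shows "submodule N \<complex> (ad_rep L) \<longleftrightarrow> cmat.subspace N \<and> N \<subseteq> L"
proof -
  interpret M: cmodule "ad_rep L" using module_ad_rep[OF assms] by (simp add: cmodule_iff)
  show ?thesis by (auto simp: M.submodule_iff cmat.subspace_def)
qed

text \<open>A matrix is a function of two coordinates. The second one transforms by the dual, but
  for a skew matrix this is the natural action again, so the bracket with a rotation is
  \<open>wact\<close> on words of length 2 with label 0.\<close>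

lemma word_map_gl:
  assumes "1 \<le> c"
  shows "word_map d nb c 2 (ad_rep (gl (d + 2 * nb))) (\<lambda>f u v. f [(0, u), (0, v)])"
    and "word_im d nb c 2 (\<lambda>f u v. f [(0, u), (0, v)]) = gl (d + 2 * nb)"
proof -
  let ?D = "d + 2 * nb"
  let ?\<Phi> = "\<lambda>f u v. f [(0 :: nat, u :: nat), (0, v)] :: complex"
  have w: "[(0, u), (0, v)] \<in> words c ?D 2 \<longleftrightarrow> u < ?D \<and> v < ?D" for u v
    using assms by (auto simp: words_def)
  have im: "?\<Phi> f \<in> gl ?D" if "f \<in> cspace (words c ?D 2)" for f
  proof -
    have "f [(0, u), (0, v)] = 0" if "\<not> (u < ?D \<and> v < ?D)" for u v
      using \<open>f \<in> _\<close> that w unfolding cspace_def by blast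
    then show ?thesis unfolding gl_def by blast
  qed
  show "word_map d nb c 2 (ad_rep (gl ?D)) ?\<Phi>"
    unfolding word_map_def
  proof (intro conjI allI impI ballI)
    show "cmap (words c ?D 2) (ad_rep (gl ?D)) ?\<Phi>"
      unfolding cmap_def using im by (auto simp: fun_eq_iff)
    fix i j f assume ij: "i < nb" "j < nb" "i \<noteq> j" and f: "f \<in> cspace (words c ?D 2)"
    show "act (ad_rep (gl ?D)) (rot d i j) (?\<Phi> f) = ?\<Phi> (wact d i j f)"
      unfolding ad_rep_simps
    proof (intro ext)
      fix u v
      show "lie_bracket (rot d i j) (?\<Phi> f) u v = wact d i j f [(0, u), (0, v)]"
        unfolding lie_bracket_rot[OF ij im[OF f]]
        by (simp add: wact_def wsg_def wsw_def numeral_2_eq_2)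
    qed
  qed
  show "word_im d nb c 2 ?\<Phi> = gl ?D"
  proof
    show "word_im d nb c 2 ?\<Phi> \<subseteq> gl ?D" using im by (auto simp: word_im_def)
    show "gl ?D \<subseteq> word_im d nb c 2 ?\<Phi>"
    proof
      fix A assume A: "A \<in> gl ?D"
      define f where "f w = (if w \<in> words c ?D 2 then A (snd (w ! 0)) (snd (w ! 1)) else 0)" for w :: word
      have "f \<in> cspace (words c ?D 2)" by (simp add: cspace_def f_def)
      moreover have "?\<Phi> f = A"
      proof (intro ext)
        fix u v
        have "A u v = 0" if "\<not> (u < ?D \<and> v < ?D)" using A that unfolding gl_def by blast
        then show "?\<Phi> f u v = A u v" unfolding f_def w by auto
      qed
      ultimately show "A \<in> word_im d nb c 2 ?\<Phi>" unfolding word_im_def by blast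
    qed
  qed
qed

text \<open>The classical algebra is a rotation-stable subspace of \<open>gl\<close>, and
  \<open>word_map_submodule\<close> makes it an image in its own right.\<close>

lemma word_map_exhaustion:
  fixes s r c nb
  defines "d \<equiv> nat_dim s r 1"
  assumes c: "1 \<le> c"
  shows "\<exists>\<Psi>. word_map d nb c 2 (ad_rep (gl (d + 2 * nb))) \<Psi> \<and> word_im d nb c 2 \<Psi> = exhaustion s r (level s nb)"
proof (rule word_map_submodule[OF _ word_map_gl(1)[OF c]])
  have dims: "nat_dim s r (level s nb) = d + 2 * nb" unfolding nat_dim_level d_def by simp
  have gl: "exhaustion s r (level s nb) \<subseteq> gl (d + 2 * nb)" using exhaustion_gl[of s r "level s nb"] dims by simp
  show "cmodule (ad_rep (gl (d + 2 * nb)))" using module_ad_rep[OF subspace_gl] by (simp add: cmodule_iff)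
  show "submodule (exhaustion s r (level s nb)) \<complex> (ad_rep (gl (d + 2 * nb)))"
    unfolding submodule_ad_rep_iff[OF subspace_gl] using subspace_exhaustion gl by blast
  show "exhaustion s r (level s nb) \<subseteq> word_im d nb c 2 (\<lambda>f u v. f [(0, u), (0, v)])"
    using word_map_gl(2)[OF c] gl by simp
  show "act (ad_rep (gl (d + 2 * nb))) (rot d i j) v \<in> exhaustion s r (level s nb)"
    if "i < nb" "j < nb" "i \<noteq> j" "v \<in> exhaustion s r (level s nb)" for i j v
    unfolding ad_rep_simps d_def using that by (intro lie_bracket_exhaustion rot_exhaustion)
qed

section \<open>Free modules and tensor powers\<close>

abbreviation single :: "'x => 'y => ('x \<Rightarrow>\<^sub>0 'y::zero)" where
  "single \<equiv> Poly_Mapping.single"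

abbreviation keys :: "('x \<Rightarrow>\<^sub>0 'y::zero) => 'x set" where
  "keys \<equiv> Poly_Mapping.keys"

abbreviation lookup :: "('x \<Rightarrow>\<^sub>0 'y::zero) => 'x => 'y" where
  "lookup \<equiv> Poly_Mapping.lookup"

lemma lookup_pm_scale [simp]: "lookup (pm_scale c f) w = c * lookup f w"
  by (simp add: pm_scale_def Poly_Mapping.map.rep_eq when_def)

lemma pm_scale_simps [simp]:
  "pm_scale c (single w a) = single w (c * a)"
  "pm_scale 1 f = f" "pm_scale 0 f = 0" "pm_scale c 0 = 0" "pm_scale c (pm_scale a f) = pm_scale (c * a) f"
  by (simp_all add: poly_mapping_eq_iff fun_eq_iff lookup_single when_def)

lemma pm_scale_linear:
  "pm_scale c (f + g) = pm_scale c f + pm_scale c g" "pm_scale (a + b) f = pm_scale a f + pm_scale b f"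
  "pm_scale c (f - g) = pm_scale c f - pm_scale c g" "pm_scale (- 1) f = - f"
  by (simp_all add: poly_mapping_eq_iff fun_eq_iff lookup_add lookup_minus algebra_simps)

lemma pm_scale_sum: "pm_scale c (\<Sum>i\<in>I. f i) = (\<Sum>i\<in>I. pm_scale c (f i))"
  by (induction I rule: infinite_finite_induct) (simp_all add: pm_scale_linear)

lemma keys_pm_scale: "keys (pm_scale c f) \<subseteq> keys f"
  by (auto simp: in_keys_iff)

definition lin_ext :: "('x => ('y \<Rightarrow>\<^sub>0 complex)) => ('x \<Rightarrow>\<^sub>0 complex) => ('y \<Rightarrow>\<^sub>0 complex)" where
  "lin_ext \<psi> f = (\<Sum>w\<in>keys f. pm_scale (lookup f w) (\<psi> w))"

lemma lin_ext_superset: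
  "finite A ==> keys f \<subseteq> A ==> lin_ext \<psi> f = (\<Sum>w\<in>A. pm_scale (lookup f w) (\<psi> w))"
  unfolding lin_ext_def by (rule sum.mono_neutral_left) (auto simp: in_keys_iff)

lemma lin_ext_simps:
  "lin_ext \<psi> (f + g) = lin_ext \<psi> f + lin_ext \<psi> g" "lin_ext \<psi> (pm_scale c f) = pm_scale c (lin_ext \<psi> f)"
  "lin_ext \<psi> (single w c) = pm_scale c (\<psi> w)" "lin_ext \<psi> 0 = 0" "lin_ext \<psi> (f - g) = lin_ext \<psi> f - lin_ext \<psi> g"
proof -
  have add: "lin_ext \<psi> (f + g) = lin_ext \<psi> f + lin_ext \<psi> g" for f g
  proof -
    let ?A = "keys f \<union> keys g"
    have "keys (f + g) \<subseteq> ?A" by (rule Poly_Mapping.keys_add)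
    then show ?thesis
      by (simp add: lin_ext_superset[of ?A] lookup_add pm_scale_linear sum.distrib)
  qed
  have scale: "lin_ext \<psi> (pm_scale c f) = pm_scale c (lin_ext \<psi> f)" for c f
    by (simp add: lin_ext_superset[of "keys f" "pm_scale c f"] keys_pm_scale)
      (simp add: lin_ext_def pm_scale_sum)
  show "lin_ext \<psi> (f + g) = lin_ext \<psi> f + lin_ext \<psi> g" "lin_ext \<psi> (pm_scale c f) = pm_scale c (lin_ext \<psi> f)"
    by (rule add, rule scale)
  show "lin_ext \<psi> (single w c) = pm_scale c (\<psi> w)"
    by (subst lin_ext_superset[of "{w}"]) auto
  show "lin_ext \<psi> 0 = 0" by (simp add: lin_ext_def)
  show "lin_ext \<psi> (f - g) = lin_ext \<psi> f - lin_ext \<psi> g"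
  proof -
    have "lin_ext \<psi> (- g) = - lin_ext \<psi> g" using scale[of "- 1" g] by (simp only: pm_scale_linear(4))
    then show ?thesis using add[of f "- g"] by simp
  qed
qed

lemma free_rep_simps [simp]:
  "carrier (free_rep Y \<phi>) = {f. keys f \<subseteq> Y}" "\<zero>\<^bsub>free_rep Y \<phi>\<^esub> = 0"
  "f \<oplus>\<^bsub>free_rep Y \<phi>\<^esub> g = f + g" "c \<odot>\<^bsub>free_rep Y \<phi>\<^esub> f = pm_scale c f"
  "act (free_rep Y \<phi>) x = lin_ext (\<phi> x)"
  by (simp_all add: free_rep_def lin_ext_def fun_eq_iff)

lemma keys_add_subset: "keys f \<subseteq> Y ==> keys g \<subseteq> Y ==> keys (f + g) \<subseteq> Y"
  using Poly_Mapping.keys_add[of f g] by blast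

lemma keys_scale_subset: "keys f \<subseteq> Y ==> keys (pm_scale c f) \<subseteq> Y"
  using keys_pm_scale[of c f] by blast

lemma module_free_rep: "module \<complex> (free_rep Y \<phi>)"
  by (rule module_direct)
    (auto simp: keys_add_subset keys_scale_subset pm_scale_linear add_ac)

lemma cmodule_free_rep: "cmodule (free_rep Y \<phi>)"
  using module_free_rep by (simp add: cmodule_iff)

lemma keys_lin_ext:
  assumes "!!w. w \<in> Y ==> keys (\<psi> w) \<subseteq> Z" "keys f \<subseteq> Y"
  shows "keys (lin_ext \<psi> f) \<subseteq> Z"
proof -
  have "keys (\<Sum>w\<in>A. pm_scale (lookup f w) (\<psi> w)) \<subseteq> Z" if "finite A" "A \<subseteq> Y" for A
    using that by (induction A rule: finite_induct) (simp_all add: keys_add_subset keys_scale_subset assms(1))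
  then show ?thesis unfolding lin_ext_def using assms(2) by simp
qed

lemma act_linear_free_rep:
  assumes "!!w. w \<in> Y ==> keys (\<phi> x w) \<subseteq> Y"
  shows "act_linear (free_rep Y \<phi>) x"
  unfolding act_linear_def lin_map_def using keys_lin_ext[where \<psi> = "\<phi> x" and Y = Y and Z = Y, OF assms] by (auto simp: lin_ext_simps)

lemma minus_free_rep:
  assumes "keys f \<subseteq> Y" "keys g \<subseteq> Y"
  shows "f \<ominus>\<^bsub>free_rep Y \<phi>\<^esub> g = f - g"
proof -
  interpret cmodule "free_rep Y \<phi>" by (rule cmodule_free_rep)
  show ?thesis using assms by (simp add: diff_eq_scale pm_scale_linear)
qed

lemma submodule_free_rep_iff:
  "submodule S \<complex> (free_rep Y \<phi>) \<longleftrightarrow> (\<forall>f\<in>S. keys f \<subseteq> Y) \<and> 0 \<in> S \<and>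
     (\<forall>f\<in>S. \<forall>g\<in>S. f + g \<in> S) \<and> (\<forall>c. \<forall>f\<in>S. pm_scale c f \<in> S)"
proof -
  interpret cmodule "free_rep Y \<phi>" by (rule cmodule_free_rep)
  show ?thesis by (auto simp: submodule_iff)
qed

lemma submodule_free_rep_sum:
  assumes "submodule S \<complex> (free_rep Y \<phi>)" "!!i. i \<in> I ==> f i \<in> S"
  shows "(\<Sum>i\<in>I. f i) \<in> S"
  using assms(2) assms(1)[unfolded submodule_free_rep_iff]
  by (induction I rule: infinite_finite_induct) auto

lemma free_rep_spanned:
  assumes S: "submodule S \<complex> (free_rep Y \<phi>)" and "!!w. w \<in> Y ==> single w 1 \<in> S"
    and f: "keys f \<subseteq> Y"
  shows "f \<in> S"
proof -
  have "lin_ext (\<lambda>w. single w 1) f = f"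
  proof -
    have "lookup (\<Sum>w\<in>A. pm_scale (lookup f w) (single w 1)) v
        = (\<Sum>w\<in>A. lookup f w when w = v)" for A v
      by (induction A rule: infinite_finite_induct) (simp_all add: lookup_add lookup_single)
    then show ?thesis
      by (simp add: poly_mapping_eq_iff fun_eq_iff lin_ext_def when_def in_keys_iff)
  qed
  moreover have "lin_ext (\<lambda>w. single w 1) f \<in> S"
    unfolding lin_ext_def
    by (rule submodule_free_rep_sum[OF S]) (use assms S[unfolded submodule_free_rep_iff] in blast)
  ultimately show ?thesis by simp
qed

context cmodule
begin

lemma submodule_Inter: "(!!N. N \<in> \<N> ==> submodule N \<complex> M) ==> \<N> \<noteq> {} ==> submodule (\<Inter>\<N>) \<complex> M"
  unfolding submodule_iff by blast

end

lemma submodule_lin_span: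
  fixes M :: "'v rep"
  assumes "cmodule M" "S \<subseteq> carrier M"
  shows "submodule (lin_span M S) \<complex> M"
proof -
  interpret cmodule M by fact
  show ?thesis unfolding lin_span_def
    by (rule submodule_Inter) (use assms(2) carrier_submodule in auto)
qed

lemma lin_span_superset: "S \<subseteq> lin_span M S"
  unfolding lin_span_def by blast

lemma lin_span_minimal: "submodule N \<complex> M ==> S \<subseteq> N ==> lin_span M S \<subseteq> N"
  unfolding lin_span_def by blast

lemma lin_span_invariant:
  fixes M :: "'v rep"
  assumes M: "cmodule M" and S: "S \<subseteq> carrier M" and T: "lin_map M M T"
    and im: "!!v. v \<in> S ==> T v \<in> lin_span M S" and v: "v \<in> lin_span M S"
  shows "T v \<in> lin_span M S"
proof -
  interpret cmodule M by fact
  have "lin_span M S \<subseteq> {v \<in> carrier M. T v \<in> lin_span M S}"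
    by (rule lin_span_minimal[OF submodule_vimage[OF M T submodule_lin_span[OF M S]]]) (use S im in auto)
  then show ?thesis using v by blast
qed

text \<open>Generation in the form of an induction principle: a property that defines a submodule
  has to be checked on \<open>B\<close> only.\<close>

definition spanned :: "'v rep => 'v set => bool" where
  "spanned M B \<longleftrightarrow> (\<forall>S. submodule S \<complex> M \<longrightarrow> B \<subseteq> S \<longrightarrow> carrier M \<subseteq> S)"

section \<open>Tensor powers by generators and relations\<close>

locale tensor = W: cmodule W for W :: "'v rep" +
  fixes K :: nat
begin

abbreviation F where "F \<equiv> tuples_rep K W"
abbreviation R where "R \<equiv> lin_span F (tensor_rels K W)"

definition tup :: "'v list set" where "tup = {ws. length ws = K \<and> set ws \<subseteq> carrier W}"

definition leib :: "mat => 'v list => ('v list \<Rightarrow>\<^sub>0 complex)" where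
  "leib x ws = (\<Sum>i<K. single (ws[i := act W x (ws ! i)]) 1)"

lemma F_eq: "F = free_rep tup leib"
  unfolding tuples_rep_def tup_def leib_def ..

lemma tup_update: "ws \<in> tup ==> u \<in> carrier W ==> ws[i := u] \<in> tup"
  unfolding tup_def using set_update_subsetI[of ws "carrier W" u i] by simp

lemma tup_nth: "ws \<in> tup ==> i < K ==> ws ! i \<in> carrier W"
  unfolding tup_def using nth_mem by blast

lemma tup_length: "ws \<in> tup ==> length ws = K"
  by (simp add: tup_def)

lemma keys_diff_subset: "keys f \<subseteq> Y ==> keys g \<subseteq> Y ==> keys (f - g) \<subseteq> Y"
  for f g :: "'x \<Rightarrow>\<^sub>0 complex"
  using Poly_Mapping.keys_diff[of f g] by blast

lemma tensor_rels_subset: "tensor_rels K W \<subseteq> carrier F"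
proof
  have k: "keys (single ws c) \<subseteq> tup" if "ws \<in> tup" for ws and c :: complex
    using that by simp
  fix g assume "g \<in> tensor_rels K W"
  then consider
    (add) ws i u v where "ws \<in> tup" "i < K" "u \<in> carrier W" "v \<in> carrier W"
      "g = single (ws[i := u \<oplus>\<^bsub>W\<^esub> v]) 1 - single (ws[i := u]) 1 - single (ws[i := v]) 1"
  | (scale) ws i c u where "ws \<in> tup" "i < K" "u \<in> carrier W"
      "g = single (ws[i := c \<odot>\<^bsub>W\<^esub> u]) 1 - single (ws[i := u]) c"
    unfolding tensor_rels_def tup_def by blast
  then show "g \<in> carrier F"
    by cases (simp_all only: F_eq free_rep_simps mem_Collect_eq keys_diff_subset k tup_update W.add.m_closed W.scale_closed)
qed

lemma R_submodule: "submodule R \<complex> F"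
  by (rule submodule_lin_span[OF _ tensor_rels_subset]) (simp add: F_eq cmodule_free_rep)

sublocale Q: quot F R
  by (simp add: quot_def quot_axioms_def R_submodule) (simp add: F_eq cmodule_free_rep)

lemma tensor_power_eq: "tensor_power K W = quot_rep F R"
  by (simp add: tensor_power_def)

definition tcl :: "('v list \<Rightarrow>\<^sub>0 complex) => ('v list \<Rightarrow>\<^sub>0 complex) set" where
  "tcl = qcl F R"

lemma cmodule_T: "cmodule (tensor_power K W)"
  unfolding tensor_power_eq cmodule_iff by (rule Q.module_quot)

lemma lin_map_tcl: "lin_map F (tensor_power K W) tcl"
  unfolding tensor_power_eq tcl_def by (rule Q.lin_map_qcl)

lemma single_in_F: "ws \<in> tup ==> single ws c \<in> carrier F"
  by (auto simp: F_eq split: if_splits)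

lemma tcl_eqI: "f \<in> carrier F ==> g \<in> carrier F ==> f - g \<in> R ==> tcl f = tcl g"
  unfolding tcl_def using Q.qcl_eq_iff[of f g] by (simp add: F_eq minus_free_rep)

lemma F_add: "f \<in> carrier F ==> g \<in> carrier F ==> f + g \<in> carrier F"
  by (simp add: F_eq keys_add_subset)

lemma rel_add:
  assumes "ws \<in> tup" "i < K" "u \<in> carrier W" "v \<in> carrier W"
  shows "single (ws[i := u \<oplus>\<^bsub>W\<^esub> v]) 1
        - single (ws[i := u]) 1 - single (ws[i := v]) 1 \<in> R"
  using assms by (intro subsetD[OF lin_span_superset]) (unfold tensor_rels_def tup_def, blast)

lemma rel_scale:
  assumes "ws \<in> tup" "i < K" "u \<in> carrier W"
  shows "single (ws[i := c \<odot>\<^bsub>W\<^esub> u]) 1 - single (ws[i := u]) c \<in> R"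
  using assms by (intro subsetD[OF lin_span_superset]) (unfold tensor_rels_def tup_def, blast)

lemma tcl_add:
  assumes "ws \<in> tup" "i < K" "u \<in> carrier W" "v \<in> carrier W"
  shows "tcl (single (ws[i := u \<oplus>\<^bsub>W\<^esub> v]) 1)
    = tcl (single (ws[i := u]) 1) \<oplus>\<^bsub>tensor_power K W\<^esub> tcl (single (ws[i := v]) 1)"
proof -
  have c: "single (ws[i := w]) 1 \<in> carrier F" if "w \<in> carrier W" for w
    by (rule single_in_F[OF tup_update[OF assms(1) that]])
  have "tcl (single (ws[i := u \<oplus>\<^bsub>W\<^esub> v]) 1)
      = tcl (single (ws[i := u]) 1 + single (ws[i := v]) 1)"
    using rel_add[OF assms] assms(3,4)
    by (intro tcl_eqI F_add c) (simp_all add: diff_diff_eq)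
  then show ?thesis using lin_map_add[OF lin_map_tcl c[OF assms(3)] c[OF assms(4)]] by (simp add: F_eq)
qed

lemma tcl_scale:
  assumes "ws \<in> tup" "i < K" "u \<in> carrier W"
  shows "tcl (single (ws[i := c \<odot>\<^bsub>W\<^esub> u]) 1) = c \<odot>\<^bsub>tensor_power K W\<^esub> tcl (single (ws[i := u]) 1)"
proof -
  have k: "single (ws[i := w]) a \<in> carrier F" if "w \<in> carrier W" for w a
    by (rule single_in_F[OF tup_update[OF assms(1) that]])
  have "tcl (single (ws[i := c \<odot>\<^bsub>W\<^esub> u]) 1) = tcl (single (ws[i := u]) c)"
    using rel_scale[OF assms] k assms(3) by (intro tcl_eqI) auto
  then show ?thesis using lin_map_scale[OF lin_map_tcl k[OF assms(3), of 1], of c] by (simp add: F_eq)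
qed

lemma leib_in_F:
  assumes x: "act_linear W x" and ws: "ws \<in> tup"
  shows "leib x ws \<in> carrier F"
proof -
  have "act W x (ws ! i) \<in> carrier W" if "i < K" for i
    using x lin_map_closed tup_nth[OF ws that] unfolding act_linear_def by metis
  then show ?thesis unfolding leib_def
    using tup_update[OF ws] by (intro submodule_free_rep_sum[of _ tup leib])
      (auto simp: F_eq submodule_free_rep_iff keys_add_subset keys_scale_subset split: if_splits)
qed

lemma act_linear_F: "act_linear W x ==> act_linear F x"
  using leib_in_F unfolding F_eq by (intro act_linear_free_rep) auto

lemma act_F_single: "act F x (single ws c) = pm_scale c (leib x ws)"
  by (simp add: F_eq lin_ext_simps)

lemma R_sum: "(!!i. i \<in> I ==> f i \<in> R) ==> (\<Sum>i\<in>I. f i) \<in> R"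
  using submodule_free_rep_sum[of R tup leib I f] R_submodule by (simp add: F_eq)

text \<open>By the Leibniz rule a relation at position \<open>i\<close> goes to a sum over positions
  \<open>j\<close>: for \<open>j = i\<close> it is a relation between the images under
  \<open>x\<close>, for the others the same relation with entry \<open>j\<close> changed.\<close>

lemma act_R:
  assumes x: "act_linear W x" and f: "f \<in> R"
  shows "act F x f \<in> R"
proof (rule lin_span_invariant[OF _ tensor_rels_subset _ _ f])
  have lx: "lin_map W W (act W x)" using x by (simp add: act_linear_def)
  note xc = lin_map_closed[OF lx]
  show "cmodule F" by (simp add: F_eq cmodule_free_rep)
  show "lin_map F F (act F x)" using act_linear_F[OF x] by (simp add: act_linear_def)
  fix g assume "g \<in> tensor_rels K W"
  then consider
    (add) ws i u v where "ws \<in> tup" "i < K" "u \<in> carrier W" "v \<in> carrier W"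
      "g = single (ws[i := u \<oplus>\<^bsub>W\<^esub> v]) 1 - single (ws[i := u]) 1 - single (ws[i := v]) 1"
  | (scale) ws i c u where "ws \<in> tup" "i < K" "u \<in> carrier W"
      "g = single (ws[i := c \<odot>\<^bsub>W\<^esub> u]) 1 - single (ws[i := u]) c"
    unfolding tensor_rels_def tup_def by blast
  then show "act F x g \<in> R"
  proof cases
    case add
    have "act F x g = leib x (ws[i := u \<oplus>\<^bsub>W\<^esub> v]) - leib x (ws[i := u]) - leib x (ws[i := v])"
      unfolding add(5) by (simp add: F_eq lin_ext_simps)
    also have "\<dots> = (\<Sum>j<K. single ((ws[i := u \<oplus>\<^bsub>W\<^esub> v])[j := act W x (ws[i := u \<oplus>\<^bsub>W\<^esub> v] ! j)]) 1
        - single ((ws[i := u])[j := act W x (ws[i := u] ! j)]) 1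
        - single ((ws[i := v])[j := act W x (ws[i := v] ! j)]) 1)"
      by (simp add: leib_def sum_subtractf)
    also have "\<dots> \<in> R"
    proof (rule R_sum)
      fix j assume j: "j \<in> {..<K}"
      show "single ((ws[i := u \<oplus>\<^bsub>W\<^esub> v])[j := act W x (ws[i := u \<oplus>\<^bsub>W\<^esub> v] ! j)]) 1
        - single ((ws[i := u])[j := act W x (ws[i := u] ! j)]) 1
        - single ((ws[i := v])[j := act W x (ws[i := v] ! j)]) 1 \<in> R"
      proof (cases "j = i")
        case True
        then show ?thesis
          using rel_add[OF add(1,2) xc[OF add(3)] xc[OF add(4)]] add(1-4) by (simp add: tup_length lin_map_add[OF lx])
      next
        case False
        have "ws[j := act W x (ws ! j)] \<in> tup" using j by (intro tup_update[OF add(1)] xc tup_nth[OF add(1)]) auto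
        from rel_add[OF this add(2-4)] show ?thesis using False by (simp add: list_update_swap[of j i])
      qed
    qed
    finally show ?thesis .
  next
    case scale
    have "act F x g = leib x (ws[i := c \<odot>\<^bsub>W\<^esub> u]) - pm_scale c (leib x (ws[i := u]))"
      unfolding scale(4) by (simp add: F_eq lin_ext_simps)
    also have "\<dots> = (\<Sum>j<K. single ((ws[i := c \<odot>\<^bsub>W\<^esub> u])[j := act W x (ws[i := c \<odot>\<^bsub>W\<^esub> u] ! j)]) 1
        - single ((ws[i := u])[j := act W x (ws[i := u] ! j)]) c)"
      by (simp add: leib_def sum_subtractf pm_scale_sum)
    also have "\<dots> \<in> R"
    proof (rule R_sum)
      fix j assume j: "j \<in> {..<K}"
      show "single ((ws[i := c \<odot>\<^bsub>W\<^esub> u])[j := act W x (ws[i := c \<odot>\<^bsub>W\<^esub> u] ! j)]) 1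
        - single ((ws[i := u])[j := act W x (ws[i := u] ! j)]) c \<in> R"
      proof (cases "j = i")
        case True
        then show ?thesis
          using rel_scale[OF scale(1,2) xc[OF scale(3)]] scale(1-3) by (simp add: tup_length lin_map_scale[OF lx])
      next
        case False
        have "ws[j := act W x (ws ! j)] \<in> tup" using j by (intro tup_update[OF scale(1)] xc tup_nth[OF scale(1)]) auto
        from rel_scale[OF this scale(2,3)] show ?thesis using False by (simp add: list_update_swap[of j i])
      qed
    qed
    finally show ?thesis .
  qed
qed

lemma act_tcl: "act_linear W x ==> f \<in> carrier F ==> act (tensor_power K W) x (tcl f) = tcl (act F x f)"
  unfolding tensor_power_eq tcl_def by (rule Q.qcl_act[OF act_linear_F act_R])

lemma act_linear_T: "act_linear W x ==> act_linear (tensor_power K W) x"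
  unfolding tensor_power_eq by (rule Q.act_linear_quot[OF act_linear_F act_R])

lemma tensor_spanned:
  assumes S: "submodule S \<complex> (tensor_power K W)" and gen: "!!ws. ws \<in> tup ==> tcl (single ws 1) \<in> S"
  shows "carrier (tensor_power K W) \<subseteq> S"
proof -
  have "submodule {f \<in> carrier F. tcl f \<in> S} \<complex> F"
    by (rule Q.M.submodule_vimage[OF cmodule_T lin_map_tcl S])
  then have sub: "submodule {f \<in> carrier F. tcl f \<in> S} \<complex> (free_rep tup leib)" by (simp only: F_eq)
  have "f \<in> {f \<in> carrier F. tcl f \<in> S}" if "f \<in> carrier F" for f
    by (rule free_rep_spanned[OF sub]) (use gen single_in_F that in \<open>auto simp: F_eq\<close>)
  then show ?thesis unfolding tensor_power_eq Q.carrier_quot tcl_def by blast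
qed

text \<open>The entries are freed one position at a time: with the other entries fixed, the vectors
  whose tensor lies in \<open>S\<close> form a submodule, which contains \<open>B\<close> by
  induction. In \<open>main\<close>, the positions from \<open>j\<close> on are those still confined
  to \<open>B\<close>.\<close>

lemma tensor_spanned_basis:
  assumes S: "submodule S \<complex> (tensor_power K W)" and B: "spanned W B" "B \<subseteq> carrier W"
    and gen: "!!ws. length ws = K ==> set ws \<subseteq> B ==> tcl (single ws 1) \<in> S"
  shows "carrier (tensor_power K W) \<subseteq> S"
proof -
  interpret T: cmodule "tensor_power K W" by (rule cmodule_T)
  have main: "tcl (single ws 1) \<in> S"
    if "j \<le> K" "ws \<in> tup" "!!i. j \<le> i ==> i < K ==> ws ! i \<in> B" for j ws
    using that
  proof (induction j arbitrary: ws)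
    case 0
    then show ?case using tup_length[OF 0(2)] by (intro gen) (auto simp: in_set_conv_nth)
  next
    case (Suc j)
    then have j: "j < K" by simp
    define V where "V = {u \<in> carrier W. tcl (single (ws[j := u]) 1) \<in> S}"
    have lw: "length ws = K" by (rule tup_length[OF Suc.prems(2)])
    have "submodule V \<complex> W"
      unfolding W.submodule_iff
    proof (intro conjI ballI allI)
      show "V \<subseteq> carrier W" unfolding V_def by blast
      have "\<zero>\<^bsub>W\<^esub> = 0 \<odot>\<^bsub>W\<^esub> \<zero>\<^bsub>W\<^esub>" by simp
      have c0: "tcl (single (ws[j := \<zero>\<^bsub>W\<^esub>]) 1) \<in> carrier (tensor_power K W)"
        by (rule lin_map_closed[OF lin_map_tcl single_in_F[OF tup_update[OF Suc.prems(2) W.zero_closed]]])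
      have "tcl (single (ws[j := 0 \<odot>\<^bsub>W\<^esub> \<zero>\<^bsub>W\<^esub>]) 1) = \<zero>\<^bsub>tensor_power K W\<^esub>"
        unfolding tcl_scale[OF Suc.prems(2) j W.zero_closed] using c0 by (rule T.scale_zero)
      then show "\<zero>\<^bsub>W\<^esub> \<in> V" using T.submodule_zero_mem[OF S] by (simp add: V_def)
    next
      fix v w assume "v \<in> V" "w \<in> V"
      then show "v \<oplus>\<^bsub>W\<^esub> w \<in> V"
        using tcl_add[OF Suc.prems(2) j] T.submodule_add[OF S] by (simp add: V_def)
    next
      fix c v assume "v \<in> V"
      then show "c \<odot>\<^bsub>W\<^esub> v \<in> V"
        using tcl_scale[OF Suc.prems(2) j] T.submodule_scale[OF S] by (simp add: V_def)
    qed
    moreover have "B \<subseteq> V"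
    proof
      fix u assume u: "u \<in> B"
      then have uW: "u \<in> carrier W" using B(2) by blast
      have "ws[j := u] ! i \<in> B" if "j \<le> i" "i < K" for i
        using that u Suc.prems(3)[of i] lw by (cases "i = j") auto
      then show "u \<in> V" using Suc.IH[OF _ tup_update[OF Suc.prems(2) uW]] j uW by (simp add: V_def)
    qed
    ultimately have "carrier W \<subseteq> V" using B(1) unfolding spanned_def by blast
    then have "ws ! j \<in> V" using tup_nth[OF Suc.prems(2) j] by blast
    then show ?case by (simp add: V_def)
  qed
  show ?thesis
    by (rule tensor_spanned[OF S]) (rule main[of K], auto)
qed

text \<open>A word goes to the tensor of the vectors \<open>b\<close> of its letters, which is
  equivariant because the rotations move letters up to a scalar. The minus sign in the last
  hypothesis is the transposition between acting on basis vectors and acting on coordinate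
  functions.\<close>

theorem word_map_tensor:
  fixes b :: "nat \<times> nat => 'v"
  assumes b: "!!\<kappa> u. \<kappa> < c ==> u < d + 2 * nb ==> b (\<kappa>, u) \<in> carrier W"
    and span: "spanned W (b ` ({..<c} \<times> {..<d + 2 * nb}))"
    and rot: "!!i j. i < nb ==> j < nb ==> i \<noteq> j ==> act_linear W (rot d i j)"
    and act: "!!i j \<kappa> u. i < nb ==> j < nb ==> i \<noteq> j ==> \<kappa> < c ==> u < d + 2 * nb ==>
      act W (rot d i j) (b (\<kappa>, u)) = (- sg d i j u) \<odot>\<^bsub>W\<^esub> b (\<kappa>, sw d i j u)"
  shows "\<exists>\<Phi>. word_map d nb c K (tensor_power K W) \<Phi> \<and> word_im d nb c K \<Phi> = carrier (tensor_power K W)"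
proof -
  let ?Y = "words c (d + 2 * nb) K"
  let ?T = "tensor_power K W"
  interpret T: cmodule ?T by (rule cmodule_T)
  define \<Psi> where "\<Psi> f = (\<Sum>w\<in>?Y. single (map b w) (f w))" for f :: "word => complex"
  define \<Phi> where "\<Phi> f = tcl (\<Psi> f)" for f
  have bt: "map b w \<in> tup" if "w \<in> ?Y" for w
    using that b by (auto simp: words_def tup_def)
  have \<Psi>F: "\<Psi> f \<in> carrier F" for f
    unfolding \<Psi>_def using bt by (intro submodule_free_rep_sum[of _ tup leib])
      (auto simp: F_eq submodule_free_rep_iff keys_add_subset keys_scale_subset split: if_splits)
  have \<Psi>_add: "\<Psi> (f + g) = \<Psi> f + \<Psi> g" for f g by (simp add: \<Psi>_def single_add sum.distrib)
  have \<Psi>_scale: "\<Psi> (fscale a f) = pm_scale a (\<Psi> f)" for a f by (simp add: \<Psi>_def pm_scale_sum)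
  have \<Psi>_0: "\<Psi> 0 = 0" by (simp add: \<Psi>_def)
  have \<Psi>_neg: "\<Psi> (- f) = - \<Psi> f" for f by (simp add: \<Psi>_def single_uminus sum_negf)
  have \<Psi>_sum: "\<Psi> (\<Sum>p\<in>I. f p) = (\<Sum>p\<in>I. \<Psi> (f p))" for f and I :: "nat set"
    by (induction I rule: infinite_finite_induct) (simp_all only: \<Psi>_0 \<Psi>_add sum.empty sum.insert sum.infinite simp_thms)
  have \<Psi>_delta: "\<Psi> (delta w) = single (map b w) 1" if "w \<in> ?Y" for w
  proof -
    have "\<Psi> (delta w) = (\<Sum>v\<in>?Y. if v = w then single (map b w) 1 else 0)"
      unfolding \<Psi>_def by (rule sum.cong) (auto simp: delta_def)
    then show ?thesis using that by (simp add: finite_words)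
  qed
  have cm: "cmap ?Y ?T \<Phi>"
    unfolding cmap_def \<Phi>_def \<Psi>_add \<Psi>_scale
    using lin_map_closed[OF lin_map_tcl \<Psi>F] lin_map_add[OF lin_map_tcl \<Psi>F \<Psi>F] lin_map_scale[OF lin_map_tcl \<Psi>F]
    by (simp add: F_eq)
  have wm: "word_map d nb c K ?T \<Phi>"
    unfolding word_map_def
  proof (intro conjI allI impI ballI)
    fix i j f assume ij: "i < nb" "j < nb" "i \<noteq> j" and f: "f \<in> cspace ?Y"
    have r: "lin_map ?T ?T (act ?T (rot d i j))" using act_linear_T[OF rot[OF ij]] by (simp add: act_linear_def)
    show "act ?T (rot d i j) (\<Phi> f) = \<Phi> (wact d i j f)"
    proof (rule cmap_eqI[OF cmodule_T finite_words _ _ _ f])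
      show "cmap ?Y ?T (\<lambda>f. act ?T (rot d i j) (\<Phi> f))"
        unfolding cmap_def using lin_mapD[OF r cmap_closed[OF cm]]
        by (simp add: cmap_add[OF cm] cmap_scale[OF cm] cmap_closed[OF cm])
      show "cmap ?Y ?T (\<lambda>f. \<Phi> (wact d i j f))"
        unfolding cmap_def wact_add wact_scale
        using cmap_closed[OF cm wact_cspace[OF ij]] cmap_add[OF cm wact_cspace[OF ij] wact_cspace[OF ij]]
          cmap_scale[OF cm wact_cspace[OF ij]] by simp
    next
      fix w assume w: "w \<in> ?Y"
      have lw: "length w = K" by (rule length_words[OF w])
      have w': "wsw d i j p w \<in> ?Y" for p by (rule wsw_in_words[OF w ij(1,2)])
      have "leib (rot d i j) (map b w) - \<Psi> (wact d i j (delta w))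
          = (\<Sum>p<K. single ((map b w)[p := act W (rot d i j) (map b w ! p)]) 1
              - single (map b (wsw d i j p w)) (- wsg d i j p w))"
        unfolding wact_delta[OF ij(3)] \<Psi>_neg \<Psi>_sum \<Psi>_scale \<Psi>_delta[OF w'] lw
        by (simp add: leib_def sum.distrib sum_subtractf single_uminus sum_negf)
      also have "\<dots> \<in> R"
      proof (rule R_sum)
        fix p assume "p \<in> {..<K}"
        then have p: "p < K" by simp
        obtain \<kappa> u where ku: "w ! p = (\<kappa>, u)" by (cases "w ! p")
        have "w ! p \<in> {..<c} \<times> {..<d + 2 * nb}" using w p lw nth_mem[of p w] unfolding words_def by blast
        then have ku': "\<kappa> < c" "u < d + 2 * nb" using ku by auto
        have "(map b w)[p := act W (rot d i j) (map b w ! p)]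
            = (map b w)[p := (- sg d i j u) \<odot>\<^bsub>W\<^esub> b (\<kappa>, sw d i j u)]"
          using p lw act[OF ij ku'] by (simp add: ku)
        moreover have "map b (wsw d i j p w) = (map b w)[p := b (\<kappa>, sw d i j u)]"
          using ku by (simp add: wsw_def map_update)
        moreover have "wsg d i j p w = sg d i j u" by (simp add: wsg_def ku)
        ultimately show "single ((map b w)[p := act W (rot d i j) (map b w ! p)]) 1
              - single (map b (wsw d i j p w)) (- wsg d i j p w) \<in> R"
          using rel_scale[OF bt[OF w] p b[OF ku'(1) sw_less[OF ku'(2) ij(1,2)]], of "- sg d i j u"] by simp
      qed
      finally have "tcl (leib (rot d i j) (map b w)) = tcl (\<Psi> (wact d i j (delta w)))"
        by (intro tcl_eqI leib_in_F[OF rot[OF ij] bt[OF w]] \<Psi>F)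
      then show "act ?T (rot d i j) (\<Phi> (delta w)) = \<Phi> (wact d i j (delta w))"
        unfolding \<Phi>_def \<Psi>_delta[OF w] act_tcl[OF rot[OF ij] single_in_F[OF bt[OF w]]] act_F_single by simp
    qed
  qed (rule cm)
  have "carrier ?T \<subseteq> word_im d nb c K \<Phi>"
  proof (rule tensor_spanned_basis[OF submodule_word_im[OF cmodule_T wm] span])
    show "b ` ({..<c} \<times> {..<d + 2 * nb}) \<subseteq> carrier W" using b by auto
    fix ws assume ws: "length ws = K" "set ws \<subseteq> b ` ({..<c} \<times> {..<d + 2 * nb})"
    then have "ws \<in> lists (b ` ({..<c} \<times> {..<d + 2 * nb}))" by blast
    then obtain w where w: "w \<in> lists ({..<c} \<times> {..<d + 2 * nb})" "ws = map b w"
      unfolding lists_image by blast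
    then have wY: "w \<in> ?Y" using ws(1) by (auto simp: words_def)
    then have "\<Phi> (delta w) = tcl (single ws 1)" by (simp add: \<Phi>_def \<Psi>_delta w(2))
    then show "tcl (single ws 1) \<in> word_im d nb c K \<Phi>"
      unfolding word_im_def using delta_in_cspace[OF wY] by (metis imageI)
  qed
  moreover have "word_im d nb c K \<Phi> \<subseteq> carrier ?T"
    unfolding word_im_def using cmap_closed[OF cm] by blast
  ultimately show ?thesis using wm by blast
qed

text \<open>\<open>x\<close> minus the sum of the \<open>e i\<close>, applied to a pure tensor, is
  the sum over \<open>i\<close> of the tensors whose entry \<open>i\<close> has been hit by
  \<open>x - e i\<close>. Each of them is left with one shift fewer in total, and the real part of
  the sum is at most \<open>K\<close> times \<open>\<rho>\<close>.\<close>

theorem wt_space_tensor: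
  assumes x: "act_linear W x" and wt: "carrier W \<subseteq> wt_space W (act W x) \<rho>"
  shows "carrier (tensor_power K W) \<subseteq> wt_space (tensor_power K W) (act (tensor_power K W) x) (real K * \<rho>)"
proof -
  let ?T = "tensor_power K W"
  interpret W: endo W "act W x" using x W.cmodule_axioms by (simp add: endo_def endo_axioms_def act_linear_def)
  interpret T: endo ?T "act ?T x"
    using act_linear_T[OF x] cmodule_T by (simp add: endo_def endo_axioms_def act_linear_def)
  let ?N = "wt_space ?T (act ?T x) (real K * \<rho>)"
  have N: "submodule ?N \<complex> ?T" by (rule T.submodule_wt_space)
  have pre: "submodule {f \<in> carrier F. tcl f \<in> ?N} \<complex> (free_rep tup leib)"
    using Q.M.submodule_vimage[OF cmodule_T lin_map_tcl N] by (simp only: F_eq)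
  have main: "tcl (single ws 1) \<in> ?N"
    if "ws \<in> tup" "length as = K" "!!i. i < K ==> shifts W (act W x) (as ! i) (ws ! i) = \<zero>\<^bsub>W\<^esub>"
      "!!i. i < K ==> \<forall>a\<in>set (as ! i). Re a \<le> \<rho>" for ws as
    using that
  proof (induction "\<Sum>i<K. length (as ! i)" arbitrary: ws as rule: less_induct)
    case less
    note ws = less.prems(1)
    have sc: "tcl (single ws 1) \<in> carrier ?T" by (rule lin_map_closed[OF lin_map_tcl single_in_F[OF ws]])
    show ?case
    proof (cases "\<exists>i<K. as ! i = []")
      case True
      then obtain i where i: "i < K" "as ! i = []" by blast
      then have "ws ! i = \<zero>\<^bsub>W\<^esub>" using less.prems(3)[OF i(1)] by (simp add: W.shifts_simps)
      then have "ws = ws[i := 0 \<odot>\<^bsub>W\<^esub> \<zero>\<^bsub>W\<^esub>]" by (metis W.scale_zero_right list_update_id)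
      then have "tcl (single ws 1) = 0 \<odot>\<^bsub>?T\<^esub> tcl (single (ws[i := \<zero>\<^bsub>W\<^esub>]) 1)"
        using tcl_scale[OF ws i(1) W.zero_closed, of 0] by simp
      also have "\<dots> = \<zero>\<^bsub>?T\<^esub>"
        using lin_map_closed[OF lin_map_tcl single_in_F[OF tup_update[OF ws W.zero_closed]]] by (rule T.scale_zero)
      finally show ?thesis using T.submodule_zero_mem[OF N] by simp
    next
      case False
      define e where "e i = last (as ! i)" for i
      define us where "us i = ws[i := shift W (act W x) (e i) (ws ! i)]" for i
      have Rei: "Re (e i) \<le> \<rho>" if "i < K" for i
        using less.prems(4)[OF that] False that unfolding e_def by (metis last_in_set)
      have us: "us i \<in> tup" if "i < K" for i
        unfolding us_def by (rule tup_update[OF ws W.shift_closed[OF tup_nth[OF ws that]]])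
      have IH: "tcl (single (us i) 1) \<in> ?N" if i: "i < K" for i
      proof -
        define bs where "bs = as[i := butlast (as ! i)]"
        have ne: "as ! i \<noteq> []" using False i by blast
        have lw: "length ws = K" "i < length as" using tup_length[OF ws] less.prems(2) i by auto
        show ?thesis
        proof (rule less.hyps[of bs])
          have "(\<Sum>j<K. length (bs ! j)) < (\<Sum>j<K. length (as ! j))"
          proof (rule sum_strict_mono_ex1)
            show "\<forall>j\<in>{..<K}. length (bs ! j) \<le> length (as ! j)"
              using lw by (auto simp: bs_def nth_list_update)
            show "\<exists>j\<in>{..<K}. length (bs ! j) < length (as ! j)"
              using i ne lw by (intro bexI[of _ i]) (auto simp: bs_def)
          qed simp
          then show "(\<Sum>j<K. length (bs ! j)) < (\<Sum>j<K. length (as ! j))" .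
          show "us i \<in> tup" by (rule us[OF i])
          show "length bs = K" using less.prems(2) by (simp add: bs_def)
          fix j assume j: "j < K"
          show "\<forall>a\<in>set (bs ! j). Re a \<le> \<rho>"
            using less.prems(4)[OF j] lw by (cases "j = i") (auto simp: bs_def dest: in_set_butlastD)
          show "shifts W (act W x) (bs ! j) (us i ! j) = \<zero>\<^bsub>W\<^esub>"
          proof (cases "j = i")
            case True
            have "as ! i = butlast (as ! i) @ [e i]" using ne by (simp add: e_def)
            then have "shifts W (act W x) (butlast (as ! i)) (shift W (act W x) (e i) (ws ! i)) = \<zero>\<^bsub>W\<^esub>"
              using less.prems(3)[OF i] by (metis W.shifts_simps)
            then show ?thesis using True lw i by (simp add: bs_def us_def)
          next
            case False
            then show ?thesis using less.prems(3)[OF j] by (simp add: bs_def us_def)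
          qed
        qed
      qed
      have "(\<Sum>i<K. single (us i) 1) \<in> {f \<in> carrier F. tcl f \<in> ?N}"
        by (rule submodule_free_rep_sum[OF pre]) (use IH us single_in_F in auto)
      then have sumN: "tcl (\<Sum>i<K. single (us i) 1) \<in> ?N" and sumF: "(\<Sum>i<K. single (us i) 1) \<in> carrier F"
        by auto
      define s where "s = (\<Sum>i<K. e i)"
      have lF: "leib x ws + single ws (- s) \<in> carrier F"
        by (rule F_add[OF leib_in_F[OF x ws] single_in_F[OF ws]])
      \<comment> \<open>The Leibniz identity holds modulo the multilinearity relations; the
        difference is exhibited as a sum of such relations.\<close>
      have "(\<Sum>i<K. single (us i) 1) - (leib x ws + single ws (- s))
          = (\<Sum>i<K. (single (us i) 1 - single (ws[i := act W x (ws ! i)]) 1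
              - single (ws[i := (- e i) \<odot>\<^bsub>W\<^esub> (ws ! i)]) 1)
            + (single (ws[i := (- e i) \<odot>\<^bsub>W\<^esub> (ws ! i)]) 1 - single (ws[i := ws ! i]) (- e i)))"
      proof -
        have "single ws (- s) = (\<Sum>i<K. single ws (- e i))"
        proof -
          have "single ws (- (\<Sum>i<m. e i)) = (\<Sum>i<m. single ws (- e i))" for m
            by (induction m) (simp_all add: single_diff single_uminus)
          then show ?thesis by (simp add: s_def)
        qed
        then show ?thesis by (simp add: leib_def sum_subtractf sum.distrib)
      qed
      also have "\<dots> \<in> R"
      proof (rule R_sum)
        fix i assume "i \<in> {..<K}"
        then have i: "i < K" by simp
        note wi = tup_nth[OF ws i]
        have "(single (us i) 1 - single (ws[i := act W x (ws ! i)]) 1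
              - single (ws[i := (- e i) \<odot>\<^bsub>W\<^esub> (ws ! i)]) 1) \<in> R"
          unfolding us_def shift_def using rel_add[OF ws i W.T_closed[OF wi] W.scale_closed[OF wi]] by blast
        moreover have "single (ws[i := (- e i) \<odot>\<^bsub>W\<^esub> (ws ! i)]) 1 - single (ws[i := ws ! i]) (- e i) \<in> R"
          by (rule rel_scale[OF ws i wi])
        ultimately show "(single (us i) 1 - single (ws[i := act W x (ws ! i)]) 1
              - single (ws[i := (- e i) \<odot>\<^bsub>W\<^esub> (ws ! i)]) 1)
            + (single (ws[i := (- e i) \<odot>\<^bsub>W\<^esub> (ws ! i)]) 1 - single (ws[i := ws ! i]) (- e i)) \<in> R"
          using R_submodule[unfolded F_eq submodule_free_rep_iff] by (simp only: F_eq)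
      qed
      finally have "tcl (\<Sum>i<K. single (us i) 1) = tcl (leib x ws + single ws (- s))"
        by (rule tcl_eqI[OF sumF lF])
      also have "\<dots> = shift ?T (act ?T x) s (tcl (single ws 1))"
        using lin_map_add[OF lin_map_tcl leib_in_F[OF x ws] single_in_F[OF ws, of "- s"]]
          lin_map_scale[OF lin_map_tcl single_in_F[OF ws, of 1], of "- s"]
          act_tcl[OF x single_in_F[OF ws, of 1]] act_F_single[of x ws 1]
        by (simp add: shift_def F_eq)
      finally have "shift ?T (act ?T x) s (tcl (single ws 1)) \<in> ?N" using sumN by simp
      moreover have "Re s \<le> real K * \<rho>"
      proof -
        have "Re s = (\<Sum>i<K. Re (e i))" by (simp add: s_def)
        also have "\<dots> \<le> (\<Sum>i<K. \<rho>)" by (rule sum_mono) (use Rei in auto)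
        finally show ?thesis by simp
      qed
      ultimately show ?thesis using T.wt_space_step[OF sc] by blast
    qed
  qed
  show ?thesis
  proof (rule tensor_spanned[OF N])
    fix ws assume ws: "ws \<in> tup"
    have "\<exists>as. \<forall>i<K. shifts W (act W x) (as i) (ws ! i) = \<zero>\<^bsub>W\<^esub> \<and> (\<forall>a\<in>set (as i). Re a \<le> \<rho>)"
      using tup_nth[OF ws] wt unfolding wt_space_def by (intro choice) blast
    then obtain as where as: "!!i. i < K ==> shifts W (act W x) (as i) (ws ! i) = \<zero>\<^bsub>W\<^esub>"
      "!!i. i < K ==> \<forall>a\<in>set (as i). Re a \<le> \<rho>" by blast
    show "tcl (single ws 1) \<in> ?N"
      by (rule main[OF ws, of "map as [0..<K]"]) (use as in auto)
  qed
qed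

end

section \<open>Mixed tensors\<close>

locale fun_endo =
  fixes T :: "('i => complex) => 'i => complex"
  assumes T_add: "T (f + g) = T f + T g" and T_scale: "T (fscale c f) = fscale c (T f)"
begin

lemma T_pow_add: "(T ^^ i) (f + g) = (T ^^ i) f + (T ^^ i) g"
  by (induction i) (simp_all only: funpow.simps id_apply comp_apply T_add)

lemma T_pow_scale: "(T ^^ i) (fscale c f) = fscale c ((T ^^ i) f)"
  by (induction i) (simp_all only: funpow.simps id_apply comp_apply T_scale)

definition peval :: "complex Polynomial.poly => ('i => complex) => 'i => complex" where
  "peval p v = (\<Sum>i\<le>Polynomial.degree p. fscale (Polynomial.coeff p i) ((T ^^ i) v))"

lemma peval_bound: "Polynomial.degree p \<le> n ==> peval p v = (\<Sum>i\<le>n. fscale (Polynomial.coeff p i) ((T ^^ i) v))"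
  unfolding peval_def by (rule sum.mono_neutral_left) (auto simp: Polynomial.coeff_eq_0)

lemma peval_linear_factor: "peval ([:- z, 1:] * q) v = peval q (T v + fscale (- z) v)"
proof -
  let ?n = "Polynomial.degree q"
  let ?c = "Polynomial.coeff q"
  have eq: "[:- z, 1:] * q = Polynomial.smult (- z) q + Polynomial.pCons 0 q" by simp
  have deg: "Polynomial.degree ([:- z, 1:] * q) \<le> Suc ?n"
    by (rule order.trans[OF Polynomial.degree_mult_le]) simp
  have "peval ([:- z, 1:] * q) v
      = (\<Sum>i\<le>Suc ?n. fscale (- z * ?c i) ((T ^^ i) v)) + (\<Sum>i\<le>Suc ?n. fscale (Polynomial.coeff (Polynomial.pCons 0 q) i) ((T ^^ i) v))"
    unfolding peval_bound[OF deg] sum.distrib[symmetric]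
    by (rule sum.cong[OF refl]) (simp add: eq fun_eq_iff algebra_simps del: mult_pCons_left)
  also have "(\<Sum>i\<le>Suc ?n. fscale (- z * ?c i) ((T ^^ i) v)) = (\<Sum>i\<le>?n. fscale (- z * ?c i) ((T ^^ i) v))"
    by (simp add: Polynomial.coeff_eq_0)
  also have "(\<Sum>i\<le>Suc ?n. fscale (Polynomial.coeff (Polynomial.pCons 0 q) i) ((T ^^ i) v)) = (\<Sum>i\<le>?n. fscale (?c i) ((T ^^ i) (T v)))"
    by (simp add: sum.atMost_Suc_shift funpow_swap1 del: sum.atMost_Suc funpow.simps) (simp add: funpow_Suc_right del: funpow.simps)
  also have "(\<Sum>i\<le>?n. fscale (- z * ?c i) ((T ^^ i) v)) + (\<Sum>i\<le>?n. fscale (?c i) ((T ^^ i) (T v))) = peval q (T v + fscale (- z) v)"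
    unfolding peval_def sum.distrib[symmetric] T_pow_add T_pow_scale
    by (rule sum.cong[OF refl]) (simp add: fun_eq_iff algebra_simps)
  finally show ?thesis .
qed

text \<open>Induction on the degree: a root \<open>z\<close>, from the fundamental theorem of
  algebra, is split off and turns \<open>v\<close> into \<open>T v - z v\<close>. A nonzero constant
  that annihilates \<open>v\<close> forces \<open>v = 0\<close>.\<close>

lemma annihilated_by_shifts:
  assumes "p \<noteq> 0" "peval p v = 0"
  shows "\<exists>as. foldr (\<lambda>a u. T u + fscale (- a) u) as v = 0"
  using assms
proof (induction "Polynomial.degree p" arbitrary: p v)
  case 0
  have "fscale (Polynomial.coeff p 0) v = 0"
    using 0 peval_bound[of p 0 v] by (simp only: atMost_0 sum.insert finite.emptyI sum.empty funpow_0 add_0_right empty_iff not_False_eq_True)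
  moreover have "Polynomial.coeff p 0 \<noteq> 0" using 0 Polynomial.leading_coeff_0_iff[of p] by simp
  ultimately have "v = 0" using cfun.scale_eq_0_iff by blast
  then show ?case by (intro exI[of _ "[]"]) simp
next
  case (Suc n)
  have "\<not> constant (poly p)" using Suc.hyps(2) by (simp add: constant_degree)
  then obtain z where "poly p z = 0" using fundamental_theorem_of_algebra by blast
  then obtain q where q: "p = [:- z, 1:] * q" by (metis dvdE poly_eq_0_iff_dvd)
  then have q0: "q \<noteq> 0" using Suc.prems(1) by auto
  then have "n = Polynomial.degree q" using Suc.hyps(2) unfolding q
    by (subst (asm) Polynomial.degree_mult_eq) auto
  moreover have "peval q (T v + fscale (- z) v) = 0" using Suc.prems(2) unfolding q peval_linear_factor .
  ultimately obtain as where "foldr (\<lambda>a u. T u + fscale (- a) u) as (T v + fscale (- z) v) = 0"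
    using Suc.hyps(1)[of q] q0 by blast
  then show ?case by (intro exI[of _ "as @ [z]"]) simp
qed

text \<open>The \<open>card S + 1\<close> vectors \<open>v, T v, ...\<close> are linearly dependent,
  and a dependency is an annihilating polynomial.\<close>

lemma finite_dim_annihilated:
  assumes S: "finite S" and stable: "!!f. f \<in> cspace S ==> T f \<in> cspace S" and v: "v \<in> cspace S"
  shows "\<exists>as. foldr (\<lambda>a u. T u + fscale (- a) u) as v = 0"
proof -
  let ?d = "card S"
  have pw: "(T ^^ i) v \<in> cspace S" for i by (induction i) (simp_all add: v stable)
  obtain c where c: "\<exists>i\<in>{..?d}. c i \<noteq> 0" "\<forall>s\<in>S. (\<Sum>i\<in>{..?d}. c i * (T ^^ i) v s) = 0"
    using underdetermined_system[OF S finite_atMost, of ?d "\<lambda>i. (T ^^ i) v"] by auto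
  define p where "p = (\<Sum>i\<le>?d. Polynomial.monom (c i) i)"
  have co: "Polynomial.coeff p i = (if i \<le> ?d then c i else 0)" for i
    by (simp add: p_def Polynomial.coeff_sum)
  have "p \<noteq> 0" using c(1) co by (metis atMost_iff Polynomial.coeff_0)
  moreover have "Polynomial.degree p \<le> ?d" by (rule Polynomial.degree_le) (simp add: co)
  then have "peval p v = (\<Sum>i\<le>?d. fscale (c i) ((T ^^ i) v))"
    by (simp add: peval_bound co)
  moreover have "\<dots> = 0"
  proof
    fix s
    show "(\<Sum>i\<le>?d. fscale (c i) ((T ^^ i) v)) s = 0 s"
    proof (cases "s \<in> S")
      case False
      then have "(T ^^ i) v s = 0" for i using pw by (auto simp: cspace_def)
      then show ?thesis by (simp add: sum_fun_apply)
    qed (use c(2) in \<open>simp add: sum_fun_apply\<close>)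
  qed
  ultimately show ?thesis using annihilated_by_shifts by metis
qed

end

section \<open>The natural module and its dual\<close>

lemma nat_rep_simps [simp]:
  "carrier (nat_rep D) = cspace {..<D}" "\<zero>\<^bsub>nat_rep D\<^esub> = 0" "v \<oplus>\<^bsub>nat_rep D\<^esub> w = v + w"
  "c \<odot>\<^bsub>nat_rep D\<^esub> v = fscale c v" "act (nat_rep D) x v = (\<lambda>i. \<Sum>j<D. x i j * v j)"
  by (auto simp: nat_rep_def cspace_def fscale_def)

lemma cmodule_nat_rep: "cmodule (nat_rep D)"
  unfolding cmodule_iff
  by (rule module_direct) (auto simp: cspace_zero cspace_add cspace_scale fun_eq_iff algebra_simps)

lemma act_linear_nat_rep:
  assumes "x \<in> gl D"
  shows "act_linear (nat_rep D) x"
proof -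
  have "x i j = 0" if "\<not> i < D" for i j using assms that unfolding gl_def by blast
  then have "(\<lambda>i. \<Sum>j<D. x i j * v j) \<in> cspace {..<D}" for v by (simp add: cspace_def)
  then show ?thesis unfolding act_linear_def lin_map_def
    by (auto simp: fun_eq_iff sum.distrib algebra_simps sum_distrib_left)
qed

definition all_wt :: "'v rep => mat => real => bool" where
  "all_wt M x \<rho> \<longleftrightarrow> cmodule M \<and> act_linear M x \<and> carrier M \<subseteq> wt_space M (act M x) \<rho>"

lemma all_wt_mono:
  assumes "all_wt M x \<rho>" "\<rho> \<le> \<rho>'"
  shows "all_wt M x \<rho>'"
proof -
  interpret endo M "act M x" using assms(1) by (simp add: all_wt_def endo_def endo_axioms_def act_linear_def)
  show ?thesis using assms wt_space_mono[OF assms(2)] unfolding all_wt_def by blast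
qed

lemma all_wt_endo: "all_wt M x \<rho> ==> endo M (act M x)"
  by (simp add: all_wt_def endo_def endo_axioms_def act_linear_def)

lemma submodule_nat_rep_subspace: "submodule S \<complex> (nat_rep D) ==> cfun.subspace S"
proof -
  interpret cmodule "nat_rep D" by (rule cmodule_nat_rep)
  assume "submodule S \<complex> (nat_rep D)"
  then show ?thesis unfolding submodule_iff cfun.subspace_def by simp
qed

text \<open>The bound is uniform in \<open>D\<close>, since \<open>x\<close> acts by zero on the
  coordinates from \<open>d\<close> on and these contribute only the weight 0.\<close>

lemma all_wt_nat_rep:
  assumes x: "x \<in> gl d"
  shows "\<exists>\<rho>\<ge>0. \<forall>D\<ge>d. all_wt (nat_rep D) x \<rho>"
proof -
  define T where "T v = (\<lambda>i. \<Sum>j<d. x i j * v j)" for v :: "nat => complex"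
  interpret fun_endo T
    by unfold_locales (auto simp: T_def fun_eq_iff sum.distrib algebra_simps sum_distrib_left)
  have x0: "x i j = 0" if "\<not> (i < d \<and> j < d)" for i j using x that unfolding gl_def by blast
  have "T f \<in> cspace {..<d}" for f using x0 by (simp add: cspace_def T_def)
  then have "\<exists>as. foldr (\<lambda>a u. T u + fscale (- a) u) as (delta u) = 0" if "u < d" for u
    using finite_dim_annihilated[of "{..<d}" "delta u"] that delta_in_cspace[of u "{..<d}"] by simp
  then obtain as where as: "!!u. u < d ==> foldr (\<lambda>a u. T u + fscale (- a) u) (as u) (delta u) = 0"
    by metis
  \<comment> \<open>The inserted 0 accounts for the coordinates from \<open>d\<close> on, and keeps
    the set nonempty.\<close>
  define \<rho> where "\<rho> = Max (insert 0 (Re ` (\<Union>u<d. set (as u))))"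
  have fin: "finite (insert 0 (Re ` (\<Union>u<d. set (as u))))" by auto
  have \<rho>0: "0 \<le> \<rho>" unfolding \<rho>_def using fin by (rule Max_ge) simp
  have \<rho>: "Re a \<le> \<rho>" if "u < d" "a \<in> set (as u)" for a u
    unfolding \<rho>_def using fin by (rule Max_ge) (use that in blast)
  have "all_wt (nat_rep D) x \<rho>" if D: "d \<le> D" for D
  proof -
    have lin: "act_linear (nat_rep D) x" using act_linear_nat_rep x gl_mono[OF D] by blast
    interpret M: endo "nat_rep D" "act (nat_rep D) x"
      using lin cmodule_nat_rep by (simp add: endo_def endo_axioms_def act_linear_def)
    have actT: "act (nat_rep D) x v = T v" for v
      unfolding nat_rep_simps T_def
      by (rule ext, rule sum.mono_neutral_right) (use D x0 in auto)
    have sh: "shifts (nat_rep D) (act (nat_rep D) x) bs v = foldr (\<lambda>a u. T u + fscale (- a) u) bs v" for bs v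
      by (induction bs) (simp_all add: shifts_def shift_def actT del: nat_rep_simps(5))
    let ?W = "wt_space (nat_rep D) (act (nat_rep D) x) \<rho>"
    have "delta u \<in> ?W" if u: "u < D" for u
    proof (cases "u < d")
      case True
      show ?thesis
        by (rule M.wt_spaceI[of _ "as u"])
          (use u True \<rho> as delta_in_cspace[of u "{..<D}"] in \<open>auto simp: sh simp del: nat_rep_simps(5)\<close>)
    next
      case False
      have "T (delta u) = 0" using False by (auto simp: T_def delta_def fun_eq_iff intro!: sum.neutral)
      then show ?thesis
        by (intro M.wt_space_eigenvector[of _ 0])
          (use u \<rho>0 delta_in_cspace[of u "{..<D}"] in \<open>auto simp: actT fun_eq_iff simp del: nat_rep_simps(5)\<close>)
    qed
    then have "f \<in> ?W" if "f \<in> cspace {..<D}" for f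
      by (intro cmap_induct[OF finite_lessThan that submodule_nat_rep_subspace[OF M.submodule_wt_space]]) auto
    then show ?thesis using lin cmodule_nat_rep unfolding all_wt_def by auto
  qed
  then show ?thesis using \<rho>0 by blast
qed

lemma dual_rep_simps [simp]:
  "\<zero>\<^bsub>dual_rep M\<^esub> = (\<lambda>v\<in>carrier M. 0)" "f \<oplus>\<^bsub>dual_rep M\<^esub> g = (\<lambda>v\<in>carrier M. f v + g v)"
  "c \<odot>\<^bsub>dual_rep M\<^esub> f = (\<lambda>v\<in>carrier M. c * f v)" "act (dual_rep M) x f = (\<lambda>v\<in>carrier M. - f (act M x v))"
  by (simp_all add: dual_rep_def)

lemma mem_dual_iff: "f \<in> carrier (dual_rep M) \<longleftrightarrow> f \<in> extensional (carrier M) \<and>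
    (\<forall>v\<in>carrier M. \<forall>w\<in>carrier M. f (v \<oplus>\<^bsub>M\<^esub> w) = f v + f w) \<and>
    (\<forall>c. \<forall>v\<in>carrier M. f (c \<odot>\<^bsub>M\<^esub> v) = c * f v)"
  by (simp add: dual_rep_def)

lemma cmodule_dual_rep:
  assumes "cmodule M"
  shows "cmodule (dual_rep M)"
  unfolding cmodule_iff
proof -
  interpret cmodule M by fact
  have ext: "f = g" if "f \<in> carrier (dual_rep M)" "g \<in> extensional (carrier M)" "!!v. v \<in> carrier M ==> f v = g v" for f g
    using that by (intro extensionalityI[of _ "carrier M"]) (auto simp: mem_dual_iff)
  show "module \<complex> (dual_rep M)"
  proof (rule module_direct)
    show "\<zero>\<^bsub>dual_rep M\<^esub> \<oplus>\<^bsub>dual_rep M\<^esub> v = v" "1 \<odot>\<^bsub>dual_rep M\<^esub> v = v" if "v \<in> carrier (dual_rep M)" for v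
      using that by (intro ext[symmetric]; simp)+
  qed (auto simp: mem_dual_iff algebra_simps restrict_def fun_eq_iff extensional_def)
qed

lemma act_linear_dual:
  assumes M: "cmodule M" and x: "act_linear M x"
  shows "act_linear (dual_rep M) x"
proof -
  interpret cmodule M by fact
  have l: "lin_map M M (act M x)" using x by (simp add: act_linear_def)
  show ?thesis
    unfolding act_linear_def lin_map_def
    by (auto simp: mem_dual_iff lin_mapD[OF l] restrict_def fun_eq_iff extensional_def)
qed

definition neg_tr :: "mat => mat" where "neg_tr x = (\<lambda>i j. - x j i)"

text \<open>The dot product identifies the natural module with its dual; a matrix then acts through
  its negative transpose, which is the matrix itself for rotations.\<close>

definition dmap :: "nat => (nat => complex) => (nat => complex) => complex" where
  "dmap D v = (\<lambda>w\<in>cspace {..<D}. \<Sum>u<D. v u * w u)"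

lemma lin_map_dmap: "lin_map (nat_rep D) (dual_rep (nat_rep D)) (dmap D)"
  unfolding lin_map_def
  by (auto simp: dmap_def mem_dual_iff fun_eq_iff restrict_def extensional_def cspace_add cspace_scale sum.distrib algebra_simps sum_distrib_left)

lemma dmap_surj: "carrier (dual_rep (nat_rep D)) \<subseteq> dmap D ` carrier (nat_rep D)"
proof
  fix f assume f: "f \<in> carrier (dual_rep (nat_rep D))"
  define v where "v u = (if u < D then f (delta u) else 0)" for u
  have "cfun.subspace {w \<in> cspace {..<D}. f w = (\<Sum>u<D. v u * w u)}"
    unfolding cfun.subspace_def
  proof (intro conjI ballI allI)
    have "\<forall>c. \<forall>v\<in>cspace {..<D}. f (fscale c v) = c * f v" using f by (simp add: mem_dual_iff)
    then have "f (fscale 0 0) = 0 * f 0" using cspace_zero by blast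
    then show "0 \<in> {w \<in> cspace {..<D}. f w = (\<Sum>u<D. v u * w u)}" by (simp add: cspace_zero)
  qed (use f in \<open>auto simp: mem_dual_iff cspace_add cspace_scale sum.distrib algebra_simps sum_distrib_left\<close>)
  moreover have "delta w \<in> {w \<in> cspace {..<D}. f w = (\<Sum>u<D. v u * w u)}" if w: "w \<in> {..<D}" for w
  proof -
    have "(\<Sum>u<D. v u * delta w u) = (\<Sum>u<D. if u = w then v w else 0)"
      by (rule sum.cong) (auto simp: delta_def)
    then show ?thesis using w delta_in_cspace[OF w] by (simp add: v_def)
  qed
  ultimately have "w \<in> {w \<in> cspace {..<D}. f w = (\<Sum>u<D. v u * w u)}" if "w \<in> cspace {..<D}" for w
    using cmap_induct[OF finite_lessThan that] by blast
  then have "f = dmap D v"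
    using f by (intro extensionalityI[of _ "cspace {..<D}"]) (auto simp: mem_dual_iff dmap_def)
  moreover have "v \<in> cspace {..<D}" by (simp add: cspace_def v_def)
  ultimately show "f \<in> dmap D ` carrier (nat_rep D)" by simp
qed

lemma dmap_act:
  assumes x: "x \<in> gl D"
  shows "dmap D (act (nat_rep D) (neg_tr x) v) = act (dual_rep (nat_rep D)) x (dmap D v)"
proof -
  have xc: "(\<lambda>i. \<Sum>j<D. x i j * w j) \<in> cspace {..<D}" if "w \<in> cspace {..<D}" for w
    using lin_map_closed[of "nat_rep D" "nat_rep D" "act (nat_rep D) x" w] act_linear_nat_rep[OF x] that
    by (simp add: act_linear_def)
  have "(\<Sum>u<D. (\<Sum>j<D. neg_tr x u j * v j) * w u) = - (\<Sum>u<D. v u * (\<Sum>j<D. x u j * w j))" for w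
  proof -
    have "(\<Sum>u<D. (\<Sum>j<D. neg_tr x u j * v j) * w u) = (\<Sum>u<D. \<Sum>j<D. - (v j * (x j u * w u)))"
      by (simp add: neg_tr_def sum_distrib_left mult_ac)
    also have "\<dots> = (\<Sum>j<D. \<Sum>u<D. - (v j * (x j u * w u)))" by (rule sum.swap)
    also have "\<dots> = - (\<Sum>u<D. v u * (\<Sum>j<D. x u j * w j))" by (simp add: sum_distrib_left sum_negf)
    finally show ?thesis .
  qed
  then show ?thesis using xc by (auto simp: dmap_def fun_eq_iff)
qed

lemma neg_tr_gl: "x \<in> gl D ==> neg_tr x \<in> gl D"
  by (auto simp: gl_def neg_tr_def)

lemma endo_dual_nat_rep: "x \<in> gl D ==> endo (dual_rep (nat_rep D)) (act (dual_rep (nat_rep D)) x)"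
  using act_linear_dual[OF cmodule_nat_rep act_linear_nat_rep] cmodule_dual_rep[OF cmodule_nat_rep]
  by (simp add: endo_def endo_axioms_def act_linear_def)

lemma all_wt_dual_nat_rep:
  assumes x: "x \<in> gl d"
  shows "\<exists>\<rho>\<ge>0. \<forall>D\<ge>d. all_wt (dual_rep (nat_rep D)) x \<rho>"
proof -
  obtain \<rho> where \<rho>: "0 \<le> \<rho>" "!!D. d \<le> D ==> all_wt (nat_rep D) (neg_tr x) \<rho>"
    using all_wt_nat_rep[OF neg_tr_gl[OF x]] by blast
  have "all_wt (dual_rep (nat_rep D)) x \<rho>" if D: "d \<le> D" for D
  proof -
    have xD: "x \<in> gl D" using x gl_mono[OF D] by blast
    have "f \<in> wt_space (dual_rep (nat_rep D)) (act (dual_rep (nat_rep D)) x) \<rho>" if f: "f \<in> carrier (dual_rep (nat_rep D))" for f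
    proof -
      obtain v where v: "v \<in> carrier (nat_rep D)" "f = dmap D v" using subsetD[OF dmap_surj f] by blast
      then have "v \<in> wt_space (nat_rep D) (act (nat_rep D) (neg_tr x)) \<rho>"
        using \<rho>(2)[OF D] unfolding all_wt_def by blast
      then have "dmap D v \<in> wt_space (dual_rep (nat_rep D)) (act (dual_rep (nat_rep D)) x) \<rho>"
        using wt_space_equivariant[where \<phi> = "dmap D", OF all_wt_endo[OF \<rho>(2)[OF D]] endo_dual_nat_rep[OF xD] lin_map_dmap]
          dmap_act[OF xD] by blast
      then show ?thesis by (simp only: v(2))
    qed
    then show ?thesis
      unfolding all_wt_def
      using act_linear_dual[OF cmodule_nat_rep act_linear_nat_rep[OF xD]] cmodule_dual_rep[OF cmodule_nat_rep] by blast
  qed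
  then show ?thesis using \<rho>(1) by blast
qed

text \<open>A spanning family on which the rotations act as on the basis of \<open>c\<close> copies
  of the natural module. This is what passes to direct sums and what \<open>word_map_tensor\<close>
  asks for.\<close>

definition letters :: "nat => nat => nat => 'v rep => (nat \<times> nat => 'v) => bool" where
  "letters d nb c M \<beta> \<longleftrightarrow> cmodule M \<and> (\<forall>\<kappa><c. \<forall>u<d + 2 * nb. \<beta> (\<kappa>, u) \<in> carrier M) \<and>
     spanned M (\<beta> ` ({..<c} \<times> {..<d + 2 * nb})) \<and>
     (\<forall>i<nb. \<forall>j<nb. i \<noteq> j \<longrightarrow> act_linear M (rot d i j) \<and> (\<forall>\<kappa><c. \<forall>u<d + 2 * nb.
        act M (rot d i j) (\<beta> (\<kappa>, u)) = (- sg d i j u) \<odot>\<^bsub>M\<^esub> \<beta> (\<kappa>, sw d i j u)))"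

lemma rot_delta:
  assumes ij: "i \<noteq> j" and u: "u < D"
  shows "act (nat_rep D) (rot d i j) (delta u) = fscale (- sg d i j u) (delta (sw d i j u))"
proof
  fix k
  have "(\<Sum>j'<D. rot d i j k j' * delta u j') = (\<Sum>j'<D. if j' = u then rot d i j k u else 0)"
    by (rule sum.cong) (auto simp: delta_def)
  also have "\<dots> = rot d i j k u" using u by simp
  also have "\<dots> = - sg d i j u * delta (sw d i j u) k"
    using sw_commute[OF ij, of u d k] sg_sw[OF ij] by (auto simp: rot_def delta_def)
  finally show "act (nat_rep D) (rot d i j) (delta u) k = fscale (- sg d i j u) (delta (sw d i j u)) k" by simp
qed

lemma neg_tr_rot: "i \<noteq> j ==> neg_tr (rot d i j) = rot d i j"
  using sw_commute[of i j] sg_sw[of i j] by (auto simp: neg_tr_def rot_def fun_eq_iff)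

lemma letters_nat_rep: "letters d nb 1 (nat_rep (d + 2 * nb)) (\<lambda>(\<kappa>, u). delta u)"
proof -
  let ?D = "d + 2 * nb"
  have "spanned (nat_rep ?D) ((\<lambda>(\<kappa>, u). delta u) ` ({..<1 :: nat} \<times> {..<?D}))"
    unfolding spanned_def
  proof (intro allI impI subsetI)
    fix S f assume S: "submodule S \<complex> (nat_rep ?D)" and B: "(\<lambda>(\<kappa>, u). delta u) ` ({..<1 :: nat} \<times> {..<?D}) \<subseteq> S"
      and f: "f \<in> carrier (nat_rep ?D)"
    have "delta u \<in> S" if "u < ?D" for u using B that by force
    then show "f \<in> S"
      using f by (intro cmap_induct[of "{..<?D}" f, OF _ _ submodule_nat_rep_subspace[OF S]]) auto
  qed
  then show ?thesis
    unfolding letters_def using rot_delta act_linear_nat_rep[OF rot_gl] cmodule_nat_rep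
    by (auto simp: delta_in_cspace simp del: nat_rep_simps(5))
qed

lemma spanned_image:
  assumes "cmodule M" "cmodule N" "spanned M B" "lin_map M N \<phi>" "carrier N \<subseteq> \<phi> ` carrier M" "B \<subseteq> carrier M"
  shows "spanned N (\<phi> ` B)"
  unfolding spanned_def
proof (intro allI impI)
  interpret M: cmodule M by fact
  fix S assume S: "submodule S \<complex> N" "\<phi> ` B \<subseteq> S"
  have "carrier M \<subseteq> {v \<in> carrier M. \<phi> v \<in> S}"
    using assms(3) M.submodule_vimage[OF assms(2,4) S(1)] S(2) assms(6) unfolding spanned_def by blast
  then show "carrier N \<subseteq> S" using assms(5) by blast
qed

lemma letters_dual_nat_rep: "letters d nb 1 (dual_rep (nat_rep (d + 2 * nb))) (\<lambda>(\<kappa>, u). dmap (d + 2 * nb) (delta u))"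
proof -
  let ?D = "d + 2 * nb"
  let ?B = "(\<lambda>(\<kappa>, u). delta u) ` ({..<1 :: nat} \<times> {..<?D}) :: (nat => complex) set"
  have "?B \<subseteq> carrier (nat_rep ?D)" by (auto simp: delta_in_cspace)
  then have "spanned (dual_rep (nat_rep ?D)) (dmap ?D ` ?B)"
    using letters_nat_rep[of d nb] unfolding letters_def
    by (intro spanned_image[OF cmodule_nat_rep cmodule_dual_rep[OF cmodule_nat_rep] _ lin_map_dmap dmap_surj]) auto
  moreover have "dmap ?D ` ?B = (\<lambda>(\<kappa>, u). dmap ?D (delta u)) ` ({..<1 :: nat} \<times> {..<?D})" by force
  moreover have "act (dual_rep (nat_rep ?D)) (rot d i j) (dmap ?D (delta u)) = (- sg d i j u) \<odot>\<^bsub>dual_rep (nat_rep ?D)\<^esub> dmap ?D (delta (sw d i j u))"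
    if ij: "i < nb" "j < nb" "i \<noteq> j" and u: "u < ?D" for i j u
    using dmap_act[OF rot_gl[OF ij(1,2)], of d "delta u"] rot_delta[OF ij(3) u, of d]
      lin_map_scale[OF lin_map_dmap[of ?D], of "delta (sw d i j u)" "- sg d i j u"] sw_less[OF u ij(1,2)]
    by (simp add: neg_tr_rot[OF ij(3)] delta_in_cspace del: nat_rep_simps(5) dual_rep_simps)
  moreover have "dmap ?D (delta u) \<in> carrier (dual_rep (nat_rep ?D))" if "u < ?D" for u
    by (rule lin_map_closed[OF lin_map_dmap]) (simp add: delta_in_cspace that)
  ultimately show ?thesis
    unfolding letters_def
    using act_linear_dual[OF cmodule_nat_rep act_linear_nat_rep[OF rot_gl]] cmodule_dual_rep[OF cmodule_nat_rep]
    by (auto simp del: dual_rep_simps)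
qed

section \<open>Trivial modules, powers and direct sums\<close>

lemma triv_rep_simps [simp]:
  "carrier triv_rep = UNIV" "\<zero>\<^bsub>triv_rep\<^esub> = 0" "v \<oplus>\<^bsub>triv_rep\<^esub> w = v + w" "c \<odot>\<^bsub>triv_rep\<^esub> v = c * v" "act triv_rep x v = 0"
  by (simp_all add: triv_rep_def)

lemma cmodule_triv_rep: "cmodule triv_rep"
  unfolding cmodule_iff by (rule module_direct) (auto simp: algebra_simps)

lemma act_linear_triv_rep: "act_linear triv_rep x"
  by (simp add: act_linear_def lin_map_def)

lemma all_wt_triv_rep: "0 \<le> \<rho> ==> all_wt triv_rep x \<rho>"
proof -
  assume "0 \<le> \<rho>"
  interpret endo triv_rep "act triv_rep x"
    using act_linear_triv_rep[of x] cmodule_triv_rep by (simp add: endo_def endo_axioms_def act_linear_def)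
  have "v \<in> wt_space triv_rep (act triv_rep x) \<rho>" for v
    by (rule wt_space_eigenvector[of _ 0]) (use \<open>0 \<le> \<rho>\<close> in auto)
  then show ?thesis using act_linear_triv_rep cmodule_triv_rep by (auto simp: all_wt_def)
qed

text \<open>Coordinate 0 lies below \<open>d\<close> and is never moved, so its letter can carry the
  trivial module while all other letters go to 0.\<close>

lemma letters_triv_rep:
  assumes "0 < d"
  shows "letters d nb 1 triv_rep (\<lambda>(\<kappa>, u). if u = 0 then 1 else 0)"
proof -
  interpret cmodule triv_rep by (rule cmodule_triv_rep)
  have span: "spanned triv_rep ((\<lambda>(\<kappa>, u). if u = 0 then 1 else 0) ` ({..<1 :: nat} \<times> {..<d + 2 * nb}))"
    unfolding spanned_def
  proof (intro allI impI subsetI)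
    fix S v assume S: "submodule S \<complex> triv_rep" and B: "(\<lambda>(\<kappa>, u). if u = 0 then 1 else 0) ` ({..<1 :: nat} \<times> {..<d + 2 * nb}) \<subseteq> S"
    have "(0, 0) \<in> {..<1 :: nat} \<times> {..<d + 2 * nb}" using assms by simp
    then have "1 \<in> S" using B by (force simp: image_subset_iff)
    from submodule_scale[OF S this, of v] show "v \<in> S" by simp
  qed
  have "sg d i j 0 = 0" for i j using assms by (simp add: sg_def)
  moreover have "sw d i j u \<noteq> 0" if "u \<noteq> 0" for i j u using assms that by (auto simp: sw_def)
  ultimately have sw0: "sw d i j u = 0 \<longleftrightarrow> u = 0" "sg d i j 0 = 0" for i j u
    using assms by (auto simp: sw_def)
  show ?thesis
    unfolding letters_def using span cmodule_triv_rep act_linear_triv_rep by (auto simp: sw0)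
qed

lemma power_rep_simps [simp]:
  "carrier (power_rep M a) = {..<a} \<rightarrow>\<^sub>E carrier M" "\<zero>\<^bsub>power_rep M a\<^esub> = (\<lambda>i\<in>{..<a}. \<zero>\<^bsub>M\<^esub>)"
  "f \<oplus>\<^bsub>power_rep M a\<^esub> g = (\<lambda>i\<in>{..<a}. f i \<oplus>\<^bsub>M\<^esub> g i)" "c \<odot>\<^bsub>power_rep M a\<^esub> f = (\<lambda>i\<in>{..<a}. c \<odot>\<^bsub>M\<^esub> f i)"
  "act (power_rep M a) x f = (\<lambda>i\<in>{..<a}. act M x (f i))"
  by (simp_all add: power_rep_def)

lemma cmodule_power_rep:
  assumes "cmodule M"
  shows "cmodule (power_rep M a)"
  unfolding cmodule_iff
proof -
  interpret cmodule M by fact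
  show "module \<complex> (power_rep M a)"
    by (rule module_direct)
      (auto simp: PiE_iff extensional_def fun_eq_iff restrict_def a_ac scale_add_left scale_add_right scale_scale
        neg_eq_scale[symmetric] l_neg r_neg)
qed

lemma act_linear_power_rep:
  assumes "act_linear M x"
  shows "act_linear (power_rep M a) x"
proof -
  have l: "lin_map M M (act M x)" using assms by (simp add: act_linear_def)
  show ?thesis unfolding act_linear_def lin_map_def
  proof (intro conjI ballI allI funcsetI)
    fix f assume f: "f \<in> carrier (power_rep M a)"
    then have fm: "f i \<in> carrier M" if "i < a" for i using that by auto
    show "act (power_rep M a) x f \<in> carrier (power_rep M a)"
      using lin_map_closed[OF l fm] by auto
    show "act (power_rep M a) x (c \<odot>\<^bsub>power_rep M a\<^esub> f) = c \<odot>\<^bsub>power_rep M a\<^esub> act (power_rep M a) x f" for c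
      by (rule ext) (simp add: restrict_def lin_map_scale[OF l fm])
    fix g assume g: "g \<in> carrier (power_rep M a)"
    then have gm: "g i \<in> carrier M" if "i < a" for i using that by auto
    show "act (power_rep M a) x (f \<oplus>\<^bsub>power_rep M a\<^esub> g) = act (power_rep M a) x f \<oplus>\<^bsub>power_rep M a\<^esub> act (power_rep M a) x g"
      by (rule ext) (simp add: restrict_def lin_map_add[OF l fm gm])
  qed
qed

definition pin :: "nat => 'v rep => nat => 'v => nat => 'v" where
  "pin a M k v = (\<lambda>i\<in>{..<a}. if i = k then v else \<zero>\<^bsub>M\<^esub>)"

lemma lin_map_pin: "cmodule M ==> lin_map M (power_rep M a) (pin a M k)"
proof -
  assume "cmodule M"
  then interpret cmodule M .
  show ?thesis
    unfolding lin_map_def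
  proof (intro conjI ballI allI funcsetI)
    show "pin a M k v \<in> carrier (power_rep M a)" if "v \<in> carrier M" for v
      using that by (auto simp: pin_def)
    show "pin a M k (v \<oplus>\<^bsub>M\<^esub> w) = pin a M k v \<oplus>\<^bsub>power_rep M a\<^esub> pin a M k w" for v w
      by (rule ext) (simp add: pin_def restrict_def)
    show "pin a M k (c \<odot>\<^bsub>M\<^esub> v) = c \<odot>\<^bsub>power_rep M a\<^esub> pin a M k v" for c v
      by (rule ext) (simp add: pin_def restrict_def)
  qed
qed

lemma pin_act:
  assumes "cmodule M" "act_linear M x"
  shows "pin a M k (act M x v) = act (power_rep M a) x (pin a M k v)"
proof -
  have "act M x \<zero>\<^bsub>M\<^esub> = \<zero>\<^bsub>M\<^esub>"
    by (rule lin_map_zero[OF assms(1,1)]) (use assms(2) in \<open>simp add: act_linear_def\<close>)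
  then show ?thesis by (intro ext) (simp add: pin_def restrict_def)
qed

lemma power_rep_spanned:
  assumes M: "cmodule M" and B: "spanned M B" "B \<subseteq> carrier M"
  shows "spanned (power_rep M a) (\<Union>k<a. pin a M k ` B)"
  unfolding spanned_def
proof (intro allI impI subsetI)
  interpret M: cmodule M by fact
  interpret P: cmodule "power_rep M a" by (rule cmodule_power_rep[OF M])
  fix S f assume S: "submodule S \<complex> (power_rep M a)" and BS: "(\<Union>k<a. pin a M k ` B) \<subseteq> S"
    and f: "f \<in> carrier (power_rep M a)"
  have pinS: "pin a M k v \<in> S" if k: "k < a" and v: "v \<in> carrier M" for k v
  proof -
    have "submodule {v \<in> carrier M. pin a M k v \<in> S} \<complex> M"
      by (rule M.submodule_vimage[OF P.cmodule_axioms lin_map_pin[OF M] S])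
    then have "carrier M \<subseteq> {v \<in> carrier M. pin a M k v \<in> S}"
      using B BS k unfolding spanned_def by blast
    then show ?thesis using v by blast
  qed
  have "(\<lambda>i\<in>{..<a}. if i < m then f i else \<zero>\<^bsub>M\<^esub>) \<in> S" if "m \<le> a" for m
    using that
  proof (induction m)
    case 0
    then show ?case using P.submodule_zero_mem[OF S] by (simp add: restrict_def)
  next
    case (Suc m)
    have fm: "f i \<in> carrier M" if "i < a" for i using f that by auto
    have eq: "(\<lambda>i\<in>{..<a}. if i < Suc m then f i else \<zero>\<^bsub>M\<^esub>)
        = (\<lambda>i\<in>{..<a}. if i < m then f i else \<zero>\<^bsub>M\<^esub>) \<oplus>\<^bsub>power_rep M a\<^esub> pin a M m (f m)"
      using fm Suc.prems by (auto simp: pin_def fun_eq_iff restrict_def less_Suc_eq)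
    have "pin a M m (f m) \<in> S" using pinS[OF _ fm, of m m] Suc.prems by simp
    then show ?case unfolding eq
      by (intro P.submodule_add[OF S] Suc.IH) (use Suc.prems in simp)
  qed
  from this[OF order_refl] have "(\<lambda>i\<in>{..<a}. if i < a then f i else \<zero>\<^bsub>M\<^esub>) \<in> S" .
  moreover have "(\<lambda>i\<in>{..<a}. if i < a then f i else \<zero>\<^bsub>M\<^esub>) = f"
  proof
    fix i
    have "f i = undefined" if "i \<notin> {..<a}" using f that PiE_arb[of f "{..<a}" "\<lambda>_. carrier M" i] by simp
    then show "(\<lambda>i\<in>{..<a}. if i < a then f i else \<zero>\<^bsub>M\<^esub>) i = f i" by (cases "i < a") simp_all
  qed
  ultimately show "f \<in> S" by metis
qed

lemma lettersD:
  assumes "letters d nb c M \<beta>"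
  shows letters_cmodule: "cmodule M"
    and letters_closed: "\<kappa> < c ==> u < d + 2 * nb ==> \<beta> (\<kappa>, u) \<in> carrier M"
    and letters_spanned: "spanned M (\<beta> ` ({..<c} \<times> {..<d + 2 * nb}))"
    and letters_act_linear: "i < nb ==> j < nb ==> i \<noteq> j ==> act_linear M (rot d i j)"
    and letters_act: "i < nb ==> j < nb ==> i \<noteq> j ==> \<kappa> < c ==> u < d + 2 * nb ==>
      act M (rot d i j) (\<beta> (\<kappa>, u)) = (- sg d i j u) \<odot>\<^bsub>M\<^esub> \<beta> (\<kappa>, sw d i j u)"
proof -
  note D = assms[unfolded letters_def]
  note D3 = D[THEN conjunct2, THEN conjunct2, THEN conjunct2, rule_format]
  show "cmodule M" by (rule D[THEN conjunct1])
  show "\<kappa> < c ==> u < d + 2 * nb ==> \<beta> (\<kappa>, u) \<in> carrier M"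
    by (rule D[THEN conjunct2, THEN conjunct1, rule_format])
  show "spanned M (\<beta> ` ({..<c} \<times> {..<d + 2 * nb}))"
    by (rule D[THEN conjunct2, THEN conjunct2, THEN conjunct1])
  show "i < nb ==> j < nb ==> i \<noteq> j ==> act_linear M (rot d i j)"
    by (rule D3[THEN conjunct1])
  show "i < nb ==> j < nb ==> i \<noteq> j ==> \<kappa> < c ==> u < d + 2 * nb ==>
      act M (rot d i j) (\<beta> (\<kappa>, u)) = (- sg d i j u) \<odot>\<^bsub>M\<^esub> \<beta> (\<kappa>, sw d i j u)"
    by (rule D3[THEN conjunct2, rule_format])
qed

lemma letters_power_rep:
  assumes L: "letters d nb 1 M \<beta>"
  shows "letters d nb a (power_rep M a) (\<lambda>(\<kappa>, u). pin a M \<kappa> (\<beta> (0, u)))"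
  unfolding letters_def prod.case
proof (intro conjI allI impI)
  note M = letters_cmodule[OF L]
  let ?D = "d + 2 * nb"
  have z1: "0 < (1 :: nat)" by simp
  have B1: "\<beta> ` ({..<1} \<times> {..<?D}) = (\<lambda>u. \<beta> (0, u)) ` {..<?D}" by force
  have B: "(\<lambda>u. \<beta> (0, u)) ` {..<?D} \<subseteq> carrier M" using letters_closed[OF L z1] by blast
  have "spanned (power_rep M a) (\<Union>k<a. pin a M k ` (\<lambda>u. \<beta> (0, u)) ` {..<?D})"
    by (rule power_rep_spanned[OF M letters_spanned[OF L, unfolded B1] B])
  moreover have "(\<Union>k<a. pin a M k ` (\<lambda>u. \<beta> (0, u)) ` {..<?D})
      = (\<lambda>(\<kappa>, u). pin a M \<kappa> (\<beta> (0, u))) ` ({..<a} \<times> {..<?D})"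
    unfolding image_image by fast
  ultimately show "spanned (power_rep M a) ((\<lambda>(\<kappa>, u). pin a M \<kappa> (\<beta> (0, u))) ` ({..<a} \<times> {..<?D}))"
    by (simp only:)
  show "cmodule (power_rep M a)" by (rule cmodule_power_rep[OF M])
  show "pin a M \<kappa> (\<beta> (0, u)) \<in> carrier (power_rep M a)" if "u < ?D" for \<kappa> u
    by (rule lin_map_closed[OF lin_map_pin[OF M] letters_closed[OF L z1 that]])
  fix i j assume ij: "i < nb" "j < nb" "i \<noteq> j"
  show "act_linear (power_rep M a) (rot d i j)"
    by (rule act_linear_power_rep[OF letters_act_linear[OF L ij]])
  fix \<kappa> u assume "\<kappa> < a" and u: "u < ?D"
  have "act (power_rep M a) (rot d i j) (pin a M \<kappa> (\<beta> (0, u))) = pin a M \<kappa> (act M (rot d i j) (\<beta> (0, u)))"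
    by (rule pin_act[OF M letters_act_linear[OF L ij], symmetric])
  also have "\<dots> = (- sg d i j u) \<odot>\<^bsub>power_rep M a\<^esub> pin a M \<kappa> (\<beta> (0, sw d i j u))"
    unfolding letters_act[OF L ij z1 u]
    by (rule lin_map_scale[OF lin_map_pin[OF M] letters_closed[OF L z1 sw_less[OF u ij(1,2)]]])
  finally show "act (power_rep M a) (rot d i j) (pin a M \<kappa> (\<beta> (0, u)))
      = (- sg d i j u) \<odot>\<^bsub>power_rep M a\<^esub> pin a M \<kappa> (\<beta> (0, sw d i j u))" .
qed

lemma all_wt_spanned:
  assumes M: "cmodule M" and x: "act_linear M x" and B: "spanned M B" "B \<subseteq> wt_space M (act M x) \<rho>"
  shows "all_wt M x \<rho>"
proof -
  interpret endo M "act M x" using M x by (simp add: endo_def endo_axioms_def act_linear_def)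
  show ?thesis using M x B submodule_wt_space unfolding all_wt_def spanned_def by blast
qed

lemma all_wt_power_rep:
  assumes M: "all_wt M x \<rho>"
  shows "all_wt (power_rep M a) x \<rho>"
proof (rule all_wt_spanned)
  have cM: "cmodule M" and x: "act_linear M x" using M by (auto simp: all_wt_def)
  show "cmodule (power_rep M a)" "act_linear (power_rep M a) x"
    by (rule cmodule_power_rep[OF cM], rule act_linear_power_rep[OF x])
  then have e: "endo (power_rep M a) (act (power_rep M a) x)" by (simp add: endo_def endo_axioms_def act_linear_def)
  show "spanned (power_rep M a) (\<Union>k<a. pin a M k ` carrier M)"
    by (rule power_rep_spanned[OF cM]) (auto simp: spanned_def)
  show "(\<Union>k<a. pin a M k ` carrier M) \<subseteq> wt_space (power_rep M a) (act (power_rep M a) x) \<rho>"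
  proof
    fix f assume "f \<in> (\<Union>k<a. pin a M k ` carrier M)"
    then obtain k v where kv: "v \<in> carrier M" "f = pin a M k v" by blast
    then have "v \<in> wt_space M (act M x) \<rho>" using M by (auto simp: all_wt_def)
    then show "f \<in> wt_space (power_rep M a) (act (power_rep M a) x) \<rho>" unfolding kv(2)
      using wt_space_equivariant[where \<phi> = "pin a M k", OF all_wt_endo[OF M] e lin_map_pin[OF cM]]
        pin_act[OF cM x] by blast
  qed
qed

lemma dsum_rep_simps [simp]:
  "carrier (dsum_rep M N) = carrier M \<times> carrier N" "\<zero>\<^bsub>dsum_rep M N\<^esub> = (\<zero>\<^bsub>M\<^esub>, \<zero>\<^bsub>N\<^esub>)"
  "u \<oplus>\<^bsub>dsum_rep M N\<^esub> v = (fst u \<oplus>\<^bsub>M\<^esub> fst v, snd u \<oplus>\<^bsub>N\<^esub> snd v)"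
  "c \<odot>\<^bsub>dsum_rep M N\<^esub> u = (c \<odot>\<^bsub>M\<^esub> fst u, c \<odot>\<^bsub>N\<^esub> snd u)" "act (dsum_rep M N) x u = (act M x (fst u), act N x (snd u))"
  by (simp_all add: dsum_rep_def)

lemma cmodule_dsum_rep:
  assumes "cmodule M" "cmodule N"
  shows "cmodule (dsum_rep M N)"
  unfolding cmodule_iff
proof -
  interpret M: cmodule M by fact
  interpret N: cmodule N by fact
  show "module \<complex> (dsum_rep M N)"
    by (rule module_direct)
      (auto simp: M.a_ac N.a_ac M.scale_add_left N.scale_add_left M.scale_add_right N.scale_add_right
        M.scale_scale N.scale_scale M.neg_eq_scale[symmetric] N.neg_eq_scale[symmetric] M.l_neg N.l_neg M.r_neg N.r_neg)
qed

lemma act_linear_dsum_rep: "act_linear M x ==> act_linear N x ==> act_linear (dsum_rep M N) x"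
  by (auto simp: act_linear_def lin_map_def Pi_iff)

lemma dsum_spanned:
  assumes M: "cmodule M" and N: "cmodule N" and A: "spanned M A" "A \<subseteq> carrier M" and B: "spanned N B" "B \<subseteq> carrier N"
  shows "spanned (dsum_rep M N) ((\<lambda>v. (v, \<zero>\<^bsub>N\<^esub>)) ` A \<union> (\<lambda>w. (\<zero>\<^bsub>M\<^esub>, w)) ` B)"
  unfolding spanned_def
proof (intro allI impI subsetI)
  interpret M: cmodule M by fact
  interpret N: cmodule N by fact
  interpret D: cmodule "dsum_rep M N" by (rule cmodule_dsum_rep[OF M N])
  have l: "lin_map M (dsum_rep M N) (\<lambda>v. (v, \<zero>\<^bsub>N\<^esub>))" "lin_map N (dsum_rep M N) (\<lambda>w. (\<zero>\<^bsub>M\<^esub>, w))"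
    by (auto simp: lin_map_def)
  fix S p assume S: "submodule S \<complex> (dsum_rep M N)" and sub: "(\<lambda>v. (v, \<zero>\<^bsub>N\<^esub>)) ` A \<union> (\<lambda>w. (\<zero>\<^bsub>M\<^esub>, w)) ` B \<subseteq> S"
    and p: "p \<in> carrier (dsum_rep M N)"
  have "carrier M \<subseteq> {v \<in> carrier M. (v, \<zero>\<^bsub>N\<^esub>) \<in> S}"
    using A sub M.submodule_vimage[OF D.cmodule_axioms l(1) S] unfolding spanned_def by blast
  moreover have "carrier N \<subseteq> {w \<in> carrier N. (\<zero>\<^bsub>M\<^esub>, w) \<in> S}"
    using B sub N.submodule_vimage[OF D.cmodule_axioms l(2) S] unfolding spanned_def by blast
  ultimately have "(fst p, \<zero>\<^bsub>N\<^esub>) \<in> S" "(\<zero>\<^bsub>M\<^esub>, snd p) \<in> S" using p by auto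
  from D.submodule_add[OF S this] show "p \<in> S" using p by auto
qed

lemma letters_dsum_rep:
  assumes M: "letters d nb a M \<alpha>" and N: "letters d nb b N \<beta>"
  shows "letters d nb (a + b) (dsum_rep M N)
    (\<lambda>(\<kappa>, u). if \<kappa> < a then (\<alpha> (\<kappa>, u), \<zero>\<^bsub>N\<^esub>) else (\<zero>\<^bsub>M\<^esub>, \<beta> (\<kappa> - a, u)))" (is "letters d nb _ _ ?\<gamma>")
proof -
  let ?D = "d + 2 * nb"
  have cM: "cmodule M" and cN: "cmodule N" using M N by (auto simp: letters_def)
  interpret M: cmodule M by (rule cM)
  interpret N: cmodule N by (rule cN)
  have "?\<gamma> ` ({..<a + b} \<times> {..<?D}) = (\<lambda>v. (v, \<zero>\<^bsub>N\<^esub>)) ` \<alpha> ` ({..<a} \<times> {..<?D}) \<union> (\<lambda>w. (\<zero>\<^bsub>M\<^esub>, w)) ` \<beta> ` ({..<b} \<times> {..<?D})"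
    (is "?L = ?R")
  proof
    show "?L \<subseteq> ?R" by (auto split: if_splits)
    show "?R \<subseteq> ?L"
    proof
      fix p assume "p \<in> ?R"
      then consider \<kappa> u where "\<kappa> < a" "u < ?D" "p = (\<alpha> (\<kappa>, u), \<zero>\<^bsub>N\<^esub>)"
        | \<kappa> u where "\<kappa> < b" "u < ?D" "p = (\<zero>\<^bsub>M\<^esub>, \<beta> (\<kappa>, u))" by auto
      then show "p \<in> ?L"
      proof cases
        case 1 then show ?thesis by (intro image_eqI[of _ _ "(\<kappa>, u)"]) auto
      next
        case 2 then show ?thesis by (intro image_eqI[of _ _ "(a + \<kappa>, u)"]) auto
      qed
    qed
  qed
  moreover have "spanned (dsum_rep M N) ((\<lambda>v. (v, \<zero>\<^bsub>N\<^esub>)) ` \<alpha> ` ({..<a} \<times> {..<?D}) \<union> (\<lambda>w. (\<zero>\<^bsub>M\<^esub>, w)) ` \<beta> ` ({..<b} \<times> {..<?D}))"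
    using letters_closed[OF M] letters_closed[OF N]
    by (intro dsum_spanned[OF cM cN letters_spanned[OF M] _ letters_spanned[OF N]]) auto
  ultimately have span: "spanned (dsum_rep M N) (?\<gamma> ` ({..<a + b} \<times> {..<?D}))" by (simp only:)
  show ?thesis
    unfolding letters_def
  proof (intro conjI allI impI)
    show "cmodule (dsum_rep M N)" by (rule cmodule_dsum_rep[OF cM cN])
    show "spanned (dsum_rep M N) (?\<gamma> ` ({..<a + b} \<times> {..<?D}))" by (rule span)
    show "?\<gamma> (\<kappa>, u) \<in> carrier (dsum_rep M N)" if "\<kappa> < a + b" "u < ?D" for \<kappa> u
      using that letters_closed[OF M, of \<kappa> u] letters_closed[OF N, of "\<kappa> - a" u] by simp
    fix i j assume ij: "i < nb" "j < nb" "i \<noteq> j"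
    show "act_linear (dsum_rep M N) (rot d i j)"
      by (rule act_linear_dsum_rep[OF letters_act_linear[OF M ij] letters_act_linear[OF N ij]])
    have z: "act M (rot d i j) \<zero>\<^bsub>M\<^esub> = \<zero>\<^bsub>M\<^esub>" "act N (rot d i j) \<zero>\<^bsub>N\<^esub> = \<zero>\<^bsub>N\<^esub>"
      using letters_act_linear[OF M ij] letters_act_linear[OF N ij] lin_map_zero[OF cM cM] lin_map_zero[OF cN cN]
      by (simp_all add: act_linear_def)
    show "act (dsum_rep M N) (rot d i j) (?\<gamma> (\<kappa>, u)) = (- sg d i j u) \<odot>\<^bsub>dsum_rep M N\<^esub> ?\<gamma> (\<kappa>, sw d i j u)"
      if "\<kappa> < a + b" "u < ?D" for \<kappa> u
      using that letters_act[OF M ij, of \<kappa> u] letters_act[OF N ij, of "\<kappa> - a" u] by (simp add: z)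
  qed
qed

lemma all_wt_dsum_rep:
  assumes M: "all_wt M x \<rho>" and N: "all_wt N x \<rho>"
  shows "all_wt (dsum_rep M N) x \<rho>"
proof (rule all_wt_spanned)
  have cM: "cmodule M" and cN: "cmodule N" and x: "act_linear M x" "act_linear N x" using M N by (auto simp: all_wt_def)
  interpret M: cmodule M by (rule cM)
  interpret N: cmodule N by (rule cN)
  show c: "cmodule (dsum_rep M N)" by (rule cmodule_dsum_rep[OF cM cN])
  show a: "act_linear (dsum_rep M N) x" by (rule act_linear_dsum_rep[OF x])
  from c a have e: "endo (dsum_rep M N) (act (dsum_rep M N) x)" by (simp add: endo_def endo_axioms_def act_linear_def)
  have l: "lin_map M (dsum_rep M N) (\<lambda>v. (v, \<zero>\<^bsub>N\<^esub>))" "lin_map N (dsum_rep M N) (\<lambda>w. (\<zero>\<^bsub>M\<^esub>, w))"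
    by (auto simp: lin_map_def)
  have z: "act M x \<zero>\<^bsub>M\<^esub> = \<zero>\<^bsub>M\<^esub>" "act N x \<zero>\<^bsub>N\<^esub> = \<zero>\<^bsub>N\<^esub>"
    using x lin_map_zero[OF cM cM] lin_map_zero[OF cN cN] by (auto simp: act_linear_def)
  show "spanned (dsum_rep M N) ((\<lambda>v. (v, \<zero>\<^bsub>N\<^esub>)) ` carrier M \<union> (\<lambda>w. (\<zero>\<^bsub>M\<^esub>, w)) ` carrier N)"
    by (rule dsum_spanned[OF cM cN]) (auto simp: spanned_def)
  have "(v, \<zero>\<^bsub>N\<^esub>) \<in> wt_space (dsum_rep M N) (act (dsum_rep M N) x) \<rho>" if "v \<in> carrier M" for v
    by (rule wt_space_equivariant[where \<phi> = "\<lambda>v. (v, \<zero>\<^bsub>N\<^esub>)", OF all_wt_endo[OF M] e l(1)])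
      (use M that z in \<open>auto simp: all_wt_def\<close>)
  moreover have "(\<zero>\<^bsub>M\<^esub>, w) \<in> wt_space (dsum_rep M N) (act (dsum_rep M N) x) \<rho>" if "w \<in> carrier N" for w
    by (rule wt_space_equivariant[where \<phi> = "\<lambda>w. (\<zero>\<^bsub>M\<^esub>, w)", OF all_wt_endo[OF N] e l(2)])
      (use N that z in \<open>auto simp: all_wt_def\<close>)
  ultimately show "(\<lambda>v. (v, \<zero>\<^bsub>N\<^esub>)) ` carrier M \<union> (\<lambda>w. (\<zero>\<^bsub>M\<^esub>, w)) ` carrier N \<subseteq> wt_space (dsum_rep M N) (act (dsum_rep M N) x) \<rho>"
    by blast
qed

theorem mixed_tensors_word_map:
  assumes "0 < d"
  shows "\<exists>\<Phi>. word_map d nb (a + (b + c)) l (mixed_tensors (d + 2 * nb) l a b c) \<Phi> \<and>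
    word_im d nb (a + (b + c)) l \<Phi> = carrier (mixed_tensors (d + 2 * nb) l a b c)"
proof -
  define W where "W = dsum_rep (power_rep (nat_rep (d + 2 * nb)) a)
    (dsum_rep (power_rep (dual_rep (nat_rep (d + 2 * nb))) b) (power_rep triv_rep c))"
  have "\<exists>\<beta>. letters d nb (a + (b + c)) W \<beta>"
    unfolding W_def
    using letters_dsum_rep[OF letters_power_rep[OF letters_nat_rep]
        letters_dsum_rep[OF letters_power_rep[OF letters_dual_nat_rep] letters_power_rep[OF letters_triv_rep[OF assms]]]]
    by blast
  then obtain \<beta> where \<beta>: "letters d nb (a + (b + c)) W \<beta>" by blast
  then interpret tensor W l by (simp add: tensor_def letters_def)
  show ?thesis
    unfolding mixed_tensors_def W_def[symmetric]
    by (rule word_map_tensor[of "a + (b + c)" d nb \<beta>]) (use \<beta> in \<open>auto simp: letters_def\<close>)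
qed

lemma cmodule_mixed_tensors: "cmodule (mixed_tensors D l a b c)"
proof -
  define W where "W = dsum_rep (power_rep (nat_rep D) a) (dsum_rep (power_rep (dual_rep (nat_rep D)) b) (power_rep triv_rep c))"
  have "cmodule W" unfolding W_def
    by (intro cmodule_dsum_rep cmodule_power_rep cmodule_dual_rep cmodule_nat_rep cmodule_triv_rep)
  then interpret tensor W l by (simp add: tensor_def)
  show ?thesis unfolding mixed_tensors_def W_def[symmetric] by (rule cmodule_T)
qed

text \<open>Uniformity in \<open>D\<close> is the point: it later gives one bound for the weights of
  \<open>E\<close> on all its levels.\<close>

theorem all_wt_mixed_tensors:
  assumes x: "x \<in> gl d"
  shows "\<exists>\<rho>. \<forall>D\<ge>d. all_wt (mixed_tensors D l a b c) x \<rho>"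
proof -
  obtain \<rho>1 where \<rho>1: "0 \<le> \<rho>1" "!!D. d \<le> D ==> all_wt (nat_rep D) x \<rho>1"
    using all_wt_nat_rep[OF x] by blast
  obtain \<rho>2 where \<rho>2: "0 \<le> \<rho>2" "!!D. d \<le> D ==> all_wt (dual_rep (nat_rep D)) x \<rho>2"
    using all_wt_dual_nat_rep[OF x] by blast
  define \<rho> where "\<rho> = max \<rho>1 \<rho>2"
  have "all_wt (mixed_tensors D l a b c) x (real l * \<rho>)" if D: "d \<le> D" for D
  proof -
    define W where "W = dsum_rep (power_rep (nat_rep D) a) (dsum_rep (power_rep (dual_rep (nat_rep D)) b) (power_rep triv_rep c))"
    have W: "all_wt W x \<rho>"
      unfolding W_def
      by (intro all_wt_dsum_rep all_wt_power_rep all_wt_mono[OF \<rho>1(2)[OF D]] all_wt_mono[OF \<rho>2(2)[OF D]] all_wt_triv_rep)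
        (use \<rho>1(1) in \<open>auto simp: \<rho>_def\<close>)
    then interpret tensor W l by (simp add: tensor_def all_wt_def)
    have "act_linear W x" "carrier W \<subseteq> wt_space W (act W x) \<rho>" using W by (auto simp: all_wt_def)
    then show ?thesis
      unfolding mixed_tensors_def W_def[symmetric] all_wt_def
      using cmodule_T act_linear_T wt_space_tensor by blast
  qed
  then show ?thesis by blast
qed

section \<open>Universal enveloping algebras\<close>

text \<open>With concatenation as addition of exponents, the convolution product of
  \<open>poly_mapping\<close> is the product of the free algebra, and its ring laws become
  available.\<close>

instantiation list :: (type) monoid_add
begin
definition zero_list :: "'a list" where "zero_list = []"
definition plus_list :: "'a list => 'a list => 'a list" where "plus_list = (@)"
instance by standard (simp_all add: zero_list_def plus_list_def)
end

lemma lin_ext_single [simp]: "lin_ext (\<lambda>w. single w 1) f = f"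
proof -
  have "lookup (\<Sum>w\<in>A. pm_scale (lookup f w) (single w 1)) v
      = (\<Sum>w\<in>A. lookup f w when w = v)" for A v
    by (induction A rule: infinite_finite_induct) (simp_all add: lookup_add lookup_single)
  then show ?thesis
    by (simp add: poly_mapping_eq_iff fun_eq_iff lin_ext_def when_def in_keys_iff)
qed

lemma sum_single: "(\<Sum>w\<in>keys f. single w (lookup f w)) = f"
  for f :: "'x \<Rightarrow>\<^sub>0 complex"
  using lin_ext_single[of f] unfolding lin_ext_def by simp

lemma lin_ext_fun:
  "lin_ext (\<lambda>w. \<psi> w - \<chi> w) f = lin_ext \<psi> f - lin_ext \<chi> f"
  "lin_ext (\<lambda>w. \<psi> w + \<chi> w) f = lin_ext \<psi> f + lin_ext \<chi> f"
  "lin_ext (\<lambda>w. pm_scale c (\<psi> w)) f = pm_scale c (lin_ext \<psi> f)"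
  by (simp_all add: lin_ext_def pm_scale_linear sum_subtractf sum.distrib pm_scale_sum mult.commute)

lemma lin_ext_sum: "lin_ext \<psi> (\<Sum>i\<in>I. f i) = (\<Sum>i\<in>I. lin_ext \<psi> (f i))"
  by (induction I rule: infinite_finite_induct) (simp_all add: lin_ext_simps)

lemma lin_ext_comp: "lin_ext \<psi> (lin_ext \<chi> f) = lin_ext (\<lambda>w. lin_ext \<psi> (\<chi> w)) f"
  by (simp add: lin_ext_def[of \<chi>] lin_ext_sum lin_ext_simps lin_ext_def[of "\<lambda>w. lin_ext \<psi> (\<chi> w)"])

lemma lin_ext_mem:
  assumes S: "submodule S \<complex> (free_rep Z \<phi>)" and "!!w. w \<in> Y ==> \<psi> w \<in> S" "keys f \<subseteq> Y"
  shows "lin_ext \<psi> f \<in> S"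
  unfolding lin_ext_def
  by (rule submodule_free_rep_sum[OF S]) (use assms S[unfolded submodule_free_rep_iff] in blast)

lemma lin_map_free_eq:
  assumes M: "cmodule M" and \<alpha>: "lin_map (free_rep Y \<phi>) M \<alpha>" and \<beta>: "lin_map (free_rep Y \<phi>) M \<beta>"
    and eq: "!!w. w \<in> Y ==> \<alpha> (single w 1) = \<beta> (single w 1)"
    and f: "keys f \<subseteq> Y"
  shows "\<alpha> f = \<beta> f"
proof -
  let ?F = "free_rep Y \<phi>"
  interpret F: cmodule ?F by (rule cmodule_free_rep)
  have "submodule {f \<in> carrier ?F. \<alpha> f = \<beta> f} \<complex> ?F"
    unfolding F.submodule_iff
  proof (intro conjI ballI allI)
    show "\<zero>\<^bsub>?F\<^esub> \<in> {f \<in> carrier ?F. \<alpha> f = \<beta> f}"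
      using lin_map_zero[OF F.cmodule_axioms M \<alpha>] lin_map_zero[OF F.cmodule_axioms M \<beta>] F.zero_closed by simp
    fix f assume f: "f \<in> {f \<in> carrier ?F. \<alpha> f = \<beta> f}"
    then have fc: "f \<in> carrier ?F" "\<alpha> f = \<beta> f" by blast+
    show "c \<odot>\<^bsub>?F\<^esub> f \<in> {f \<in> carrier ?F. \<alpha> f = \<beta> f}" for c
      using F.scale_closed[OF fc(1), of c] lin_map_scale[OF \<alpha> fc(1)] lin_map_scale[OF \<beta> fc(1)] fc(2) by simp
    fix g assume "g \<in> {f \<in> carrier ?F. \<alpha> f = \<beta> f}"
    then have gc: "g \<in> carrier ?F" "\<alpha> g = \<beta> g" by blast+
    show "f \<oplus>\<^bsub>?F\<^esub> g \<in> {f \<in> carrier ?F. \<alpha> f = \<beta> f}"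
      using F.a_closed[OF fc(1) gc(1)] lin_map_add[OF \<alpha> fc(1) gc(1)] lin_map_add[OF \<beta> fc(1) gc(1)] fc(2) gc(2) by simp
  qed blast
  from free_rep_spanned[OF this _ f] show ?thesis using eq by simp
qed

lemma free_alg_simps [simp]:
  "carrier (free_alg L) = {f. keys f \<subseteq> lists L}" "\<zero>\<^bsub>free_alg L\<^esub> = 0" "f \<oplus>\<^bsub>free_alg L\<^esub> g = f + g"
  "\<one>\<^bsub>free_alg L\<^esub> = single [] 1" "f \<otimes>\<^bsub>free_alg L\<^esub> g = f * g"
proof -
  have "(\<Sum>u\<in>keys f. \<Sum>v\<in>keys g.
      single (u @ v) (lookup f u * lookup g v)) = f * g"
  proof -
    have "f * g = (\<Sum>u\<in>keys f. single u (lookup f u))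
        * (\<Sum>v\<in>keys g. single v (lookup g v))"
      by (simp only: sum_single)
    also have "\<dots> = (\<Sum>u\<in>keys f. \<Sum>v\<in>keys g.
        single (u @ v) (lookup f u * lookup g v))"
      by (simp add: sum_product mult_single plus_list_def)
    finally show ?thesis ..
  qed
  then show "f \<otimes>\<^bsub>free_alg L\<^esub> g = f * g" by (simp add: free_alg_def)
qed (simp_all add: free_alg_def)

lemma single_Nil_eq_one: "single [] (1 :: complex) = (1 :: mat list \<Rightarrow>\<^sub>0 complex)"
  using single_one[where ?'a = "mat list" and ?'b = complex] by (simp add: zero_list_def)

text \<open>Scaling is multiplication by a multiple of the empty word, so ideals of the free algebra
  are subspaces.\<close>

lemma pm_scale_mult: "pm_scale c f = single [] c * f" for f :: "mat list \<Rightarrow>\<^sub>0 complex"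
proof -
  have "single [] c * f = (\<Sum>w\<in>keys f. single [] c * single w (lookup f w))"
    by (subst sum_single[symmetric, of f]) (simp only: sum_distrib_left)
  also have "\<dots> = pm_scale c f"
    by (subst (2) sum_single[symmetric, of f]) (simp add: mult_single plus_list_def pm_scale_sum)
  finally show ?thesis ..
qed

lemma pm_scale_mult_right: "f * pm_scale c g = pm_scale c (f * g)" "pm_scale c f * g = pm_scale c (f * g)"
  for f g :: "mat list \<Rightarrow>\<^sub>0 complex"
proof -
  show "pm_scale c f * g = pm_scale c (f * g)" by (simp add: pm_scale_mult mult.assoc)
  have "single w a * single [] c = single [] c * single w a" for w :: "mat list" and a
    by (simp add: mult_single plus_list_def mult.commute)
  then have "f * single [] c = single [] c * f"
    by (subst (1 2) sum_single[symmetric, of f]) (simp only: sum_distrib_left sum_distrib_right)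
  then show "f * pm_scale c g = pm_scale c (f * g)" by (simp only: pm_scale_mult mult.assoc[symmetric])
qed

lemma keys_mult_lists:
  "keys f \<subseteq> lists L ==> keys g \<subseteq> lists L ==> keys (f * g) \<subseteq> lists L"
  for f g :: "mat list \<Rightarrow>\<^sub>0 complex"
  using keys_mult[of f g] by (fastforce simp: plus_list_def)

lemma ring_free_alg: "ring (free_alg L)"
proof (rule ringI)
  show "abelian_group (free_alg L)"
  proof (rule abelian_groupI)
    fix f assume f: "f \<in> carrier (free_alg L)"
    then show "\<exists>y\<in>carrier (free_alg L). y \<oplus>\<^bsub>free_alg L\<^esub> f = \<zero>\<^bsub>free_alg L\<^esub>"
      by (intro bexI[of _ "- f"]) simp_all
  qed (auto simp: keys_add_subset add_ac)
  show "monoid (free_alg L)"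
    by (rule monoidI) (auto simp: keys_mult_lists mult.assoc single_Nil_eq_one zero_list_def)
qed (simp_all add: distrib_left distrib_right)

lemma a_inv_free_alg: "f \<in> carrier (free_alg L) ==> \<ominus>\<^bsub>free_alg L\<^esub> f = - f"
proof -
  assume f: "f \<in> carrier (free_alg L)"
  interpret ring "free_alg L" by (rule ring_free_alg)
  show ?thesis using minus_equality[of "- f" f] f by simp
qed

lemma minus_free_alg: "f \<in> carrier (free_alg L) ==> g \<in> carrier (free_alg L) ==> f \<ominus>\<^bsub>free_alg L\<^esub> g = f - g"
proof -
  assume fg: "f \<in> carrier (free_alg L)" "g \<in> carrier (free_alg L)"
  interpret ring "free_alg L" by (rule ring_free_alg)
  show ?thesis using a_inv_free_alg[OF fg(2)] by (simp add: minus_eq)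
qed

lemma ideal_free_algI:
  assumes sub: "!!f. f \<in> J ==> keys f \<subseteq> lists L" and "0 \<in> J"
    and "!!f g. f \<in> J ==> g \<in> J ==> f + g \<in> J"
    and l: "!!f g. f \<in> J ==> keys g \<subseteq> lists L ==> g * f \<in> J"
    and "!!f g. f \<in> J ==> keys g \<subseteq> lists L ==> f * g \<in> J"
  shows "ideal J (free_alg L)"
proof (rule idealI[OF ring_free_alg])
  interpret ring "free_alg L" by (rule ring_free_alg)
  have neg: "- f \<in> J" if "f \<in> J" for f
  proof -
    have "single [] (- 1) * f \<in> J" by (rule l[OF that]) simp
    then show ?thesis by (simp add: pm_scale_mult[symmetric] pm_scale_linear)
  qed
  show "subgroup J (add_monoid (free_alg L))"
  proof (rule subgroup.intro)
    show "inv\<^bsub>add_monoid (free_alg L)\<^esub> f \<in> J" if "f \<in> J" for f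
      using neg[OF that] a_inv_free_alg[of f L] sub[OF that] by (simp add: a_inv_def)
  qed (use assms in auto)
qed (use assms in auto)

section \<open>The enveloping algebra as a quotient\<close>

definition lie_closed :: "mat set => bool" where
  "lie_closed L \<longleftrightarrow> cmat.subspace L \<and> (\<forall>x\<in>L. \<forall>y\<in>L. lie_bracket x y \<in> L)"

locale enveloping =
  fixes L :: "mat set"
  assumes L: "lie_closed L"
begin

abbreviation A where "A \<equiv> free_alg L"
abbreviation I where "I \<equiv> uea_ideal L"
abbreviation U where "U \<equiv> uea L"
abbreviation cl where "cl \<equiv> uea_class L"

sublocale A: ring A by (rule ring_free_alg)

lemma L_closed: "x \<in> L ==> y \<in> L ==> x + y \<in> L" "x \<in> L ==> mat_scale c x \<in> L" "x \<in> L ==> y \<in> L ==> lie_bracket x y \<in> L"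
  using L by (auto simp: lie_closed_def cmat.subspace_add cmat.subspace_scale)

lemma keys_word: "w \<in> lists L ==> keys (single w c) \<subseteq> lists L" for c :: complex
  by simp

lemma uea_rels_subset: "uea_rels L \<subseteq> carrier A"
  unfolding uea_rels_def
  by (auto simp: L_closed dest!: subsetD[OF keys_diff] split: if_splits)

sublocale ideal I A
  unfolding uea_ideal_def by (rule A.genideal_ideal[OF uea_rels_subset])

lemma rels_in_I: "uea_rels L \<subseteq> I"
  unfolding uea_ideal_def by (rule A.genideal_self[OF uea_rels_subset])

lemma I_closed:
  "f \<in> I ==> keys f \<subseteq> lists L" "0 \<in> I" "f \<in> I ==> g \<in> I ==> f + g \<in> I"
  "f \<in> I ==> keys g \<subseteq> lists L ==> g * f \<in> I" "f \<in> I ==> keys g \<subseteq> lists L ==> f * g \<in> I"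
  using Icarr[of f] additive_subgroup.zero_closed[OF is_additive_subgroup] additive_subgroup.a_closed[OF is_additive_subgroup, of f g]
    I_l_closed[of f g] I_r_closed[of f g] by auto

lemma cl_eq_iff:
  assumes "keys f \<subseteq> lists L" "keys g \<subseteq> lists L"
  shows "cl f = cl g \<longleftrightarrow> f - g \<in> I"
proof -
  have f: "f \<in> carrier A" and g: "g \<in> carrier A" using assms by auto
  show ?thesis
  proof
    assume "cl f = cl g"
    then have "f \<in> I +>\<^bsub>A\<^esub> g" using a_rcos_self[OF f] by (simp add: uea_class_def)
    then show "f - g \<in> I" using a_rcos_module[OF g f] minus_free_alg[OF f g] by (simp add: A.minus_eq)
  next
    assume "f - g \<in> I"
    then have "f \<in> I +>\<^bsub>A\<^esub> g" using a_rcos_module[OF g f] minus_free_alg[OF f g] by (simp add: A.minus_eq)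
    from a_repr_independence'[OF this g] show "cl f = cl g" by (simp add: uea_class_def)
  qed
qed

lemma mem_cl:
  assumes "keys g \<subseteq> lists L"
  shows "f \<in> cl g \<longleftrightarrow> keys f \<subseteq> lists L \<and> f - g \<in> I"
proof -
  have g: "g \<in> carrier A" using assms by simp
  show ?thesis
  proof (cases "f \<in> carrier A")
    case True
    then show ?thesis using a_rcos_module[OF g True] minus_free_alg[OF True g] by (simp add: A.minus_eq uea_class_def)
  next
    case False
    then show ?thesis using a_elemrcos_carrier[OF g, of f] by (auto simp: uea_class_def)
  qed
qed

lemma carrier_U: "carrier U = cl ` {f. keys f \<subseteq> lists L}"
  by (auto simp: uea_def FactRing_def ring.extend_def A_RCOSETS_def' uea_class_def)

lemma cl_add:
  "keys f \<subseteq> lists L ==> keys g \<subseteq> lists L ==> cl f \<oplus>\<^bsub>U\<^esub> cl g = cl (f + g)"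
  using a_rcos_sum[of f g] by (simp add: uea_def FactRing_def ring.extend_def uea_class_def)

lemma cl_mult:
  "keys f \<subseteq> lists L ==> keys g \<subseteq> lists L ==> cl f \<otimes>\<^bsub>U\<^esub> cl g = cl (f * g)"
  using rcoset_mult_add[of f g] by (simp add: uea_def FactRing_def ring.extend_def uea_class_def)

lemma cl_scale:
  assumes g: "keys g \<subseteq> lists L"
  shows "c \<odot>\<^bsub>U\<^esub> cl g = cl (pm_scale c g)"
proof -
  have "cl (pm_scale c f) = cl (pm_scale c g)" if "f \<in> cl g" for f
  proof -
    have f: "keys f \<subseteq> lists L" "f - g \<in> I" using that mem_cl[OF g] by auto
    have "pm_scale c (f - g) \<in> I" unfolding pm_scale_mult by (rule I_closed(4)[OF f(2)]) simp
    then show ?thesis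
      using cl_eq_iff[OF keys_scale_subset[OF f(1)] keys_scale_subset[OF g]] by (simp add: pm_scale_linear)
  qed
  moreover have "g \<in> cl g" using mem_cl[OF g] g I_closed(2) by simp
  ultimately have "(\<Union>f\<in>cl g. uea_class L (pm_scale c f)) = cl (pm_scale c g)" by blast
  then show ?thesis by (simp add: uea_def ring.extend_def module.fields_def)
qed

end

text \<open>The relations of \<open>P\<close> are among those of \<open>G\<close>, so the ideal of
  \<open>G\<close> contracts to an ideal of the free algebra on \<open>P\<close> that contains them,
  hence contains \<open>uea_ideal P\<close>. All representatives from \<open>P\<close> thus give one
  class in \<open>G\<close>.\<close>

lemma uea_incl_class:
  assumes P: "lie_closed P" and G: "lie_closed G" and sub: "P \<subseteq> G" and f: "keys f \<subseteq> lists P"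
  shows "uea_incl G (uea_class P f) = uea_class G f"
proof -
  interpret P: enveloping P by unfold_locales (rule P)
  interpret G: enveloping G by unfold_locales (rule G)
  have PG: "lists P \<subseteq> lists G" using sub by (rule lists_mono)
  have "ideal {f. keys f \<subseteq> lists P \<and> f \<in> uea_ideal G} (free_alg P)"
  proof (rule ideal_free_algI)
    fix f g :: "mat list \<Rightarrow>\<^sub>0 complex"
    assume f: "f \<in> {f. keys f \<subseteq> lists P \<and> f \<in> uea_ideal G}" and g: "keys g \<subseteq> lists P"
    then have "keys g \<subseteq> lists G" using PG by blast
    then show "g * f \<in> {f. keys f \<subseteq> lists P \<and> f \<in> uea_ideal G}"
      "f * g \<in> {f. keys f \<subseteq> lists P \<and> f \<in> uea_ideal G}"
      using f g keys_mult_lists[of f P g] keys_mult_lists[of g P f] G.I_closed(4,5)[of f g] by simp_all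
  qed (simp_all add: G.I_closed(2,3) keys_add_subset)
  moreover have "uea_rels P \<subseteq> uea_rels G" using sub unfolding uea_rels_def by blast
  then have "uea_rels P \<subseteq> {f. keys f \<subseteq> lists P \<and> f \<in> uea_ideal G}"
    using P.uea_rels_subset G.rels_in_I
    unfolding Collect_conj_eq Int_subset_iff Collect_mem_eq free_alg_def by (simp add: order_trans)
  ultimately have "uea_ideal P \<subseteq> uea_ideal G"
    using P.A.genideal_minimal unfolding uea_ideal_def[of P] by blast
  then have "uea_class G g = uea_class G f" if "g \<in> uea_class P f" for g
    using that G.cl_eq_iff[of g f] P.mem_cl[OF f, of g] f PG by blast
  moreover have "f \<in> uea_class P f" using P.mem_cl[OF f] f P.I_closed(2) by simp
  ultimately show ?thesis unfolding uea_incl_def by blast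
qed

section \<open>The action of the enveloping algebra on a module\<close>

locale uea_module = E: cmodule E + enveloping L for E :: "'e rep" and L +
  assumes rep: "lie_rep L E"
begin

lemma foldr_lin: "w \<in> lists L ==> lin_map E E (foldr (act E) w)"
proof (induction w)
  case Nil
  show ?case by (simp add: lin_map_def)
next
  case (Cons x w)
  then show ?case using lin_map_comp[OF Cons.IH lie_rep_act_linear[OF rep, of x]] by (simp add: comp_def)
qed

lemma foldr_closed [simp]: "w \<in> lists L ==> e \<in> carrier E ==> foldr (act E) w e \<in> carrier E"
  using lin_map_closed[OF foldr_lin] .

lemma word_act_superset:
  assumes "finite Z" "keys f \<subseteq> Z" "Z \<subseteq> lists L" "e \<in> carrier E"
  shows "word_act E f e = (\<Oplus>\<^bsub>E\<^esub>w\<in>Z. lookup f w \<odot>\<^bsub>E\<^esub> foldr (act E) w e)"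
  unfolding word_act_def
proof (rule E.add.finprod_mono_neutral_cong_left[OF assms(1,2)])
  show "(\<lambda>w. lookup f w \<odot>\<^bsub>E\<^esub> foldr (act E) w e) \<in> Z \<rightarrow> carrier E"
    using assms by (auto intro!: E.scale_closed foldr_closed)
  show "lookup f w \<odot>\<^bsub>E\<^esub> foldr (act E) w e = \<zero>\<^bsub>E\<^esub>" if "w \<in> Z - keys f" for w
  proof -
    have "foldr (act E) w e \<in> carrier E" using that assms by (intro foldr_closed) auto
    then show ?thesis using that by (simp add: in_keys_iff)
  qed
qed simp

text \<open>\<open>free_rep\<close> serves as the bare vector space on words here, so
  \<open>\<phi>\<close> is arbitrary.\<close>

lemma lin_map_word_act:
  assumes e: "e \<in> carrier E"
  shows "lin_map (free_rep (lists L) \<phi>) E (\<lambda>f. word_act E f e)"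
proof -
  have mem: "(\<lambda>w. lookup f w \<odot>\<^bsub>E\<^esub> foldr (act E) w e) \<in> Z \<rightarrow> carrier E" if "Z \<subseteq> lists L" for f Z
    using that e by (auto intro!: E.scale_closed foldr_closed)
  show ?thesis
    unfolding lin_map_def
  proof (intro conjI ballI allI funcsetI)
    fix f assume "f \<in> carrier (free_rep (lists L) \<phi>)"
    then have f: "keys f \<subseteq> lists L" by simp
    show "word_act E f e \<in> carrier E" unfolding word_act_def by (rule E.finsum_closed[OF mem[OF f]])
    show "word_act E (c \<odot>\<^bsub>free_rep (lists L) \<phi>\<^esub> f) e = c \<odot>\<^bsub>E\<^esub> word_act E f e" for c
    proof -
      have "word_act E (pm_scale c f) e = (\<Oplus>\<^bsub>E\<^esub>w\<in>keys f. c \<odot>\<^bsub>E\<^esub> (lookup f w \<odot>\<^bsub>E\<^esub> foldr (act E) w e))"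
        unfolding word_act_superset[OF finite_keys keys_pm_scale f e]
        by (rule E.finsum_cong') (use f e in \<open>auto simp: E.scale_scale subset_iff\<close>)
      also have "\<dots> = c \<odot>\<^bsub>E\<^esub> word_act E f e"
        unfolding word_act_def using E.finsum_smult_ldistr[OF finite_keys _ mem[OF f], of c f] by simp
      finally show ?thesis by simp
    qed
    fix g assume "g \<in> carrier (free_rep (lists L) \<phi>)"
    then have g: "keys g \<subseteq> lists L" by simp
    let ?Z = "keys f \<union> keys g"
    have Z: "?Z \<subseteq> lists L" "finite ?Z" using f g by auto
    have "word_act E (f + g) e = (\<Oplus>\<^bsub>E\<^esub>w\<in>?Z. (lookup f w \<odot>\<^bsub>E\<^esub> foldr (act E) w e) \<oplus>\<^bsub>E\<^esub> (lookup g w \<odot>\<^bsub>E\<^esub> foldr (act E) w e))"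
      unfolding word_act_superset[OF Z(2) Poly_Mapping.keys_add Z(1) e] lookup_add
      by (rule E.finsum_cong') (use Z e in \<open>auto simp: E.scale_add_left subset_iff\<close>)
    also have "\<dots> = word_act E f e \<oplus>\<^bsub>E\<^esub> word_act E g e"
      unfolding word_act_superset[OF Z(2) Un_upper1 Z(1) e] word_act_superset[OF Z(2) Un_upper2 Z(1) e]
      by (rule E.finsum_addf[OF mem[OF Z(1)] mem[OF Z(1)]])
    finally show "word_act E (f \<oplus>\<^bsub>free_rep (lists L) \<phi>\<^esub> g) e = word_act E f e \<oplus>\<^bsub>E\<^esub> word_act E g e" by simp
  qed
qed

lemma word_act_single: "w \<in> lists L ==> e \<in> carrier E ==> word_act E (single w c) e = c \<odot>\<^bsub>E\<^esub> foldr (act E) w e"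
  by (subst word_act_superset[of "{w}"]) (auto simp: E.finsum_insert)

lemma word_act_closed: "keys f \<subseteq> lists L ==> e \<in> carrier E ==> word_act E f e \<in> carrier E"
  using lin_map_closed[OF lin_map_word_act, of e f] by simp

lemma word_act_mult:
  assumes f: "keys f \<subseteq> lists L" and g: "keys g \<subseteq> lists L" and e: "e \<in> carrier E"
  shows "word_act E (f * g) e = word_act E f (word_act E g e)"
proof -
  let ?F = "free_rep (lists L) (\<lambda>_ _. 0)"
  have single: "word_act E (single u 1 * g) e = foldr (act E) u (word_act E g e)" if u: "u \<in> lists L" for u
  proof (rule lin_map_free_eq[OF E.cmodule_axioms _ _ _ g])
    have "lin_map ?F ?F (\<lambda>g. single u 1 * g)"
      using u keys_mult_lists[OF keys_word[OF u]] by (auto simp: lin_map_def distrib_left pm_scale_mult_right)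
    from lin_map_comp[OF this lin_map_word_act[OF e]]
    show "lin_map ?F E (\<lambda>g. word_act E (single u 1 * g) e)" .
    show "lin_map ?F E (\<lambda>g. foldr (act E) u (word_act E g e))"
      by (rule lin_map_comp[OF lin_map_word_act[OF e] foldr_lin[OF u]])
    fix w assume w: "w \<in> lists L"
    then have "u @ w \<in> lists L" using u by auto
    then show "word_act E (single u 1 * single w 1) e = foldr (act E) u (word_act E (single w 1) e)"
      using u w e by (simp add: mult_single plus_list_def word_act_single foldr_append[symmetric] del: foldr_append)
  qed
  show ?thesis
  proof (rule lin_map_free_eq[OF E.cmodule_axioms _ _ _ f])
    have "lin_map ?F ?F (\<lambda>f. f * g)"
      using keys_mult_lists[OF _ g] by (auto simp: lin_map_def distrib_right pm_scale_mult_right)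
    from lin_map_comp[OF this lin_map_word_act[OF e]]
    show "lin_map ?F E (\<lambda>f. word_act E (f * g) e)" .
    show "lin_map ?F E (\<lambda>f. word_act E f (word_act E g e))"
      by (rule lin_map_word_act[OF word_act_closed[OF g e]])
    show "word_act E (single u 1 * g) e = word_act E (single u 1) (word_act E g e)" if "u \<in> lists L" for u
      using single[OF that] that word_act_single[OF that word_act_closed[OF g e], of 1] word_act_closed[OF g e] by simp
  qed
qed

text \<open>The elements of the free algebra that annihilate \<open>E\<close> form an ideal, and it
  contains the relations because \<open>E\<close> is a representation.\<close>

lemma word_act_ideal:
  assumes "f \<in> I" "e \<in> carrier E"
  shows "word_act E f e = \<zero>\<^bsub>E\<^esub>"
proof -
  let ?F = "free_rep (lists L) (\<lambda>_ _. 0)"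
  define J where "J = {f. keys f \<subseteq> lists L \<and> (\<forall>e\<in>carrier E. word_act E f e = \<zero>\<^bsub>E\<^esub>)}"
  have zero: "word_act E f \<zero>\<^bsub>E\<^esub> = \<zero>\<^bsub>E\<^esub>" if "keys f \<subseteq> lists L" for f
    using word_act_mult[OF that, of 0 "\<zero>\<^bsub>E\<^esub>"] lin_map_zero[OF cmodule_free_rep E.cmodule_axioms lin_map_word_act[of "\<zero>\<^bsub>E\<^esub>" "\<lambda>_ _. 0"]]
    by simp
  note wl = lin_map_word_act[where \<phi> = "\<lambda>_ _. 0"]
  have add: "word_act E (f + g) e = word_act E f e \<oplus>\<^bsub>E\<^esub> word_act E g e"
    if "keys f \<subseteq> lists L" "keys g \<subseteq> lists L" "e \<in> carrier E" for f g e
    using lin_map_add[OF wl[OF that(3)], of f g] that by simp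
  have diff: "word_act E (f - g) e = word_act E f e \<ominus>\<^bsub>E\<^esub> word_act E g e"
    if "keys f \<subseteq> lists L" "keys g \<subseteq> lists L" "e \<in> carrier E" for f g e
    using lin_map_diff[OF cmodule_free_rep E.cmodule_axioms wl[OF that(3)], of f g] minus_free_rep[OF that(1,2), of "\<lambda>_ _. 0"] that by simp
  have "ideal J (free_alg L)"
  proof (rule ideal_free_algI)
    show "0 \<in> J" using lin_map_zero[OF cmodule_free_rep E.cmodule_axioms wl] by (simp add: J_def)
  qed (auto simp: J_def keys_add_subset keys_mult_lists add word_act_mult word_act_closed zero)
  moreover have "uea_rels L \<subseteq> J"
  proof
    fix g assume g: "g \<in> uea_rels L"
    then have gk: "keys g \<subseteq> lists L" using uea_rels_subset by auto
    have s: "word_act E (single [x] c) e = c \<odot>\<^bsub>E\<^esub> act E x e"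
      "word_act E (single [x, y] c) e = c \<odot>\<^bsub>E\<^esub> act E x (act E y e)"
      if "x \<in> L" "y \<in> L" "e \<in> carrier E" for x y c e
      using word_act_single[of "[x]" e c] word_act_single[of "[x, y]" e c] that by simp_all
    have k: "keys (single w c) \<subseteq> lists L" if "set w \<subseteq> L" for w and c :: complex using that by auto
    have kd: "keys (f - g) \<subseteq> lists L" if "keys f \<subseteq> lists L" "keys g \<subseteq> lists L" for f g :: "mat list \<Rightarrow>\<^sub>0 complex"
      using that Poly_Mapping.keys_diff[of f g] by blast
    have cancel: "(v \<oplus>\<^bsub>E\<^esub> w) \<ominus>\<^bsub>E\<^esub> v \<ominus>\<^bsub>E\<^esub> w = \<zero>\<^bsub>E\<^esub>" if "v \<in> carrier E" "w \<in> carrier E" for v w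
    proof -
      have "(v \<oplus>\<^bsub>E\<^esub> w) \<ominus>\<^bsub>E\<^esub> v \<ominus>\<^bsub>E\<^esub> w = (v \<oplus>\<^bsub>E\<^esub> \<ominus>\<^bsub>E\<^esub> v) \<oplus>\<^bsub>E\<^esub> (w \<oplus>\<^bsub>E\<^esub> \<ominus>\<^bsub>E\<^esub> w)"
        using that by (simp add: E.minus_eq E.a_ac)
      then show ?thesis using that by (simp add: E.r_neg)
    qed
    from g consider (add) x y where "x \<in> L" "y \<in> L" "g = single [x + y] 1 - single [x] 1 - single [y] 1"
      | (scale) c x where "x \<in> L" "g = single [mat_scale c x] 1 - single [x] c"
      | (bracket) x y where "x \<in> L" "y \<in> L" "g = single [x, y] 1 - single [y, x] 1 - single [lie_bracket x y] 1"
      unfolding uea_rels_def by blast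
    then have "word_act E g e = \<zero>\<^bsub>E\<^esub>" if e: "e \<in> carrier E" for e
    proof cases
      case add
      note c = act_closed[OF rep add(1) e] act_closed[OF rep add(2) e]
      show ?thesis unfolding add(3)
        using add(1,2) e c cancel[OF c] by (simp add: diff kd k s L_closed act_plus[OF rep add(1) e add(2)] del: keys_single)
    next
      case scale
      note c = act_closed[OF rep scale(1) e]
      show ?thesis unfolding scale(2)
        using scale(1) e c by (simp add: diff kd k s L_closed act_mat_scale[OF rep scale(1) e] E.diff_zero_iff del: keys_single)
    next
      case bracket
      note c = act_closed[OF rep bracket(1) act_closed[OF rep bracket(2) e]] act_closed[OF rep bracket(2) act_closed[OF rep bracket(1) e]]
      show ?thesis unfolding bracket(3)
        using bracket(1,2) e c by (simp add: diff kd k s L_closed act_bracket[OF rep bracket(1) e bracket(2)] E.diff_zero_iff del: keys_single)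
    qed
    then show "g \<in> J" using gk by (simp add: J_def)
  qed
  ultimately have "I \<subseteq> J" unfolding uea_ideal_def by (rule A.genideal_minimal)
  then show ?thesis using assms by (auto simp: J_def)
qed

lemma uea_act_class:
  assumes f: "keys f \<subseteq> lists L" and e: "e \<in> carrier E"
  shows "uea_act E (cl f) e = word_act E f e"
proof -
  have "word_act E g e = word_act E f e" if "g \<in> cl f" for g
  proof -
    have g: "keys g \<subseteq> lists L" "g - f \<in> I" using mem_cl[OF f] that by auto
    have "word_act E g e = word_act E (g - f) e \<oplus>\<^bsub>E\<^esub> word_act E f e"
      using lin_map_add[OF lin_map_word_act[OF e, of "\<lambda>_ _. 0"], of "g - f" f] I_closed(1)[OF g(2)] f by simp
    then show ?thesis using word_act_ideal[OF g(2) e] word_act_closed[OF f e] by simp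
  qed
  moreover have "f \<in> cl f" using mem_cl[OF f] f I_closed(2) by simp
  ultimately have "(\<lambda>f. word_act E f e) ` cl f = {word_act E f e}" by blast
  then show ?thesis by (simp add: uea_act_def)
qed

end

section \<open>Induced modules\<close>

context enveloping
begin

definition gen :: "mat => (mat list \<Rightarrow>\<^sub>0 complex) set" where
  "gen x = cl (single [x] 1)"

lemma U_obtain:
  assumes "u \<in> carrier U"
  obtains f where "keys f \<subseteq> lists L" "u = cl f"
  using assms carrier_U by blast

lemma cl_in_U: "keys f \<subseteq> lists L ==> cl f \<in> carrier U"
  using carrier_U by blast

lemma gen_in_U: "x \<in> L ==> gen x \<in> carrier U"
  unfolding gen_def by (rule cl_in_U) simp

lemma U_closed:
  assumes "u \<in> carrier U" "v \<in> carrier U"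
  shows "u \<oplus>\<^bsub>U\<^esub> v \<in> carrier U" "u \<otimes>\<^bsub>U\<^esub> v \<in> carrier U" "c \<odot>\<^bsub>U\<^esub> u \<in> carrier U"
proof -
  obtain f g where fg: "keys f \<subseteq> lists L" "u = cl f" "keys g \<subseteq> lists L" "v = cl g"
    using assms by (elim U_obtain)
  show "u \<oplus>\<^bsub>U\<^esub> v \<in> carrier U" "u \<otimes>\<^bsub>U\<^esub> v \<in> carrier U" "c \<odot>\<^bsub>U\<^esub> u \<in> carrier U"
    unfolding fg(2,4) using fg(1,3)
    by (simp_all only: cl_add cl_mult cl_scale cl_in_U keys_add_subset keys_mult_lists keys_scale_subset)
qed

lemma U_laws:
  assumes "u \<in> carrier U" "v \<in> carrier U" "w \<in> carrier U"
  shows "(u \<otimes>\<^bsub>U\<^esub> v) \<otimes>\<^bsub>U\<^esub> w = u \<otimes>\<^bsub>U\<^esub> (v \<otimes>\<^bsub>U\<^esub> w)"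
    and "u \<otimes>\<^bsub>U\<^esub> (v \<oplus>\<^bsub>U\<^esub> w) = u \<otimes>\<^bsub>U\<^esub> v \<oplus>\<^bsub>U\<^esub> u \<otimes>\<^bsub>U\<^esub> w"
    and "(u \<oplus>\<^bsub>U\<^esub> v) \<otimes>\<^bsub>U\<^esub> w = u \<otimes>\<^bsub>U\<^esub> w \<oplus>\<^bsub>U\<^esub> v \<otimes>\<^bsub>U\<^esub> w"
    and "u \<otimes>\<^bsub>U\<^esub> (c \<odot>\<^bsub>U\<^esub> v) = c \<odot>\<^bsub>U\<^esub> (u \<otimes>\<^bsub>U\<^esub> v)"
    and "(c \<odot>\<^bsub>U\<^esub> u) \<otimes>\<^bsub>U\<^esub> v = c \<odot>\<^bsub>U\<^esub> (u \<otimes>\<^bsub>U\<^esub> v)"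
proof -
  obtain f g h where fg: "keys f \<subseteq> lists L" "u = cl f" "keys g \<subseteq> lists L" "v = cl g"
    "keys h \<subseteq> lists L" "w = cl h"
    using assms by (elim U_obtain)
  note r = cl_add cl_mult cl_scale keys_add_subset keys_mult_lists keys_scale_subset fg(1,3,5)
  show "(u \<otimes>\<^bsub>U\<^esub> v) \<otimes>\<^bsub>U\<^esub> w = u \<otimes>\<^bsub>U\<^esub> (v \<otimes>\<^bsub>U\<^esub> w)"
    "u \<otimes>\<^bsub>U\<^esub> (v \<oplus>\<^bsub>U\<^esub> w) = u \<otimes>\<^bsub>U\<^esub> v \<oplus>\<^bsub>U\<^esub> u \<otimes>\<^bsub>U\<^esub> w"
    "(u \<oplus>\<^bsub>U\<^esub> v) \<otimes>\<^bsub>U\<^esub> w = u \<otimes>\<^bsub>U\<^esub> w \<oplus>\<^bsub>U\<^esub> v \<otimes>\<^bsub>U\<^esub> w"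
    "u \<otimes>\<^bsub>U\<^esub> (c \<odot>\<^bsub>U\<^esub> v) = c \<odot>\<^bsub>U\<^esub> (u \<otimes>\<^bsub>U\<^esub> v)"
    "(c \<odot>\<^bsub>U\<^esub> u) \<otimes>\<^bsub>U\<^esub> v = c \<odot>\<^bsub>U\<^esub> (u \<otimes>\<^bsub>U\<^esub> v)"
    unfolding fg(2,4,6) by (simp_all add: r mult.assoc distrib_left distrib_right pm_scale_mult_right)
qed

definition uone :: "(mat list \<Rightarrow>\<^sub>0 complex) set" where "uone = cl (single [] 1)"

lemma uone_in_U: "uone \<in> carrier U"
  unfolding uone_def by (rule cl_in_U) simp

lemma uone_mult: "u \<in> carrier U ==> u \<otimes>\<^bsub>U\<^esub> uone = u" "u \<in> carrier U ==> uone \<otimes>\<^bsub>U\<^esub> u = u"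
proof -
  have k: "keys (single [] (1 :: complex)) \<subseteq> lists L" by simp
  assume "u \<in> carrier U"
  then obtain f where f: "keys f \<subseteq> lists L" "u = cl f" by (elim U_obtain)
  show "u \<otimes>\<^bsub>U\<^esub> uone = u" "uone \<otimes>\<^bsub>U\<^esub> u = u"
    unfolding f(2) uone_def cl_mult[OF f(1) k] cl_mult[OF k f(1)] by (simp_all add: single_Nil_eq_one)
qed

lemma keys_single_words [simp]: "set w \<subseteq> L ==> keys (single w c) \<subseteq> lists L" for c :: complex
  by auto

lemma gen_add: "x \<in> L ==> y \<in> L ==> gen (x + y) = gen x \<oplus>\<^bsub>U\<^esub> gen y"
proof -
  assume xy: "x \<in> L" "y \<in> L"
  have "single [x + y] 1 - single [x] 1 - single [y] 1 \<in> uea_rels L"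
    using xy unfolding uea_rels_def by blast
  then have "single [x + y] 1 - (single [x] 1 + single [y] 1) \<in> I"
    using rels_in_I by (auto simp: diff_diff_eq)
  moreover have k: "keys (single [z] (1 :: complex)) \<subseteq> lists L" if "z \<in> L" for z using that by simp
  ultimately have "gen (x + y) = cl (single [x] 1 + single [y] 1)"
    unfolding gen_def using xy L_closed(1)[OF xy] cl_eq_iff[OF k[OF L_closed(1)[OF xy]] keys_add_subset[OF k[OF xy(1)] k[OF xy(2)]]] by blast
  then show ?thesis unfolding gen_def cl_add[OF k[OF xy(1)] k[OF xy(2)]] .
qed

lemma gen_scale: "x \<in> L ==> gen (mat_scale c x) = c \<odot>\<^bsub>U\<^esub> gen x"
proof -
  assume x: "x \<in> L"
  have "single [mat_scale c x] 1 - single [x] c \<in> uea_rels L"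
    using x unfolding uea_rels_def by blast
  then have "single [mat_scale c x] 1 - single [x] c \<in> I" using rels_in_I by blast
  moreover have k: "keys (single [z] a) \<subseteq> lists L" if "z \<in> L" for z and a :: complex using that by simp
  ultimately have "gen (mat_scale c x) = cl (single [x] c)"
    unfolding gen_def using cl_eq_iff[OF k[OF L_closed(2)[OF x]] k[OF x]] by blast
  then show ?thesis unfolding gen_def cl_scale[OF k[OF x]] by simp
qed

lemma gen_bracket: "x \<in> L ==> y \<in> L ==> gen x \<otimes>\<^bsub>U\<^esub> gen y = gen (lie_bracket x y) \<oplus>\<^bsub>U\<^esub> gen y \<otimes>\<^bsub>U\<^esub> gen x"
proof -
  assume xy: "x \<in> L" "y \<in> L"
  have k: "keys (single [z] a) \<subseteq> lists L" if "z \<in> L" for z and a :: complex using that by simp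
  have k2: "keys (single [y, x] (1 :: complex)) \<subseteq> lists L" "keys (single [x, y] (1 :: complex)) \<subseteq> lists L"
    using xy by simp_all
  note kb = k[OF L_closed(3)[OF xy]]
  have g: "gen a \<otimes>\<^bsub>U\<^esub> gen b = cl (single [a, b] 1)" if "a \<in> L" "b \<in> L" for a b
    unfolding gen_def cl_mult[OF k[OF that(1)] k[OF that(2)]] by (simp add: mult_single plus_list_def)
  have "single [x, y] 1 - single [y, x] 1 - single [lie_bracket x y] 1 \<in> uea_rels L"
    using xy unfolding uea_rels_def by blast
  then have "single [x, y] 1 - (single [lie_bracket x y] 1 + single [y, x] 1) \<in> I"
    using rels_in_I by (auto simp: diff_diff_eq add.commute)
  then have "cl (single [x, y] 1) = cl (single [lie_bracket x y] 1 + single [y, x] 1)"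
    using cl_eq_iff[OF k2(2) keys_add_subset[OF kb k2(1)]] by blast
  then show ?thesis unfolding g[OF xy] g[OF xy(2,1)] unfolding gen_def cl_add[OF kb k2(1)] .
qed

end

section \<open>The tensor product over the subalgebra\<close>

locale inducing =
  fixes G P :: "mat set" and E :: "'e rep"
  assumes closed_G: "lie_closed G" and closed_P: "lie_closed P" and sub: "P \<subseteq> G" and rep: "lie_rep P E"
begin

sublocale G: enveloping G by unfold_locales (rule closed_G)

sublocale P: uea_module E P
  using lie_rep_module[OF rep] by (simp add: uea_module_def uea_module_axioms_def enveloping_def closed_P rep)

abbreviation UG where "UG \<equiv> uea G"
abbreviation F where "F \<equiv> ind_free G E"
abbreviation N where "N \<equiv> lin_span F (ind_rels G P E)"

definition pairs :: "((mat list \<Rightarrow>\<^sub>0 complex) set \<times> 'e) set" where "pairs = carrier UG \<times> carrier E"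

definition left_mult :: "mat => (mat list \<Rightarrow>\<^sub>0 complex) set \<times> 'e => ((mat list \<Rightarrow>\<^sub>0 complex) set \<times> 'e \<Rightarrow>\<^sub>0 complex)" where
  "left_mult x = (\<lambda>(u, e). single (G.gen x \<otimes>\<^bsub>UG\<^esub> u, e) 1)"

lemma F_eq: "F = free_rep pairs left_mult"
  unfolding ind_free_def pairs_def left_mult_def G.gen_def ..

lemma cmodule_F: "cmodule F"
  unfolding F_eq by (rule cmodule_free_rep)

lemma keys_pair: "u \<in> carrier UG ==> e \<in> carrier E ==> keys (single (u, e) c) \<subseteq> pairs" for c :: complex
  by (simp add: pairs_def)

lemma incl_closed: "q \<in> carrier (uea P) ==> uea_incl G q \<in> carrier UG"
proof -
  assume "q \<in> carrier (uea P)"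
  then obtain f where f: "keys f \<subseteq> lists P" "q = uea_class P f" by (elim P.U_obtain)
  moreover have "keys f \<subseteq> lists G" by (rule order_trans[OF f(1) lists_mono[OF sub]])
  ultimately show ?thesis using uea_incl_class[OF closed_P closed_G sub f(1)] G.cl_in_U by simp
qed

lemma uea_act_closed: "q \<in> carrier (uea P) ==> e \<in> carrier E ==> uea_act E q e \<in> carrier E"
proof -
  assume "q \<in> carrier (uea P)" and e: "e \<in> carrier E"
  then obtain f where f: "keys f \<subseteq> lists P" "q = uea_class P f" by (elim P.U_obtain)
  then show ?thesis using P.uea_act_class[OF f(1) e] P.word_act_closed[OF f(1) e] by simp
qed

lemma rel_cases:
  assumes "r \<in> ind_rels G P E"
  obtains
    (add1) u u' e where "u \<in> carrier UG" "u' \<in> carrier UG" "e \<in> carrier E"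
      "r = single (u \<oplus>\<^bsub>UG\<^esub> u', e) 1 - single (u, e) 1 - single (u', e) 1"
  | (add2) u e e' where "u \<in> carrier UG" "e \<in> carrier E" "e' \<in> carrier E"
      "r = single (u, e \<oplus>\<^bsub>E\<^esub> e') 1 - single (u, e) 1 - single (u, e') 1"
  | (scale1) c u e where "u \<in> carrier UG" "e \<in> carrier E"
      "r = single (c \<odot>\<^bsub>UG\<^esub> u, e) 1 - single (u, e) c"
  | (scale2) c u e where "u \<in> carrier UG" "e \<in> carrier E"
      "r = single (u, c \<odot>\<^bsub>E\<^esub> e) 1 - single (u, e) c"
  | (bal) u q e where "u \<in> carrier UG" "q \<in> carrier (uea P)" "e \<in> carrier E"
      "r = single (u \<otimes>\<^bsub>UG\<^esub> uea_incl G q, e) 1 - single (u, uea_act E q e) 1"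
  using assms unfolding ind_rels_def Un_iff mem_Collect_eq
  by (elim disjE exE conjE)
    ((rule add1; assumption) | (rule add2; assumption) | (rule scale1; assumption) | (rule scale2; assumption)
      | (rule bal; assumption))+

lemma keys_diff_sub: "keys f \<subseteq> Z ==> keys g \<subseteq> Z ==> keys (f - g) \<subseteq> Z"
  for f g :: "'x \<Rightarrow>\<^sub>0 complex"
  using Poly_Mapping.keys_diff[of f g] by blast

lemma rels_subset: "ind_rels G P E \<subseteq> carrier F"
proof
  fix r assume "r \<in> ind_rels G P E"
  then show "r \<in> carrier F"
    by (cases rule: rel_cases)
      (simp_all only: F_eq free_rep_simps mem_Collect_eq keys_diff_sub keys_pair G.U_closed P.E.a_closed
        P.E.scale_closed incl_closed uea_act_closed)
qed

lemma N_sub: "submodule N \<complex> F"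
  by (rule submodule_lin_span[OF cmodule_F rels_subset])

lemma N_sub': "submodule N \<complex> (free_rep pairs left_mult)"
  using N_sub by (simp only: F_eq)

sublocale Q: quot F N
  using cmodule_F N_sub by (simp add: quot_def quot_axioms_def)

lemma induced_eq: "induced G P E = quot_rep F N"
  by (simp add: induced_def)

lemma rel_in_N: "r \<in> ind_rels G P E ==> r \<in> N"
  by (rule subsetD[OF lin_span_superset])

lemma
  assumes "u \<in> carrier UG" "e \<in> carrier E"
  shows rel_add1: "u' \<in> carrier UG ==>
      single (u \<oplus>\<^bsub>UG\<^esub> u', e) 1 - single (u, e) 1 - single (u', e) 1 \<in> N"
    and rel_add2: "e' \<in> carrier E ==>
      single (u, e \<oplus>\<^bsub>E\<^esub> e') 1 - single (u, e) 1 - single (u, e') 1 \<in> N"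
    and rel_scale1: "single (c \<odot>\<^bsub>UG\<^esub> u, e) 1 - single (u, e) c \<in> N"
    and rel_scale2: "single (u, c \<odot>\<^bsub>E\<^esub> e) 1 - single (u, e) c \<in> N"
    and rel_bal: "q \<in> carrier (uea P) ==>
      single (u \<otimes>\<^bsub>UG\<^esub> uea_incl G q, e) 1 - single (u, uea_act E q e) 1 \<in> N"
proof -
  show "single (u \<oplus>\<^bsub>UG\<^esub> u', e) 1 - single (u, e) 1 - single (u', e) 1 \<in> N" if "u' \<in> carrier UG"
    by (rule rel_in_N, unfold ind_rels_def, rule UnI1, rule UnI1, rule UnI1, rule UnI1, rule CollectI, intro exI conjI, rule refl; fact)
  show "single (u, e \<oplus>\<^bsub>E\<^esub> e') 1 - single (u, e) 1 - single (u, e') 1 \<in> N" if "e' \<in> carrier E"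
    by (rule rel_in_N, unfold ind_rels_def, rule UnI1, rule UnI1, rule UnI1, rule UnI2, rule CollectI, intro exI conjI, rule refl; fact)
  show "single (c \<odot>\<^bsub>UG\<^esub> u, e) 1 - single (u, e) c \<in> N"
    by (rule rel_in_N, unfold ind_rels_def, rule UnI1, rule UnI1, rule UnI2, rule CollectI, intro exI conjI, rule refl; fact)
  show "single (u, c \<odot>\<^bsub>E\<^esub> e) 1 - single (u, e) c \<in> N"
    by (rule rel_in_N, unfold ind_rels_def, rule UnI1, rule UnI2, rule CollectI, intro exI conjI, rule refl; fact)
  show "single (u \<otimes>\<^bsub>UG\<^esub> uea_incl G q, e) 1 - single (u, uea_act E q e) 1 \<in> N" if "q \<in> carrier (uea P)"
    by (rule rel_in_N, unfold ind_rels_def, rule UnI2, rule CollectI, intro exI conjI, rule refl; fact)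
qed

lemma keys_left_mult: "x \<in> G ==> w \<in> pairs ==> keys (left_mult x w) \<subseteq> pairs"
  by (auto simp: left_mult_def pairs_def G.U_closed G.gen_in_U split: if_splits)

lemma act_linear_F: "x \<in> G ==> act_linear F x"
  unfolding F_eq by (rule act_linear_free_rep) (rule keys_left_mult)

lemma act_F_single: "act F x (single (u, e) c) = single (G.gen x \<otimes>\<^bsub>UG\<^esub> u, e) c"
  by (simp add: F_eq lin_ext_simps left_mult_def)

lemma act_F_diff: "act F x (f - g) = act F x f - act F x g"
  by (simp add: F_eq lin_ext_simps)

text \<open>Left multiplication by the class of \<open>x\<close> takes a relation at
  \<open>u\<close> to the same relation at the product. For the balancing relation this is
  associativity, as that one multiplies \<open>u\<close> on the right.\<close>

lemma act_N:
  assumes x: "x \<in> G" and n: "n \<in> N"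
  shows "act F x n \<in> N"
proof (rule lin_span_invariant[OF cmodule_F rels_subset _ _ n])
  show "lin_map F F (act F x)" using act_linear_F[OF x] by (simp add: act_linear_def)
  note g = G.gen_in_U[OF x]
  fix r assume "r \<in> ind_rels G P E"
  then show "act F x r \<in> N"
  proof (cases rule: rel_cases)
    case (add1 u u' e)
    then show ?thesis using rel_add1[OF G.U_closed(2)[OF g add1(1)] add1(3) G.U_closed(2)[OF g add1(2)]]
      by (simp add: act_F_diff act_F_single G.U_laws(2)[OF g])
  next
    case (add2 u e e')
    then show ?thesis using rel_add2[OF G.U_closed(2)[OF g add2(1)] add2(2,3)] by (simp add: act_F_diff act_F_single)
  next
    case (scale1 c u e)
    then show ?thesis using rel_scale1[OF G.U_closed(2)[OF g scale1(1)] scale1(2)]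
      by (simp add: act_F_diff act_F_single G.U_laws(4)[OF g scale1(1) g])
  next
    case (scale2 c u e)
    then show ?thesis using rel_scale2[OF G.U_closed(2)[OF g scale2(1)] scale2(2)] by (simp add: act_F_diff act_F_single)
  next
    case (bal u q e)
    then show ?thesis using rel_bal[OF G.U_closed(2)[OF g bal(1)] bal(3,2)]
      by (simp add: act_F_diff act_F_single G.U_laws(1)[OF g bal(1) incl_closed[OF bal(2)]])
  qed
qed

lemma act_qcl: "x \<in> G ==> f \<in> carrier F ==> act (induced G P E) x (qcl F N f) = qcl F N (act F x f)"
  unfolding induced_eq by (rule Q.qcl_act[OF act_linear_F act_N])

lemma cmodule_induced: "cmodule (induced G P E)"
  unfolding induced_eq cmodule_iff by (rule Q.module_quot)

lemma qcl_eqI: "f \<in> carrier F ==> g \<in> carrier F ==> f - g \<in> N ==> qcl F N f = qcl F N g"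
  using Q.qcl_eq_iff[of f g] by (simp add: F_eq minus_free_rep)

lemma act_F_closed: "x \<in> G ==> f \<in> carrier F ==> act F x f \<in> carrier F"
  using act_linear_F lin_map_closed unfolding act_linear_def by metis

lemma lin_map_q: "lin_map F (induced G P E) (qcl F N)"
  unfolding induced_eq by (rule Q.lin_map_qcl)

text \<open>On a pair \<open>(u, e)\<close> each law of a representation reduces to a relation in
  the first factor, by the relations of the enveloping algebra; \<open>lin_ext_mem\<close> carries
  this to linear combinations.\<close>

theorem lie_rep_induced: "lie_rep G (induced G P E)"
  unfolding lie_rep_iff
proof (intro conjI ballI allI)
  let ?Y = "induced G P E"
  interpret Y: cmodule ?Y by (rule cmodule_induced)
  show "module \<complex> ?Y" using cmodule_induced by (simp add: cmodule_iff)
  show "act_linear ?Y x" if "x \<in> G" for x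
    unfolding induced_eq by (rule Q.act_linear_quot[OF act_linear_F[OF that] act_N[OF that]])
  have car: "\<exists>f\<in>carrier F. v = qcl F N f" if "v \<in> carrier ?Y" for v
    using that Q.carrier_quot unfolding induced_eq by blast
  have addF: "f + g \<in> carrier F" if "f \<in> carrier F" "g \<in> carrier F" for f g using that by (simp add: F_eq keys_add_subset)
  have scF: "pm_scale c f \<in> carrier F" if "f \<in> carrier F" for f c using that by (simp add: F_eq keys_scale_subset)
  have qadd: "qcl F N (f + g) = qcl F N f \<oplus>\<^bsub>?Y\<^esub> qcl F N g" if "f \<in> carrier F" "g \<in> carrier F" for f g
    using lin_map_add[OF lin_map_q that] by (simp add: F_eq)
  have qsc: "qcl F N (pm_scale c f) = c \<odot>\<^bsub>?Y\<^esub> qcl F N f" if "f \<in> carrier F" for f c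
    using lin_map_scale[OF lin_map_q that] by (simp add: F_eq)
  {
    fix x y v assume x: "x \<in> G" and y: "y \<in> G" and "v \<in> carrier ?Y"
    then obtain f where f: "f \<in> carrier F" "v = qcl F N f" using car by blast
    note cx = act_F_closed[OF x f(1)] and cy = act_F_closed[OF y f(1)]
    have "lin_ext (\<lambda>w. left_mult (x + y) w - left_mult x w - left_mult y w) f \<in> N"
    proof (rule lin_ext_mem[OF N_sub'])
      fix w assume "w \<in> pairs"
      then obtain u e where ue: "w = (u, e)" "u \<in> carrier UG" "e \<in> carrier E" by (auto simp: pairs_def)
      show "left_mult (x + y) w - left_mult x w - left_mult y w \<in> N"
        using rel_add1[OF G.U_closed(2)[OF G.gen_in_U[OF x] ue(2)] ue(3) G.U_closed(2)[OF G.gen_in_U[OF y] ue(2)]]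
        by (simp add: left_mult_def ue(1) G.gen_add[OF x y] G.U_laws(3)[OF G.gen_in_U[OF x] G.gen_in_U[OF y] ue(2)])
    qed (use f in \<open>simp add: F_eq\<close>)
    then have "act F (x + y) f - (act F x f + act F y f) \<in> N"
      by (simp add: lin_ext_fun diff_diff_eq F_eq)
    then have "qcl F N (act F (x + y) f) = qcl F N (act F x f + act F y f)"
      by (rule qcl_eqI[OF act_F_closed[OF G.L_closed(1)[OF x y] f(1)] addF[OF cx cy]])
    then show "act ?Y (x + y) v = act ?Y x v \<oplus>\<^bsub>?Y\<^esub> act ?Y y v"
      unfolding f(2) act_qcl[OF x f(1)] act_qcl[OF y f(1)] act_qcl[OF G.L_closed(1)[OF x y] f(1)] qadd[OF cx cy] .
    have cxy: "act F x (act F y f) \<in> carrier F" "act F y (act F x f) \<in> carrier F"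
      by (rule act_F_closed[OF x cy], rule act_F_closed[OF y cx])
    have "lin_ext (\<lambda>w. lin_ext (left_mult x) (left_mult y w) - left_mult (lie_bracket x y) w - lin_ext (left_mult y) (left_mult x w)) f \<in> N"
    proof (rule lin_ext_mem[OF N_sub'])
      fix w assume "w \<in> pairs"
      then obtain u e where ue: "w = (u, e)" "u \<in> carrier UG" "e \<in> carrier E" by (auto simp: pairs_def)
      note gx = G.gen_in_U[OF x] and gy = G.gen_in_U[OF y] and gb = G.gen_in_U[OF G.L_closed(3)[OF x y]]
      have "G.gen x \<otimes>\<^bsub>UG\<^esub> (G.gen y \<otimes>\<^bsub>UG\<^esub> u) = G.gen (lie_bracket x y) \<otimes>\<^bsub>UG\<^esub> u \<oplus>\<^bsub>UG\<^esub> G.gen y \<otimes>\<^bsub>UG\<^esub> (G.gen x \<otimes>\<^bsub>UG\<^esub> u)"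
        unfolding G.U_laws(1)[OF gx gy ue(2), symmetric] G.gen_bracket[OF x y] G.U_laws(3)[OF gb G.U_closed(2)[OF gy gx] ue(2)]
          G.U_laws(1)[OF gy gx ue(2)] ..
      then show "lin_ext (left_mult x) (left_mult y w) - left_mult (lie_bracket x y) w - lin_ext (left_mult y) (left_mult x w) \<in> N"
        using rel_add1[OF G.U_closed(2)[OF gb ue(2)] ue(3) G.U_closed(2)[OF gy G.U_closed(2)[OF gx ue(2)]]]
        by (simp add: left_mult_def ue(1) lin_ext_simps)
    qed (use f in \<open>simp add: F_eq\<close>)
    then have N1: "act F x (act F y f) - (act F (lie_bracket x y) f + act F y (act F x f)) \<in> N"
      by (simp add: lin_ext_fun diff_diff_eq F_eq lin_ext_comp)
    have cb: "act F (lie_bracket x y) f \<in> carrier F" by (rule act_F_closed[OF G.L_closed(3)[OF x y] f(1)])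
    have "qcl F N (act F x (act F y f)) = qcl F N (act F (lie_bracket x y) f) \<oplus>\<^bsub>?Y\<^esub> qcl F N (act F y (act F x f))"
      using qcl_eqI[OF cxy(1) addF[OF cb cxy(2)] N1] qadd[OF cb cxy(2)] by simp
    moreover have "qcl F N (act F (lie_bracket x y) f) \<in> carrier ?Y" "qcl F N (act F y (act F x f)) \<in> carrier ?Y"
      by (rule lin_map_closed[OF lin_map_q cb], rule lin_map_closed[OF lin_map_q cxy(2)])
    ultimately show "act ?Y (lie_bracket x y) v = act ?Y x (act ?Y y v) \<ominus>\<^bsub>?Y\<^esub> act ?Y y (act ?Y x v)"
      unfolding f(2) act_qcl[OF x f(1)] act_qcl[OF y f(1)] act_qcl[OF G.L_closed(3)[OF x y] f(1)] act_qcl[OF x cy] act_qcl[OF y cx]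
      by (simp add: Y.minus_eq Y.a_assoc Y.r_neg)
  next
    fix x c v assume x: "x \<in> G" and "v \<in> carrier ?Y"
    then obtain f where f: "f \<in> carrier F" "v = qcl F N f" using car by blast
    note cx = act_F_closed[OF x f(1)]
    have "lin_ext (\<lambda>w. left_mult (mat_scale c x) w - pm_scale c (left_mult x w)) f \<in> N"
    proof (rule lin_ext_mem[OF N_sub'])
      fix w assume "w \<in> pairs"
      then obtain u e where ue: "w = (u, e)" "u \<in> carrier UG" "e \<in> carrier E" by (auto simp: pairs_def)
      show "left_mult (mat_scale c x) w - pm_scale c (left_mult x w) \<in> N"
        using rel_scale1[OF G.U_closed(2)[OF G.gen_in_U[OF x] ue(2)] ue(3), of c]
        by (simp add: left_mult_def ue(1) G.gen_scale[OF x] G.U_laws(5)[OF G.gen_in_U[OF x] ue(2) ue(2)])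
    qed (use f in \<open>simp add: F_eq\<close>)
    then have "act F (mat_scale c x) f - pm_scale c (act F x f) \<in> N"
      by (simp add: lin_ext_fun F_eq)
    then have "qcl F N (act F (mat_scale c x) f) = qcl F N (pm_scale c (act F x f))"
      by (rule qcl_eqI[OF act_F_closed[OF G.L_closed(2)[OF x] f(1)] scF[OF cx]])
    then show "act ?Y (mat_scale c x) v = c \<odot>\<^bsub>?Y\<^esub> act ?Y x v"
      unfolding f(2) act_qcl[OF x f(1)] act_qcl[OF G.L_closed(2)[OF x] f(1)] qsc[OF cx] .
  }
qed

text \<open>The canonical map \<open>e \<mapsto> 1 \<otimes> e\<close>.\<close>

definition eta :: "'e => ((mat list \<Rightarrow>\<^sub>0 complex) set \<times> 'e \<Rightarrow>\<^sub>0 complex) set" where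
  "eta e = qcl F N (single (G.uone, e) 1)"

lemma single_F: "u \<in> carrier UG ==> e \<in> carrier E ==> single (u, e) c \<in> carrier F"
  using keys_pair by (simp add: F_eq pairs_def)

lemma F_sum_diff: "f \<in> carrier F ==> g \<in> carrier F ==> f + g \<in> carrier F"
  by (simp add: F_eq keys_add_subset)

lemma lin_map_eta: "lin_map E (induced G P E) eta"
  unfolding lin_map_def
proof (intro conjI ballI allI funcsetI)
  note one = G.uone_in_U
  fix e assume e: "e \<in> carrier E"
  note s = single_F[OF one e]
  show "eta e \<in> carrier (induced G P E)" unfolding eta_def by (rule lin_map_closed[OF lin_map_q s])
  show "eta (c \<odot>\<^bsub>E\<^esub> e) = c \<odot>\<^bsub>induced G P E\<^esub> eta e" for c
    unfolding eta_def qcl_eqI[OF single_F[OF one P.E.scale_closed[OF e]] s rel_scale2[OF one e]]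
    using lin_map_scale[OF lin_map_q s[of 1], of c] by (simp add: F_eq)
  fix e' assume e': "e' \<in> carrier E"
  note s' = single_F[OF one e']
  have "qcl F N (single (G.uone, e \<oplus>\<^bsub>E\<^esub> e') 1) = qcl F N (single (G.uone, e) 1 + single (G.uone, e') 1)"
    using rel_add2[OF one e e'] by (intro qcl_eqI single_F one F_sum_diff P.E.a_closed e e') (simp add: diff_diff_eq)
  then show "eta (e \<oplus>\<^bsub>E\<^esub> e') = eta e \<oplus>\<^bsub>induced G P E\<^esub> eta e'"
    unfolding eta_def using lin_map_add[OF lin_map_q s s', of 1 1] by (simp add: F_eq)
qed

text \<open>The balancing relation with \<open>u = 1\<close> and \<open>q\<close> the class of
  \<open>x\<close>.\<close>

lemma act_eta:
  assumes x: "x \<in> P" and e: "e \<in> carrier E"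
  shows "act (induced G P E) x (eta e) = eta (act E x e)"
proof -
  have xG: "x \<in> G" using x sub by blast
  have k: "keys (single [x] (1 :: complex)) \<subseteq> lists P" using x by simp
  have gx: "P.gen x \<in> carrier (uea P)" by (rule P.gen_in_U[OF x])
  have incl: "uea_incl G (P.gen x) = G.gen x" unfolding P.gen_def G.gen_def by (rule uea_incl_class[OF closed_P closed_G sub k])
  have ua: "uea_act E (P.gen x) e = act E x e"
    unfolding P.gen_def P.uea_act_class[OF k e] using P.word_act_single[of "[x]" e 1] x e act_closed[OF rep x e] by simp
  have "act (induced G P E) x (eta e) = qcl F N (single (G.gen x, e) 1)"
    unfolding eta_def act_qcl[OF xG single_F[OF G.uone_in_U e]] act_F_single G.uone_mult(1)[OF G.gen_in_U[OF xG]] ..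
  also have "\<dots> = eta (act E x e)"
    unfolding eta_def
  proof (rule qcl_eqI)
    show "single (G.gen x, e) 1 - single (G.uone, act E x e) 1 \<in> N"
      using rel_bal[OF G.uone_in_U e gx] unfolding incl ua G.uone_mult(2)[OF G.gen_in_U[OF xG]] .
  qed (intro single_F G.gen_in_U[OF xG] e G.uone_in_U act_closed[OF rep x e])+
  finally show ?thesis .
qed

text \<open>A word \<open>x # w\<close> in the first factor is the result of \<open>x\<close> acting
  on the pair with \<open>w\<close>, down to the empty word, which is \<open>eta e\<close>. Sums of
  words and of pairs follow by linearity.\<close>

lemma induced_generated:
  assumes S: "submodule S \<complex> (induced G P E)" and stable: "!!x v. x \<in> G ==> v \<in> S ==> act (induced G P E) x v \<in> S"
    and eta: "!!e. e \<in> carrier E ==> eta e \<in> S"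
  shows "carrier (induced G P E) \<subseteq> S"
proof -
  interpret Y: cmodule "induced G P E" by (rule cmodule_induced)
  have word: "qcl F N (single (uea_class G (single w 1), e) 1) \<in> S" if "w \<in> lists G" "e \<in> carrier E" for w e
    using that
  proof (induction w)
    case Nil
    then show ?case using eta by (simp add: eta_def G.uone_def)
  next
    case (Cons x w)
    have k: "keys (single w (1 :: complex)) \<subseteq> lists G" "keys (single [x] (1 :: complex)) \<subseteq> lists G"
      using Cons.hyps by simp_all
    have "uea_class G (single (x # w) 1) = G.gen x \<otimes>\<^bsub>UG\<^esub> uea_class G (single w 1)"
      unfolding G.gen_def G.cl_mult[OF k(2,1)] by (simp add: mult_single plus_list_def)
    then have "qcl F N (single (uea_class G (single (x # w) 1), e) 1)
        = act (induced G P E) x (qcl F N (single (uea_class G (single w 1), e) 1))"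
      using act_qcl[OF Cons.hyps(1) single_F[OF G.cl_in_U[OF k(1)] Cons.prems]] by (simp add: act_F_single)
    then show ?case using stable Cons by simp
  qed
  have pair: "qcl F N (single (uea_class G f, e) 1) \<in> S" if f: "keys f \<subseteq> lists G" and e: "e \<in> carrier E" for f e
  proof -
    let ?V = "{f. keys f \<subseteq> lists G \<and> qcl F N (single (uea_class G f, e) 1) \<in> S}"
    let ?q = "\<lambda>f. qcl F N (single (uea_class G f, e) 1)"
    have add: "?q (f + g) = ?q f \<oplus>\<^bsub>induced G P E\<^esub> ?q g" if "keys f \<subseteq> lists G" "keys g \<subseteq> lists G" for f g
    proof -
      note c = G.cl_in_U[OF that(1)] G.cl_in_U[OF that(2)]
      have "?q (f + g) = qcl F N (single (uea_class G f, e) 1 + single (uea_class G g, e) 1)"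
        using rel_add1[OF c(1) e c(2)] G.cl_add[OF that]
        by (intro qcl_eqI single_F F_sum_diff c e G.cl_in_U keys_add_subset that) (simp add: diff_diff_eq)
      then show ?thesis using lin_map_add[OF lin_map_q single_F[OF c(1) e] single_F[OF c(2) e], of 1 1] by (simp add: F_eq)
    qed
    have scale: "?q (pm_scale c f) = c \<odot>\<^bsub>induced G P E\<^esub> ?q f" if "keys f \<subseteq> lists G" for f c
    proof -
      note k = G.cl_in_U[OF that]
      have "?q (pm_scale c f) = qcl F N (single (uea_class G f, e) c)"
        using rel_scale1[OF k e, of c] G.cl_scale[OF that, of c]
        by (intro qcl_eqI single_F k e G.cl_in_U keys_scale_subset that) simp
      then show ?thesis using lin_map_scale[OF lin_map_q single_F[OF k e, of 1], of c] by (simp add: F_eq)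
    qed
    have zero: "0 \<in> ?V"
    proof -
      have "?q (pm_scale 0 (single [] 1)) = 0 \<odot>\<^bsub>induced G P E\<^esub> ?q (single [] 1)"
        by (rule scale) simp
      also have "\<dots> \<in> S" using word[of "[]" e] e by (intro Y.submodule_scale[OF S]) simp
      finally show ?thesis by simp
    qed
    have "submodule ?V \<complex> (free_rep (lists G) (\<lambda>_ _. 0))"
      unfolding submodule_free_rep_iff using zero
      by (auto simp: add scale keys_add_subset keys_scale_subset Y.submodule_add[OF S] Y.submodule_scale[OF S])
    from free_rep_spanned[OF this _ f] show ?thesis using word e by auto
  qed
  have "submodule {f \<in> carrier F. qcl F N f \<in> S} \<complex> F"
    by (rule Q.M.submodule_vimage[OF cmodule_induced lin_map_q S])
  then have V: "submodule {f \<in> carrier F. qcl F N f \<in> S} \<complex> (free_rep pairs left_mult)" by (simp only: F_eq)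
  have "qcl F N f \<in> S" if f: "f \<in> carrier F" for f
  proof -
    have "f \<in> {f \<in> carrier F. qcl F N f \<in> S}"
    proof (rule free_rep_spanned[OF V])
      fix w assume "w \<in> pairs"
      then obtain u e where ue: "w = (u, e)" "u \<in> carrier UG" "e \<in> carrier E" by (auto simp: pairs_def)
      obtain g where g: "keys g \<subseteq> lists G" "u = uea_class G g" using ue(2) by (elim G.U_obtain)
      show "single w 1 \<in> {f \<in> carrier F. qcl F N f \<in> S}"
        using pair[OF g(1) ue(3)] single_F[OF ue(2,3), of 1] unfolding ue(1) g(2) by blast
    qed (use f in \<open>simp add: F_eq\<close>)
    then show ?thesis by blast
  qed
  then show ?thesis unfolding induced_eq Q.carrier_quot by blast
qed

end

section \<open>Modules filtered by images of word maps\<close>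

lemma words_mono: "c \<le> c' ==> words c D K \<subseteq> words c' D K"
proof
  fix w assume c: "c \<le> c'" and w: "w \<in> words c D K"
  have "set w \<subseteq> {..<c} \<times> {..<D}" using w by (simp add: words_def)
  also have "\<dots> \<subseteq> {..<c'} \<times> {..<D}" using c by auto
  finally show "w \<in> words c' D K" using w by (simp add: words_def)
qed

text \<open>Functions are first restricted to the words with the old labels; rotations do not touch
  labels, so the restriction is equivariant.\<close>

lemma word_map_labels:
  assumes \<Phi>: "word_map d nb c K M \<Phi>" and le: "c \<le> c'"
  shows "\<exists>\<Psi>. word_map d nb c' K M \<Psi> \<and> word_im d nb c K \<Phi> \<subseteq> word_im d nb c' K \<Psi>"
proof -
  let ?W = "words c (d + 2 * nb) K" and ?W' = "words c' (d + 2 * nb) K"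
  have sub: "?W \<subseteq> ?W'" by (rule words_mono[OF le])
  define R where "R f = (\<lambda>w. if w \<in> ?W then f w else (0 :: complex))" for f :: "word => complex"
  have R_in: "R f \<in> cspace ?W" for f by (simp add: R_def cspace_def)
  have R_linear: "R (f + g) = R f + R g" "R (fscale a f) = fscale a (R f)" for f g a
    by (auto simp: R_def fun_eq_iff)
  have R_id: "R f = f" if "f \<in> cspace ?W" for f
    using that by (auto simp: R_def cspace_def fun_eq_iff)
  have R_wact: "R (wact d i j f) = wact d i j (R f)" if ij: "i < nb" "j < nb" "i \<noteq> j" for i j f
  proof
    fix w
    have iff: "wsw d i j p w \<in> ?W \<longleftrightarrow> w \<in> ?W" if p: "p < length w" for p
      using wsw_in_words[OF _ ij(1,2), of w c d K p] wsw_in_words[OF _ ij(1,2), of "wsw d i j p w" c d K p]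
      unfolding wsw_wsw[OF ij(3) p] by blast
    have "(\<Sum>p<length w. wsg d i j p w * R f (wsw d i j p w))
        = (\<Sum>p<length w. if w \<in> ?W then wsg d i j p w * f (wsw d i j p w) else 0)"
      by (rule sum.cong) (simp_all add: R_def iff)
    then show "R (wact d i j f) w = wact d i j (R f) w"
      unfolding wact_def by (cases "w \<in> ?W") (simp_all add: R_def[where f = "\<lambda>w. sum (g w) (h w)" for g h])
  qed
  have "word_map d nb c' K M (\<lambda>f. \<Phi> (R f))"
    unfolding word_map_def cmap_def R_linear
    using cmap_closed[OF word_map_cmap[OF \<Phi>] R_in] cmap_add[OF word_map_cmap[OF \<Phi>] R_in R_in]
      cmap_scale[OF word_map_cmap[OF \<Phi>] R_in] word_map_act[OF \<Phi> _ _ _ R_in] R_wact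
    by simp
  moreover have "word_im d nb c K \<Phi> \<subseteq> word_im d nb c' K (\<lambda>f. \<Phi> (R f))"
  proof
    fix v assume "v \<in> word_im d nb c K \<Phi>"
    then obtain f where f: "f \<in> cspace ?W" "v = \<Phi> f" unfolding word_im_def by blast
    moreover have "f \<in> cspace ?W'" using f(1) sub unfolding cspace_def by blast
    ultimately show "v \<in> word_im d nb c' K (\<lambda>f. \<Phi> (R f))" unfolding word_im_def using R_id by force
  qed
  ultimately show ?thesis by blast
qed

lemma word_map_comp:
  assumes \<Phi>: "word_map d nb c K M \<Phi>" and sub: "word_im d nb c K \<Phi> \<subseteq> S" and \<phi>: "lin_map (restr M S) N \<phi>"
    and rot: "!!i j v. i < nb ==> j < nb ==> i \<noteq> j ==> v \<in> S ==> \<phi> (act M (rot d i j) v) = act N (rot d i j) (\<phi> v)"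
  shows "word_map d nb c K N (\<lambda>f. \<phi> (\<Phi> f))" "word_im d nb c K (\<lambda>f. \<phi> (\<Phi> f)) = \<phi> ` word_im d nb c K \<Phi>"
proof -
  let ?W = "words c (d + 2 * nb) K"
  have S: "\<Phi> f \<in> S" if "f \<in> cspace ?W" for f using that sub unfolding word_im_def by blast
  note cm = word_map_cmap[OF \<Phi>]
  show "word_map d nb c K N (\<lambda>f. \<phi> (\<Phi> f))"
    unfolding word_map_def cmap_def
  proof (intro conjI ballI allI impI)
    fix f assume f: "f \<in> cspace ?W"
    show "\<phi> (\<Phi> f) \<in> carrier N" using lin_map_closed[OF \<phi>] S[OF f] by simp
    show "\<phi> (\<Phi> (fscale a f)) = a \<odot>\<^bsub>N\<^esub> \<phi> (\<Phi> f)" for a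
      using lin_map_scale[OF \<phi>, of "\<Phi> f" a] S[OF f] by (simp add: cmap_scale[OF cm f])
    show "\<phi> (\<Phi> (f + h)) = \<phi> (\<Phi> f) \<oplus>\<^bsub>N\<^esub> \<phi> (\<Phi> h)" if h: "h \<in> cspace ?W" for h
      using lin_map_add[OF \<phi>, of "\<Phi> f" "\<Phi> h"] S[OF f] S[OF h] by (simp add: cmap_add[OF cm f h])
    show "act N (rot d i j) (\<phi> (\<Phi> f)) = \<phi> (\<Phi> (wact d i j f))" if ij: "i < nb" "j < nb" "i \<noteq> j" for i j
      using rot[OF ij S[OF f]] word_map_act[OF \<Phi> ij f] by simp
  qed
  show "word_im d nb c K (\<lambda>f. \<phi> (\<Phi> f)) = \<phi> ` word_im d nb c K \<Phi>"
    unfolding word_im_def by (simp add: image_image)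
qed

lemma act_act:
  assumes Y: "lie_rep L Y" and x: "x \<in> L" and y: "y \<in> L" and v: "v \<in> carrier Y"
  shows "act Y x (act Y y v) = act Y (lie_bracket x y) v \<oplus>\<^bsub>Y\<^esub> act Y y (act Y x v)"
proof -
  interpret Y: cmodule Y by (rule lie_rep_module[OF Y])
  show ?thesis unfolding act_bracket[OF Y x v y]
    using Y.add_diff_cancel_sub[OF act_closed[OF Y x act_closed[OF Y y v]] act_closed[OF Y y act_closed[OF Y x v]]] by simp
qed

lemma wact_delta_pair:
  assumes ij: "i \<noteq> j" and q: "length q = 2"
  shows "wact d i j (delta q)
    = fscale (- wsg d i j 0 q) (delta (wsw d i j 0 q)) + fscale (- wsg d i j 1 q) (delta (wsw d i j 1 q))"
proof -
  have "wact d i j (delta []) = 0"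
    by (auto simp: wact_def fun_eq_iff delta_def wsw_def)
  then have "wact d i j (delta (q @ [])) = - (\<Sum>p<length q. fscale (wsg d i j p q) (delta (wsw d i j p q)))"
    unfolding wact_delta_append[OF ij] by (simp add: wprefix_linear)
  moreover have "{..<2 :: nat} = {0, 1}" by auto
  ultimately show ?thesis using q by (simp add: fun_eq_iff)
qed

text \<open>\<open>word_map_prod\<close> is applied to the adjoint module: a word \<open>q\<close>
  with label 0 acts by the element \<open>\<Theta> (delta q)\<close> of \<open>L\<close>, and
  equivariance is the identity \<open>x (y v) = [x, y] v + y (x v)\<close>.\<close>

theorem word_map_action:
  fixes s r nb
  defines "d \<equiv> nat_dim s r 1" and "L \<equiv> exhaustion s r (level s nb)"
  assumes Y: "lie_rep g Y" and L: "L \<subseteq> g" and \<Phi>: "word_map d nb c K Y \<Phi>" and c: "2 \<le> c"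
  shows "\<exists>\<Psi>. word_map d nb c (2 + K) Y \<Psi> \<and> word_im d nb c K \<Phi> \<subseteq> word_im d nb c (2 + K) \<Psi> \<and>
    (\<forall>x\<in>L. \<forall>v\<in>word_im d nb c K \<Phi>. act Y x v \<in> word_im d nb c (2 + K) \<Psi>)"
proof -
  interpret Y: cmodule Y by (rule lie_rep_module[OF Y])
  have cY: "cmodule Y" by (rule lie_rep_module[OF Y])
  let ?D = "d + 2 * nb"
  obtain \<Theta> where \<Theta>: "word_map d nb 1 2 (ad_rep (gl ?D)) \<Theta>" "word_im d nb 1 2 \<Theta> = L"
    using word_map_exhaustion[of 1 s r nb] unfolding d_def L_def by auto
  have \<Theta>L: "\<Theta> f \<in> L" if "f \<in> cspace (words 1 ?D 2)" for f
    using that \<Theta>(2) unfolding word_im_def by blast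
  note \<Theta>cm = word_map_cmap[OF \<Theta>(1)]
  \<comment> \<open>A word with the spare label 1 at coordinate 0, which lies below
    \<open>d\<close>, is fixed by all rotations. Acting by the identity there keeps the old image
    inside the new one.\<close>
  let ?e = "[(1, 0), (1, 0)] :: word"
  have d: "0 < d" unfolding d_def by (rule nat_dim_pos)
  have e_in: "?e \<in> words c ?D 2" using c d by (simp add: words_def)
  have e_notin: "?e \<notin> words 1 ?D 2" by (simp add: words_def)
  define \<omega> where "\<omega> q = (if q \<in> words 1 ?D 2 then act Y (\<Theta> (delta q)) else if q = ?e then (\<lambda>v. v) else (\<lambda>v. \<zero>\<^bsub>Y\<^esub>))" for q
  have \<Theta>g: "\<Theta> f \<in> g" if "f \<in> cspace (words 1 ?D 2)" for f using \<Theta>L[OF that] L by blast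
  have rot_g: "rot d i j \<in> g" if "i < nb" "j < nb" "i \<noteq> j" for i j
    using rot_exhaustion[OF that, of s r] L unfolding d_def L_def by blast
  have \<omega>_lin: "lin_map Y Y (\<omega> q)" for q
  proof -
    have "lin_map Y Y (\<lambda>v. v)" "lin_map Y Y (\<lambda>v. \<zero>\<^bsub>Y\<^esub>)" by (simp_all add: lin_map_def)
    then show ?thesis unfolding \<omega>_def using lie_rep_act_linear[OF Y \<Theta>g[OF delta_in_cspace]] by simp
  qed
  have "\<exists>\<Psi>. word_map d nb c (2 + K) Y \<Psi> \<and>
    (\<forall>q\<in>words c ?D 2. \<omega> q ` word_im d nb c K \<Phi> \<subseteq> word_im d nb c (2 + K) \<Psi>)"
  proof (rule word_map_prod[OF cY \<Phi>])
    show "act_linear Y (rot d i j)" if "i < nb" "j < nb" "i \<noteq> j" for i j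
      unfolding act_linear_def by (rule lie_rep_act_linear[OF Y rot_g[OF that]])
    show "lin_map Y Y (\<omega> q)" for q by (rule \<omega>_lin)
    fix i j q v assume ij: "i < nb" "j < nb" "i \<noteq> j" and q: "q \<in> words c ?D 2" and v: "v \<in> carrier Y"
    let ?R = "rot d i j"
    note Rg = rot_g[OF ij]
    have len: "length q = 2" by (rule length_words[OF q])
    have iff: "wsw d i j p q \<in> words 1 ?D 2 \<longleftrightarrow> q \<in> words 1 ?D 2" if p: "p < 2" for p
      using wsw_in_words[OF _ ij(1,2), of q 1 d 2 p] wsw_in_words[OF _ ij(1,2), of "wsw d i j p q" 1 d 2 p]
      unfolding wsw_wsw[OF ij(3) p[folded len]] by blast
    have fix_e: "wsw d i j p ?e = ?e" "wsg d i j p ?e = 0" if "p < 2" for p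
      using that d by (auto simp: wsw_def wsg_def sw_def sg_def less_2_cases_iff)
    have eqe: "wsw d i j p q = ?e \<longleftrightarrow> q = ?e" if p: "p < 2" for p
      using wsw_wsw[OF ij(3) p[folded len], of d] fix_e[OF p] by metis
    show "act Y ?R (\<omega> q v) = \<omega> q (act Y ?R v) \<oplus>\<^bsub>Y\<^esub>
        ((- wsg d i j 0 q) \<odot>\<^bsub>Y\<^esub> \<omega> (wsw d i j 0 q) v \<oplus>\<^bsub>Y\<^esub> (- wsg d i j 1 q) \<odot>\<^bsub>Y\<^esub> \<omega> (wsw d i j 1 q) v)"
    proof (cases "q \<in> words 1 ?D 2")
      case True
      have in1: "wsw d i j 0 q \<in> words 1 ?D 2" "wsw d i j 1 q \<in> words 1 ?D 2" using True iff by auto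
      note dl = delta_in_cspace[OF True] delta_in_cspace[OF in1(1)] delta_in_cspace[OF in1(2)]
      note gl = \<Theta>g[OF dl(1)] \<Theta>g[OF dl(2)] \<Theta>g[OF dl(3)]
      have "lie_bracket ?R (\<Theta> (delta q)) = \<Theta> (wact d i j (delta q))"
        using word_map_act[OF \<Theta>(1) ij dl(1)] by simp
      also have "\<dots> = mat_scale (- wsg d i j 0 q) (\<Theta> (delta (wsw d i j 0 q))) + mat_scale (- wsg d i j 1 q) (\<Theta> (delta (wsw d i j 1 q)))"
        unfolding wact_delta_pair[OF ij(3) len] cmap_add[OF \<Theta>cm cspace_scale[OF dl(2)] cspace_scale[OF dl(3)]]
          cmap_scale[OF \<Theta>cm dl(2)] cmap_scale[OF \<Theta>cm dl(3)] ad_rep_simps ..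
      finally have br: "lie_bracket ?R (\<Theta> (delta q)) = mat_scale (- wsg d i j 0 q) (\<Theta> (delta (wsw d i j 0 q))) + mat_scale (- wsg d i j 1 q) (\<Theta> (delta (wsw d i j 1 q)))" .
      have sg: "mat_scale a x \<in> g" if "x \<in> L" for a x
        using cmat.subspace_scale[OF subspace_exhaustion that[unfolded L_def]] L unfolding L_def by blast
      note LL = \<Theta>L[OF dl(2)] \<Theta>L[OF dl(3)]
      have "act Y (lie_bracket ?R (\<Theta> (delta q))) v = (- wsg d i j 0 q) \<odot>\<^bsub>Y\<^esub> act Y (\<Theta> (delta (wsw d i j 0 q))) v
          \<oplus>\<^bsub>Y\<^esub> (- wsg d i j 1 q) \<odot>\<^bsub>Y\<^esub> act Y (\<Theta> (delta (wsw d i j 1 q))) v"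
        unfolding br act_plus[OF Y sg[OF LL(1)] v sg[OF LL(2)]] act_mat_scale[OF Y gl(2) v] act_mat_scale[OF Y gl(3) v] ..
      moreover have "act Y ?R (act Y (\<Theta> (delta q)) v)
          = act Y (\<Theta> (delta q)) (act Y ?R v) \<oplus>\<^bsub>Y\<^esub> act Y (lie_bracket ?R (\<Theta> (delta q))) v"
      proof -
        have "lie_bracket ?R (\<Theta> (delta q)) \<in> L"
          using lie_bracket_exhaustion[OF rot_exhaustion[OF ij, of s r]] \<Theta>L[OF dl(1)] unfolding L_def d_def by blast
        then have "act Y (lie_bracket ?R (\<Theta> (delta q))) v \<in> carrier Y" using act_closed[OF Y _ v] L by blast
        then show ?thesis unfolding act_act[OF Y Rg gl(1) v]
          by (rule Y.a_comm[OF _ act_closed[OF Y gl(1) act_closed[OF Y Rg v]]])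
      qed
      ultimately show ?thesis unfolding \<omega>_def using True in1 by simp
    next
      case False
      have z: "act Y ?R \<zero>\<^bsub>Y\<^esub> = \<zero>\<^bsub>Y\<^esub>" by (rule lin_map_zero[OF cY cY lie_rep_act_linear[OF Y Rg]])
      show ?thesis
      proof (cases "q = ?e")
        case True
        then show ?thesis using lin_map_closed[OF \<omega>_lin v] fix_e act_closed[OF Y Rg v] e_notin
          by (simp add: \<omega>_def v)
      next
        case F: False
        have "\<omega> q = (\<lambda>v. \<zero>\<^bsub>Y\<^esub>)" "\<omega> (wsw d i j 0 q) = (\<lambda>v. \<zero>\<^bsub>Y\<^esub>)" "\<omega> (wsw d i j 1 q) = (\<lambda>v. \<zero>\<^bsub>Y\<^esub>)"
          unfolding \<omega>_def using False F iff[of 0] iff[of 1] eqe[of 0] eqe[of 1] by simp_all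
        then show ?thesis by (simp add: z)
      qed
    qed
  qed
  then obtain \<Psi> where \<Psi>: "word_map d nb c (2 + K) Y \<Psi>"
    and im: "!!q v. q \<in> words c ?D 2 ==> v \<in> word_im d nb c K \<Phi> ==> \<omega> q v \<in> word_im d nb c (2 + K) \<Psi>" by blast
  note I\<Psi> = submodule_word_im[OF cY \<Psi>] and I\<Phi> = submodule_word_im[OF cY \<Phi>]
  have sub: "words 1 ?D 2 \<subseteq> words c ?D 2" using c by (intro words_mono) simp
  have "act Y x v \<in> word_im d nb c (2 + K) \<Psi>" if x: "x \<in> L" and v: "v \<in> word_im d nb c K \<Phi>" for x v
  proof -
    have vc: "v \<in> carrier Y" by (rule Y.submodule_carrier[OF I\<Phi> v])
    obtain f where f: "f \<in> cspace (words 1 ?D 2)" "x = \<Theta> f" using x \<Theta>(2) unfolding word_im_def by blast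
    \<comment> \<open>The action is known on the basis functions \<open>delta q\<close>; linearity
      in the acting element extends it to all of \<open>L\<close>.\<close>
    let ?T = "{f \<in> cspace (words 1 ?D 2). act Y (\<Theta> f) v \<in> word_im d nb c (2 + K) \<Psi>}"
    have T: "cfun.subspace ?T"
    proof (rule cfun.subspaceI)
      have add: "act Y (\<Theta> (f + h)) v = act Y (\<Theta> f) v \<oplus>\<^bsub>Y\<^esub> act Y (\<Theta> h) v"
        if f: "f \<in> cspace (words 1 ?D 2)" and h: "h \<in> cspace (words 1 ?D 2)" for f h
        using cmap_add[OF \<Theta>cm f h] act_plus[OF Y \<Theta>g[OF f] vc \<Theta>g[OF h]] by simp
      have scale: "act Y (\<Theta> (fscale a f)) v = a \<odot>\<^bsub>Y\<^esub> act Y (\<Theta> f) v"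
        if f: "f \<in> cspace (words 1 ?D 2)" for f a
        using cmap_scale[OF \<Theta>cm f] act_mat_scale[OF Y \<Theta>g[OF f] vc] by simp
      show "0 \<in> ?T"
        using scale[OF cspace_zero, of 0] Y.submodule_zero_mem[OF I\<Psi>] act_closed[OF Y \<Theta>g[OF cspace_zero] vc]
        by (simp add: cspace_zero)
      show "f + h \<in> ?T" if "f \<in> ?T" "h \<in> ?T" for f h
        using that add[of f h] Y.submodule_add[OF I\<Psi>] cspace_add[of f _ h] by simp
      show "fscale a f \<in> ?T" if "f \<in> ?T" for f a
        using that scale[of f a] Y.submodule_scale[OF I\<Psi>] cspace_scale[of f] by simp
    qed
    have "f \<in> ?T"
    proof (rule cmap_induct[OF finite_words f(1) T])
      fix q assume q: "q \<in> words 1 ?D 2"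
      then have "\<omega> q = act Y (\<Theta> (delta q))" by (simp add: \<omega>_def)
      then show "delta q \<in> ?T" using im[OF subsetD[OF sub q] v] delta_in_cspace[OF q] by simp
    qed
    then show ?thesis by (simp add: f(2))
  qed
  moreover have "word_im d nb c K \<Phi> \<subseteq> word_im d nb c (2 + K) \<Psi>"
    using im[OF e_in] e_notin by (auto simp: \<omega>_def)
  ultimately show ?thesis using \<Psi> by blast
qed

section \<open>Generated submodules, unions and sums\<close>

lemma subrep_gen_subrep:
  assumes L: "lie_rep L M" and S: "S \<subseteq> carrier M"
  shows "subrep L M (gen_subrep L M S)"
proof -
  interpret M: cmodule M by (rule lie_rep_module[OF L])
  let ?N = "{N. subrep L M N \<and> S \<subseteq> N}"
  have "subrep L M (carrier M)" unfolding subrep_def using M.carrier_submodule act_closed[OF L] by blast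
  then have ne: "?N \<noteq> {}" using S by blast
  have "submodule (\<Inter>?N) \<complex> M" by (rule M.submodule_Inter) (use ne in \<open>auto simp: subrep_def\<close>)
  moreover have "act M x v \<in> \<Inter>?N" if "x \<in> L" "v \<in> \<Inter>?N" for x v using that unfolding subrep_def by blast
  ultimately show ?thesis unfolding subrep_def gen_subrep_def by blast
qed

lemma gen_subrep_minimal: "subrep L M N ==> S \<subseteq> N ==> gen_subrep L M S \<subseteq> N"
  unfolding gen_subrep_def by blast

lemma (in cmodule) submodule_directed_Union:
  fixes A :: "nat => 'v set"
  assumes A: "!!i. submodule (A i) \<complex> M" and mono: "!!i j. i \<le> j ==> A i \<subseteq> A j"
  shows "submodule (\<Union>i. A i) \<complex> M"
  unfolding submodule_iff
proof (intro conjI ballI allI)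
  show "(\<Union>i. A i) \<subseteq> carrier M" using submodule_carrier[OF A] by blast
  show "\<zero> \<in> (\<Union>i. A i)" using submodule_zero_mem[OF A] by blast
  show "c \<odot> v \<in> (\<Union>i. A i)" if "v \<in> (\<Union>i. A i)" for c v using that submodule_scale[OF A] by blast
  fix v w assume "v \<in> (\<Union>i. A i)" "w \<in> (\<Union>i. A i)"
  then obtain i j where "v \<in> A i" "w \<in> A j" by blast
  then have "v \<in> A (max i j)" "w \<in> A (max i j)" using mono[of i "max i j"] mono[of j "max i j"] by auto
  then show "v \<oplus> w \<in> (\<Union>i. A i)" using submodule_add[OF A] by blast
qed

lemma (in cmodule) submodule_sum:
  assumes A: "submodule A \<complex> M" and D: "submodule D \<complex> M"
  shows "submodule {a \<oplus> b |a b. a \<in> A \<and> b \<in> D} \<complex> M"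
  unfolding submodule_iff
proof (intro conjI ballI allI)
  note c = submodule_carrier[OF A] submodule_carrier[OF D]
  show "{a \<oplus> b |a b. a \<in> A \<and> b \<in> D} \<subseteq> carrier M" using c by blast
  show "\<zero> \<in> {a \<oplus> b |a b. a \<in> A \<and> b \<in> D}"
    using submodule_zero_mem[OF A] submodule_zero_mem[OF D] by force
  fix v assume "v \<in> {a \<oplus> b |a b. a \<in> A \<and> b \<in> D}"
  then obtain a b where ab: "v = a \<oplus> b" "a \<in> A" "b \<in> D" by blast
  have "x \<odot> v = x \<odot> a \<oplus> x \<odot> b" for x unfolding ab(1) by (rule scale_add_right[OF c(1)[OF ab(2)] c(2)[OF ab(3)]])
  then show "x \<odot> v \<in> {a \<oplus> b |a b. a \<in> A \<and> b \<in> D}" for x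
    using submodule_scale[OF A ab(2)] submodule_scale[OF D ab(3)] by blast
  fix w assume "w \<in> {a \<oplus> b |a b. a \<in> A \<and> b \<in> D}"
  then obtain a' b' where ab': "w = a' \<oplus> b'" "a' \<in> A" "b' \<in> D" by blast
  have "v \<oplus> w = (a \<oplus> a') \<oplus> (b \<oplus> b')"
    unfolding ab(1) ab'(1) using c(1)[OF ab(2)] c(2)[OF ab(3)] c(1)[OF ab'(2)] c(2)[OF ab'(3)] by (simp add: a_ac)
  then show "v \<oplus> w \<in> {a \<oplus> b |a b. a \<in> A \<and> b \<in> D}"
    using submodule_add[OF A ab(2) ab'(2)] submodule_add[OF D ab(3) ab'(3)] by blast
qed

section \<open>The filtration by degree\<close>

text \<open>What the finiteness argument uses of the induced module: subspaces \<open>B nb\<close>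
  that generate it and, for large \<open>nb\<close>, lie in images of words of one degree
  \<open>K\<close>. Two labels are required for \<open>word_map_action\<close>.\<close>

locale filtered_rep =
  fixes s :: series and r c K :: nat and g :: "mat set" and Y :: "'v rep" and B :: "nat => 'v set"
  assumes g_eq: "g = (\<Union>i\<in>{1..}. exhaustion s r i)"
    and rep: "lie_rep g Y"
    and B_sub: "submodule (B nb) \<complex> Y"
    and B_mono: "nb \<le> nb' ==> B nb \<subseteq> B nb'"
    and covered: "\<exists>N. \<forall>nb\<ge>N. \<exists>\<Phi>. word_map (nat_dim s r 1) nb c K Y \<Phi> \<and> B nb \<subseteq> word_im (nat_dim s r 1) nb c K \<Phi>"
    and labels: "2 \<le> c"
    and generated: "submodule S \<complex> Y ==> (!!x v. x \<in> g ==> v \<in> S ==> act Y x v \<in> S) ==> (!!nb. B nb \<subseteq> S) ==>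
      carrier Y \<subseteq> S"
begin

abbreviation d where "d \<equiv> nat_dim s r 1"
abbreviation Lv where "Lv nb \<equiv> exhaustion s r (level s nb)"

sublocale Y: cmodule Y by (rule lie_rep_module[OF rep])

lemma cY: "cmodule Y" by (rule lie_rep_module[OF rep])

lemma Lv_g: "Lv nb \<subseteq> g"
  using level_ge(2) unfolding g_eq by blast

lemma Lv_mono: "nb \<le> nb' ==> Lv nb \<subseteq> Lv nb'"
  by (intro exhaustion_mono level_mono)

lemma exhaustion_Lv: "exhaustion s r i \<subseteq> Lv i"
  using exhaustion_mono[of i "level s i"] level_ge(1)[of i s] by simp

lemma g_Lv: "x \<in> g ==> \<exists>N. \<forall>nb\<ge>N. x \<in> Lv nb"
  using exhaustion_Lv Lv_mono unfolding g_eq by blast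

lemma rot_g: "i \<noteq> j ==> rot d i j \<in> g"
  using rot_exhaustion[of i "Suc (max i j)" j s r] Lv_g[of "Suc (max i j)"] by auto

text \<open>The step of degree \<open>j\<close> at level \<open>nb\<close>: only
  \<open>Lv nb\<close> acts, so that it stays in the image of words over \<open>nb\<close> blocks,
  at the cost of two more letters per step.\<close>

primrec FF :: "nat => nat => 'v set" where
  "FF 0 = B"
| "FF (Suc j) = (\<lambda>nb. lin_span Y (FF j nb \<union> (\<Union>x\<in>Lv nb. act Y x ` FF j nb)))"

lemma act_g: "x \<in> g ==> v \<in> carrier Y ==> act Y x v \<in> carrier Y"
  by (rule act_closed[OF rep])

lemma FF_sub: "submodule (FF j nb) \<complex> Y"
proof (induction j)
  case 0
  show ?case by (simp add: B_sub)
next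
  case (Suc j)
  have "act Y x v \<in> carrier Y" if "x \<in> Lv nb" "v \<in> FF j nb" for x v
    using act_g[OF subsetD[OF Lv_g that(1)] Y.submodule_carrier[OF Suc that(2)]] .
  then show ?case using Y.submodule_carrier[OF Suc] by (auto intro!: submodule_lin_span[OF cY])
qed

lemma FF_carrier: "v \<in> FF j nb ==> v \<in> carrier Y"
  by (rule Y.submodule_carrier[OF FF_sub])

lemma FF_Suc: "v \<in> FF j nb ==> v \<in> FF (Suc j) nb"
  using lin_span_superset[of "FF j nb \<union> (\<Union>x\<in>Lv nb. act Y x ` FF j nb)" Y] by auto

lemma FF_act: "x \<in> Lv nb ==> v \<in> FF j nb ==> act Y x v \<in> FF (Suc j) nb"
  using lin_span_superset[of "FF j nb \<union> (\<Union>x\<in>Lv nb. act Y x ` FF j nb)" Y] by auto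

lemma FF_minimal:
  assumes "submodule S \<complex> Y" "FF j nb \<subseteq> S" "!!x v. x \<in> Lv nb ==> v \<in> FF j nb ==> act Y x v \<in> S"
  shows "FF (Suc j) nb \<subseteq> S"
  unfolding FF.simps(2) by (rule lin_span_minimal[OF assms(1)]) (use assms(2,3) in blast)

lemma FF_mono: "nb \<le> nb' ==> FF j nb \<subseteq> FF j nb'"
proof (induction j)
  case 0
  then show ?case by (simp add: B_mono)
next
  case (Suc j)
  note IH = subsetD[OF Suc.IH[OF Suc.prems]]
  show ?case
  proof (rule FF_minimal[OF FF_sub])
    show "FF j nb \<subseteq> FF (Suc j) nb'" using FF_Suc IH by blast
    show "act Y x v \<in> FF (Suc j) nb'" if "x \<in> Lv nb" "v \<in> FF j nb" for x v
      by (rule FF_act[OF subsetD[OF Lv_mono[OF Suc.prems] that(1)] IH[OF that(2)]])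
  qed
qed

lemma FF_covered: "\<exists>N. \<forall>nb\<ge>N. \<exists>\<Phi>. word_map d nb c (2 * j + K) Y \<Phi> \<and> FF j nb \<subseteq> word_im d nb c (2 * j + K) \<Phi>"
proof (induction j)
  case 0
  show ?case using covered by simp
next
  case (Suc j)
  then obtain N where N: "!!nb. nb \<ge> N ==> \<exists>\<Phi>. word_map d nb c (2 * j + K) Y \<Phi> \<and> FF j nb \<subseteq> word_im d nb c (2 * j + K) \<Phi>"
    by blast
  have "\<exists>\<Psi>. word_map d nb c (2 * Suc j + K) Y \<Psi> \<and> FF (Suc j) nb \<subseteq> word_im d nb c (2 * Suc j + K) \<Psi>" if nb: "nb \<ge> N" for nb
  proof -
    obtain \<Phi> where \<Phi>: "word_map d nb c (2 * j + K) Y \<Phi>" "FF j nb \<subseteq> word_im d nb c (2 * j + K) \<Phi>" using N[OF nb] by blast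
    obtain \<Psi> where \<Psi>: "word_map d nb c (2 + (2 * j + K)) Y \<Psi>"
        "word_im d nb c (2 * j + K) \<Phi> \<subseteq> word_im d nb c (2 + (2 * j + K)) \<Psi>"
        "\<forall>x\<in>Lv nb. \<forall>v\<in>word_im d nb c (2 * j + K) \<Phi>. act Y x v \<in> word_im d nb c (2 + (2 * j + K)) \<Psi>"
      using word_map_action[OF rep Lv_g \<Phi>(1) labels] by blast
    have "FF (Suc j) nb \<subseteq> word_im d nb c (2 + (2 * j + K)) \<Psi>"
      by (rule FF_minimal[OF submodule_word_im[OF cY \<Psi>(1)]]) (use \<Phi>(2) \<Psi>(2,3) in blast)+
    then show ?thesis using \<Psi>(1) by (auto simp: add.assoc)
  qed
  then show ?case by blast
qed

definition Fil :: "nat => 'v set" where "Fil j = (\<Union>nb. FF j nb)"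

lemma Fil_sub: "submodule (Fil j) \<complex> Y"
  unfolding Fil_def by (rule Y.submodule_directed_Union[OF FF_sub FF_mono])

lemma Fil_carrier: "v \<in> Fil j ==> v \<in> carrier Y"
  by (rule Y.submodule_carrier[OF Fil_sub])

lemma Fil_Suc: "v \<in> Fil j ==> v \<in> Fil (Suc j)"
  using FF_Suc unfolding Fil_def by blast

lemma Fil_mono: "j \<le> j' ==> Fil j \<subseteq> Fil j'"
  by (rule lift_Suc_mono_le[of Fil]) (use Fil_Suc in blast)+

lemma Fil_eventually: "v \<in> Fil j ==> \<exists>N. \<forall>nb\<ge>N. v \<in> FF j nb"
  using FF_mono unfolding Fil_def by blast

lemma Fil_act:
  assumes "x \<in> g" "v \<in> Fil j"
  shows "act Y x v \<in> Fil (Suc j)"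
proof -
  obtain N1 where N1: "!!nb. nb \<ge> N1 ==> v \<in> FF j nb" using Fil_eventually[OF assms(2)] by blast
  obtain N2 where N2: "!!nb. nb \<ge> N2 ==> x \<in> Lv nb" using g_Lv[OF assms(1)] by blast
  have "act Y x v \<in> FF (Suc j) (max N1 N2)" by (rule FF_act) (simp_all add: N1 N2)
  then show ?thesis unfolding Fil_def by blast
qed

lemma Fil_minimal:
  assumes "submodule S \<complex> Y" "Fil j \<subseteq> S" "!!x v. x \<in> g ==> v \<in> Fil j ==> act Y x v \<in> S"
  shows "Fil (Suc j) \<subseteq> S"
proof -
  have "FF (Suc j) nb \<subseteq> S" for nb
    by (rule FF_minimal[OF assms(1)]) (use assms(2,3) Lv_g in \<open>unfold Fil_def, blast+\<close>)
  then show ?thesis unfolding Fil_def[of "Suc j"] by blast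
qed

lemma carrier_Fil: "carrier Y \<subseteq> (\<Union>j. Fil j)"
proof (rule generated)
  show "submodule (\<Union>j. Fil j) \<complex> Y" by (rule Y.submodule_directed_Union[OF Fil_sub Fil_mono])
  show "act Y x v \<in> (\<Union>j. Fil j)" if "x \<in> g" "v \<in> (\<Union>j. Fil j)" for x v using that Fil_act by blast
  have "B nb \<subseteq> Fil 0" for nb unfolding Fil_def by auto
  then show "B nb \<subseteq> (\<Union>j. Fil j)" for nb by blast
qed

text \<open>Stability is asked level by level, so that it passes to every \<open>FF j nb\<close> and
  not only to the unions over \<open>nb\<close>.\<close>

definition stable :: "mat set => bool" where
  "stable P \<longleftrightarrow> P \<subseteq> g \<and> (\<forall>nb. \<forall>x\<in>P \<inter> Lv nb. \<forall>v\<in>B nb. act Y x v \<in> B nb)"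

text \<open>From \<open>x (y v) = [x, y] v + y (x v)\<close>: the bracket lies again in
  \<open>Lv nb\<close>, and \<open>x v\<close> stays in the previous step by induction.\<close>

lemma FF_stable:
  assumes P: "stable P" and x: "x \<in> P" "x \<in> Lv nb"
  shows "v \<in> FF j nb ==> act Y x v \<in> FF j nb"
proof (induction j arbitrary: v)
  case 0
  then show ?case using P x unfolding stable_def by simp
next
  case (Suc j)
  have xg: "x \<in> g" using Lv_g x by blast
  let ?S = "{v \<in> carrier Y. act Y x v \<in> FF (Suc j) nb}"
  have "FF (Suc j) nb \<subseteq> ?S"
  proof (rule FF_minimal)
    show "submodule ?S \<complex> Y" by (rule Y.submodule_vimage[OF cY lie_rep_act_linear[OF rep xg] FF_sub])
    show "FF j nb \<subseteq> ?S" using FF_carrier FF_act[OF x(2)] by blast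
    fix y v assume y: "y \<in> Lv nb" and v: "v \<in> FF j nb"
    have yg: "y \<in> g" using Lv_g y by blast
    have "act Y x (act Y y v) = act Y (lie_bracket x y) v \<oplus>\<^bsub>Y\<^esub> act Y y (act Y x v)"
      by (rule act_act[OF rep xg yg FF_carrier[OF v]])
    also have "\<dots> \<in> FF (Suc j) nb"
      by (rule Y.submodule_add[OF FF_sub FF_act[OF lie_bracket_exhaustion[OF x(2) y] v] FF_act[OF y Suc.IH[OF v]]])
    finally show "act Y y v \<in> ?S" using act_g[OF yg FF_carrier[OF v]] by blast
  qed
  then show ?case using Suc.prems by blast
qed

lemma Fil_stable:
  assumes P: "stable P" and x: "x \<in> P" and v: "v \<in> Fil j"
  shows "act Y x v \<in> Fil j"
proof -
  obtain N1 where N1: "!!nb. nb \<ge> N1 ==> v \<in> FF j nb" using Fil_eventually[OF v] by blast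
  obtain N2 where N2: "!!nb. nb \<ge> N2 ==> x \<in> Lv nb" using g_Lv[of x] P x unfolding stable_def by blast
  have "act Y x v \<in> FF j (max N1 N2)" by (rule FF_stable[OF P x]) (simp_all add: N1 N2)
  then show ?thesis unfolding Fil_def by blast
qed

definition bnd :: "nat => nat" where
  "bnd j = card (words c (d + 4 * (2 * j + K)) (2 * j + K) \<times> words c (d + 4 * (2 * j + K)) (2 * j + K))"

text \<open>Finitely many witnesses of strictness all lie in \<open>FF j nb\<close> for one large
  \<open>nb\<close>, where the bound for words applies; it is the same for all
  \<open>nb\<close>.\<close>

lemma Fil_chain:
  fixes N :: "nat => 'v set"
  assumes I: "finite I" and mono: "mono N"
    and N: "!!k. submodule (N k) \<complex> Y" "!!k i j v. i \<noteq> j ==> v \<in> N k ==> act Y (rot d i j) v \<in> N k"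
    and strict: "!!k. k \<in> I ==> \<exists>v. v \<in> Fil j \<and> v \<in> N (Suc k) \<and> v \<notin> N k"
  shows "card I \<le> bnd j"
proof -
  have "\<forall>k\<in>I. \<exists>v M. (\<forall>nb\<ge>M. v \<in> FF j nb) \<and> v \<in> N (Suc k) \<and> v \<notin> N k"
    using strict Fil_eventually by metis
  then obtain f M where f: "!!k. k \<in> I ==> (\<forall>nb\<ge>M k. f k \<in> FF j nb) \<and> f k \<in> N (Suc k) \<and> f k \<notin> N k" by metis
  obtain N0 where N0: "!!nb. nb \<ge> N0 ==> \<exists>\<Phi>. word_map d nb c (2 * j + K) Y \<Phi> \<and> FF j nb \<subseteq> word_im d nb c (2 * j + K) \<Phi>"
    using FF_covered[of j] by blast
  define nb where "nb = Max (insert N0 (M ` I))"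
  have "nb \<ge> N0" "!!k. k \<in> I ==> nb \<ge> M k" unfolding nb_def using I by auto
  moreover obtain \<Phi> where \<Phi>: "word_map d nb c (2 * j + K) Y \<Phi>" "FF j nb \<subseteq> word_im d nb c (2 * j + K) \<Phi>"
    using N0[OF \<open>nb \<ge> N0\<close>] by blast
  ultimately have "!!k. k \<in> I ==> \<exists>v. v \<in> word_im d nb c (2 * j + K) \<Phi> \<and> v \<in> N (Suc k) \<and> v \<notin> N k"
    using f by blast
  then show ?thesis unfolding bnd_def
    by (intro word_map_chain[OF cY \<Phi>(1) I mono N(1)]) (use N(2) in blast)+
qed

text \<open>A vector lies in \<open>FF j nb\<close> for some \<open>j\<close> and all large
  \<open>nb\<close>; that space is stable under the level \<open>n\<close> part of \<open>P\<close>
  and lies in the finite-dimensional image of a word map.\<close>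

lemma integrable_stable:
  assumes P: "stable P"
  shows "integrable_rep (exhaustion s r) P Y"
  unfolding integrable_rep_def
proof (intro ballI allI impI)
  fix v n assume v: "v \<in> carrier Y" and n: "1 \<le> (n :: nat)"
  let ?L = "P \<inter> exhaustion s r n"
  have Pg: "?L \<subseteq> g" using P unfolding stable_def by blast
  obtain j where "v \<in> Fil j" using v carrier_Fil by blast
  then obtain N1 where N1: "!!nb. nb \<ge> N1 ==> v \<in> FF j nb" using Fil_eventually by blast
  obtain N0 where N0: "!!nb. nb \<ge> N0 ==> \<exists>\<Phi>. word_map d nb c (2 * j + K) Y \<Phi> \<and> FF j nb \<subseteq> word_im d nb c (2 * j + K) \<Phi>"
    using FF_covered[of j] by blast
  define nb where "nb = max n (max N0 N1)"
  have nb: "n \<le> nb" "N0 \<le> nb" "N1 \<le> nb" unfolding nb_def by simp_all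
  obtain \<Phi> where \<Phi>: "word_map d nb c (2 * j + K) Y \<Phi>" "FF j nb \<subseteq> word_im d nb c (2 * j + K) \<Phi>"
    using N0[OF nb(2)] by blast
  have "?L \<subseteq> Lv nb" using exhaustion_Lv[of n] Lv_mono[OF nb(1)] by blast
  then have "subrep ?L Y (FF j nb)" unfolding subrep_def using FF_sub FF_stable[OF P] by blast
  then have "gen_subrep ?L Y {v} \<subseteq> FF j nb" by (rule gen_subrep_minimal) (simp add: N1 nb)
  moreover have "submodule (gen_subrep ?L Y {v}) \<complex> Y"
    using subrep_gen_subrep[OF lie_rep_mono[OF rep Pg], of "{v}"] v unfolding subrep_def by blast
  ultimately show "fin_dim Y (gen_subrep ?L Y {v})"
    using \<Phi>(2) by (intro word_map_fin_dim[OF cY \<Phi>(1)]) blast+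
qed

lemma gen_Fil:
  assumes P: "stable P" and F: "finite F" "F \<subseteq> carrier Y"
  obtains j where "gen_subrep P Y F \<subseteq> Fil j"
proof -
  have "\<exists>j. F \<subseteq> Fil j" using F
  proof (induction F rule: finite_induct)
    case empty
    show ?case by blast
  next
    case (insert v F)
    then obtain j j' where "F \<subseteq> Fil j" "v \<in> Fil j'" using carrier_Fil by blast
    then have "insert v F \<subseteq> Fil (max j j')" using Fil_mono[of j "max j j'"] Fil_mono[of j' "max j j'"] by auto
    then show ?case by blast
  qed
  then obtain j where j: "F \<subseteq> Fil j" by blast
  have "subrep P Y (Fil j)" unfolding subrep_def using Fil_sub Fil_stable[OF P] by blast
  then show ?thesis using that gen_subrep_minimal j by blast
qed

text \<open>Only the steps of the list that are visible inside \<open>Fil j\<close> are counted; the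
  list itself may be longer than any bound.\<close>

lemma list_chain:
  assumes P: "stable P" and rot: "!!i j. i \<noteq> j ==> rot d i j \<in> P"
    and cs: "cs \<noteq> []" "!!N. N \<in> set cs ==> subrep P Y N" "!!i. Suc i < length cs ==> cs ! i \<subseteq> cs ! Suc i"
    and I: "I \<subseteq> {i. Suc i < length cs}" and strict: "!!k. k \<in> I ==> \<exists>v. v \<in> Fil j \<and> v \<in> cs ! Suc k \<and> v \<notin> cs ! k"
  shows "card I \<le> bnd j"
proof (rule Fil_chain)
  \<comment> \<open>The list continued by its last entry, as a chain indexed by all natural
    numbers.\<close>
  let ?N = "\<lambda>k. cs ! min k (length cs - 1)"
  have mem: "?N k \<in> set cs" for k using cs(1) by (intro nth_mem) (simp add: min_less_iff_disj)
  have "I \<subseteq> {..<length cs}" using I by auto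
  then show "finite I" using finite_subset by blast
  show "mono ?N"
    unfolding mono_iff_le_Suc
  proof
    fix k
    show "?N k \<subseteq> ?N (Suc k)"
    proof (cases "Suc k < length cs")
      case True
      then show ?thesis using cs(3)[OF True] by (simp add: min_absorb1)
    next
      case False
      then show ?thesis by (simp add: min_absorb2)
    qed
  qed
  show "submodule (?N k) \<complex> Y" for k using cs(2)[OF mem] unfolding subrep_def by blast
  show "act Y (rot d i j) v \<in> ?N k" if "i \<noteq> j" "v \<in> ?N k" for k i j v
    using cs(2)[OF mem] rot[OF that(1)] that(2) unfolding subrep_def by blast
  show "\<exists>v. v \<in> Fil j \<and> v \<in> ?N (Suc k) \<and> v \<notin> ?N k" if "k \<in> I" for k
    using strict[OF that] subsetD[OF I that] by (simp add: min_absorb1)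
qed

text \<open>A finitely generated submodule lies in one \<open>Fil j\<close>, where every step of a
  strict chain is visible, so \<open>Suc (bnd j)\<close> bounds the number of terms.\<close>

theorem finite_length_gen:
  assumes P: "stable P" and rot: "!!i j. i \<noteq> j ==> rot d i j \<in> P" and F: "finite F" "F \<subseteq> carrier Y"
  shows "finite_length P (restr Y (gen_subrep P Y F))"
proof -
  obtain j where j: "gen_subrep P Y F \<subseteq> Fil j" by (rule gen_Fil[OF P F])
  have repP: "lie_rep P Y" using lie_rep_mono[OF rep] P unfolding stable_def by blast
  note gen = subrep_gen_subrep[OF repP F(2)]
  have genm: "submodule (gen_subrep P Y F) \<complex> Y" using gen unfolding subrep_def by blast
  have mod: "module \<complex> Y" using cY by (simp add: cmodule_iff)
  show ?thesis
  proof (rule finite_length_if_chains_bounded[OF lie_rep_restr[OF repP gen]])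
    fix cs assume sorted: "sorted_wrt (\<subset>) cs" and sub: "\<forall>N\<in>set cs. subrep P (restr Y (gen_subrep P Y F)) N"
    have st: "cs ! i \<subset> cs ! Suc i" if "Suc i < length cs" for i
      using sorted_wrt_nth_less[OF sorted _ that, of i] by simp
    have sub': "subrep P Y N \<and> N \<subseteq> gen_subrep P Y F" if "N \<in> set cs" for N
      using sub that subrep_restr_iff[OF mod genm] by blast
    show "length cs \<le> Suc (bnd j)"
    proof (cases "cs = []")
      case False
      have "card {i. Suc i < length cs} \<le> bnd j"
      proof (rule list_chain[OF P rot False])
        fix k assume "k \<in> {i. Suc i < length cs}"
        then show "\<exists>v. v \<in> Fil j \<and> v \<in> cs ! Suc k \<and> v \<notin> cs ! k"
          using st[of k] sub'[of "cs ! Suc k"] j by auto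
      qed (use sub' st in auto)
      moreover have "{i. Suc i < length cs} = {..<length cs - 1}" by auto
      ultimately show ?thesis by simp
    qed simp
  qed
qed

end

section \<open>Multiplicities of simple modules\<close>

text \<open>An isomorphism from a factor is replaced by a surjection on \<open>D\<close> with kernel
  \<open>A\<close>, so that the arguments below can work with vectors of \<open>Y\<close> rather
  than cosets.\<close>

lemma rep_iso_quot:
  assumes Y: "lie_rep L Y" and A: "subrep L Y A" and D: "subrep L Y D" and AD: "A \<subseteq> D" and S: "lie_rep L S"
    and iso: "rep_iso L (quot_rep (restr Y D) A) S"
  shows "\<exists>\<psi>. lin_map (restr Y D) S \<psi> \<and> (\<forall>x\<in>L. \<forall>v\<in>D. \<psi> (act Y x v) = act S x (\<psi> v)) \<and> \<psi> ` D = carrier S \<and>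
    (\<forall>v\<in>D. \<psi> v = \<zero>\<^bsub>S\<^esub> \<longleftrightarrow> v \<in> A)"
proof -
  let ?R = "restr Y D"
  have mod: "module \<complex> Y" using lie_rep_module[OF Y] by (simp add: cmodule_iff)
  have sub: "submodule A \<complex> Y" "submodule D \<complex> Y" using A D unfolding subrep_def by blast+
  interpret Q: quot ?R A by (rule quot_restr[OF mod sub AD])
  obtain \<phi> where \<phi>: "rep_hom L (quot_rep ?R A) S \<phi>" "bij_betw \<phi> (carrier (quot_rep ?R A)) (carrier S)"
    using iso unfolding rep_iso_def by blast
  have lin: "lin_map (quot_rep ?R A) S \<phi>" using \<phi>(1) unfolding rep_hom_def lin_map_def by blast
  have cQ: "cmodule (quot_rep ?R A)" using Q.module_quot by (simp add: cmodule_iff)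
  have eq: "\<phi> (qcl ?R A (act Y x v)) = act S x (\<phi> (qcl ?R A v))" if x: "x \<in> L" and v: "v \<in> D" for x v
  proof -
    have al: "act_linear ?R x" using lie_rep_restr[OF Y D] x unfolding lie_rep_iff by blast
    have st: "act ?R x w \<in> A" if "w \<in> A" for w using A x that unfolding subrep_def by simp
    have "act (quot_rep ?R A) x (qcl ?R A v) = qcl ?R A (act ?R x v)" using Q.qcl_act[OF al st, of v] v by simp
    moreover have "qcl ?R A v \<in> carrier (quot_rep ?R A)" by (rule Q.qcl_in) (simp add: v)
    then have "\<phi> (act (quot_rep ?R A) x (qcl ?R A v)) = act S x (\<phi> (qcl ?R A v))"
      using \<phi>(1) x unfolding rep_hom_def by blast
    ultimately show ?thesis by simp
  qed
  have ker: "\<phi> (qcl ?R A v) = \<zero>\<^bsub>S\<^esub> \<longleftrightarrow> v \<in> A" if v: "v \<in> D" for v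
  proof -
    have z: "\<phi> \<zero>\<^bsub>quot_rep ?R A\<^esub> = \<zero>\<^bsub>S\<^esub>" by (rule lin_map_zero[OF cQ lie_rep_module[OF S] lin])
    have "\<zero>\<^bsub>quot_rep ?R A\<^esub> \<in> carrier (quot_rep ?R A)"
      using cmodule.submodule_zero_mem[OF cQ cmodule.carrier_submodule[OF cQ]] .
    moreover have "qcl ?R A v \<in> carrier (quot_rep ?R A)" by (rule Q.qcl_in) (simp add: v)
    ultimately have "\<phi> (qcl ?R A v) = \<phi> \<zero>\<^bsub>quot_rep ?R A\<^esub> \<longleftrightarrow> qcl ?R A v = \<zero>\<^bsub>quot_rep ?R A\<^esub>"
      using bij_betw_imp_inj_on[OF \<phi>(2)] by (simp add: inj_on_eq_iff)
    then show ?thesis using Q.qcl_eq_zero_iff[of v] v by (simp add: z)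
  qed
  have "(\<lambda>v. \<phi> (qcl ?R A v)) ` D = \<phi> ` carrier (quot_rep ?R A)"
    unfolding Q.carrier_quot by (simp add: image_image)
  also have "\<dots> = carrier S" by (rule bij_betw_imp_surj_on[OF \<phi>(2)])
  finally have im: "(\<lambda>v. \<phi> (qcl ?R A v)) ` D = carrier S" .
  show ?thesis using lin_map_comp[OF Q.lin_map_qcl lin] eq im ker by blast
qed

context filtered_rep
begin

text \<open>If \<open>h\<close> has an eigenvector in \<open>S\<close>, its eigenvalue
  \<open>a\<close> fixes a degree \<open>j\<close> with \<open>\<rho> j < Re a\<close>; a preimage
  in any factor isomorphic to \<open>S\<close> is an eigenvector modulo the lower term, and
  \<open>eigenvector_in_summand\<close> moves it into \<open>Fil j\<close>. If there is none,
  \<open>S\<close> cannot occur, because a product of shifts annihilates each vector of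
  \<open>Y\<close>.\<close>

theorem multiplicity_bounded:
  assumes P: "stable P" and rot: "!!i j. i \<noteq> j ==> rot d i j \<in> P" and h: "h \<in> P"
    and split: "!!j v. v \<in> carrier Y ==> \<exists>v\<^sub>0 v\<^sub>1. v = v\<^sub>0 \<oplus>\<^bsub>Y\<^esub> v\<^sub>1 \<and> v\<^sub>0 \<in> Fil j \<and> v\<^sub>1 \<in> wt_space Y (act Y h) (\<rho> j)"
    and lim: "!!t. \<exists>j. \<rho> j < t"
    and wts: "!!v. v \<in> carrier Y ==> \<exists>\<tau>. v \<in> wt_space Y (act Y h) \<tau>"
    and S: "simple_rep P S"
  shows "\<exists>b. \<forall>F cs. finite F \<and> F \<subseteq> carrier Y \<and> composition_series P (restr Y (gen_subrep P Y F)) cs \<longrightarrow>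
    factor_count P (restr Y (gen_subrep P Y F)) cs S \<le> b"
proof -
  have repP: "lie_rep P Y" using lie_rep_mono[OF rep] P unfolding stable_def by blast
  have repS: "lie_rep P S" using S unfolding simple_rep_def by blast
  interpret S: cmodule S by (rule lie_rep_module[OF repS])
  interpret E: endo Y "act Y h" by (rule endo_act[OF repP h])
  have mod: "module \<complex> Y" using cY by (simp add: cmodule_iff)
  let ?sh = "shift Y (act Y h)"
  have series: "cs \<noteq> []" "!!N. N \<in> set cs ==> subrep P Y N" "!!i. Suc i < length cs ==> cs ! i \<subseteq> cs ! Suc i"
    if F: "F \<subseteq> carrier Y" and cs: "composition_series P (restr Y (gen_subrep P Y F)) cs" for F cs
  proof -
    have "submodule (gen_subrep P Y F) \<complex> Y" using subrep_gen_subrep[OF repP F] unfolding subrep_def by blast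
    then show "cs \<noteq> []" "!!N. N \<in> set cs ==> subrep P Y N" "!!i. Suc i < length cs ==> cs ! i \<subseteq> cs ! Suc i"
      using cs subrep_restr_iff[OF mod] unfolding composition_series_def by blast+
  qed
  have factor: "\<exists>\<psi>. \<psi> ` (cs ! Suc i) = carrier S \<and> (\<forall>v\<in>cs ! Suc i. \<psi> v = \<zero>\<^bsub>S\<^esub> \<longleftrightarrow> v \<in> cs ! i) \<and>
      (\<forall>v\<in>cs ! Suc i. \<forall>a. \<psi> (?sh a v) = shift S (act S h) a (\<psi> v))"
    if F: "F \<subseteq> carrier Y" and cs: "composition_series P (restr Y (gen_subrep P Y F)) cs"
      and i: "Suc i < length cs" "rep_iso P (comp_factor (restr Y (gen_subrep P Y F)) cs i) S" for F cs i
  proof -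
    note se = series[OF F cs]
    have sub: "subrep P Y (cs ! i)" "subrep P Y (cs ! Suc i)" using se(2) i(1) by simp_all
    obtain \<psi> where \<psi>: "lin_map (restr Y (cs ! Suc i)) S \<psi>" "\<forall>x\<in>P. \<forall>v\<in>cs ! Suc i. \<psi> (act Y x v) = act S x (\<psi> v)"
      "\<psi> ` (cs ! Suc i) = carrier S" "\<forall>v\<in>cs ! Suc i. \<psi> v = \<zero>\<^bsub>S\<^esub> \<longleftrightarrow> v \<in> cs ! i"
      using rep_iso_quot[OF repP sub se(3)[OF i(1)] repS] i(2) unfolding comp_factor_def restr_restr by blast
    have "\<psi> (?sh a v) = shift S (act S h) a (\<psi> v)" if v: "v \<in> cs ! Suc i" for v a
    proof -
      have "act Y h v \<in> cs ! Suc i" "(- a) \<odot>\<^bsub>Y\<^esub> v \<in> cs ! Suc i"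
        using sub(2) h v Y.submodule_scale unfolding subrep_def by blast+
      then show ?thesis unfolding shift_def
        using lin_map_add[OF \<psi>(1), of "act Y h v" "(- a) \<odot>\<^bsub>Y\<^esub> v"] lin_map_scale[OF \<psi>(1), of v "- a"] \<psi>(2) h v by simp
    qed
    then show ?thesis using \<psi>(3,4) by blast
  qed
  show ?thesis
  proof (cases "\<exists>a u. u \<in> carrier S \<and> u \<noteq> \<zero>\<^bsub>S\<^esub> \<and> shift S (act S h) a u = \<zero>\<^bsub>S\<^esub>")
    case True
    then obtain a u where u: "u \<in> carrier S" "u \<noteq> \<zero>\<^bsub>S\<^esub>" "shift S (act S h) a u = \<zero>\<^bsub>S\<^esub>" by blast
    obtain j where j: "\<rho> j < Re a" using lim by blast
    have "factor_count P (restr Y (gen_subrep P Y F)) cs S \<le> bnd j"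
      if F: "F \<subseteq> carrier Y" and cs: "composition_series P (restr Y (gen_subrep P Y F)) cs" for F cs
      unfolding factor_count_def
    proof (rule list_chain[OF P rot series[OF F cs]])
      fix k assume "k \<in> {i. Suc i < length cs \<and> rep_iso P (comp_factor (restr Y (gen_subrep P Y F)) cs i) S}"
      then have k: "Suc k < length cs" "rep_iso P (comp_factor (restr Y (gen_subrep P Y F)) cs k) S" by simp_all
      obtain \<psi> where \<psi>: "\<psi> ` (cs ! Suc k) = carrier S" "\<forall>v\<in>cs ! Suc k. \<psi> v = \<zero>\<^bsub>S\<^esub> \<longleftrightarrow> v \<in> cs ! k"
        "\<forall>v\<in>cs ! Suc k. \<forall>a. \<psi> (?sh a v) = shift S (act S h) a (\<psi> v)"
        using factor[OF F cs k] by blast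
      have sub: "subrep P Y (cs ! k)" "subrep P Y (cs ! Suc k)" using series(2)[OF F cs] k(1) by simp_all
      have subm: "submodule (cs ! k) \<complex> Y" "submodule (cs ! Suc k) \<complex> Y" using sub unfolding subrep_def by blast+
      have st: "act Y h v \<in> cs ! k" if "v \<in> cs ! k" for v using sub(1) h that unfolding subrep_def by blast
      have st': "act Y h v \<in> cs ! Suc k" if "v \<in> cs ! Suc k" for v using sub(2) h that unfolding subrep_def by blast
      obtain v where v: "v \<in> cs ! Suc k" "u = \<psi> v" using \<psi>(1) u(1) by blast
      have vA: "v \<notin> cs ! k" using \<psi>(2) v u(2) by blast
      have "\<psi> (?sh a v) = \<zero>\<^bsub>S\<^esub>" using \<psi>(3) v u(3) by simp
      then have shA: "?sh a v \<in> cs ! k" using \<psi>(2) E.shift_stable[OF subm(2) st' v(1)] by blast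
      obtain v\<^sub>0 v\<^sub>1 where sp: "v = v\<^sub>0 \<oplus>\<^bsub>Y\<^esub> v\<^sub>1" "v\<^sub>0 \<in> Fil j" "v\<^sub>1 \<in> wt_space Y (act Y h) (\<rho> j)"
        using split[OF Y.submodule_carrier[OF subm(2) v(1)], of j] by blast
      from E.eigenvector_in_summand[OF subm(1) st subm(2) st' Fil_sub Fil_stable[OF P h] v(1) vA shA sp j]
      show "\<exists>v. v \<in> Fil j \<and> v \<in> cs ! Suc k \<and> v \<notin> cs ! k" by blast
    qed auto
    then show ?thesis by blast
  next
    case False
    have "\<not> rep_iso P (comp_factor (restr Y (gen_subrep P Y F)) cs i) S"
      if F: "F \<subseteq> carrier Y" and cs: "composition_series P (restr Y (gen_subrep P Y F)) cs" and i: "Suc i < length cs" for F cs i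
    proof
      assume iso: "rep_iso P (comp_factor (restr Y (gen_subrep P Y F)) cs i) S"
      obtain \<psi> where \<psi>: "\<psi> ` (cs ! Suc i) = carrier S" "\<forall>v\<in>cs ! Suc i. \<psi> v = \<zero>\<^bsub>S\<^esub> \<longleftrightarrow> v \<in> cs ! i"
        "\<forall>v\<in>cs ! Suc i. \<forall>a. \<psi> (?sh a v) = shift S (act S h) a (\<psi> v)"
        using factor[OF F cs i iso] by blast
      have sub: "subrep P Y (cs ! i)" "subrep P Y (cs ! Suc i)" using series(2)[OF F cs] i by simp_all
      have subm: "submodule (cs ! i) \<complex> Y" "submodule (cs ! Suc i) \<complex> Y" using sub unfolding subrep_def by blast+
      have st': "act Y h v \<in> cs ! Suc i" if "v \<in> cs ! Suc i" for v using sub(2) h that unfolding subrep_def by blast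
      have "\<exists>u\<in>carrier S. u \<noteq> \<zero>\<^bsub>S\<^esub>"
        using S S.submodule_zero_mem[OF S.carrier_submodule] unfolding simple_rep_def by blast
      then obtain u where u: "u \<in> \<psi> ` (cs ! Suc i)" "u \<noteq> \<zero>\<^bsub>S\<^esub>" unfolding \<psi>(1) by blast
      from u(1) obtain v where v: "v \<in> cs ! Suc i" "u = \<psi> v" by blast
      then have v: "v \<in> cs ! Suc i" "v \<notin> cs ! i" using \<psi>(2) u(2) by blast+
      \<comment> \<open>Applying the shifts one by one, the last vector that is still outside
        \<open>cs ! i\<close> is an eigenvector modulo \<open>cs ! i\<close>.\<close>
      have "\<exists>a w. w \<in> cs ! Suc i \<and> w \<notin> cs ! i \<and> ?sh a w \<in> cs ! i" if "shifts Y (act Y h) as v \<in> cs ! i" for as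
        using that
      proof (induction as)
        case Nil
        then show ?case using v by (simp add: shifts_def)
      next
        case (Cons a as)
        let ?w = "shifts Y (act Y h) as v"
        have "?w \<in> cs ! Suc i" by (rule E.shifts_stable[OF subm(2) st' v(1)])
        then show ?case using Cons by (cases "?w \<in> cs ! i") (auto simp: E.shifts_simps)
      qed
      moreover obtain as where "shifts Y (act Y h) as v = \<zero>\<^bsub>Y\<^esub>"
        using wts[OF Y.submodule_carrier[OF subm(2) v(1)]] unfolding wt_space_def by blast
      ultimately obtain a w where w: "w \<in> cs ! Suc i" "w \<notin> cs ! i" "?sh a w \<in> cs ! i"
        using Y.submodule_zero_mem[OF subm(1)] by metis
      have "shift S (act S h) a (\<psi> w) = \<zero>\<^bsub>S\<^esub>" using \<psi>(2,3) w(1,3) E.shift_stable[OF subm(2) st' w(1)] by metis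
      moreover have "\<psi> w \<in> carrier S" "\<psi> w \<noteq> \<zero>\<^bsub>S\<^esub>" using \<psi>(1,2) w(1,2) by blast+
      ultimately show False using False by blast
    qed
    then have "factor_count P (restr Y (gen_subrep P Y F)) cs S \<le> 0"
      if "F \<subseteq> carrier Y" "composition_series P (restr Y (gen_subrep P Y F)) cs" for F cs
      unfolding factor_count_def using that by (metis (mono_tags, lifting) Collect_empty_eq card.empty le_refl)
    then show ?thesis by blast
  qed
qed

section \<open>Splitting by the weights of h\<close>

context
  fixes h \<rho> P
  assumes P: "stable P" and h: "h \<in> g" and ad: "endo (ad_rep g) (lie_bracket h)"
    and B_wt: "!!nb. B nb \<subseteq> wt_space Y (act Y h) \<rho>"
begin

interpretation E: endo Y "act Y h" by (rule endo_act[OF rep h])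

lemma wt_act:
  assumes x: "x \<in> wt_space (ad_rep g) (lie_bracket h) \<alpha>" and v: "v \<in> wt_space Y (act Y h) \<beta>"
  shows "act Y x v \<in> wt_space Y (act Y h) (\<alpha> + \<beta>)"
proof (rule wt_space_bilinear[OF ad E.endo_axioms E.endo_axioms _ _ _ x v])
  show "lin_map (ad_rep g) Y (\<lambda>u. act Y u v)" if "v \<in> carrier Y" for v
    unfolding lin_map_def using act_closed[OF rep _ that] act_plus[OF rep _ that] act_mat_scale[OF rep _ that] by simp
  show "lin_map Y Y (act Y u)" if "u \<in> carrier (ad_rep g)" for u using lie_rep_act_linear[OF rep] that by simp
  show "act Y h (act Y u v) = act Y (lie_bracket h u) v \<oplus>\<^bsub>Y\<^esub> act Y u (act Y h v)"
    if "u \<in> carrier (ad_rep g)" "v \<in> carrier Y" for u v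
    using act_act[OF rep h] that by simp
qed

lemma Fil_0_wt: "Fil 0 \<subseteq> wt_space Y (act Y h) \<rho>"
  using B_wt unfolding Fil_def by auto

text \<open>Each degree raises the real parts of the weights by at most
  \<open>\<tau>\<close>.\<close>

lemma all_weights:
  assumes g: "g \<subseteq> wt_space (ad_rep g) (lie_bracket h) \<tau>" and \<tau>: "0 \<le> \<tau>" and v: "v \<in> carrier Y"
  shows "\<exists>\<tau>. v \<in> wt_space Y (act Y h) \<tau>"
proof -
  have "Fil j \<subseteq> wt_space Y (act Y h) (\<rho> + real j * \<tau>)" for j
  proof (induction j)
    case 0
    show ?case using Fil_0_wt by simp
  next
    case (Suc j)
    show ?case
    proof (rule Fil_minimal[OF E.submodule_wt_space])
      show "Fil j \<subseteq> wt_space Y (act Y h) (\<rho> + real (Suc j) * \<tau>)"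
        using Suc E.wt_space_mono[of "\<rho> + real j * \<tau>" "\<rho> + real (Suc j) * \<tau>"] \<tau> by (auto simp: distrib_right)
      show "act Y x v \<in> wt_space Y (act Y h) (\<rho> + real (Suc j) * \<tau>)" if "x \<in> g" "v \<in> Fil j" for x v
        using wt_act[OF subsetD[OF g that(1)] subsetD[OF Suc that(2)]] by (simp add: algebra_simps)
    qed
  qed
  then show ?thesis using v carrier_Fil by blast
qed

context
  fixes \<epsilon> :: real
  assumes \<epsilon>: "0 \<le> \<epsilon>" and decomp: "!!x. x \<in> g ==> \<exists>y z. x = y + z \<and> y \<in> P \<and> z \<in> wt_space (ad_rep g) (lie_bracket h) (- \<epsilon>)"
begin

text \<open>\<open>V\<close> is the previous step of the filtration, or zero at the start. For
  \<open>v = v0 + v1\<close> and \<open>x = y + z\<close> as in the hypotheses, \<open>x v0\<close>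
  and \<open>y v1\<close> stay in \<open>Fil j\<close>, and \<open>z v1\<close> has its weight
  lowered by \<open>\<epsilon>\<close>.\<close>

lemma split_step:
  assumes V: "V \<subseteq> Fil j" "!!x v. x \<in> g ==> v \<in> V ==> act Y x v \<in> Fil j"
    and split: "Fil j \<subseteq> {a \<oplus>\<^bsub>Y\<^esub> b |a b. a \<in> V \<and> b \<in> Fil j \<inter> wt_space Y (act Y h) \<tau>}"
  shows "Fil (Suc j) \<subseteq> {a \<oplus>\<^bsub>Y\<^esub> b |a b. a \<in> Fil j \<and> b \<in> Fil (Suc j) \<inter> wt_space Y (act Y h) (\<tau> - \<epsilon>)}"
    (is "_ \<subseteq> ?S")
proof (rule Fil_minimal)
  have T: "submodule (Fil (Suc j) \<inter> wt_space Y (act Y h) (\<tau> - \<epsilon>)) \<complex> Y"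
    by (rule Y.submodule_Int[OF Fil_sub E.submodule_wt_space])
  show "submodule ?S \<complex> Y" by (rule Y.submodule_sum[OF Fil_sub T])
  show "Fil j \<subseteq> ?S"
  proof
    fix v assume v: "v \<in> Fil j"
    then have "v = v \<oplus>\<^bsub>Y\<^esub> \<zero>\<^bsub>Y\<^esub>" using Fil_carrier[OF v] by simp
    then show "v \<in> ?S" using v Y.submodule_zero_mem[OF T] by blast
  qed
  fix x v assume x: "x \<in> g" and "v \<in> Fil j"
  then obtain v0 v1 where v: "v = v0 \<oplus>\<^bsub>Y\<^esub> v1" "v0 \<in> V" "v1 \<in> Fil j" "v1 \<in> wt_space Y (act Y h) \<tau>" using split by blast
  obtain y z where yz: "x = y + z" "y \<in> P" "z \<in> wt_space (ad_rep g) (lie_bracket h) (- \<epsilon>)" using decomp[OF x] by blast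
  have yg: "y \<in> g" using P yz(2) unfolding stable_def by blast
  have zg: "z \<in> g" using yz(3) unfolding wt_space_def by simp
  note c0 = Fil_carrier[OF subsetD[OF V(1) v(2)]] and c1 = Fil_carrier[OF v(3)]
  have a: "act Y x v0 \<in> Fil j" "act Y y v1 \<in> Fil j" by (rule V(2)[OF x v(2)], rule Fil_stable[OF P yz(2) v(3)])
  have b: "act Y z v1 \<in> Fil (Suc j)" by (rule Fil_act[OF zg v(3)])
  have b': "act Y z v1 \<in> wt_space Y (act Y h) (\<tau> - \<epsilon>)" using wt_act[OF yz(3) v(4)] by (simp add: add.commute)
  have "act Y x v = act Y x v0 \<oplus>\<^bsub>Y\<^esub> act Y x v1" unfolding v(1) by (rule act_add[OF rep x c0 c1])
  also have "act Y x v1 = act Y y v1 \<oplus>\<^bsub>Y\<^esub> act Y z v1" unfolding yz(1) by (rule act_plus[OF rep yg c1 zg])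
  also have "act Y x v0 \<oplus>\<^bsub>Y\<^esub> (act Y y v1 \<oplus>\<^bsub>Y\<^esub> act Y z v1) = (act Y x v0 \<oplus>\<^bsub>Y\<^esub> act Y y v1) \<oplus>\<^bsub>Y\<^esub> act Y z v1"
    using Fil_carrier[OF a(1)] Fil_carrier[OF a(2)] Fil_carrier[OF b] by (simp add: Y.a_assoc)
  finally show "act Y x v \<in> ?S" using Y.submodule_add[OF Fil_sub a] b b' by blast
qed

text \<open>Modulo lower degree, each passage to the next degree costs one factor of negative
  weight, hence the distance of \<open>Suc j\<close> times \<open>\<epsilon>\<close> below the bound
  \<open>\<rho>\<close> for degree 0.\<close>

lemma Fil_split_Suc:
  "Fil (Suc j) \<subseteq> {a \<oplus>\<^bsub>Y\<^esub> b |a b. a \<in> Fil j \<and> b \<in> Fil (Suc j) \<inter> wt_space Y (act Y h) (\<rho> - real (Suc j) * \<epsilon>)}"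
proof (induction j)
  case 0
  \<comment> \<open>Degree 0 has no lower step, so all of it counts as low part and \<open>V\<close>
    is zero.\<close>
  have "Fil 0 \<subseteq> {a \<oplus>\<^bsub>Y\<^esub> b |a b. a \<in> {\<zero>\<^bsub>Y\<^esub>} \<and> b \<in> Fil 0 \<inter> wt_space Y (act Y h) \<rho>}"
  proof
    fix v assume v: "v \<in> Fil 0"
    then have "v = \<zero>\<^bsub>Y\<^esub> \<oplus>\<^bsub>Y\<^esub> v" using Fil_carrier[OF v] by simp
    then show "v \<in> {a \<oplus>\<^bsub>Y\<^esub> b |a b. a \<in> {\<zero>\<^bsub>Y\<^esub>} \<and> b \<in> Fil 0 \<inter> wt_space Y (act Y h) \<rho>}" using v Fil_0_wt by blast
  qed
  moreover have "act Y x \<zero>\<^bsub>Y\<^esub> = \<zero>\<^bsub>Y\<^esub>" if "x \<in> g" for x by (rule lin_map_zero[OF cY cY lie_rep_act_linear[OF rep that]])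
  ultimately show ?case using split_step[of "{\<zero>\<^bsub>Y\<^esub>}" 0 \<rho>] Y.submodule_zero_mem[OF Fil_sub] by simp
next
  case (Suc j)
  have eq: "\<rho> - real (Suc j) * \<epsilon> - \<epsilon> = \<rho> - real (Suc (Suc j)) * \<epsilon>" by (simp add: algebra_simps)
  show ?case by (rule split_step[OF Fil_mono[OF le_SucI[OF order_refl]] Fil_act Suc.IH, unfolded eq])
qed

theorem carrier_split:
  assumes v: "v \<in> carrier Y"
  shows "\<exists>v\<^sub>0 v\<^sub>1. v = v\<^sub>0 \<oplus>\<^bsub>Y\<^esub> v\<^sub>1 \<and> v\<^sub>0 \<in> Fil j \<and> v\<^sub>1 \<in> wt_space Y (act Y h) (\<rho> - real (Suc j) * \<epsilon>)"
proof -
  let ?W = "wt_space Y (act Y h) (\<rho> - real (Suc j) * \<epsilon>)"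
  let ?S = "{a \<oplus>\<^bsub>Y\<^esub> b |a b. a \<in> Fil j \<and> b \<in> ?W}"
  have S: "submodule ?S \<complex> Y" by (rule Y.submodule_sum[OF Fil_sub E.submodule_wt_space])
  have "Fil (j + i) \<subseteq> ?S" for i
  proof (induction i)
    case 0
    show ?case
    proof
      fix v assume v: "v \<in> Fil (j + 0)"
      then have "v = v \<oplus>\<^bsub>Y\<^esub> \<zero>\<^bsub>Y\<^esub>" using Fil_carrier[OF v] by simp
      then show "v \<in> ?S" using v Y.submodule_zero_mem[OF E.submodule_wt_space] by auto
    qed
  next
    case (Suc i)
    show ?case
    proof
      fix v assume "v \<in> Fil (j + Suc i)"
      then obtain a b where ab: "v = a \<oplus>\<^bsub>Y\<^esub> b" "a \<in> Fil (j + i)" "b \<in> wt_space Y (act Y h) (\<rho> - real (Suc (j + i)) * \<epsilon>)"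
        using Fil_split_Suc[of "j + i"] by auto
      \<comment> \<open>The remainders of higher degrees have even lower weights, so the bound of
        degree \<open>Suc j\<close> holds for all of them.\<close>
      have "real (Suc j) * \<epsilon> \<le> real (Suc (j + i)) * \<epsilon>" using \<epsilon> by (intro mult_right_mono) simp_all
      then have b: "b \<in> ?W" using ab(3) E.wt_space_mono[of "\<rho> - real (Suc (j + i)) * \<epsilon>" "\<rho> - real (Suc j) * \<epsilon>"] by auto
      then have "b = \<zero>\<^bsub>Y\<^esub> \<oplus>\<^bsub>Y\<^esub> b" using Y.submodule_carrier[OF E.submodule_wt_space] by simp
      then have "b \<in> ?S" using b Y.submodule_zero_mem[OF Fil_sub] by blast
      then show "v \<in> ?S" unfolding ab(1) using Y.submodule_add[OF S] Suc ab(2) by blast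
    qed
  qed
  moreover obtain j' where "v \<in> Fil j'" using v carrier_Fil by blast
  then have "v \<in> Fil (j + j')" using Fil_mono[of j' "j + j'"] by auto
  ultimately show ?thesis by blast
qed

end

end

end

section \<open>The parabolic subalgebra and its Levi part\<close>

locale parabolic_setting =
  fixes s :: series and r :: nat
    and G :: "nat => mat set" and g :: "mat set"
    and k0 t0 k p m n :: "mat set"
    and m' n' :: "nat => mat set"
    and E :: "'e rep" and E' :: "nat => 'e set"
    and l a b c :: nat
  assumes G: "G = exhaustion s r" and g: "g = (\<Union>i\<in>{1..}. G i)"
    and k0: "reductive_in k0 (G 1)"
    and t0: "cartan_subalgebra t0 k0"
    and k: "k = sum_space k0 (centralizer g k0)"
    and p: "compatible_parabolic t0 G p"
    and n': "\<forall>i\<ge>1. n' i = nilradical (p \<inter> G i)"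
    and p_decomp: "\<forall>i\<ge>1. p \<inter> G i = sum_space (m' i) (n' i) \<and> m' i \<inter> n' i = {0}"
    and m'_red: "\<forall>i\<ge>1. reductive_in (m' i) (G i)"
    and m'_Suc: "\<forall>i\<ge>1. m' (Suc i) \<inter> G i = m' i"
    and t0_m': "\<forall>i\<ge>1. t0 \<subseteq> m' i \<and> centralizer (G i) k0 \<subseteq> m' i"
    and m: "m = (\<Union>i\<in>{1..}. m' i)" and n: "n = (\<Union>i\<in>{1..}. n' i)"
    and E: "lie_rep m E"
    and E': "\<forall>i\<ge>1. subrep (m' i) E (E' i) \<and> E' i \<subseteq> E' (Suc i)"
    and carrier_E: "carrier E = (\<Union>i\<in>{1..}. E' i)"
    and embeds: "\<exists>N. \<forall>i\<ge>N. simple_rep (m' i) (restr E (E' i)) \<and>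
           rep_embeds (m' i) (restr E (E' i)) (mixed_tensors (nat_dim s r i) l a b c)"
begin

abbreviation d where "d \<equiv> nat_dim s r 1"

lemma G_subspace: "cmat.subspace (G i)"
  and G_bracket: "x \<in> G i ==> y \<in> G i ==> lie_bracket x y \<in> G i"
  and G_gl: "G i \<subseteq> gl (nat_dim s r i)"
  and G_mono: "i \<le> j ==> G i \<subseteq> G j"
  unfolding G by (rule subspace_exhaustion lie_bracket_exhaustion exhaustion_gl exhaustion_mono; assumption)+

lemma G_g: "1 \<le> i ==> G i \<subseteq> g"
  unfolding g by auto

lemma g_common:
  assumes "x \<in> g" "y \<in> g"
  obtains i where "1 \<le> i" "x \<in> G i" "y \<in> G i"
proof -
  obtain i j where ij: "1 \<le> i" "x \<in> G i" "1 \<le> j" "y \<in> G j" using assms unfolding g by auto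
  then have "x \<in> G (max i j)" "y \<in> G (max i j)" using G_mono[of i "max i j"] G_mono[of j "max i j"] by auto
  then show ?thesis using that[of "max i j"] ij by simp
qed

lemma subspace_Union_chain:
  assumes "!!i. 1 \<le> i ==> cmat.subspace (A i)" "!!i j. 1 \<le> i ==> i \<le> j ==> A i \<subseteq> A j"
  shows "cmat.subspace (\<Union>i\<in>{1 :: nat..}. A i)"
proof (rule cmat.subspaceI)
  show "0 \<in> (\<Union>i\<in>{1..}. A i)" using cmat.subspace_0[OF assms(1)[of 1]] by auto
  show "mat_scale c x \<in> (\<Union>i\<in>{1..}. A i)" if "x \<in> (\<Union>i\<in>{1..}. A i)" for c x
    using that cmat.subspace_scale[OF assms(1)] by auto
  fix x y assume "x \<in> (\<Union>i\<in>{1..}. A i)" "y \<in> (\<Union>i\<in>{1..}. A i)"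
  then obtain i j where ij: "1 \<le> i" "x \<in> A i" "1 \<le> j" "y \<in> A j" by auto
  then have "x \<in> A (max i j)" "y \<in> A (max i j)" "1 \<le> max i j"
    using assms(2)[of i "max i j"] assms(2)[of j "max i j"] by auto
  then show "x + y \<in> (\<Union>i\<in>{1..}. A i)" using cmat.subspace_add[OF assms(1)] by blast
qed

lemma g_subspace: "cmat.subspace g"
  unfolding g by (rule subspace_Union_chain[OF G_subspace G_mono])

lemma g_bracket: "x \<in> g ==> y \<in> g ==> lie_bracket x y \<in> g"
  by (meson g_common G_bracket G_g subsetD)

lemma m'_subspace: "1 \<le> i ==> cmat.subspace (m' i)"
  and m'_G: "1 \<le> i ==> m' i \<subseteq> G i"
  and m'_bracket: "1 \<le> i ==> x \<in> m' i ==> y \<in> m' i ==> lie_bracket x y \<in> m' i"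
  using m'_red unfolding reductive_in_def lie_subalgebra_def by blast+

lemma m'_mono:
  assumes "1 \<le> i" "i \<le> j"
  shows "m' i \<subseteq> m' j"
  using assms(2,1)
proof (induction j rule: dec_induct)
  case (step j)
  then have "m' (Suc j) \<inter> G j = m' j" using m'_Suc by simp
  then show ?case using step by blast
qed simp

lemma m'_Int:
  assumes "1 \<le> i" "i \<le> j"
  shows "m' j \<inter> G i = m' i"
  using assms(2,1)
proof (induction j rule: dec_induct)
  case base
  then show ?case using m'_G by blast
next
  case (step j)
  then have "m' (Suc j) \<inter> G j = m' j" using m'_Suc by simp
  then show ?case using step G_mono[of i j] by blast
qed

lemma m_Int: "1 \<le> i ==> x \<in> m ==> x \<in> G i ==> x \<in> m' i"
proof -
  assume i: "1 \<le> i" and x: "x \<in> m" "x \<in> G i"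
  obtain j where j: "1 \<le> j" "x \<in> m' j" using x(1) unfolding m by auto
  have "x \<in> m' (max i j)" using m'_mono[of j "max i j"] j by auto
  then show "x \<in> m' i" using m'_Int[of i "max i j"] i x(2) by auto
qed

lemma m_subspace: "cmat.subspace m"
  unfolding m by (rule subspace_Union_chain[OF m'_subspace m'_mono])

lemma m'_m: "1 \<le> i ==> m' i \<subseteq> m"
  unfolding m by auto

lemma m_g: "m \<subseteq> g"
  unfolding m using m'_G G_g by fastforce

lemma m_bracket: "x \<in> m ==> y \<in> m ==> lie_bracket x y \<in> m"
proof -
  assume xy: "x \<in> m" "y \<in> m"
  then obtain i where "1 \<le> i" "x \<in> G i" "y \<in> G i" using g_common[of x y] m_g by blast
  then show ?thesis using m'_bracket m_Int xy m'_m by blast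
qed

lemma p_subspace: "cmat.subspace p" and p_g: "p \<subseteq> g" and p_bracket: "x \<in> p ==> y \<in> p ==> lie_bracket x y \<in> p"
  using p unfolding compatible_parabolic_def lie_subalgebra_def g[symmetric] by blast+

lemma n'_Suc:
  assumes "1 \<le> i"
  shows "n' i = n' (Suc i) \<inter> G i"
proof -
  have "nilradical (p \<inter> G i) = nilradical (p \<inter> G (Suc i)) \<inter> G i"
    using p assms unfolding compatible_parabolic_def by blast
  moreover have "n' i = nilradical (p \<inter> G i)" "n' (Suc i) = nilradical (p \<inter> G (Suc i))" using n' assms by simp_all
  ultimately show ?thesis by simp
qed

lemma n'_mono:
  assumes "1 \<le> i" "i \<le> j"
  shows "n' i \<subseteq> n' j"
  using assms(2,1)
proof (induction j rule: dec_induct)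
  case (step j)
  then show ?case using n'_Suc[of j] by auto
qed simp

lemma n'_subspace: "1 \<le> i ==> cmat.subspace (n' i)"
  using n' unfolding nilradical_def by simp

lemma p_level: "1 \<le> i ==> x \<in> p \<inter> G i \<longleftrightarrow> (\<exists>y z. x = y + z \<and> y \<in> m' i \<and> z \<in> n' i)"
  using p_decomp unfolding sum_space_def by blast

lemma m'_p: "1 \<le> i ==> m' i \<subseteq> p \<inter> G i"
proof
  fix x assume "1 \<le> i" "x \<in> m' i"
  then show "x \<in> p \<inter> G i" using p_level[of i x] cmat.subspace_0[OF n'_subspace, of i] by (metis add_0_right)
qed

lemma n'_p: "1 \<le> i ==> n' i \<subseteq> p \<inter> G i"
proof
  fix x assume "1 \<le> i" "x \<in> n' i"
  then show "x \<in> p \<inter> G i" using p_level[of i x] cmat.subspace_0[OF m'_subspace, of i] by (metis add_0_left)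
qed

lemma m_p: "m \<subseteq> p"
  unfolding m using m'_p by fastforce

text \<open>The matrices whose bracket with \<open>x\<close> stays in \<open>n' i\<close> form a
  subspace that contains every nilpotent ideal, hence the span of these ideals.\<close>

lemma n'_ideal:
  assumes i: "1 \<le> i" and x: "x \<in> p" "x \<in> G i" and y: "y \<in> n' i"
  shows "lie_bracket x y \<in> n' i"
proof -
  have ni: "n' i = cmat.span (\<Union>{I. lie_ideal I (p \<inter> G i) \<and> nilpotent_lie I})" using n' i unfolding nilradical_def by simp
  let ?D = "nat_dim s r i"
  have xD: "x \<in> gl ?D" using G_gl x by blast
  have "cmat.span (\<Union>{I. lie_ideal I (p \<inter> G i) \<and> nilpotent_lie I}) \<subseteq> {y \<in> gl ?D. lie_bracket x y \<in> n' i}"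
  proof (rule cmat.span_minimal)
    show "cmat.subspace {y \<in> gl ?D. lie_bracket x y \<in> n' i}"
    proof (rule cmat.subspaceI)
      note nS = n'_subspace[OF i]
      note gS = subspace_gl[of ?D]
      have z: "lie_bracket x 0 = 0" using lie_bracket_scale_right[OF xD xD xD, of 0] cmat.scale_zero_left by simp
      show "0 \<in> {y \<in> gl ?D. lie_bracket x y \<in> n' i}" using cmat.subspace_0[OF nS] cmat.subspace_0[OF gS] z by simp
      show "u + v \<in> {y \<in> gl ?D. lie_bracket x y \<in> n' i}"
        if "u \<in> {y \<in> gl ?D. lie_bracket x y \<in> n' i}" "v \<in> {y \<in> gl ?D. lie_bracket x y \<in> n' i}" for u v
        using that cmat.subspace_add[OF nS] cmat.subspace_add[OF gS] lie_bracket_add_right[OF xD] by simp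
      show "mat_scale c u \<in> {y \<in> gl ?D. lie_bracket x y \<in> n' i}"
        if "u \<in> {y \<in> gl ?D. lie_bracket x y \<in> n' i}" for c u
        using that cmat.subspace_scale[OF nS] cmat.subspace_scale[OF gS] lie_bracket_scale_right[OF xD _ xD] by simp
    qed
  next
    show "\<Union>{I. lie_ideal I (p \<inter> G i) \<and> nilpotent_lie I} \<subseteq> {y \<in> gl ?D. lie_bracket x y \<in> n' i}"
    proof
      fix y assume "y \<in> \<Union>{I. lie_ideal I (p \<inter> G i) \<and> nilpotent_lie I}"
      then obtain I where I: "lie_ideal I (p \<inter> G i)" "nilpotent_lie I" "y \<in> I" by blast
      then have "lie_bracket x y \<in> I" "y \<in> gl ?D" using x G_gl unfolding lie_ideal_def by blast+
      moreover have "I \<subseteq> n' i" unfolding ni using I by (intro subset_trans[OF _ cmat.span_superset]) blast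
      ultimately show "y \<in> {y \<in> gl ?D. lie_bracket x y \<in> n' i}" by blast
    qed
  qed
  then show ?thesis using y ni by blast
qed

section \<open>The projection onto the Levi part\<close>

text \<open>The description that \<open>extend_by_zero\<close> uses; on \<open>p\<close> it is the
  projection to \<open>m\<close> along \<open>n\<close>.\<close>

definition lev :: "mat => mat" where "lev x = (THE y. y \<in> m \<and> x - y \<in> n)"

lemma lev_eq:
  assumes "y \<in> m" "x - y \<in> n"
  shows "lev x = y"
  unfolding lev_def
proof (rule the_equality)
  show "y \<in> m \<and> x - y \<in> n" using assms by blast
  fix z assume z: "z \<in> m \<and> x - z \<in> n"
  \<comment> \<open>\<open>m\<close> and \<open>n\<close> are unions, while directness is known
    level by level; the two decompositions are compared at one common level.\<close>
  have "\<exists>i\<ge>1. A \<subseteq> m' i" if "finite A" "A \<subseteq> m" for A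
    using that
  proof (induction rule: finite_induct)
    case (insert w A)
    then obtain i j where ij: "1 \<le> i" "A \<subseteq> m' i" "1 \<le> j" "w \<in> m' j" unfolding m by auto
    then have "insert w A \<subseteq> m' (max i j)" using m'_mono[of i "max i j"] m'_mono[of j "max i j"] by auto
    then show ?case using ij(1) by (intro exI[of _ "max i j"]) auto
  qed auto
  from this[of "{y, z}"] obtain i1 where i1: "1 \<le> i1" "y \<in> m' i1" "z \<in> m' i1" using assms z by auto
  obtain i2 i3 where i23: "1 \<le> i2" "x - y \<in> n' i2" "1 \<le> i3" "x - z \<in> n' i3" using assms z unfolding n by auto
  define i where "i = max i1 (max i2 i3)"
  have i: "1 \<le> i" "i1 \<le> i" "i2 \<le> i" "i3 \<le> i" using i1(1) unfolding i_def by auto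
  have "z - y \<in> m' i" using cmat.subspace_diff[OF m'_subspace[OF i(1)]] m'_mono[OF i1(1) i(2)] i1 by blast
  moreover have "(x - y) - (x - z) \<in> n' i"
    using cmat.subspace_diff[OF n'_subspace[OF i(1)]] n'_mono[OF i23(1) i(3)] n'_mono[OF i23(3) i(4)] i23 by blast
  then have "z - y \<in> n' i" by simp
  ultimately have "z - y = 0" using p_decomp i(1) by blast
  then show "z = y" by simp
qed

lemma lev_level:
  assumes i: "1 \<le> i" and x: "x \<in> p" "x \<in> G i"
  shows "lev x \<in> m' i" "x - lev x \<in> n' i"
proof -
  obtain y z where yz: "x = y + z" "y \<in> m' i" "z \<in> n' i" using p_level[OF i, of x] x by blast
  have "lev x = y"
  proof (rule lev_eq)
    show "y \<in> m" using yz(2) m'_m[OF i] by blast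
    show "x - y \<in> n" using yz(1,3) i unfolding n by auto
  qed
  then show "lev x \<in> m' i" "x - lev x \<in> n' i" using yz by simp_all
qed

lemma lev_levelI: "1 \<le> i ==> y \<in> m' i ==> x - y \<in> n' i ==> lev x = y"
  using m'_m by (intro lev_eq) (auto simp: n)

lemma lev_m: "x \<in> m ==> lev x = x"
proof -
  assume "x \<in> m"
  moreover have "0 \<in> n" unfolding n using cmat.subspace_0[OF n'_subspace[of 1]] by auto
  ultimately show ?thesis by (intro lev_eq) simp_all
qed

lemma lev_in_m:
  assumes x: "x \<in> p"
  shows "lev x \<in> m"
proof -
  obtain i where "1 \<le> i" "x \<in> G i" using g_common[of x x] x p_g by blast
  then show ?thesis using lev_level(1)[OF _ x] m'_m by blast
qed

text \<open>\<open>n' i\<close> is an ideal of \<open>p \<inter> G i\<close>, so the projection to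
  the complementary subalgebra is a homomorphism, and letting \<open>n\<close> act by zero gives a
  module over \<open>p\<close>.\<close>

lemma
  assumes x: "x \<in> p" and y: "y \<in> p"
  shows lev_add: "lev (x + y) = lev x + lev y"
    and lev_bracket: "lev (lie_bracket x y) = lie_bracket (lev x) (lev y)"
proof -
  obtain i where i: "1 \<le> i" "x \<in> G i" "y \<in> G i" using g_common[of x y] x y p_g by blast
  note lx = lev_level[OF i(1) x i(2)] and ly = lev_level[OF i(1) y i(3)]
  note mS = m'_subspace[OF i(1)] and nS = n'_subspace[OF i(1)]
  show "lev (x + y) = lev x + lev y"
    using cmat.subspace_add[OF nS lx(2) ly(2)] cmat.subspace_add[OF mS lx(1) ly(1)]
    by (intro lev_levelI[OF i(1)]) (simp_all add: algebra_simps)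
  define u v where "u = lev x" and "v = x - lev x"
  define u' v' where "u' = lev y" and "v' = y - lev y"
  have xy: "x = u + v" "y = u' + v'" unfolding u_def v_def u'_def v'_def by simp_all
  have um: "u \<in> m' i" "v \<in> n' i" "u' \<in> m' i" "v' \<in> n' i" unfolding u_def v_def u'_def v'_def by (rule lx ly)+
  have inG: "u \<in> p" "u \<in> G i" "v \<in> p" "v \<in> G i" "u' \<in> p" "u' \<in> G i" "v' \<in> p" "v' \<in> G i"
    using um m'_p[OF i(1)] n'_p[OF i(1)] by blast+
  let ?D = "nat_dim s r i"
  have gl: "u \<in> gl ?D" "v \<in> gl ?D" "u' \<in> gl ?D" "v' \<in> gl ?D" using inG G_gl by blast+
  have "lie_bracket x y - lie_bracket u u' = lie_bracket u v' + (- lie_bracket u' v + lie_bracket v v')"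
    unfolding xy lie_bracket_add_left[OF gl(1,2) cmat.subspace_add[OF subspace_gl gl(3,4)]]
      lie_bracket_add_right[OF gl(1) gl(3,4)] lie_bracket_add_right[OF gl(2) gl(3,4)] lie_bracket_anti[OF gl(3,2) gl(3)]
    by simp
  moreover have "\<dots> \<in> n' i"
    by (intro cmat.subspace_add[OF nS] cmat.subspace_neg[OF nS] n'_ideal[OF i(1)] inG um)
  ultimately have "lie_bracket x y - lie_bracket u u' \<in> n' i" by simp
  then show "lev (lie_bracket x y) = lie_bracket (lev x) (lev y)"
    unfolding u_def[symmetric] u'_def[symmetric] by (rule lev_levelI[OF i(1) m'_bracket[OF i(1) um(1,3)]])
qed

lemma lev_scale: "x \<in> p ==> lev (mat_scale t x) = mat_scale t (lev x)"
proof -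
  assume x: "x \<in> p"
  obtain i where i: "1 \<le> i" "x \<in> G i" using g_common[of x x] x p_g by blast
  note lx = lev_level[OF i(1) x i(2)]
  show ?thesis
    using cmat.subspace_scale[OF n'_subspace[OF i(1)] lx(2), of t] cmat.subspace_scale[OF m'_subspace[OF i(1)] lx(1), of t]
    by (intro lev_levelI[OF i(1)]) (simp_all add: cmat.scale_right_diff_distrib)
qed

abbreviation Et where "Et \<equiv> extend_by_zero m n E"

lemma Et_simps [simp]:
  "carrier Et = carrier E" "\<zero>\<^bsub>Et\<^esub> = \<zero>\<^bsub>E\<^esub>" "v \<oplus>\<^bsub>Et\<^esub> w = v \<oplus>\<^bsub>E\<^esub> w" "x \<odot>\<^bsub>Et\<^esub> v = x \<odot>\<^bsub>E\<^esub> v"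
  "act Et y = act E (lev y)"
  by (simp_all add: extend_by_zero_def lev_def)

lemma lie_rep_Et: "lie_rep p Et"
  unfolding lie_rep_iff
proof (intro conjI ballI allI)
  have mE: "module \<complex> E" using lie_rep_module[OF E] by (simp add: cmodule_iff)
  show mEt: "module \<complex> Et" by (rule module_image[OF mE, of _ "\<lambda>v. v"]) simp_all
  show "act_linear Et x" if "x \<in> p" for x
    using lie_rep_act_linear[OF E lev_in_m[OF that]] by (simp add: act_linear_def lin_map_def)
  fix x y v assume x: "x \<in> p" and y: "y \<in> p" and v: "v \<in> carrier Et"
  have v': "v \<in> carrier E" using v by simp
  note lx = lev_in_m[OF x] and ly = lev_in_m[OF y]
  show "act Et (x + y) v = act Et x v \<oplus>\<^bsub>Et\<^esub> act Et y v"
    using act_plus[OF E lx v' ly] by (simp add: lev_add[OF x y])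
  show "act Et (lie_bracket x y) v = act Et x (act Et y v) \<ominus>\<^bsub>Et\<^esub> act Et y (act Et x v)"
  proof -
    interpret E: cmodule E by (rule lie_rep_module[OF E])
    interpret Et: cmodule Et using mEt by (simp add: cmodule_iff)
    note cl = act_closed[OF E lx act_closed[OF E ly v']] act_closed[OF E ly act_closed[OF E lx v']]
    show ?thesis
      using act_bracket[OF E lx v' ly] cl by (simp add: lev_bracket[OF x y] E.diff_eq_scale Et.diff_eq_scale)
  qed
next
  fix x c v assume x: "x \<in> p" and v: "v \<in> carrier Et"
  then show "act Et (mat_scale c x) v = c \<odot>\<^bsub>Et\<^esub> act Et x v"
    using act_mat_scale[OF E lev_in_m[OF x], of v c] by (simp add: lev_scale)
qed

end

section \<open>The induced module as a filtered module\<close>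

context parabolic_setting
begin

sublocale ind: inducing g p Et
  using g_subspace g_bracket p_subspace p_bracket p_g lie_rep_Et
  by (unfold_locales) (auto simp: lie_closed_def)

abbreviation Y where "Y \<equiv> induced g p Et"

lemma cE: "cmodule E" by (rule lie_rep_module[OF E])

lemma cmodule_Y: "cmodule Y" by (rule ind.cmodule_induced)

lemma lin_map_eta_E: "lin_map E Y ind.eta"
  using ind.lin_map_eta by (simp add: lin_map_def)

lemma eta_act: "x \<in> m ==> e \<in> carrier E ==> act Y x (ind.eta e) = ind.eta (act E x e)"
  using ind.act_eta[of x e] m_p by (auto simp: lev_m)

lemma E'_sub: "1 \<le> i ==> submodule (E' i) \<complex> E"
  and E'_act: "1 \<le> i ==> x \<in> m' i ==> e \<in> E' i ==> act E x e \<in> E' i"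
  using E' unfolding subrep_def by blast+

lemma E'_carrier: "1 \<le> i ==> e \<in> E' i ==> e \<in> carrier E"
  unfolding carrier_E by auto

lemma E'_mono:
  assumes "1 \<le> i" "i \<le> j"
  shows "E' i \<subseteq> E' j"
  using assms(2,1)
proof (induction j rule: dec_induct)
  case (step j)
  then have "E' j \<subseteq> E' (Suc j)" using E' by simp
  then show ?case using step by blast
qed simp

lemma rot_G: "i < nb ==> j < nb ==> i \<noteq> j ==> rot d i j \<in> G (level s nb)"
  unfolding G by (rule rot_exhaustion)

lemma k0_gl: "k0 \<subseteq> gl d" and k0_G: "k0 \<subseteq> G 1" and k0_subspace: "cmat.subspace k0"
  and k0_bracket: "x \<in> k0 ==> y \<in> k0 ==> lie_bracket x y \<in> k0"
  using k0 G_gl[of 1] unfolding reductive_in_def lie_subalgebra_def by blast+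

text \<open>\<open>k0\<close> sits in the upper left corner of size \<open>d\<close>, whose products
  with matrices supported from \<open>d\<close> on are zero. This supplies the rotations to
  \<open>m\<close> and to \<open>k\<close>.\<close>

lemma supp_ge_centralizer: "x \<in> supp_ge d ==> x \<in> G i ==> x \<in> centralizer (G i) k0"
  unfolding centralizer_def using lie_bracket_supp_ge k0_gl by blast

lemma supp_ge_m': "1 \<le> i ==> x \<in> supp_ge d ==> x \<in> G i ==> x \<in> m' i"
  using supp_ge_centralizer t0_m' by blast

lemma rot_m': "i < nb ==> j < nb ==> i \<noteq> j ==> rot d i j \<in> m' (level s nb)"
  by (rule supp_ge_m'[OF level_ge(2) rot_supp_ge rot_G])

lemma subspace_centralizer: "cmat.subspace (centralizer g k0)"
proof (rule cmat.subspaceI)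
  have gl: "\<exists>D. x \<in> gl D \<and> y \<in> gl D \<and> z \<in> gl D" if xyz: "x \<in> g" "y \<in> g" "z \<in> k0" for x y z
  proof -
    obtain i where i: "1 \<le> i" "x \<in> G i" "y \<in> G i" using g_common[OF xyz(1,2)] .
    then have "z \<in> G i" using G_mono[of 1 i] k0_G xyz(3) by blast
    then show ?thesis using i G_gl by blast
  qed
  note S = g_subspace
  have scale: "lie_bracket (mat_scale t x) z = mat_scale t (lie_bracket x z)" if x: "x \<in> g" and z: "z \<in> k0" for t x z
    using gl[OF x x z] lie_bracket_scale_left by metis
  have zero: "lie_bracket 0 z = 0" if "z \<in> k0" for z
    using scale[OF cmat.subspace_0[OF S] that, of 0] by simp
  show "0 \<in> centralizer g k0" using cmat.subspace_0[OF S] zero unfolding centralizer_def by blast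
  show "mat_scale t x \<in> centralizer g k0" if "x \<in> centralizer g k0" for t x
    using that cmat.subspace_scale[OF S] scale unfolding centralizer_def by simp
  show "x + y \<in> centralizer g k0" if xy: "x \<in> centralizer g k0" "y \<in> centralizer g k0" for x y
  proof -
    have "lie_bracket (x + y) z = 0" if z: "z \<in> k0" for z
    proof -
      obtain D where "x \<in> gl D" "y \<in> gl D" "z \<in> gl D" using gl[of x y z] xy z unfolding centralizer_def by blast
      from lie_bracket_add_left[OF this] show ?thesis using xy z unfolding centralizer_def by simp
    qed
    then show ?thesis using xy cmat.subspace_add[OF S] unfolding centralizer_def by simp
  qed
qed

lemma subspace_sum_space: "cmat.subspace A ==> cmat.subspace B ==> cmat.subspace (sum_space A B)"
  unfolding sum_space_def by (rule cmat.subspace_sums)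

lemma k_subspace: "cmat.subspace k"
  unfolding k by (rule subspace_sum_space[OF k0_subspace subspace_centralizer])

lemma k0_k: "k0 \<subseteq> k"
proof
  fix x assume "x \<in> k0"
  moreover have "x = x + 0" by simp
  ultimately show "x \<in> k" using cmat.subspace_0[OF subspace_centralizer] unfolding k sum_space_def by blast
qed

lemma centralizer_k: "centralizer g k0 \<subseteq> k"
proof
  fix x assume "x \<in> centralizer g k0"
  moreover have "x = 0 + x" by simp
  ultimately show "x \<in> k" using cmat.subspace_0[OF k0_subspace] unfolding k sum_space_def by blast
qed

text \<open>The mixed brackets vanish since the second summand centralises the first; the second is
  itself closed under brackets by the Jacobi identity.\<close>

lemma k_bracket:
  assumes x: "x \<in> k" and y: "y \<in> k"
  shows "lie_bracket x y \<in> k"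
proof -
  obtain u v u' v' where uv: "x = u + v" "u \<in> k0" "v \<in> centralizer g k0" "y = u' + v'" "u' \<in> k0" "v' \<in> centralizer g k0"
    using x y unfolding k sum_space_def by blast
  then have vg: "v \<in> g" "v' \<in> g" unfolding centralizer_def by blast+
  obtain i where i: "1 \<le> i" "v \<in> G i" "v' \<in> G i" using g_common[OF vg] .
  have k0i: "k0 \<subseteq> G i" using k0_G G_mono[OF i(1)] by blast
  let ?D = "nat_dim s r i"
  have gl: "u \<in> gl ?D" "v \<in> gl ?D" "u' \<in> gl ?D" "v' \<in> gl ?D" using k0i uv i G_gl by blast+
  have z1: "lie_bracket v u' = 0" and z2: "lie_bracket v' u = 0" using uv unfolding centralizer_def by blast+
  have "lie_bracket x y = lie_bracket u u' + lie_bracket v v'"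
    unfolding uv(1,4) lie_bracket_add_left[OF gl(1,2) cmat.subspace_add[OF subspace_gl gl(3,4)]]
      lie_bracket_add_right[OF gl(1) gl(3,4)] lie_bracket_add_right[OF gl(2) gl(3,4)] lie_bracket_anti[OF gl(4,1,1)] z1 z2
    by simp
  moreover have "lie_bracket v v' \<in> centralizer g k0"
  proof -
    have "lie_bracket (lie_bracket v v') z = 0" if z: "z \<in> k0" for z
    proof -
      have zD: "z \<in> gl ?D" using z k0i G_gl by blast
      have "lie_bracket v z = 0" "lie_bracket v' z = 0" using z uv unfolding centralizer_def by blast+
      moreover have "lie_bracket w 0 = 0" if "w \<in> gl ?D" for w
        using lie_bracket_scale_right[OF that zD zD, of 0] by simp
      ultimately show ?thesis unfolding jacobi[OF gl(2,4) zD] using gl by simp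
    qed
    then show ?thesis using g_bracket[OF vg] unfolding centralizer_def by blast
  qed
  ultimately show ?thesis using k0_bracket[OF uv(2,5)] unfolding k sum_space_def by blast
qed

lemma rot_k_m: "i \<noteq> j ==> rot d i j \<in> k \<inter> m"
proof -
  assume ij: "i \<noteq> j"
  let ?nb = "Suc (max i j)"
  have r: "rot d i j \<in> m' (level s ?nb)" "rot d i j \<in> G (level s ?nb)"
    by (rule rot_m' rot_G; use ij in simp)+
  have "rot d i j \<in> centralizer g k0"
    using supp_ge_centralizer[OF rot_supp_ge r(2)] G_g[OF level_ge(2)] unfolding centralizer_def by blast
  then show ?thesis using centralizer_k r(1) m'_m[OF level_ge(2)] by blast
qed

lemma lie_subalgebra_k_m: "lie_subalgebra (k \<inter> m) m"
  unfolding lie_subalgebra_def using cmat.subspace_inter[OF k_subspace m_subspace] k_bracket m_bracket by blast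

lemma t0_k_m: "t0 \<subseteq> k \<inter> m"
  using t0 t0_m' m'_m[of 1] k0_k unfolding cartan_subalgebra_def lie_subalgebra_def by fastforce

definition B where "B nb = ind.eta ` E' (level s nb)"

text \<open>\<open>E' i\<close> embeds into mixed tensors as a rotation-stable subspace;
  \<open>word_map_submodule\<close> makes this subspace an image of words, which the inverse
  embedding followed by \<open>ind.eta\<close> carries onto \<open>B nb\<close>.\<close>

lemma B_covered:
  "\<exists>N. \<forall>nb\<ge>N. \<exists>\<Phi>. word_map d nb (a + (b + c) + 2) l Y \<Phi> \<and> B nb \<subseteq> word_im d nb (a + (b + c) + 2) l \<Phi>"
proof -
  obtain N where N: "!!i. i \<ge> N ==> rep_embeds (m' i) (restr E (E' i)) (mixed_tensors (nat_dim s r i) l a b c)"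
    using embeds by blast
  have "\<exists>\<Phi>. word_map d nb (a + (b + c) + 2) l Y \<Phi> \<and> B nb \<subseteq> word_im d nb (a + (b + c) + 2) l \<Phi>" if nb: "N \<le> nb" for nb
  proof -
    let ?i = "level s nb" and ?M = "mixed_tensors (d + 2 * nb) l a b c"
    have i: "1 \<le> ?i" "N \<le> ?i" using level_ge(1)[of nb s] level_ge(2)[of s nb] nb by simp_all
    obtain \<phi> where \<phi>: "rep_hom (m' ?i) (restr E (E' ?i)) ?M \<phi>" "inj_on \<phi> (E' ?i)"
      using N[OF i(2)] unfolding rep_embeds_def nat_dim_level by auto
    have lin: "lin_map (restr E (E' ?i)) ?M \<phi>" using \<phi>(1) unfolding rep_hom_def lin_map_def by simp
    have eq: "\<phi> (act E x e) = act ?M x (\<phi> e)" if "x \<in> m' ?i" "e \<in> E' ?i" for x e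
      using \<phi>(1) that unfolding rep_hom_def by simp
    have cM: "cmodule ?M" by (rule cmodule_mixed_tensors)
    have mE: "module \<complex> E" using cE by (simp add: cmodule_iff)
    have cEi: "cmodule (restr E (E' ?i))" using module_restr[OF mE E'_sub[OF i(1)]] by (simp add: cmodule_iff)
    let ?T = "\<phi> ` E' ?i"
    have "submodule (E' ?i) \<complex> (restr E (E' ?i))" using submodule_restr_iff[OF mE E'_sub[OF i(1)]] E'_sub[OF i(1)] by blast
    then have T: "submodule ?T \<complex> ?M" by (rule cmodule.submodule_image[OF cEi cM lin])
    obtain \<Phi> where \<Phi>: "word_map d nb (a + (b + c)) l ?M \<Phi>" "word_im d nb (a + (b + c)) l \<Phi> = carrier ?M"
      using mixed_tensors_word_map[OF nat_dim_pos] by blast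
    have "?T \<subseteq> carrier ?M" using cmodule.submodule_carrier[OF cM T] by blast
    moreover have "act ?M (rot d i j) v \<in> ?T" if ij: "i < nb" "j < nb" "i \<noteq> j" and v: "v \<in> ?T" for i j v
      using v eq[OF rot_m'[OF ij]] E'_act[OF i(1) rot_m'[OF ij]] by force
    ultimately obtain \<Psi> where \<Psi>: "word_map d nb (a + (b + c)) l ?M \<Psi>" "word_im d nb (a + (b + c)) l \<Psi> = ?T"
      using word_map_submodule[OF cM \<Phi>(1) T] \<Phi>(2) by metis
    define \<theta> where "\<theta> v = ind.eta (inv_into (E' ?i) \<phi> v)" for v
    have \<theta>: "\<theta> (\<phi> e) = ind.eta e" if "e \<in> E' ?i" for e unfolding \<theta>_def by (simp add: inv_into_f_f[OF \<phi>(2) that])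
    have "lin_map (restr ?M ?T) Y \<theta>"
      unfolding lin_map_def restr_simps
    proof (intro conjI funcsetI ballI allI)
      fix v assume "v \<in> ?T"
      then obtain e where e: "v = \<phi> e" "e \<in> E' ?i" by blast
      note ec = E'_carrier[OF i(1) e(2)]
      show "\<theta> v \<in> carrier Y" unfolding e(1) \<theta>[OF e(2)] by (rule lin_map_closed[OF lin_map_eta_E ec])
      show "\<theta> (t \<odot>\<^bsub>?M\<^esub> v) = t \<odot>\<^bsub>Y\<^esub> \<theta> v" for t
      proof -
        have "t \<odot>\<^bsub>?M\<^esub> v = \<phi> (t \<odot>\<^bsub>E\<^esub> e)" using lin_map_scale[OF lin, of e t] e by simp
        then show ?thesis using \<theta>[OF cmodule.submodule_scale[OF cE E'_sub[OF i(1)] e(2)], of t] \<theta>[OF e(2)]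
          by (simp add: e(1) lin_map_scale[OF lin_map_eta_E ec])
      qed
      fix w assume "w \<in> ?T"
      then obtain e' where e': "w = \<phi> e'" "e' \<in> E' ?i" by blast
      note ec' = E'_carrier[OF i(1) e'(2)]
      have "v \<oplus>\<^bsub>?M\<^esub> w = \<phi> (e \<oplus>\<^bsub>E\<^esub> e')" using lin_map_add[OF lin, of e e'] e e' by simp
      then show "\<theta> (v \<oplus>\<^bsub>?M\<^esub> w) = \<theta> v \<oplus>\<^bsub>Y\<^esub> \<theta> w"
        using \<theta>[OF cmodule.submodule_add[OF cE E'_sub[OF i(1)] e(2) e'(2)]] \<theta>[OF e(2)] \<theta>[OF e'(2)]
        by (simp add: e(1) e'(1) lin_map_add[OF lin_map_eta_E ec ec'])
    qed
    moreover have "\<theta> (act ?M (rot d i j) v) = act Y (rot d i j) (\<theta> v)" if ij: "i < nb" "j < nb" "i \<noteq> j" and v: "v \<in> ?T" for i j v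
    proof -
      obtain e where e: "v = \<phi> e" "e \<in> E' ?i" using v by blast
      note R = rot_m'[OF ij]
      have "\<theta> (act ?M (rot d i j) v) = ind.eta (act E (rot d i j) e)"
        unfolding e(1) eq[OF R e(2), symmetric] by (rule \<theta>[OF E'_act[OF i(1) R e(2)]])
      then show ?thesis unfolding e(1) \<theta>[OF e(2)]
        using eta_act[OF subsetD[OF m'_m[OF i(1)] R] E'_carrier[OF i(1) e(2)]] by simp
    qed
    ultimately have w: "word_map d nb (a + (b + c)) l Y (\<lambda>f. \<theta> (\<Psi> f))"
      "word_im d nb (a + (b + c)) l (\<lambda>f. \<theta> (\<Psi> f)) = \<theta> ` ?T"
      using word_map_comp[OF \<Psi>(1), of ?T Y \<theta>] \<Psi>(2) by simp_all
    have "B nb \<subseteq> \<theta> ` ?T" unfolding B_def using \<theta> by force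
    \<comment> \<open>Two more labels guarantee the label 1 that \<open>word_map_action\<close>
      needs for its fixed word.\<close>
    moreover obtain \<Psi>' where "word_map d nb (a + (b + c) + 2) l Y \<Psi>'" "\<theta> ` ?T \<subseteq> word_im d nb (a + (b + c) + 2) l \<Psi>'"
      using word_map_labels[OF w(1) le_add1[of _ 2]] unfolding w(2) by blast
    ultimately show ?thesis using subset_trans by blast
  qed
  then show ?thesis by blast
qed

sublocale fil: filtered_rep s r "a + (b + c) + 2" l g Y B
proof (rule filtered_rep.intro)
  show "g = (\<Union>i\<in>{1..}. exhaustion s r i)" using g G by simp
  show "lie_rep g Y" by (rule ind.lie_rep_induced)
  show "submodule (B nb) \<complex> Y" for nb
    unfolding B_def by (rule cmodule.submodule_image[OF cE cmodule_Y lin_map_eta_E E'_sub[OF level_ge(2)]])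
  show "B nb \<subseteq> B nb'" if "nb \<le> nb'" for nb nb'
    unfolding B_def by (rule image_mono[OF E'_mono[OF level_ge(2) level_mono[OF that]]])
  show "\<exists>N. \<forall>nb\<ge>N. \<exists>\<Phi>. word_map d nb (a + (b + c) + 2) l Y \<Phi> \<and> B nb \<subseteq> word_im d nb (a + (b + c) + 2) l \<Phi>"
    by (rule B_covered)
  show "2 \<le> a + (b + c) + 2" by simp
  fix S assume S: "submodule S \<complex> Y" "!!x v. x \<in> g ==> v \<in> S ==> act Y x v \<in> S" "!!nb. B nb \<subseteq> S"
  show "carrier Y \<subseteq> S"
  proof (rule ind.induced_generated[OF S(1,2)])
    fix e assume "e \<in> carrier Et"
    then obtain i where "1 \<le> i" "e \<in> E' i" using carrier_E by auto
    then have "e \<in> E' (level s i)" using E'_mono[of i "level s i"] level_ge(1)[of i s] by auto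
    then show "ind.eta e \<in> S" using S(3)[of i] unfolding B_def by blast
  qed
qed

text \<open>\<open>n\<close> acts by zero on the image of \<open>E\<close>, and the Levi component
  of an element of level \<open>i\<close> lies in \<open>m' i\<close>, which preserves
  \<open>E' i\<close>.\<close>

lemma stable_p: "fil.stable p"
  unfolding fil.stable_def
proof (intro conjI allI ballI)
  show "p \<subseteq> g" by (rule p_g)
  fix nb x v assume x: "x \<in> p \<inter> exhaustion s r (level s nb)" and "v \<in> B nb"
  then obtain e where e: "v = ind.eta e" "e \<in> E' (level s nb)" unfolding B_def by blast
  have "act Y x v = ind.eta (act E (lev x) e)"
    unfolding e(1) using ind.act_eta[of x e] x E'_carrier[OF level_ge(2) e(2)] by simp
  moreover have "act E (lev x) e \<in> E' (level s nb)"
    using x by (intro E'_act[OF level_ge(2) lev_level(1)[OF level_ge(2)] e(2)]) (auto simp: G)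
  ultimately show "act Y x v \<in> B nb" unfolding B_def by blast
qed

lemma stable_k_m: "fil.stable (k \<inter> m)"
  using stable_p m_p unfolding fil.stable_def by blast

end

section \<open>Weights of h on the Lie algebra and on the module\<close>

context parabolic_setting
begin

lemma module_ad_g: "module \<complex> (ad_rep g)"
  by (rule module_ad_rep[OF g_subspace])

lemma endo_ad:
  assumes h: "h \<in> g"
  shows "endo (ad_rep g) (lie_bracket h)"
proof -
  have "lin_map (ad_rep g) (ad_rep g) (lie_bracket h)"
    unfolding lin_map_def ad_rep_simps
  proof (intro conjI funcsetI ballI allI)
    fix x assume x: "x \<in> g"
    show "lie_bracket h x \<in> g" by (rule g_bracket[OF h x])
    obtain i where "1 \<le> i" "h \<in> G i" "x \<in> G i" using g_common[OF h x] .
    then have gl: "h \<in> gl (nat_dim s r i)" "x \<in> gl (nat_dim s r i)" using G_gl by blast+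
    show "lie_bracket h (mat_scale t x) = mat_scale t (lie_bracket h x)" for t
      by (rule lie_bracket_scale_right[OF gl gl(1)])
    fix y assume y: "y \<in> g"
    obtain i j where ij: "1 \<le> i" "h \<in> G i" "x \<in> G i" "1 \<le> j" "y \<in> G j" "y \<in> G j"
      using g_common[OF h x] g_common[OF y y] by metis
    have "G i \<subseteq> gl (nat_dim s r (max i j))" "G j \<subseteq> gl (nat_dim s r (max i j))"
      using G_gl[of "max i j"] G_mono[of i "max i j"] G_mono[of j "max i j"] by auto
    then show "lie_bracket h (x + y) = lie_bracket h x + lie_bracket h y"
      using lie_bracket_add_right[of h "nat_dim s r (max i j)" x y] ij by blast
  qed
  moreover have "cmodule (ad_rep g)" using module_ad_g by (simp add: cmodule_iff)
  ultimately show ?thesis by (simp add: endo_def endo_axioms_def)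
qed

context
  fixes h
  assumes h_t0: "h \<in> t0" and semi: "ad_semisimple (G (level s 1)) h"
    and par: "p \<inter> G (level s 1) = parabolic_of (G (level s 1)) h"
begin

lemma h_k_m: "h \<in> k \<inter> m"
  using t0_k_m h_t0 by blast

lemma h_g: "h \<in> g"
  using h_k_m m_g by blast

lemma h_gl: "h \<in> gl d"
  using h_t0 t0 k0_gl unfolding cartan_subalgebra_def lie_subalgebra_def by blast

lemma h_commutes: "x \<in> supp_ge d ==> lie_bracket x h = 0"
  by (rule lie_bracket_supp_ge[OF _ h_gl])

definition W where "W \<alpha> = wt_space (ad_rep g) (lie_bracket h) \<alpha>"

lemma W_subspace: "cmat.subspace (W \<alpha>)" and W_g: "W \<alpha> \<subseteq> g"
  using endo.submodule_wt_space[OF endo_ad[OF h_g]] unfolding W_def submodule_ad_rep_iff[OF g_subspace] by blast+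

lemma W_mono: "\<alpha> \<le> \<beta> ==> W \<alpha> \<subseteq> W \<beta>"
  unfolding W_def by (rule endo.wt_space_mono[OF endo_ad[OF h_g]])

lemma W_eigenvector:
  assumes "x \<in> g" "lie_bracket h x = mat_scale z x" "Re z \<le> \<alpha>"
  shows "x \<in> W \<alpha>"
  unfolding W_def using endo.wt_space_eigenvector[OF endo_ad[OF h_g], of x z] assms by simp

text \<open>The splitting \<open>\<gg> = \<pp> + W (-\<epsilon>)\<close> and the bound \<open>1 / \<epsilon>\<close> on the weights of \<open>\<gg>\<close>
  are kept in one condition that is antitone in \<open>\<epsilon>\<close>.\<close>

definition U where "U \<epsilon> = sum_space p (W (- \<epsilon>)) \<inter> W (1 / \<epsilon>)"

lemma U_subspace: "cmat.subspace (U \<epsilon>)"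
  unfolding U_def by (intro cmat.subspace_inter subspace_sum_space p_subspace W_subspace)

lemma U_antimono:
  assumes "0 < \<epsilon>" "\<epsilon> \<le> \<delta>"
  shows "U \<delta> \<subseteq> U \<epsilon>"
proof -
  have "W (- \<delta>) \<subseteq> W (- \<epsilon>)" "W (1 / \<delta>) \<subseteq> W (1 / \<epsilon>)"
    using assms by (intro W_mono; simp add: frac_le)+
  then show ?thesis unfolding U_def sum_space_def by blast
qed

lemma p_U:
  assumes "x \<in> p" "x \<in> W (1 / \<epsilon>)"
  shows "x \<in> U \<epsilon>"
proof -
  have "x = x + 0" by simp
  then show ?thesis unfolding U_def sum_space_def using assms cmat.subspace_0[OF W_subspace[of "- \<epsilon>"]] by blast
qed

text \<open>The eigenvectors of \<open>ad h\<close> span this level: those with nonnegative real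
  part lie in \<open>p\<close>, the others in the negative part, with \<open>\<epsilon>\<close> read
  off from the eigenvalue.\<close>

lemma base_U_ex: "G (level s 1) \<subseteq> {x. \<exists>\<epsilon>>0. x \<in> U \<epsilon>}"
proof -
  let ?L = "G (level s 1)"
  have "cmat.span (\<Union>\<sigma>. ad_eigenspace ?L h \<sigma>) \<subseteq> {x. \<exists>\<epsilon>>0. x \<in> U \<epsilon>}"
  proof (rule cmat.span_minimal)
    show "cmat.subspace {x. \<exists>\<epsilon>>0. x \<in> U \<epsilon>}"
    proof (rule cmat.subspaceI)
      have "(0 :: mat) \<in> U 1" by (rule cmat.subspace_0[OF U_subspace])
      then show "0 \<in> {x. \<exists>\<epsilon>>0. x \<in> U \<epsilon>}" using zero_less_one by blast
      show "mat_scale t x \<in> {x. \<exists>\<epsilon>>0. x \<in> U \<epsilon>}" if "x \<in> {x. \<exists>\<epsilon>>0. x \<in> U \<epsilon>}" for t x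
        using that cmat.subspace_scale[OF U_subspace] by blast
      fix x y assume "x \<in> {x. \<exists>\<epsilon>>0. x \<in> U \<epsilon>}" "y \<in> {x. \<exists>\<epsilon>>0. x \<in> U \<epsilon>}"
      then obtain \<epsilon> \<delta> where ed: "0 < \<epsilon>" "x \<in> U \<epsilon>" "0 < \<delta>" "y \<in> U \<delta>" by blast
      have "U \<epsilon> \<subseteq> U (min \<epsilon> \<delta>)" "U \<delta> \<subseteq> U (min \<epsilon> \<delta>)" using ed by (intro U_antimono; simp)+
      then have "x + y \<in> U (min \<epsilon> \<delta>)" using ed by (intro cmat.subspace_add[OF U_subspace]) blast+
      moreover have "0 < min \<epsilon> \<delta>" using ed by simp
      ultimately show "x + y \<in> {x. \<exists>\<epsilon>>0. x \<in> U \<epsilon>}" by blast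
    qed
    show "(\<Union>\<sigma>. ad_eigenspace ?L h \<sigma>) \<subseteq> {x. \<exists>\<epsilon>>0. x \<in> U \<epsilon>}"
    proof
      fix x assume "x \<in> (\<Union>\<sigma>. ad_eigenspace ?L h \<sigma>)"
      then obtain z where z: "x \<in> ad_eigenspace ?L h z" by blast
      then have x: "x \<in> ?L" "lie_bracket h x = mat_scale z x" unfolding ad_eigenspace_def by blast+
      have xg: "x \<in> g" using x(1) G_g[OF level_ge(2)] by blast
      note eig = W_eigenvector[OF xg x(2)]
      show "x \<in> {x. \<exists>\<epsilon>>0. x \<in> U \<epsilon>}"
      proof (cases "0 \<le> Re z")
        case True
        then have "x \<in> parabolic_of ?L h" unfolding parabolic_of_def using z by (intro cmat.span_base) blast
        then have "x \<in> p" using par by blast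
        \<comment> \<open>The value \<open>1 / (Re z + 1)\<close> is positive even for
          \<open>Re z = 0\<close>, and its inverse bounds the weight.\<close>
        moreover have "x \<in> W (1 / (1 / (Re z + 1)))" by (rule eig) simp
        ultimately have "x \<in> U (1 / (Re z + 1))" by (rule p_U)
        moreover have "0 < 1 / (Re z + 1)" using True by simp
        ultimately show ?thesis by blast
      next
        case False
        \<comment> \<open>Here \<open>\<epsilon> = - Re z\<close>; the double negation matches the
          form of \<open>U\<close>.\<close>
        have "x \<in> W (- (- Re z))" by (rule eig) simp
        then have "x \<in> sum_space p (W (- (- Re z)))"
          unfolding sum_space_def using cmat.subspace_0[OF p_subspace] by force
        moreover have "x \<in> W (1 / (- Re z))"
        proof (rule eig)
          have "0 < 1 / (- Re z)" using False by simp
          then show "Re z \<le> 1 / (- Re z)" using False by linarith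
        qed
        ultimately have "x \<in> U (- Re z)" unfolding U_def by blast
        moreover have "0 < - Re z" using False by simp
        ultimately show ?thesis by blast
      qed
    qed
  qed
  then show ?thesis using semi unfolding ad_semisimple_def by simp
qed

text \<open>The level is finite-dimensional, so finitely many values of \<open>\<epsilon>\<close>
  suffice for a spanning set, and since \<open>U\<close> is antitone their minimum serves
  all.\<close>

lemma base_U: "\<exists>\<epsilon>>0. G (level s 1) \<subseteq> U \<epsilon>"
proof -
  let ?L = "G (level s 1)" and ?D = "d + 2 * 1"
  have cgl: "cmodule (ad_rep (gl ?D))" using module_ad_rep[OF subspace_gl, of ?D] by (simp add: cmodule_iff)
  have L_gl: "?L \<subseteq> gl ?D" using G_gl[of "level s 1"] unfolding nat_dim_level .
  have Lsub: "submodule ?L \<complex> (ad_rep (gl ?D))" unfolding submodule_ad_rep_iff[OF subspace_gl] using G_subspace L_gl by blast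
  obtain \<Psi> where \<Psi>: "word_map d 1 1 2 (ad_rep (gl ?D)) \<Psi>" "word_im d 1 1 2 \<Psi> = ?L"
    using word_map_exhaustion[of 1 s r 1] unfolding G by auto
  obtain C where C: "finite C" "?L = lin_span (ad_rep (gl ?D)) C"
    using word_map_fin_dim[OF cgl \<Psi>(1) Lsub] \<Psi>(2) unfolding fin_dim_def by auto
  then have CL: "C \<subseteq> ?L" using lin_span_superset[of C] by blast
  have "\<exists>\<epsilon>>0. C \<subseteq> U \<epsilon>" using C(1) CL
  proof (induction C rule: finite_induct)
    case empty
    show ?case using zero_less_one by blast
  next
    case (insert x C)
    then obtain \<epsilon> \<delta> where ed: "0 < \<epsilon>" "C \<subseteq> U \<epsilon>" "0 < \<delta>" "x \<in> U \<delta>" using base_U_ex by blast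
    have "U \<epsilon> \<subseteq> U (min \<epsilon> \<delta>)" "U \<delta> \<subseteq> U (min \<epsilon> \<delta>)" using ed by (intro U_antimono; simp)+
    then have "insert x C \<subseteq> U (min \<epsilon> \<delta>)" using ed by blast
    moreover have "0 < min \<epsilon> \<delta>" using ed by simp
    ultimately show ?case by blast
  qed
  then obtain \<epsilon> where \<epsilon>: "0 < \<epsilon>" "C \<subseteq> U \<epsilon>" by blast
  have "submodule (U \<epsilon> \<inter> gl ?D) \<complex> (ad_rep (gl ?D))"
    unfolding submodule_ad_rep_iff[OF subspace_gl] using cmat.subspace_inter[OF U_subspace subspace_gl] by blast
  then have "lin_span (ad_rep (gl ?D)) C \<subseteq> U \<epsilon> \<inter> gl ?D"
    by (rule lin_span_minimal) (use \<epsilon>(2) CL L_gl in blast)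
  then show ?thesis using \<epsilon>(1) C(2) by blast
qed

text \<open>Rotations are supported from \<open>d\<close> on, so they commute with \<open>h\<close>,
  and the bracket with a rotation commutes with \<open>ad h\<close> by the Jacobi identity.\<close>

lemma rot_W:
  assumes ij: "i \<noteq> j" and x: "x \<in> W \<alpha>"
  shows "lie_bracket (rot d i j) x \<in> W \<alpha>"
proof -
  let ?R = "rot d i j"
  have Rg: "?R \<in> g" using rot_k_m[OF ij] m_g by blast
  have lin: "lin_map (ad_rep g) (ad_rep g) (lie_bracket ?R)" using endo_ad[OF Rg] by (simp add: endo_def endo_axioms_def)
  have comm: "lie_bracket ?R (lie_bracket h y) = lie_bracket h (lie_bracket ?R y)" if y: "y \<in> g" for y
  proof -
    obtain i1 where i1: "1 \<le> i1" "h \<in> G i1" "y \<in> G i1" using g_common[OF h_g y] .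
    obtain i2 where i2: "1 \<le> i2" "?R \<in> G i2" "?R \<in> G i2" using g_common[OF Rg Rg] .
    have "G i1 \<subseteq> gl (nat_dim s r (max i1 i2))" "G i2 \<subseteq> gl (nat_dim s r (max i1 i2))"
      using G_gl[of "max i1 i2"] G_mono[of i1 "max i1 i2"] G_mono[of i2 "max i1 i2"] by auto
    then have gl: "?R \<in> gl (nat_dim s r (max i1 i2))" "h \<in> gl (nat_dim s r (max i1 i2))" "y \<in> gl (nat_dim s r (max i1 i2))"
      using i1 i2 by blast+
    have "lie_bracket 0 y = 0" using lie_bracket_scale_left[OF gl(2,3,3), of 0] by simp
    then have "0 = lie_bracket (lie_bracket ?R h) y" unfolding h_commutes[OF rot_supp_ge] by simp
    also have "\<dots> = lie_bracket ?R (lie_bracket h y) - lie_bracket h (lie_bracket ?R y)" by (rule jacobi[OF gl])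
    finally show ?thesis by simp
  qed
  show ?thesis
    unfolding W_def
    by (rule wt_space_equivariant[where \<phi> = "lie_bracket ?R", OF endo_ad[OF h_g] endo_ad[OF h_g] lin])
      (use comm x[unfolded W_def] in simp_all)
qed

text \<open>\<open>exhaustion_generated\<close> with \<open>Q = U \<epsilon>\<close>. Matrices
  supported from \<open>d\<close> on centralise \<open>k0\<close>, so they lie in \<open>m\<close>,
  and they commute with \<open>h\<close>. Brackets with rotations preserve \<open>p\<close>, because
  rotations lie in \<open>m\<close>, and they preserve the weight spaces.\<close>

lemma g_U:
  assumes \<epsilon>: "0 < \<epsilon>" "G (level s 1) \<subseteq> U \<epsilon>"
  shows "g \<subseteq> U \<epsilon>"
proof
  fix x assume "x \<in> g"
  then obtain N where N: "\<forall>nb\<ge>N. x \<in> exhaustion s r (level s nb)" using fil.g_Lv by blast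
  let ?nb = "Suc N"
  show "x \<in> U \<epsilon>"
  proof (rule exhaustion_generated[of "U \<epsilon>" s r ?nb])
    show "cmat.subspace (U \<epsilon>)" by (rule U_subspace)
    show "exhaustion s r (level s 1) \<subseteq> U \<epsilon>" using \<epsilon>(2) unfolding G .
    show "exhaustion s r (level s ?nb) \<inter> supp_ge d \<subseteq> U \<epsilon>"
    proof
      fix y assume y: "y \<in> exhaustion s r (level s ?nb) \<inter> supp_ge d"
      then have yG: "y \<in> G (level s ?nb)" "y \<in> supp_ge d" unfolding G by blast+
      have "y \<in> p" using supp_ge_m'[OF level_ge(2) yG(2,1)] m'_p[OF level_ge(2)] by blast
      moreover have "y \<in> W (1 / \<epsilon>)"
      proof (rule W_eigenvector[of _ 0])
        show yg: "y \<in> g" using yG(1) G_g[OF level_ge(2)] by blast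
        have "y \<in> gl (nat_dim s r (level s ?nb))" using yG(1) G_gl by blast
        moreover have "h \<in> gl (nat_dim s r (level s ?nb))" using h_gl gl_mono[OF nat_dim_mono[OF level_ge(2)]] by blast
        ultimately have "lie_bracket h y = - lie_bracket y h" by (intro lie_bracket_anti)
        then show "lie_bracket h y = mat_scale 0 y" unfolding h_commutes[OF yG(2)] by simp
        show "Re 0 \<le> 1 / \<epsilon>" using \<epsilon>(1) by simp
      qed
      ultimately show "y \<in> U \<epsilon>" by (rule p_U)
    qed
    show "lie_bracket (rot d 0 j) q \<in> U \<epsilon>" if j: "0 < j" "j < ?nb" and q: "q \<in> U \<epsilon>" for j q
    proof -
      let ?R = "rot d 0 j"
      have ne: "0 \<noteq> j" using j(1) by simp
      have Rp: "?R \<in> p" using rot_k_m[OF ne] m_p by blast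
      have Rg: "?R \<in> g" using Rp p_g by blast
      obtain y z where yz: "q = y + z" "y \<in> p" "z \<in> W (- \<epsilon>)" using q unfolding U_def sum_space_def by blast
      have "lie_bracket ?R q = lie_bracket ?R y + lie_bracket ?R z"
        using endo_ad[OF Rg] yz p_g W_g lin_map_add[of "ad_rep g" "ad_rep g" "lie_bracket ?R" y z]
        by (auto simp: endo_def endo_axioms_def)
      moreover have "lie_bracket ?R y \<in> p" by (rule p_bracket[OF Rp yz(2)])
      moreover have "lie_bracket ?R z \<in> W (- \<epsilon>)" by (rule rot_W[OF ne yz(3)])
      ultimately have "lie_bracket ?R q \<in> sum_space p (W (- \<epsilon>))" unfolding sum_space_def by blast
      moreover have "lie_bracket ?R q \<in> W (1 / \<epsilon>)" using q unfolding U_def by (intro rot_W[OF ne]) blast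
      ultimately show ?thesis unfolding U_def by blast
    qed
    show "1 \<le> ?nb" by simp
    show "x \<in> exhaustion s r (level s ?nb)" using N by simp
  qed
qed

text \<open>For large levels the weights of \<open>h\<close> on \<open>E' i\<close> are among those
  on mixed tensors, whose bound does not depend on the level; smaller levels are contained in larger
  ones.\<close>

lemma B_weights: "\<exists>\<rho>. \<forall>nb. B nb \<subseteq> wt_space Y (act Y h) \<rho>"
proof -
  obtain N where N: "!!i. i \<ge> N ==> rep_embeds (m' i) (restr E (E' i)) (mixed_tensors (nat_dim s r i) l a b c)"
    using embeds by blast
  obtain \<rho> where \<rho>: "!!D. d \<le> D ==> all_wt (mixed_tensors D l a b c) h \<rho>"
    using all_wt_mixed_tensors[OF h_gl] by blast
  have "ind.eta e \<in> wt_space Y (act Y h) \<rho>" if i: "1 \<le> i" "N \<le> i" and e: "e \<in> E' i" for i e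
  proof -
    let ?M = "mixed_tensors (nat_dim s r i) l a b c"
    obtain \<phi> where \<phi>: "rep_hom (m' i) (restr E (E' i)) ?M \<phi>" "inj_on \<phi> (E' i)"
      using N[OF i(2)] unfolding rep_embeds_def by auto
    have lin: "lin_map (restr E (E' i)) ?M \<phi>" using \<phi>(1) unfolding rep_hom_def lin_map_def by simp
    have hm: "h \<in> m' i" using h_t0 t0_m' i(1) by blast
    have M: "all_wt ?M h \<rho>" by (rule \<rho>[OF nat_dim_mono[OF i(1)]])
    have mE: "module \<complex> E" using cE by (simp add: cmodule_iff)
    have sub: "subrep (m' i) E (E' i)" using E' i(1) by blast
    have rep: "lie_rep (m' i) (restr E (E' i))" by (rule lie_rep_restr[OF lie_rep_mono[OF E m'_m[OF i(1)]] sub])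
    have endoE: "endo (restr E (E' i)) (act E h)" using endo_act[OF rep hm] by (simp add: restr_def)
    have "\<phi> e \<in> wt_space ?M (act ?M h) \<rho>"
      using M lin_map_closed[OF lin, of e] e unfolding all_wt_def by auto
    then have eW: "e \<in> wt_space (restr E (E' i)) (act E h) \<rho>"
      using \<phi>(1) hm
      by (intro wt_space_reflect[where \<phi> = \<phi>, OF endoE all_wt_endo[OF M] lin]) (use \<phi>(2) e in \<open>simp_all add: rep_hom_def\<close>)
    show ?thesis
    proof (rule wt_space_equivariant[where \<phi> = ind.eta, OF endoE endo_act[OF ind.lie_rep_induced h_g]])
      show "lin_map (restr E (E' i)) Y ind.eta"
        using lin_map_eta_E E'_carrier[OF i(1)] unfolding lin_map_def by auto
      show "ind.eta (act E h v) = act Y h (ind.eta v)" if "v \<in> carrier (restr E (E' i))" for v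
        using eta_act[of h v] h_k_m E'_carrier[OF i(1), of v] that by simp
      show "e \<in> wt_space (restr E (E' i)) (act E h) \<rho>" by (rule eW)
    qed
  qed
  moreover have "N \<le> level s nb" if "N \<le> nb" for nb using that level_ge(1)[of nb s] by simp
  ultimately have "B nb \<subseteq> wt_space Y (act Y h) \<rho>" if "N \<le> nb" for nb
    using that level_ge(2) unfolding B_def by blast
  then have "B nb \<subseteq> wt_space Y (act Y h) \<rho>" for nb
    using fil.B_mono[of nb "max nb N"] by (meson max.cobounded1 max.cobounded2 subset_trans)
  then show ?thesis by blast
qed

lemma multiplicities:
  assumes S: "simple_rep (k \<inter> m) S"
  shows "\<exists>\<beta>. \<forall>F cs. finite F \<and> F \<subseteq> carrier Y \<and> composition_series (k \<inter> m) (restr Y (gen_subrep (k \<inter> m) Y F)) cs \<longrightarrow>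
    factor_count (k \<inter> m) (restr Y (gen_subrep (k \<inter> m) Y F)) cs S \<le> \<beta>"
proof -
  obtain \<epsilon> where \<epsilon>: "0 < \<epsilon>" "G (level s 1) \<subseteq> U \<epsilon>" using base_U by blast
  note gU = g_U[OF \<epsilon>]
  obtain \<rho> where \<rho>: "!!nb. B nb \<subseteq> wt_space Y (act Y h) \<rho>" using B_weights by blast
  have dec: "\<exists>y z. x = y + z \<and> y \<in> p \<and> z \<in> wt_space (ad_rep g) (lie_bracket h) (- \<epsilon>)" if "x \<in> g" for x
    using subsetD[OF gU that] unfolding U_def sum_space_def W_def by blast
  have gW: "g \<subseteq> wt_space (ad_rep g) (lie_bracket h) (1 / \<epsilon>)" using gU unfolding U_def W_def by blast
  show ?thesis
  proof (rule fil.multiplicity_bounded[OF stable_k_m rot_k_m _ _ _ _ S])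
    show "h \<in> k \<inter> m" by (rule h_k_m)
    show "\<exists>v\<^sub>0 v\<^sub>1. v = v\<^sub>0 \<oplus>\<^bsub>Y\<^esub> v\<^sub>1 \<and> v\<^sub>0 \<in> fil.Fil j \<and> v\<^sub>1 \<in> wt_space Y (act Y h) (\<rho> - real (Suc j) * \<epsilon>)"
      if "v \<in> carrier Y" for j v
      by (rule fil.carrier_split[OF stable_p h_g endo_ad[OF h_g] \<rho> less_imp_le[OF \<epsilon>(1)] dec that])
    show "\<exists>j. \<rho> - real (Suc j) * \<epsilon> < t" for t
    proof -
      obtain j where "\<rho> - t < real j * \<epsilon>" using reals_Archimedean3[OF \<epsilon>(1)] by blast
      then have "\<rho> - real (Suc j) * \<epsilon> < t" using \<epsilon>(1) by (simp add: distrib_right)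
      then show ?thesis by blast
    qed
    show "\<exists>\<tau>. v \<in> wt_space Y (act Y h) \<tau>" if "v \<in> carrier Y" for v
      by (rule fil.all_weights[OF stable_p h_g endo_ad[OF h_g] \<rho> gW _ that]) (use \<epsilon>(1) in simp)
  qed
qed

end

theorem finite_type_induced:
  "pair_module G m (k \<inter> m) Y \<and> finite_type TYPE('s) G (k \<inter> m) Y"
proof
  show "pair_module G m (k \<inter> m) Y"
    unfolding pair_module_def using lie_subalgebra_k_m lie_rep_mono[OF ind.lie_rep_induced m_g]
      fil.integrable_stable[OF stable_k_m] by (simp add: G)
  \<comment> \<open>This is the level with one block beyond \<open>d\<close>, as
    \<open>exhaustion_generated\<close> needs it for its base.\<close>
  have "compatible_parabolic_fin t0 (G (level s 1)) (p \<inter> G (level s 1))"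
    using p level_ge(2)[of s 1] unfolding compatible_parabolic_def by blast
  then obtain h where h: "h \<in> t0" "ad_semisimple (G (level s 1)) h" "p \<inter> G (level s 1) = parabolic_of (G (level s 1)) h"
    unfolding compatible_parabolic_fin_def by blast
  show "finite_type TYPE('s) G (k \<inter> m) Y"
    unfolding finite_type_def
  proof (intro conjI allI impI)
    show "finite_length (k \<inter> m) (restr Y (gen_subrep (k \<inter> m) Y F))" if "finite F \<and> F \<subseteq> carrier Y" for F
      using fil.finite_length_gen[OF stable_k_m rot_k_m] that by blast
    show "\<exists>\<beta>. \<forall>F cs. finite F \<and> F \<subseteq> carrier Y \<and>
        composition_series (k \<inter> m) (restr Y (gen_subrep (k \<inter> m) Y F)) cs \<longrightarrow>
        factor_count (k \<inter> m) (restr Y (gen_subrep (k \<inter> m) Y F)) cs S \<le> \<beta>"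
      if "simple_rep (k \<inter> m) S \<and> integrable_rep G (k \<inter> m) S" for S :: "'s rep"
      by (rule multiplicities[OF h]) (use that in blast)
  qed
qed

end

theorem proposition5p1:
  fixes s :: series and r :: nat
    and G :: "nat \<Rightarrow> mat set" and g :: "mat set"
    and k0 t0 k p m n :: "mat set"
    and m' n' :: "nat \<Rightarrow> mat set"
    and E :: "'e rep" and E' :: "nat \<Rightarrow> 'e set"
    and l a b c :: nat
  assumes "G = exhaustion s r" and "g = (\<Union>i\<in>{1..}. G i)"
    and "reductive_in k0 (G 1)"
    and "cartan_subalgebra t0 k0"
    and "k = sum_space k0 (centralizer g k0)"
    and "compatible_parabolic t0 G p"
    and "\<forall>i\<ge>1. n' i = nilradical (p \<inter> G i)"
    and "\<forall>i\<ge>1. p \<inter> G i = sum_space (m' i) (n' i) \<and> m' i \<inter> n' i = {0}"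
    and "\<forall>i\<ge>1. reductive_in (m' i) (G i)"
    and "\<forall>i\<ge>1. m' (Suc i) \<inter> G i = m' i"
    and "\<forall>i\<ge>1. t0 \<subseteq> m' i \<and> centralizer (G i) k0 \<subseteq> m' i"
    and "m = (\<Union>i\<in>{1..}. m' i)" and "n = (\<Union>i\<in>{1..}. n' i)"
    and "lie_rep m E"
    and "\<forall>i\<ge>1. subrep (m' i) E (E' i) \<and> E' i \<subseteq> E' (Suc i)"
    and "carrier E = (\<Union>i\<in>{1..}. E' i)"
    and "\<exists>N. \<forall>i\<ge>N. simple_rep (m' i) (restr E (E' i)) \<and>
           rep_embeds (m' i) (restr E (E' i)) (mixed_tensors (nat_dim s r i) l a b c)"
  shows "pair_module G m (k \<inter> m) (induced g p (extend_by_zero m n E)) \<and>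
         finite_type TYPE('s) G (k \<inter> m) (induced g p (extend_by_zero m n E))"
proof -
  interpret parabolic_setting s r G g k0 t0 k p m n m' n' E E' l a b c
    by unfold_locales (fact assms)+
  show ?thesis by (rule finite_type_induced)
qed

end
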